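(* Let $(M,g)$ be a closed oriented Riemannian surface, let $\lambda\in C^\infty(SM)$ be an arbitrary smooth function and let $\phi$ be the thermostat flow on $SM$ generated by $F=X+\lambda V$. Set $\kappa:=K_g-H\lambda+\lambda^2$. Let $p:SM\to\mathbb{R}$ be a smooth function such that $$\kappa_{p}:=\kappa+Fp+p(p-V\lambda)<0.$$ Then $\phi$ has a dominated splitting. If in addition $\kappa_{p}+\frac{(V\lambda)^{2}}{4}<0$, then the flow $\phi$ is Anosov.
   Context: $SM$ is the unit tangent bundle of $(M,g)$, $X$ the geodesic vector field, $V$ the infinitesimal generator of the $\mathrm{SO}(2)$-action (rotation in the fibres), $H$ the vector field $H=[V,X]$ (the horizontal lift of $Jv$ at $(x,v)$, $J$ being rotation by $+\pi/2$); they satisfy $[V,X]=H$, $[V,H]=-X$, $[X,H]=K_gV$, with $K_g$ the Gauss curvature (pulled back to $SM$). The flow $\phi_t$ generated by $F$ induces maps $\rho_t$, $[\xi]\mapsto[d\phi_t(\xi)]$, on the rank two bundle $E=TSM/\mathbb{R}F$. The flow has a dominated splitting if there is a continuous $\rho$-invariant splitting $E=E^u\oplus E^s$ into line subbundles and constants $C>0$, $0<\tau<1$ such that for all $t>0$ and $(x,v)\in SM$, $\|\rho_t|_{E^s(x,v)}\|\,\|\rho_{-t}|_{E^u(\phi_t(x,v))}\|\leqslant C\tau^t$. The flow is Anosov if there is a continuous $d\phi_t$-invariant splitting $TSM=\mathbb{R}F\oplus E^s\oplus E^u$ into line bundles and constants $C>0$, $0<\zeta<1<\eta$ such that for all $t>0$,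 $\|d\phi_{-t}|_{E^u}\|\leqslant C\eta^{-t}$ and $\|d\phi_t|_{E^s}\|\leqslant C\zeta^t$. *)

theory Defs
  imports "HOL-Analysis.Analysis"
begin

section \<open>Smooth maps between Euclidean spaces\<close>

primrec Ck_on :: "nat \<Rightarrow> 'a::euclidean_space set \<Rightarrow> ('a \<Rightarrow> 'b::real_normed_vector) \<Rightarrow> bool"
  where
    "Ck_on 0 S f \<longleftrightarrow> continuous_on S f"
  | "Ck_on (Suc n) S f \<longleftrightarrow> (\<forall>x\<in>S. f differentiable (at x))
       \<and> (\<forall>a. Ck_on n S (\<lambda>x. frechet_derivative f (at x) a))"

text \<open>Only used for open sets \<open>S\<close>.\<close>

definition smooth_on :: "'a::euclidean_space set \<Rightarrow> ('a \<Rightarrow> 'b::real_normed_vector) \<Rightarrow> bool"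
  where "smooth_on S f \<longleftrightarrow> (\<forall>n. Ck_on n S f)"


section \<open>Smooth manifolds\<close>

text \<open>A smooth manifold is given by a smooth atlas of parametrizations (inverses of charts)
  \<open>x : \<Omega> \<rightarrow> M\<close> with \<open>\<Omega>\<close> open in a Euclidean space. The atlas determines
  the point set and the topology. It need not be maximal: no notion below changes if the atlas is
  enlarged by compatible (for oriented surfaces: and compatibly oriented) parametrizations.\<close>

type_synonym ('m, 'e) atlas = "('e set \<times> ('e \<Rightarrow> 'm)) set"

definition carrier_of :: "('m, 'e) atlas \<Rightarrow> 'm set"
  where "carrier_of A = (\<Union>(\<Omega>, x)\<in>A. x ` \<Omega>)"

definition atlas_open :: "('m, 'e::euclidean_space) atlas \<Rightarrow> 'm set \<Rightarrow> bool"
  where "atlas_open A W \<longleftrightarrow> W \<subseteq> carrier_of A \<and> (\<forall>(\<Omega>, x)\<in>A. open {u \<in> \<Omega>. x u \<in> W})"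

definition atlas_topology :: "('m, 'e::euclidean_space) atlas \<Rightarrow> 'm topology"
  where "atlas_topology A = topology (atlas_open A)"

definition transition :: "'e set \<Rightarrow> ('e \<Rightarrow> 'm) \<Rightarrow> ('e \<Rightarrow> 'm) \<Rightarrow> 'e \<Rightarrow> 'e"
  where "transition \<Omega>' x' x = (\<lambda>u. inv_into \<Omega>' x' (x u))"

definition smooth_atlas :: "('m, 'e::euclidean_space) atlas \<Rightarrow> bool"
  where "smooth_atlas A \<longleftrightarrow>
    (\<forall>(\<Omega>, x)\<in>A. open \<Omega> \<and> inj_on x \<Omega>) \<and>
    (\<forall>(\<Omega>, x)\<in>A. \<forall>(\<Omega>', x')\<in>A.
       open {u \<in> \<Omega>. x u \<in> x' ` \<Omega>'} \<and>
       smooth_on {u \<in> \<Omega>. x u \<in> x' ` \<Omega>'} (transition \<Omega>' x' x))"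

definition smooth_manifold :: "('m, 'e::euclidean_space) atlas \<Rightarrow> bool"
  where "smooth_manifold A \<longleftrightarrow> smooth_atlas A \<and>
    Hausdorff_space (atlas_topology A) \<and> second_countable (atlas_topology A)"

definition closed_manifold :: "('m, 'e::euclidean_space) atlas \<Rightarrow> bool"
  where "closed_manifold A \<longleftrightarrow> smooth_manifold A \<and> compact_space (atlas_topology A)"

definition oriented_atlas :: "('m, real^2) atlas \<Rightarrow> bool"
  where "oriented_atlas A \<longleftrightarrow>
    (\<forall>(\<Omega>, x)\<in>A. \<forall>(\<Omega>', x')\<in>A. \<forall>u\<in>\<Omega>. x u \<in> x' ` \<Omega>' \<longrightarrow>
       det (matrix (frechet_derivative (transition \<Omega>' x' x) (at u))) > 0)"

text \<open>\<open>smooth_at A p f\<close>: the function \<open>f\<close> is smooth on a neighbourhood of \<open>p\<close>.\<close>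

definition smooth_at :: "('m, 'e::euclidean_space) atlas \<Rightarrow> 'm \<Rightarrow> ('m \<Rightarrow> real) \<Rightarrow> bool"
  where "smooth_at A p f \<longleftrightarrow>
    (\<forall>(\<Omega>, x)\<in>A. \<forall>u\<in>\<Omega>. x u = p \<longrightarrow>
       (\<exists>W. open W \<and> u \<in> W \<and> W \<subseteq> \<Omega> \<and> smooth_on W (\<lambda>w. f (x w))))"

definition smooth_function :: "('m, 'e::euclidean_space) atlas \<Rightarrow> ('m \<Rightarrow> real) \<Rightarrow> bool"
  where "smooth_function A f \<longleftrightarrow> (\<forall>p\<in>carrier_of A. smooth_at A p f)"


section \<open>Tangent vectors and vector fields\<close>

text \<open>Tangent vectors at \<open>p\<close> are directional derivatives acting on the functions that are smooth
  near \<open>p\<close>. They are extended by \<open>0\<close> to all other functions, so that a tangent vector is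
  determined by its action on germs.\<close>

type_synonym 'm tvec = "('m \<Rightarrow> real) \<Rightarrow> real"

definition tzero :: "'m tvec"
  where "tzero = (\<lambda>f. 0)"

definition tadd :: "'m tvec \<Rightarrow> 'm tvec \<Rightarrow> 'm tvec"
  where "tadd v w = (\<lambda>f. v f + w f)"

definition tscale :: "real \<Rightarrow> 'm tvec \<Rightarrow> 'm tvec"
  where "tscale c v = (\<lambda>f. c * v f)"

text \<open>The velocity at time \<open>0\<close> of a curve \<open>\<sigma>\<close>.\<close>

definition velocity :: "('m, 'e::euclidean_space) atlas \<Rightarrow> (real \<Rightarrow> 'm) \<Rightarrow> 'm tvec"
  where "velocity A \<sigma> = (\<lambda>f. if smooth_at A (\<sigma> 0) f then deriv (\<lambda>t. f (\<sigma> t)) 0 else 0)"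

text \<open>The tangent vector \<open>\<Sum>\<^sub>i a\<^sub>i \<partial>\<^sub>i\<close> at \<open>x u\<close>.\<close>

definition coord_vec ::
    "('m, 'e::euclidean_space) atlas \<Rightarrow> ('e \<Rightarrow> 'm) \<Rightarrow> 'e \<Rightarrow> 'e \<Rightarrow> 'm tvec"
  where "coord_vec A x u a = velocity A (\<lambda>t. x (u + t *\<^sub>R a))"

definition tangent_space :: "('m, 'e::euclidean_space) atlas \<Rightarrow> 'm \<Rightarrow> 'm tvec set"
  where "tangent_space A p = {coord_vec A x u a | \<Omega> x u a. (\<Omega>, x) \<in> A \<and> u \<in> \<Omega> \<and> x u = p}"

text \<open>A (not necessarily continuous) vector field assigns a tangent vector to each point. It acts
  on functions by \<open>Y f = (\<lambda>p. Y p f)\<close>.\<close>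

type_synonym 'm vfield = "'m \<Rightarrow> 'm tvec"

definition lie_bracket ::
    "('m, 'e::euclidean_space) atlas \<Rightarrow> 'm vfield \<Rightarrow> 'm vfield \<Rightarrow> 'm vfield"
  where "lie_bracket A Y Z = (\<lambda>p f. if smooth_at A p f
           then Y p (\<lambda>q. Z q f) - Z p (\<lambda>q. Y q f) else 0)"

definition continuous_vfield_on ::
    "('m, 'e::euclidean_space) atlas \<Rightarrow> 'm set \<Rightarrow> 'm vfield \<Rightarrow> bool"
  where "continuous_vfield_on A W Y \<longleftrightarrow>
    (\<forall>p\<in>W. Y p \<in> tangent_space A p) \<and>
    (\<forall>p\<in>W. \<forall>f. smooth_at A p f \<longrightarrow>
       topcontinuous_at (atlas_topology A) euclidean (\<lambda>q. Y q f) p)"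

definition pushforward ::
    "('m, 'e::euclidean_space) atlas \<Rightarrow> ('m \<Rightarrow> 'm) \<Rightarrow> 'm \<Rightarrow> 'm tvec \<Rightarrow> 'm tvec"
  where "pushforward A h p v = (\<lambda>f. if smooth_at A (h p) f then v (\<lambda>q. f (h q)) else 0)"


section \<open>Riemannian metrics\<close>

type_synonym 'm metric = "'m \<Rightarrow> 'm tvec \<Rightarrow> 'm tvec \<Rightarrow> real"

definition riemannian_metric :: "('m, 'e::euclidean_space) atlas \<Rightarrow> 'm metric \<Rightarrow> bool"
  where "riemannian_metric A g \<longleftrightarrow>
    (\<forall>p\<in>carrier_of A. \<forall>v\<in>tangent_space A p.
       (\<forall>w\<in>tangent_space A p. g p v w = g p w v) \<and>
       (\<forall>w\<in>tangent_space A p. \<forall>y\<in>tangent_space A p. \<forall>b c.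
          g p (tadd (tscale b v) (tscale c w)) y = b * g p v y + c * g p w y) \<and>
       (v \<noteq> tzero \<longrightarrow> g p v v > 0)) \<and>
    (\<forall>(\<Omega>, x)\<in>A. \<forall>a b. smooth_on \<Omega> (\<lambda>u. g (x u) (coord_vec A x u a) (coord_vec A x u b)))"

definition tnorm :: "'m metric \<Rightarrow> 'm \<Rightarrow> 'm tvec \<Rightarrow> real"
  where "tnorm g p v = sqrt (g p v v)"

definition closed_oriented_riemannian_surface :: "('m, real^2) atlas \<Rightarrow> 'm metric \<Rightarrow> bool"
  where "closed_oriented_riemannian_surface A g \<longleftrightarrow>
    closed_manifold A \<and> oriented_atlas A \<and> riemannian_metric A g"

text \<open>The metric in local coordinates.\<close>

definition gcoord ::
    "('m, real^2) atlas \<Rightarrow> 'm metric \<Rightarrow> (real^2 \<Rightarrow> 'm) \<Rightarrow> real^2 \<Rightarrow> real^2 \<Rightarrow> real^2 \<Rightarrow> real"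
  where "gcoord A g x u a b = g (x u) (coord_vec A x u a) (coord_vec A x u b)"

text \<open>The Levi-Civita connection in local coordinates: \<open>christoffel A g x u a b\<close> is the vector
  with components \<open>\<Sum>\<^sub>i\<^sub>j \<Gamma>\<^sup>k\<^sub>i\<^sub>j a\<^sub>i b\<^sub>j\<close>, that is,
  \<open>\<nabla>\<^sub>a b\<close> for constant \<open>a\<close> and \<open>b\<close>, given by the Koszul formula.\<close>

definition christoffel ::
    "('m, real^2) atlas \<Rightarrow> 'm metric \<Rightarrow> (real^2 \<Rightarrow> 'm) \<Rightarrow> real^2 \<Rightarrow> real^2 \<Rightarrow> real^2 \<Rightarrow> real^2"
  where "christoffel A g x u a b = (THE w. \<forall>e.
    2 * gcoord A g x u w e =
      frechet_derivative (\<lambda>y. gcoord A g x y b e) (at u) a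
    + frechet_derivative (\<lambda>y. gcoord A g x y a e) (at u) b
    - frechet_derivative (\<lambda>y. gcoord A g x y a b) (at u) e)"

text \<open>\<open>R(a,b)c = \<nabla>\<^sub>a \<nabla>\<^sub>b c - \<nabla>\<^sub>b \<nabla>\<^sub>a c\<close> for constant
  coordinate fields.\<close>

definition curvature_coord ::
    "('m, real^2) atlas \<Rightarrow> 'm metric \<Rightarrow> (real^2 \<Rightarrow> 'm) \<Rightarrow> real^2
      \<Rightarrow> real^2 \<Rightarrow> real^2 \<Rightarrow> real^2 \<Rightarrow> real^2"
  where "curvature_coord A g x u a b c =
      frechet_derivative (\<lambda>y. christoffel A g x y b c) (at u) a
    - frechet_derivative (\<lambda>y. christoffel A g x y a c) (at u) b
    + christoffel A g x u a (christoffel A g x u b c)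
    - christoffel A g x u b (christoffel A g x u a c)"

text \<open>A parametrization around \<open>p\<close> together with the coordinates of \<open>p\<close>. Everything
  defined through it below is independent of the choice.\<close>

definition coords_at :: "('m, 'e) atlas \<Rightarrow> 'm \<Rightarrow> ('e \<Rightarrow> 'm) \<times> 'e"
  where "coords_at A p = (SOME (x, u). \<exists>\<Omega>. (\<Omega>, x) \<in> A \<and> u \<in> \<Omega> \<and> x u = p)"

definition gauss_curvature :: "('m, real^2) atlas \<Rightarrow> 'm metric \<Rightarrow> 'm \<Rightarrow> real"
  where "gauss_curvature A g p = (case coords_at A p of (x, u) \<Rightarrow>
    let e1 = axis 1 1; e2 = axis 2 1 in
      gcoord A g x u (curvature_coord A g x u e1 e2 e2) e1 /
      (gcoord A g x u e1 e1 * gcoord A g x u e2 e2 - (gcoord A g x u e1 e2)\<^sup>2))"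

text \<open>Rotation by \<open>+\<pi>/2\<close> in the tangent planes.\<close>

definition positively_oriented ::
    "('m, real^2) atlas \<Rightarrow> 'm \<Rightarrow> 'm tvec \<Rightarrow> 'm tvec \<Rightarrow> bool"
  where "positively_oriented A p v w \<longleftrightarrow>
    (\<exists>\<Omega> x u a b. (\<Omega>, x) \<in> A \<and> u \<in> \<Omega> \<and> x u = p \<and>
       v = coord_vec A x u a \<and> w = coord_vec A x u b \<and> a$1 * b$2 - a$2 * b$1 > 0)"

definition rot90 :: "('m, real^2) atlas \<Rightarrow> 'm metric \<Rightarrow> 'm \<Rightarrow> 'm tvec \<Rightarrow> 'm tvec"
  where "rot90 A g p v = (THE w. w \<in> tangent_space A p \<and>
    g p v w = 0 \<and> g p w w = g p v v \<and> positively_oriented A p v w)"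


section \<open>The unit tangent bundle\<close>

type_synonym 'm tpoint = "'m \<times> 'm tvec"

definition unit_tangent_bundle :: "('m, real^2) atlas \<Rightarrow> 'm metric \<Rightarrow> 'm tpoint set"
  where "unit_tangent_bundle A g =
    {(p, v). p \<in> carrier_of A \<and> v \<in> tangent_space A p \<and> g p v v = 1}"

definition unit_vec ::
    "('m, real^2) atlas \<Rightarrow> 'm metric \<Rightarrow> (real^2 \<Rightarrow> 'm) \<Rightarrow> real^2 \<Rightarrow> real^2 \<Rightarrow> 'm tvec"
  where "unit_vec A g x u a = coord_vec A x u ((1 / sqrt (gcoord A g x u a a)) *\<^sub>R a)"

text \<open>The smooth structure of \<open>SM\<close>: a parametrization \<open>x\<close> of \<open>M\<close> induces the fibre coordinate
  \<open>\<theta>\<close> on unit vectors, where \<open>\<theta>\<close> is the Euclidean angle in coordinates of the direction.\<close>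

definition SM_atlas ::
    "('m, real^2) atlas \<Rightarrow> 'm metric \<Rightarrow> ('m tpoint, (real^2) \<times> real) atlas"
  where "SM_atlas A g =
    {(\<Omega> \<times> {\<alpha><..<\<alpha> + 2 * pi},
      \<lambda>(u, \<theta>). (x u, unit_vec A g x u (vector [cos \<theta>, sin \<theta>]))) | \<Omega> x \<alpha>. (\<Omega>, x) \<in> A}"

text \<open>The geodesic vector field, in coordinates \<open>(u, a) \<mapsto> (a, - \<Gamma>\<^sub>u(a, a))\<close>. The normalization
  only keeps the representing curve inside \<open>SM\<close>; it does not affect the velocity at
  \<open>t = 0\<close>, since the geodesic spray is tangent to \<open>SM\<close>.\<close>

definition geodesic_vfield :: "('m, real^2) atlas \<Rightarrow> 'm metric \<Rightarrow> 'm tpoint vfield"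
  where "geodesic_vfield A g z = (case coords_at A (fst z) of (x, u) \<Rightarrow>
    let a = (THE a. coord_vec A x u a = snd z) in
      velocity (SM_atlas A g)
        (\<lambda>t. (x (u + t *\<^sub>R a),
              unit_vec A g x (u + t *\<^sub>R a) (a - t *\<^sub>R christoffel A g x u a a))))"

definition vertical_vfield :: "('m, real^2) atlas \<Rightarrow> 'm metric \<Rightarrow> 'm tpoint vfield"
  where "vertical_vfield A g z = (case z of (p, v) \<Rightarrow>
    velocity (SM_atlas A g)
      (\<lambda>\<theta>. (p, tadd (tscale (cos \<theta>) v) (tscale (sin \<theta>) (rot90 A g p v)))))"

definition horizontal_vfield :: "('m, real^2) atlas \<Rightarrow> 'm metric \<Rightarrow> 'm tpoint vfield"
  where "horizontal_vfield A g =
    lie_bracket (SM_atlas A g) (vertical_vfield A g) (geodesic_vfield A g)"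


section \<open>Flows\<close>

definition product_with_line ::
    "('m, 'e::euclidean_space) atlas \<Rightarrow> (real \<times> 'm, real \<times> 'e) atlas"
  where "product_with_line A = {(UNIV \<times> \<Omega>, \<lambda>(t, u). (t, x u)) | \<Omega> x. (\<Omega>, x) \<in> A}"

text \<open>A smooth action of \<open>\<real>\<close> with infinitesimal generator \<open>Y\<close>. Smoothness of
  \<open>(t, z) \<mapsto> \<phi>\<^sub>t(z)\<close> is expressed by pulling back germs of smooth functions.\<close>

definition flow_generated_by ::
    "('m, 'e::euclidean_space) atlas \<Rightarrow> 'm vfield \<Rightarrow> (real \<Rightarrow> 'm \<Rightarrow> 'm) \<Rightarrow> bool"
  where "flow_generated_by A Y \<phi> \<longleftrightarrow>
    (\<forall>t. \<forall>z\<in>carrier_of A. \<phi> t z \<in> carrier_of A) \<and>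
    (\<forall>z\<in>carrier_of A. \<phi> 0 z = z) \<and>
    (\<forall>s t. \<forall>z\<in>carrier_of A. \<phi> (s + t) z = \<phi> s (\<phi> t z)) \<and>
    (\<forall>t. \<forall>z\<in>carrier_of A. \<forall>f. smooth_at A (\<phi> t z) f \<longrightarrow>
       smooth_at (product_with_line A) (t, z) (\<lambda>(s, w). f (\<phi> s w))) \<and>
    (\<forall>z\<in>carrier_of A. velocity A (\<lambda>t. \<phi> t z) = Y z)"

definition op_norm :: "('v \<Rightarrow> real) \<Rightarrow> ('w \<Rightarrow> real) \<Rightarrow> 'v set \<Rightarrow> ('v \<Rightarrow> 'w) \<Rightarrow> real"
  where "op_norm n n' L T = Sup {n' (T v) | v. v \<in> L \<and> n v \<le> 1}"


subsection \<open>Dominated splittings\<close>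

text \<open>Elements of the fibre \<open>E\<^sub>z = T\<^sub>z N / \<real> Y\<^sub>z\<close> are cosets, i.e. sets of tangent
  vectors.\<close>

definition flow_coset :: "'m vfield \<Rightarrow> 'm \<Rightarrow> 'm tvec \<Rightarrow> 'm tvec set"
  where "flow_coset Y z v = {tadd v (tscale c (Y z)) | c. True}"

definition quotient_fibre ::
    "('m, 'e::euclidean_space) atlas \<Rightarrow> 'm vfield \<Rightarrow> 'm \<Rightarrow> 'm tvec set set"
  where "quotient_fibre A Y z = flow_coset Y z ` tangent_space A z"

definition coset_add :: "'m tvec set \<Rightarrow> 'm tvec set \<Rightarrow> 'm tvec set"
  where "coset_add e e' = {tadd v w | v w. v \<in> e \<and> w \<in> e'}"

definition coset_norm :: "'m metric \<Rightarrow> 'm \<Rightarrow> 'm tvec set \<Rightarrow> real"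
  where "coset_norm G z e = Inf (tnorm G z ` e)"

definition continuous_quotient_line_subbundle ::
    "('m, 'e::euclidean_space) atlas \<Rightarrow> 'm vfield \<Rightarrow> ('m \<Rightarrow> 'm tvec set set) \<Rightarrow> bool"
  where "continuous_quotient_line_subbundle A Y L \<longleftrightarrow>
    (\<forall>z0\<in>carrier_of A. \<exists>W Z. openin (atlas_topology A) W \<and> z0 \<in> W \<and>
       continuous_vfield_on A W Z \<and>
       (\<forall>z\<in>W. flow_coset Y z (Z z) \<noteq> flow_coset Y z tzero \<and>
               L z = {flow_coset Y z (tscale c (Z z)) | c. True}))"

text \<open>The map induced by \<open>d\<phi>\<^sub>t\<close> on cosets.\<close>

definition quotient_flow ::
    "('m, 'e::euclidean_space) atlas \<Rightarrow> (real \<Rightarrow> 'm \<Rightarrow> 'm) \<Rightarrow> real \<Rightarrow> 'm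
      \<Rightarrow> 'm tvec set \<Rightarrow> 'm tvec set"
  where "quotient_flow A \<phi> t z e = pushforward A (\<phi> t) z ` e"

definition has_dominated_splitting ::
    "('m, 'e::euclidean_space) atlas \<Rightarrow> 'm metric \<Rightarrow> 'm vfield \<Rightarrow> (real \<Rightarrow> 'm \<Rightarrow> 'm) \<Rightarrow> bool"
  where "has_dominated_splitting A G Y \<phi> \<longleftrightarrow>
    (\<exists>Eu Es. continuous_quotient_line_subbundle A Y Eu \<and>
             continuous_quotient_line_subbundle A Y Es \<and>
      (\<forall>z\<in>carrier_of A. \<forall>e\<in>quotient_fibre A Y z.
         \<exists>!(e1, e2). e1 \<in> Eu z \<and> e2 \<in> Es z \<and> e = coset_add e1 e2) \<and>
      (\<forall>t. \<forall>z\<in>carrier_of A.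
         quotient_flow A \<phi> t z ` Eu z = Eu (\<phi> t z) \<and>
         quotient_flow A \<phi> t z ` Es z = Es (\<phi> t z)) \<and>
      (\<exists>C>0. \<exists>\<tau>>0. \<tau> < 1 \<and> (\<forall>t>0. \<forall>z\<in>carrier_of A.
         op_norm (coset_norm G z) (coset_norm G (\<phi> t z)) (Es z) (quotient_flow A \<phi> t z) *
         op_norm (coset_norm G (\<phi> t z)) (coset_norm G z) (Eu (\<phi> t z))
                 (quotient_flow A \<phi> (- t) (\<phi> t z))
         \<le> C * \<tau> powr t)))"


subsection \<open>Anosov flows\<close>

definition continuous_line_subbundle ::
    "('m, 'e::euclidean_space) atlas \<Rightarrow> ('m \<Rightarrow> 'm tvec set) \<Rightarrow> bool"
  where "continuous_line_subbundle A L \<longleftrightarrow>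
    (\<forall>z0\<in>carrier_of A. \<exists>W Z. openin (atlas_topology A) W \<and> z0 \<in> W \<and>
       continuous_vfield_on A W Z \<and>
       (\<forall>z\<in>W. Z z \<noteq> tzero \<and> L z = {tscale c (Z z) | c. True}))"

definition anosov ::
    "('m, 'e::euclidean_space) atlas \<Rightarrow> 'm metric \<Rightarrow> 'm vfield \<Rightarrow> (real \<Rightarrow> 'm \<Rightarrow> 'm) \<Rightarrow> bool"
  where "anosov A G Y \<phi> \<longleftrightarrow>
    (\<forall>z\<in>carrier_of A. Y z \<noteq> tzero) \<and>
    (\<exists>Es Eu. continuous_line_subbundle A Es \<and> continuous_line_subbundle A Eu \<and>
      (\<forall>z\<in>carrier_of A. \<forall>v\<in>tangent_space A z.
         \<exists>!(c, vs, vu). vs \<in> Es z \<and> vu \<in> Eu z \<and> v = tadd (tscale c (Y z)) (tadd vs vu)) \<and>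
      (\<forall>t. \<forall>z\<in>carrier_of A.
         pushforward A (\<phi> t) z ` Es z = Es (\<phi> t z) \<and>
         pushforward A (\<phi> t) z ` Eu z = Eu (\<phi> t z)) \<and>
      (\<exists>C>0. \<exists>\<zeta>>0. \<exists>\<eta>. \<zeta> < 1 \<and> 1 < \<eta> \<and> (\<forall>t>0. \<forall>z\<in>carrier_of A.
         op_norm (tnorm G z) (tnorm G (\<phi> (- t) z)) (Eu z) (pushforward A (\<phi> (- t)) z)
           \<le> C * \<eta> powr (- t) \<and>
         op_norm (tnorm G z) (tnorm G (\<phi> t z)) (Es z) (pushforward A (\<phi> t) z)
           \<le> C * \<zeta> powr t)))"


section \<open>Thermostats\<close>

definition thermostat_vfield ::
    "('m, real^2) atlas \<Rightarrow> 'm metric \<Rightarrow> ('m tpoint \<Rightarrow> real) \<Rightarrow> 'm tpoint vfield"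
  where "thermostat_vfield A g lam z =
    tadd (geodesic_vfield A g z) (tscale (lam z) (vertical_vfield A g z))"

definition kappa ::
    "('m, real^2) atlas \<Rightarrow> 'm metric \<Rightarrow> ('m tpoint \<Rightarrow> real) \<Rightarrow> 'm tpoint \<Rightarrow> real"
  where "kappa A g lam z =
    gauss_curvature A g (fst z) - horizontal_vfield A g z lam + (lam z)\<^sup>2"

definition kappa_p ::
    "('m, real^2) atlas \<Rightarrow> 'm metric \<Rightarrow> ('m tpoint \<Rightarrow> real) \<Rightarrow> ('m tpoint \<Rightarrow> real)
      \<Rightarrow> 'm tpoint \<Rightarrow> real"
  where "kappa_p A g lam p z =
    kappa A g lam z + thermostat_vfield A g lam z p + p z * (p z - vertical_vfield A g z lam)"


section \<open>Consistency of the encoding\<close>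

lemma istopology_atlas_open: "istopology (atlas_open A)"
proof -
  have "atlas_open A (S \<inter> T)" if "atlas_open A S" "atlas_open A T" for S T
  proof -
    have eq: "{u \<in> \<Omega>. x u \<in> S \<inter> T} = {u \<in> \<Omega>. x u \<in> S} \<inter> {u \<in> \<Omega>. x u \<in> T}" for \<Omega> and x :: "'b \<Rightarrow> 'a"
      by blast
    show ?thesis using that unfolding atlas_open_def eq by fastforce
  qed
  moreover have "atlas_open A (\<Union>\<K>)" if "\<forall>K\<in>\<K>. atlas_open A K" for \<K>
  proof -
    have eq: "{u \<in> \<Omega>. x u \<in> \<Union>\<K>} = (\<Union>K\<in>\<K>. {u \<in> \<Omega>. x u \<in> K})" for \<Omega> and x :: "'b \<Rightarrow> 'a"
      by blast
    show ?thesis using that unfolding atlas_open_def eq by fastforce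
  qed
  ultimately show ?thesis by (simp add: istopology_def)
qed

lemma openin_atlas_topology: "openin (atlas_topology A) W \<longleftrightarrow> atlas_open A W"
  by (simp add: atlas_topology_def istopology_atlas_open topology_inverse')

lemma topspace_atlas_topology:
  assumes "smooth_atlas A" shows "topspace (atlas_topology A) = carrier_of A"
proof -
  have "{u \<in> \<Omega>. x u \<in> carrier_of A} = \<Omega>" if "(\<Omega>, x) \<in> A" for \<Omega> x
    using that by (auto simp: carrier_of_def)
  then have "atlas_open A (carrier_of A)"
    using assms by (fastforce simp: atlas_open_def smooth_atlas_def)
  then show ?thesis
    by (metis atlas_open_def openin_atlas_topology openin_subset openin_topspace subset_antisym)
qed

lemma deriv_scaled_line:
  assumes d: "F differentiable (at (u::'e::euclidean_space))"
  shows "deriv (\<lambda>t. (F (u + t *\<^sub>R (r *\<^sub>R a)) :: real)) 0 = r * deriv (\<lambda>t. F (u + t *\<^sub>R a)) 0"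
proof -
  obtain F' where F': "(F has_derivative F') (at u)"
    using d by (auto simp: differentiable_def)
  have lin: "linear F'" using F' has_derivative_linear by blast
  have D: "((\<lambda>t. F (u + t *\<^sub>R b)) has_real_derivative F' b) (at 0)" for b
  proof -
    have "((\<lambda>t::real. u + t *\<^sub>R b) has_derivative (\<lambda>t. t *\<^sub>R b)) (at 0)"
      by (auto intro!: derivative_eq_intros)
    then have "((\<lambda>t. F (u + t *\<^sub>R b)) has_derivative (\<lambda>t. F' (t *\<^sub>R b))) (at 0)"
      by (rule has_derivative_compose) (use F' in simp)
    moreover have "(\<lambda>t. F' (t *\<^sub>R b)) = (*) (F' b)"
      using lin by (simp add: linear_scale fun_eq_iff)
    ultimately show ?thesis by (simp add: has_field_derivative_def)
  qed
  show ?thesis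
    using D[of "r *\<^sub>R a"] D[of a] lin by (metis DERIV_imp_deriv linear_scale real_scaleR_def)
qed

lemma coord_vec_scaleR:
  assumes "(\<Omega>, x) \<in> A" "u \<in> \<Omega>"
  shows "coord_vec A x u (r *\<^sub>R a) = tscale r (coord_vec A x u a)"
proof
  fix f
  show "coord_vec A x u (r *\<^sub>R a) f = tscale r (coord_vec A x u a) f"
  proof (cases "smooth_at A (x u) f")
    case True
    then obtain W where W: "u \<in> W" "smooth_on W (\<lambda>w. f (x w))"
      using assms by (fastforce simp: smooth_at_def)
    then have "Ck_on (Suc 0) W (\<lambda>w. f (x w))"
      by (auto simp only: smooth_on_def)
    then have "(\<lambda>w. f (x w)) differentiable (at u)"
      using W by simp
    from deriv_scaled_line[OF this, of r a] show ?thesis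
      using True by (simp add: coord_vec_def velocity_def tscale_def)
  qed (simp add: coord_vec_def velocity_def tscale_def)
qed

lemma metric_tscale:
  assumes g: "riemannian_metric A g" and p: "p \<in> carrier_of A" and v: "v \<in> tangent_space A p"
    and rv: "tscale r v \<in> tangent_space A p"
  shows "g p (tscale r v) (tscale r v) = r\<^sup>2 * g p v v"
proof -
  have lin: "g p (tscale r v) y = r * g p v y" if "y \<in> tangent_space A p" for y
  proof -
    have "g p (tadd (tscale r v) (tscale 0 v)) y = r * g p v y + 0 * g p v y"
      using g p v that unfolding riemannian_metric_def by blast
    then show ?thesis by (simp add: tadd_def tscale_def)
  qed
  have "g p v (tscale r v) = g p (tscale r v) v"
    using g p v rv unfolding riemannian_metric_def by blast
  then show ?thesis using lin[OF v] lin[OF rv] by (simp add: power2_eq_square)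
qed

lemma Ck_on_cong:
  assumes "open S" "\<And>x. x \<in> S \<Longrightarrow> f x = h x" "Ck_on n S f"
  shows "Ck_on n S h"
  using assms(2,3)
proof (induction n arbitrary: f h)
  case 0
  then show ?case by (metis Ck_on.simps(1) continuous_on_cong)
next
  case (Suc n)
  have D: "(f has_derivative F') (at x) \<longleftrightarrow> (h has_derivative F') (at x)" if "x \<in> S" for x F'
    using has_derivative_transform_within_open[OF _ \<open>open S\<close> that, of f F' UNIV h]
          has_derivative_transform_within_open[OF _ \<open>open S\<close> that, of h F' UNIV f]
          Suc.prems(1) by auto
  have "frechet_derivative f (at x) = frechet_derivative h (at x)" if "x \<in> S" for x
    using D[OF that] by (simp add: frechet_derivative_def)
  then have "Ck_on n S (\<lambda>x. frechet_derivative h (at x) a)" for a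
    using Suc.IH[of "\<lambda>x. frechet_derivative f (at x) a" "\<lambda>x. frechet_derivative h (at x) a"]
      Suc.prems(2) by simp
  moreover have "h differentiable (at x)" if "x \<in> S" for x
    using Suc.prems(2) D[OF that] that unfolding Ck_on.simps differentiable_def by blast
  ultimately show ?case by simp
qed

lemma Ck_on_inner:
  fixes f :: "'a::euclidean_space \<Rightarrow> 'b::real_inner"
  assumes "open S" "Ck_on n S f"
  shows "Ck_on n S (\<lambda>x. f x \<bullet> b)"
  using assms(2)
proof (induction n arbitrary: f)
  case 0
  then show ?case by (auto intro: continuous_intros)
next
  case (Suc n)
  have D: "((\<lambda>x. f x \<bullet> b) has_derivative (\<lambda>a. frechet_derivative f (at x) a \<bullet> b)) (at x)"
    if "x \<in> S" for x
    using Suc.prems that by (intro has_derivative_inner_left) (simp add: frechet_derivative_works)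
  have "Ck_on n S (\<lambda>x. frechet_derivative (\<lambda>x. f x \<bullet> b) (at x) a)" for a
  proof (rule Ck_on_cong[OF \<open>open S\<close>])
    show "Ck_on n S (\<lambda>x. frechet_derivative f (at x) a \<bullet> b)"
      using Suc by simp
    show "frechet_derivative f (at x) a \<bullet> b = frechet_derivative (\<lambda>x. f x \<bullet> b) (at x) a"
      if "x \<in> S" for x
      using frechet_derivative_at[OF D[OF that]] by metis
  qed
  moreover have "(\<lambda>x. f x \<bullet> b) differentiable (at x)" if "x \<in> S" for x
    using D[OF that] by (auto simp: differentiable_def)
  ultimately show ?case by simp
qed

lemma coord_vec_nonzero:
  assumes A: "smooth_atlas A" and x: "(\<Omega>, x) \<in> A" "u \<in> \<Omega>" and b: "b \<noteq> 0"
  shows "coord_vec A x u b \<noteq> tzero"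
proof -
  define f where "f q = inv_into \<Omega> x q \<bullet> b" for q
  have op: "open \<Omega>" and inj: "inj_on x \<Omega>" using A x by (auto simp: smooth_atlas_def)
  have "smooth_at A (x u) f"
    unfolding smooth_at_def
  proof (clarify, intro exI conjI)
    fix \<Omega>' x' u' assume *: "(\<Omega>', x') \<in> A" "u' \<in> \<Omega>'" "x' u' = x u"
    let ?W = "{w \<in> \<Omega>'. x' w \<in> x ` \<Omega>}"
    show W: "open ?W" using A x * unfolding smooth_atlas_def by fast
    have "smooth_on ?W (transition \<Omega> x x')" using A x * unfolding smooth_atlas_def by fast
    then show "smooth_on ?W (\<lambda>w. f (x' w))"
      unfolding smooth_on_def f_def transition_def by (intro allI Ck_on_inner[OF W]) blast
    show "u' \<in> ?W" "?W \<subseteq> \<Omega>'" using * x by auto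
  qed
  moreover have "((\<lambda>t. f (x (u + t *\<^sub>R b))) has_real_derivative b \<bullet> b) (at 0)"
  proof -
    have D: "((\<lambda>t. (u + t *\<^sub>R b) \<bullet> b) has_real_derivative b \<bullet> b) (at 0)"
      by (auto intro!: derivative_eq_intros simp: inner_add_left)
    have op': "open ((\<lambda>t. u + t *\<^sub>R b) -` \<Omega>)"
      by (intro open_vimage op continuous_intros)
    show ?thesis
      by (rule has_field_derivative_transform_within_open[OF D op'])
         (use x inj in \<open>auto simp: f_def inv_into_f_f\<close>)
  qed
  ultimately have "coord_vec A x u b f = b \<bullet> b"
    by (simp add: coord_vec_def velocity_def DERIV_imp_deriv)
  then show ?thesis using b by (metis inner_eq_zero_iff tzero_def)
qed

lemma unit_vec_normalized:
  assumes A: "smooth_atlas A" and g: "riemannian_metric A g"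
    and x: "(\<Omega>, x) \<in> A" "u \<in> \<Omega>" and b: "b \<noteq> 0"
  shows "unit_vec A g x u b \<in> tangent_space A (x u)"
    and "g (x u) (unit_vec A g x u b) (unit_vec A g x u b) = 1"
proof -
  define r where "r = 1 / sqrt (gcoord A g x u b b)"
  have p: "x u \<in> carrier_of A" using x by (auto simp: carrier_of_def)
  have T: "coord_vec A x u a \<in> tangent_space A (x u)" for a
    using x by (auto simp: tangent_space_def)
  show "unit_vec A g x u b \<in> tangent_space A (x u)" using T by (simp add: unit_vec_def)
  have pos: "gcoord A g x u b b > 0"
    using g p T coord_vec_nonzero[OF A x b] unfolding riemannian_metric_def gcoord_def by blast
  have U: "unit_vec A g x u b = tscale r (coord_vec A x u b)"
    using x by (simp add: unit_vec_def r_def coord_vec_scaleR)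
  have "g (x u) (unit_vec A g x u b) (unit_vec A g x u b) = r\<^sup>2 * gcoord A g x u b b"
    unfolding U gcoord_def
    by (rule metric_tscale[OF g p T]) (metis T U unit_vec_def)
  then show "g (x u) (unit_vec A g x u b) (unit_vec A g x u b) = 1"
    using pos by (simp add: r_def power_divide)
qed

lemma carrier_of_SM_atlas:
  assumes A: "smooth_atlas A" and g: "riemannian_metric A g"
  shows "carrier_of (SM_atlas A g) = unit_tangent_bundle A g"
proof
  show "carrier_of (SM_atlas A g) \<subseteq> unit_tangent_bundle A g"
  proof
    fix z assume "z \<in> carrier_of (SM_atlas A g)"
    then obtain \<Omega> x u \<theta> where x: "(\<Omega>, x) \<in> A" "u \<in> \<Omega>"
      and z: "z = (x u, unit_vec A g x u (vector [cos \<theta>, sin \<theta>]))"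
      by (fastforce simp: carrier_of_def SM_atlas_def)
    have "(vector [cos \<theta>, sin \<theta>] :: real^2) \<noteq> 0"
      by (metis cos_zero_iff_int sin_zero_iff_int2 sin_cos_squared_add3 vector_2 zero_index
          zero_neq_one mult_zero_left add.right_neutral)
    with unit_vec_normalized[OF A g x this] x show "z \<in> unit_tangent_bundle A g"
      by (auto simp: z unit_tangent_bundle_def carrier_of_def)
  qed
next
  show "unit_tangent_bundle A g \<subseteq> carrier_of (SM_atlas A g)"
  proof
    fix z assume "z \<in> unit_tangent_bundle A g"
    then obtain \<Omega> x u a where x: "(\<Omega>, x) \<in> A" "u \<in> \<Omega>"
      and z: "z = (x u, coord_vec A x u a)"
      and 1: "g (x u) (coord_vec A x u a) (coord_vec A x u a) = 1"
      by (auto simp: unit_tangent_bundle_def tangent_space_def)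
    have p: "x u \<in> carrier_of A" using x by (auto simp: carrier_of_def)
    have T: "coord_vec A x u a \<in> tangent_space A (x u)" for a
      using x by (auto simp: tangent_space_def)
    have sc: "g (x u) (coord_vec A x u (r *\<^sub>R c)) (coord_vec A x u (r *\<^sub>R c))
        = r\<^sup>2 * g (x u) (coord_vec A x u c) (coord_vec A x u c)" for r c
      using metric_tscale[OF g p T] T coord_vec_scaleR[OF x] by metis
    have a: "a \<noteq> 0" using sc[of 0 0] 1 by auto
    define r where "r = norm a"
    have r: "r > 0" using a by (simp add: r_def)
    have "(a$1)\<^sup>2 + (a$2)\<^sup>2 = r\<^sup>2"
      by (simp add: r_def power2_norm_eq_inner inner_vec_def sum_2 flip: power2_eq_square)
    then have "(a$1 / r)\<^sup>2 + (a$2 / r)\<^sup>2 = 1"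
      using r by (simp add: power_divide flip: add_divide_distrib)
    then obtain \<theta> where \<theta>: "a$1 / r = cos \<theta>" "a$2 / r = sin \<theta>"
      using sincos_total_2pi by metis
    define c :: "real^2" where "c = vector [cos \<theta>, sin \<theta>]"
    have ac: "a = r *\<^sub>R c" using r \<theta>
      by (simp add: vec_eq_iff forall_2 c_def field_simps)
    have "r\<^sup>2 * gcoord A g x u c c = 1" using 1 sc[of r c] by (simp add: ac gcoord_def)
    then have "gcoord A g x u c c = (1 / r)\<^sup>2" using r by (simp add: field_simps)
    then have "1 / sqrt (gcoord A g x u c c) = r" using r by simp
    then have U: "unit_vec A g x u c = coord_vec A x u a" by (simp add: unit_vec_def ac)
    have "(\<Omega> \<times> {\<theta> - pi<..<\<theta> - pi + 2 * pi},
        \<lambda>(u, \<theta>). (x u, unit_vec A g x u (vector [cos \<theta>, sin \<theta>]))) \<in> SM_atlas A g"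
      unfolding SM_atlas_def using x by blast
    moreover have "(u, \<theta>) \<in> \<Omega> \<times> {\<theta> - pi<..<\<theta> - pi + 2 * pi}" using x by simp
    moreover have "z = (\<lambda>(u, \<theta>). (x u, unit_vec A g x u (vector [cos \<theta>, sin \<theta>]))) (u, \<theta>)"
      using U by (simp add: z c_def)
    ultimately show "z \<in> carrier_of (SM_atlas A g)"
      unfolding carrier_of_def by blast
  qed
qed

end

theory Submission
  imports Defs
begin

text \<open>
  Consider the moving frame \<open>F = X + \<lambda>V\<close>, \<open>H + pV\<close>, \<open>V\<close> of \<open>SM\<close>. The structure equations turn the
  transport of a tangent vector \<open>x F + y (H + pV) + v V\<close> by the flow into the linear system
  \<open>x' = \<lambda> y\<close>, \<open>y' = p y + v\<close>, \<open>v' = - \<kappa>\<^sub>p y + (V\<lambda> - p) v\<close> along the orbit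
  (\<open>thermostat_framed_flow\<close>, \<open>cocycle_derivative\<close>). The last two equations describe the quotient by \<open>F\<close>.

  \<^bold>\<open>Domination.\<close> If \<open>\<kappa>\<^sub>p < 0\<close>, then by compactness \<open>- \<kappa>\<^sub>p\<close> is bounded below by a positive constant. The
  slope \<open>v / y\<close> solves a Riccati equation whose right-hand side is positive for small and negative for
  large positive slopes. So the flow maps a cone \<open>m \<le> v / y \<le> W\<close> into itself (\<open>in_cone_invariant\<close>), and any
  two slopes in it approach each other exponentially (\<open>slope_contraction\<close>). Cones pushed forward from the
  remote past therefore shrink to one line, the unstable direction, which depends continuously on the
  point (\<open>unstable_slope\<close>). Reversal of time and of the sign of \<open>v\<close> preserves the system (\<open>reversed\<close>) and
  yields the stable direction, with a slope between \<open>- W\<close> and \<open>- m\<close>. The logarithmic derivative of the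
  quotient of the two \<open>y\<close>-components is the difference of the slopes, at most \<open>- 2m\<close> (\<open>growth_gap\<close>).

  \<^bold>\<open>The Anosov property.\<close> The derivative of \<open>y v\<close> is \<open>v\<^sup>2 + (V\<lambda>) y v - \<kappa>\<^sub>p y\<^sup>2\<close>, a form that is positive
  definite precisely if \<open>\<kappa>\<^sub>p + (V\<lambda>)\<^sup>2 / 4 < 0\<close>. Then \<open>y v\<close>, which is comparable to \<open>y\<^sup>2\<close> on the unstable
  direction, grows exponentially (\<open>unstable_growth\<close>). Because of this growth the \<open>F\<close>-components, relative
  to \<open>y\<close>, of vectors pushed forward from the remote past converge as well, and the unstable line in the
  quotient lifts to an invariant line in the tangent bundle (\<open>unstable_lift\<close>).

  \<^bold>\<open>Geometry.\<close> The structure equations are computed in coordinates \<open>(u, a)\<close> of the tangent bundle, where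
  \<open>X = (a, - \<Gamma>(a, a))\<close>, \<open>V = (0, Ja)\<close> and \<open>H = (Ja, - \<Gamma>(a, Ja))\<close>. They express that \<open>J\<close> is parallel and that
  curvature is a single number (\<open>frame_brackets\<close>). A point of \<open>SM\<close> is described by any \<open>a \<noteq> 0\<close> up to positive
  factors, which makes these coordinates available on \<open>SM\<close> (\<open>represents_commutator\<close>,
  \<open>structure_equations\<close>).
\<close>

section \<open>Smooth maps between Euclidean spaces\<close>

subsection \<open>Closure properties\<close>

lemma Ck_on_Suc_imp:
  assumes "Ck_on (Suc n) S f" shows "Ck_on n S f"
  using assms
proof (induction n arbitrary: f)
  case 0
  then have "\<forall>x\<in>S. continuous (at x within S) f"
    by (metis Ck_on.simps(2) continuous_at_imp_continuous_at_within differentiable_imp_continuous_within)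
  then show ?case by (simp add: continuous_on_eq_continuous_within)
next
  case (Suc n)
  then show ?case by (subst Ck_on.simps, subst (asm) Ck_on.simps) blast
qed

lemma Ck_on_subset: "Ck_on n S f \<Longrightarrow> T \<subseteq> S \<Longrightarrow> Ck_on n T f"
  by (induction n arbitrary: f) (auto intro: continuous_on_subset)

lemma smooth_on_subset: "smooth_on S f \<Longrightarrow> T \<subseteq> S \<Longrightarrow> smooth_on T f"
  using Ck_on_subset unfolding smooth_on_def by blast

lemma Ck_on_SucI:
  assumes "open S" "\<And>x. x \<in> S \<Longrightarrow> (f has_derivative f' x) (at x)" "\<And>a. Ck_on n S (\<lambda>x. f' x a)"
  shows "Ck_on (Suc n) S f"
proof -
  have "f' x a = frechet_derivative f (at x) a" if "x \<in> S" for x a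
    using frechet_derivative_at[OF assms(2)[OF that]] by metis
  then have "Ck_on n S (\<lambda>x. frechet_derivative f (at x) a)" for a
    by (intro Ck_on_cong[OF assms(1) _ assms(3)[of a]]) auto
  then show ?thesis using assms(2) by (auto simp: differentiable_def)
qed

lemma Ck_on_const: "Ck_on n S (\<lambda>x. c)"
  by (induction n arbitrary: c) auto

lemma Ck_on_SucD:
  assumes "Ck_on (Suc n) S f" "x \<in> S"
  shows "(f has_derivative frechet_derivative f (at x)) (at x)"
  using assms by (simp add: frechet_derivative_works)

lemma Ck_on_add:
  assumes "open S" "Ck_on n S f" "Ck_on n S g"
  shows "Ck_on n S (\<lambda>x. f x + g x)"
  using assms(2,3)
proof (induction n arbitrary: f g)
  case 0 then show ?case by (auto intro: continuous_intros)
next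
  case (Suc n)
  show ?case
    by (rule Ck_on_SucI[OF assms(1)])
       (use Suc in \<open>auto intro!: has_derivative_add Ck_on_SucD simp del: Ck_on.simps\<close>, simp add: Suc)
qed

lemma Ck_on_bounded_linear:
  assumes "bounded_linear h" "open S" "Ck_on n S f"
  shows "Ck_on n S (\<lambda>x. h (f x))"
  using assms(3)
proof (induction n arbitrary: f)
  case 0 then show ?case
    using assms(1) by (auto intro: bounded_linear.continuous_on)
next
  case (Suc n)
  show ?case
    by (rule Ck_on_SucI[OF assms(2), where f' = "\<lambda>x a. h (frechet_derivative f (at x) a)"])
      (use Suc bounded_linear.has_derivative[OF assms(1) Ck_on_SucD[OF Suc.prems]] in auto)
qed

lemma Ck_on_bilinear:
  assumes "bounded_bilinear h" "open S" "Ck_on n S f" "Ck_on n S g"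
  shows "Ck_on n S (\<lambda>x. h (f x) (g x))"
  using assms(3,4)
proof (induction n arbitrary: f g)
  case 0 then show ?case
    using assms(1) by (auto intro: bounded_bilinear.continuous_on)
next
  case (Suc n)
  have 1: "Ck_on n S f" "Ck_on n S g" using Suc.prems by (auto intro: Ck_on_Suc_imp simp del: Ck_on.simps)
  show ?case
    by (rule Ck_on_SucI[OF assms(2), where f' = "\<lambda>x a. h (f x) (frechet_derivative g (at x) a) + h (frechet_derivative f (at x) a) (g x)"])
      (use Suc 1 bounded_bilinear.FDERIV[OF assms(1) Ck_on_SucD[OF Suc.prems(1)] Ck_on_SucD[OF Suc.prems(2)]] in \<open>auto intro!: Ck_on_add assms(2)\<close>)
qed

lemma Ck_on_sum:
  assumes "open S" "\<And>i. i \<in> I \<Longrightarrow> Ck_on n S (f i)"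
  shows "Ck_on n S (\<lambda>x. \<Sum>i\<in>I. f i x)"
  using assms(2)
  by (induction I rule: infinite_finite_induct) (auto intro: Ck_on_const Ck_on_add[OF assms(1)])

lemma linear_euclidean_expand:
  fixes L :: "'a::euclidean_space \<Rightarrow> 'b::real_normed_vector"
  assumes "linear L"
  shows "L v = (\<Sum>b\<in>Basis. (v \<bullet> b) *\<^sub>R L b)"
proof -
  have "L v = L (\<Sum>b\<in>Basis. (v \<bullet> b) *\<^sub>R b)" by (simp add: euclidean_representation)
  also have "\<dots> = (\<Sum>b\<in>Basis. (v \<bullet> b) *\<^sub>R L b)" using assms by (simp add: linear_sum linear_scale)
  finally show ?thesis .
qed

text \<open>In a basis, the derivative of a composite is a finite sum of products of derivatives. This form
  stays within the class of functions covered by the induction hypothesis.\<close>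

lemma Ck_on_compose:
  fixes g :: "'a::euclidean_space \<Rightarrow> 'b::euclidean_space"
  assumes "open S" "open T" "\<And>x. x \<in> S \<Longrightarrow> g x \<in> T" "Ck_on n S g" "Ck_on n T f"
  shows "Ck_on n S (\<lambda>x. f (g x))"
  using assms(4,5)
proof (induction n arbitrary: f)
  case 0 then show ?case
    using assms(3) by (auto intro: continuous_on_compose2)
next
  case (Suc n)
  have 1: "Ck_on n S g" using Suc.prems by (auto intro: Ck_on_Suc_imp simp del: Ck_on.simps)
  show ?case
  proof (rule Ck_on_SucI[OF assms(1)])
    fix x assume x: "x \<in> S"
    have "((\<lambda>x. f (g x)) has_derivative (\<lambda>a. frechet_derivative f (at (g x)) (frechet_derivative g (at x) a))) (at x)"
      by (rule has_derivative_compose[OF Ck_on_SucD[OF Suc.prems(1) x] Ck_on_SucD[OF Suc.prems(2) assms(3)[OF x]]])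
    moreover have "linear (frechet_derivative f (at (g x)))"
      using Ck_on_SucD[OF Suc.prems(2) assms(3)[OF x]] has_derivative_linear by blast
    ultimately show "((\<lambda>x. f (g x)) has_derivative (\<lambda>a. \<Sum>b\<in>Basis. (frechet_derivative g (at x) a \<bullet> b) *\<^sub>R frechet_derivative f (at (g x)) b)) (at x)"
      by (simp flip: linear_euclidean_expand)
  next
    fix a
    show "Ck_on n S (\<lambda>x. \<Sum>b\<in>Basis. (frechet_derivative g (at x) a \<bullet> b) *\<^sub>R frechet_derivative f (at (g x)) b)"
      using Suc assms(1) 1
      by (intro Ck_on_sum Ck_on_bilinear[OF bounded_bilinear_scaleR] Ck_on_inner
          Suc.IH[of "\<lambda>y. frechet_derivative f (at y) _"]) auto
  qed
qed

subsection \<open>Smoothness near a point\<close>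

text \<open>Smoothness as a property of the germ at a point. This is what \<open>smooth_at\<close> asks for in a chart, and it
  is closed under all the operations used below without any bookkeeping of domains.\<close>

definition smooth_near :: "('a::euclidean_space \<Rightarrow> 'b::real_normed_vector) \<Rightarrow> 'a \<Rightarrow> bool"
  where "smooth_near f x \<longleftrightarrow> (\<exists>W. open W \<and> x \<in> W \<and> smooth_on W f)"

named_theorems smooth_intros

lemma smooth_near_onI: "open W \<Longrightarrow> x \<in> W \<Longrightarrow> smooth_on W f \<Longrightarrow> smooth_near f x"
  by (auto simp: smooth_near_def)

lemma smooth_near_eventually:
  assumes "smooth_near f x" shows "\<forall>\<^sub>F y in nhds x. smooth_near f y"
  using assms unfolding smooth_near_def eventually_nhds by blast

lemma smooth_near_differentiable: "smooth_near f x \<Longrightarrow> f differentiable (at x)"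
  unfolding smooth_near_def smooth_on_def by (metis Ck_on.simps(2))

lemma smooth_near_has_derivative:
  "smooth_near f x \<Longrightarrow> (f has_derivative frechet_derivative f (at x)) (at x)"
  using smooth_near_differentiable frechet_derivative_works by blast

lemma smooth_near_linear: "smooth_near f x \<Longrightarrow> linear (frechet_derivative f (at x))"
  using smooth_near_has_derivative has_derivative_linear by blast

lemma smooth_near_isCont: "smooth_near f x \<Longrightarrow> isCont f x"
  by (simp add: smooth_near_differentiable differentiable_imp_continuous_within)

lemma smooth_near_cong:
  assumes "smooth_near f x" "\<forall>\<^sub>F y in nhds x. f y = g y" shows "smooth_near g x"
proof -
  obtain W where W: "open W" "x \<in> W" "smooth_on W f" using assms by (auto simp: smooth_near_def)
  obtain W' where W': "open W'" "x \<in> W'" "\<forall>y\<in>W'. f y = g y" using assms by (auto simp: eventually_nhds)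
  have "smooth_on (W \<inter> W') g" unfolding smooth_on_def
    using W W' Ck_on_cong[of "W \<inter> W'" f g] Ck_on_subset[of _ W f "W \<inter> W'"] by (auto simp: smooth_on_def)
  then show ?thesis using W W' by (intro smooth_near_onI[of "W \<inter> W'"]) auto
qed

lemma frechet_derivative_cong_eventually:
  assumes "\<forall>\<^sub>F y in nhds x. f y = g y"
  shows "frechet_derivative f (at x) = frechet_derivative g (at x)"
proof -
  obtain W where W: "open W" "x \<in> W" "\<forall>y\<in>W. f y = g y" using assms by (auto simp: eventually_nhds)
  then have "(f has_derivative F') (at x) \<longleftrightarrow> (g has_derivative F') (at x)" for F'
    using has_derivative_transform_within_open[of f F' x UNIV W g]
          has_derivative_transform_within_open[of g F' x UNIV W f] by auto
  then show ?thesis by (simp add: frechet_derivative_def)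
qed

lemma smooth_on_iff_near:
  assumes "open S" shows "smooth_on S f \<longleftrightarrow> (\<forall>x\<in>S. smooth_near f x)"
proof
  show "smooth_on S f \<Longrightarrow> \<forall>x\<in>S. smooth_near f x" using assms smooth_near_onI by blast
next
  assume *: "\<forall>x\<in>S. smooth_near f x"
  have "Ck_on n S f" if "\<forall>x\<in>S. \<exists>W. open W \<and> x \<in> W \<and> Ck_on n W f" for n
    using that
  proof (induction n arbitrary: f)
    case 0
    then show ?case
      by (metis Ck_on.simps(1) assms continuous_at_imp_continuous_on continuous_on_eq_continuous_at)
  next
    case (Suc n)
    then show ?case by (auto) (metis)
  qed
  then show "smooth_on S f" using * unfolding smooth_near_def smooth_on_def by metis
qed

lemma smooth_near_const [smooth_intros, simp]: "smooth_near (\<lambda>x. c) x"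
  by (auto simp: smooth_near_def smooth_on_def Ck_on_const)

lemma Ck_on_ident: "Ck_on n S (\<lambda>x. x)"
  by (cases n) (auto simp: Ck_on_const)

lemma smooth_near_ident [smooth_intros, simp]: "smooth_near (\<lambda>x. x) x"
  by (auto simp: smooth_near_def smooth_on_def Ck_on_ident)

lemma smooth_near_bounded_linear:
  assumes "bounded_linear h" "smooth_near f x" shows "smooth_near (\<lambda>x. h (f x)) x"
  using assms Ck_on_bounded_linear[OF assms(1)] unfolding smooth_near_def smooth_on_def by blast

lemma smooth_near_combine:
  assumes "\<And>n S. open S \<Longrightarrow> Ck_on n S f \<Longrightarrow> Ck_on n S g \<Longrightarrow> Ck_on n S k"
    and "smooth_near f x" "smooth_near g x"
  shows "smooth_near k x"
proof -
  obtain W W' where W: "open W" "x \<in> W" "smooth_on W f" "open W'" "x \<in> W'" "smooth_on W' g"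
    using assms by (auto simp: smooth_near_def)
  then have "smooth_on (W \<inter> W') k"
    using assms(1)[of "W \<inter> W'"] Ck_on_subset[of _ W f "W \<inter> W'"] Ck_on_subset[of _ W' g "W \<inter> W'"]
    by (auto simp: smooth_on_def)
  then show ?thesis using W by (intro smooth_near_onI[of "W \<inter> W'"]) auto
qed

lemma smooth_near_bilinear:
  assumes "bounded_bilinear h" "smooth_near f x" "smooth_near g x"
  shows "smooth_near (\<lambda>x. h (f x) (g x)) x"
  by (rule smooth_near_combine[OF Ck_on_bilinear[OF assms(1)] assms(2,3)])

lemma smooth_near_add [smooth_intros]:
  "smooth_near f x \<Longrightarrow> smooth_near g x \<Longrightarrow> smooth_near (\<lambda>x. f x + g x) x"
  by (rule smooth_near_combine[OF Ck_on_add])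

lemma smooth_near_minus [smooth_intros]:
  "smooth_near f x \<Longrightarrow> smooth_near (\<lambda>x. - f x) x"
  by (rule smooth_near_bounded_linear[OF bounded_linear_minus[OF bounded_linear_ident]])

lemma smooth_near_diff [smooth_intros]:
  "smooth_near f x \<Longrightarrow> smooth_near g x \<Longrightarrow> smooth_near (\<lambda>x. f x - g x) x"
  using smooth_near_add[of f x "\<lambda>x. - g x"] smooth_near_minus[of g x] by simp

lemmas smooth_near_scaleR [smooth_intros] = smooth_near_bilinear[OF bounded_bilinear_scaleR]
lemmas smooth_near_mult [smooth_intros] = smooth_near_bilinear[OF bounded_bilinear_mult]
lemmas smooth_near_inner [smooth_intros] = smooth_near_bilinear[OF bounded_bilinear_inner]
lemmas smooth_near_fst [smooth_intros] = smooth_near_bounded_linear[OF bounded_linear_fst]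
lemmas smooth_near_snd [smooth_intros] = smooth_near_bounded_linear[OF bounded_linear_snd]
lemma smooth_near_sum [smooth_intros]:
  "(\<And>i. i \<in> I \<Longrightarrow> smooth_near (f i) x) \<Longrightarrow> smooth_near (\<lambda>x. \<Sum>i\<in>I. f i x) x"
  by (induction I rule: infinite_finite_induct) (auto intro: smooth_near_add)

lemma smooth_near_power [smooth_intros]:
  fixes f :: "_ \<Rightarrow> real"
  shows "smooth_near f x \<Longrightarrow> smooth_near (\<lambda>x. f x ^ n) x"
  by (induction n) (auto intro: smooth_intros)

lemma smooth_near_Pair [smooth_intros]:
  fixes f :: "_ \<Rightarrow> 'b::euclidean_space" and g :: "_ \<Rightarrow> 'c::euclidean_space"
  assumes "smooth_near f x" "smooth_near g x" shows "smooth_near (\<lambda>x. (f x, g x)) x"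
proof -
  have "smooth_near (\<lambda>x. (f x, 0) + (0, g x)) x"
    by (intro smooth_near_add smooth_near_bounded_linear[OF _ assms(1)] smooth_near_bounded_linear[OF _ assms(2)])
       (auto intro: bounded_linear_intros)
  then show ?thesis by simp
qed

lemma smooth_near_compose:
  fixes g :: "'a::euclidean_space \<Rightarrow> 'b::euclidean_space"
  assumes "smooth_near g x" "smooth_near f (g x)"
  shows "smooth_near (\<lambda>x. f (g x)) x"
proof -
  obtain W T where W: "open W" "x \<in> W" "smooth_on W g" "open T" "g x \<in> T" "smooth_on T f"
    using assms by (auto simp: smooth_near_def)
  define S where "S = W \<inter> g -` T"
  have "continuous_on W g" using W(3) by (metis Ck_on.simps(1) smooth_on_def)
  then have S: "open S" "x \<in> S" using W unfolding S_def
    by (auto intro: continuous_open_preimage)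
  have "smooth_on S (\<lambda>x. f (g x))" unfolding smooth_on_def
    using W S Ck_on_compose[of S T g] Ck_on_subset[of _ W g S] by (auto simp: smooth_on_def S_def)
  then show ?thesis using S smooth_near_onI by blast
qed

lemma smooth_near_euclideanI:
  fixes f :: "_ \<Rightarrow> 'b::euclidean_space"
  assumes "\<And>b. b \<in> Basis \<Longrightarrow> smooth_near (\<lambda>x. f x \<bullet> b) x"
  shows "smooth_near f x"
proof -
  have "smooth_near (\<lambda>x. \<Sum>b\<in>Basis. (f x \<bullet> b) *\<^sub>R b) x"
    using assms by (intro smooth_near_sum smooth_near_scaleR) auto
  then show ?thesis by (simp add: euclidean_representation)
qed

lemma smooth_near_vector2 [smooth_intros]:
  assumes "smooth_near f x" "smooth_near g x"
  shows "smooth_near (\<lambda>x. vector [f x, g x] :: real^2) x"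
proof -
  have "smooth_near (\<lambda>x. f x *\<^sub>R axis 1 1 + g x *\<^sub>R (axis 2 1 :: real^2)) x"
    using assms by (intro smooth_intros)
  moreover have "(\<lambda>x. f x *\<^sub>R axis 1 1 + g x *\<^sub>R (axis 2 1 :: real^2)) = (\<lambda>x. vector [f x, g x])"
    by (auto simp: vec_eq_iff forall_2 axis_def)
  ultimately show ?thesis by simp
qed

lemma smooth_near_frechet_derivative_const:
  assumes "smooth_near f x" shows "smooth_near (\<lambda>y. frechet_derivative f (at y) a) x"
  using assms unfolding smooth_near_def smooth_on_def by (metis Ck_on.simps(2))

lemma smooth_near_frechet_derivative [smooth_intros]:
  fixes h :: "_ \<Rightarrow> 'a::euclidean_space"
  assumes "smooth_near f (k x)" "smooth_near k x" "smooth_near h x"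
  shows "smooth_near (\<lambda>y. frechet_derivative f (at (k y)) (h y)) x"
proof (rule smooth_near_cong)
  show "smooth_near (\<lambda>y. \<Sum>b\<in>Basis. (h y \<bullet> b) *\<^sub>R frechet_derivative f (at (k y)) b) x"
    by (intro smooth_near_sum smooth_near_scaleR smooth_near_inner assms(3) smooth_near_const
          smooth_near_compose[OF assms(2), where f="\<lambda>y. frechet_derivative f (at y) _"]
          smooth_near_frechet_derivative_const assms(1))
  have "\<forall>\<^sub>F y in nhds x. smooth_near f (k y)"
    using smooth_near_eventually[OF assms(1)] smooth_near_isCont[OF assms(2)]
    by (metis eventually_nhds_conv_at filterlim_iff isCont_def assms(1))
  then show "\<forall>\<^sub>F y in nhds x. (\<Sum>b\<in>Basis. (h y \<bullet> b) *\<^sub>R frechet_derivative f (at (k y)) b) = frechet_derivative f (at (k y)) (h y)"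
    by eventually_elim (simp flip: linear_euclidean_expand[OF smooth_near_linear])
qed

lemma Ck_on_SucI_real:
  fixes f :: "real \<Rightarrow> real"
  assumes "open S" "\<And>x. x \<in> S \<Longrightarrow> (f has_real_derivative f' x) (at x)" "Ck_on n S f'"
  shows "Ck_on (Suc n) S f"
  by (rule Ck_on_SucI[OF assms(1), where f' = "\<lambda>x a. f' x * a"])
     (use assms in \<open>auto simp: has_field_derivative_def intro!: Ck_on_bilinear[OF bounded_bilinear_mult] Ck_on_const\<close>)

lemma Ck_on_inverse: "Ck_on n (- {0}) (inverse :: real \<Rightarrow> real)"
proof (induction n)
  case (Suc n)
  show ?case
    by (rule Ck_on_SucI_real[where f' = "\<lambda>x. (- 1) * (inverse x * inverse x)"])
       (intro Ck_on_bilinear[OF bounded_bilinear_mult] Suc Ck_on_const | force intro!: DERIV_inverse[THEN DERIV_cong])+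
qed (auto intro: continuous_intros)

lemma smooth_near_inverse [smooth_intros]:
  "smooth_near f x \<Longrightarrow> f x \<noteq> (0::real) \<Longrightarrow> smooth_near (\<lambda>x. inverse (f x)) x"
  by (erule smooth_near_compose) (rule smooth_near_onI[of "-{0}"], auto simp: smooth_on_def Ck_on_inverse)

lemma smooth_near_divide [smooth_intros]:
  "smooth_near f x \<Longrightarrow> smooth_near g x \<Longrightarrow> g x \<noteq> (0::real) \<Longrightarrow> smooth_near (\<lambda>x. f x / g x) x"
  unfolding divide_inverse by (intro smooth_near_mult smooth_near_inverse)

lemma Ck_on_sqrt: "Ck_on n {0<..} sqrt"
proof (induction n)
  case (Suc n)
  have "Ck_on n {0<..} (\<lambda>x. inverse (sqrt x) * (1/2))"
    by (intro Ck_on_bilinear[OF bounded_bilinear_mult] Ck_on_const Ck_on_compose[OF _ _ _ Suc Ck_on_inverse]) auto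
  then show ?case
    by (intro Ck_on_SucI_real[where f' = "\<lambda>x. inverse (sqrt x) * (1/2)"])
       (auto intro!: DERIV_real_sqrt[THEN DERIV_cong])
qed (auto intro: continuous_intros)

lemma smooth_near_sqrt [smooth_intros]:
  "smooth_near f x \<Longrightarrow> f x > 0 \<Longrightarrow> smooth_near (\<lambda>x. sqrt (f x)) x"
  by (erule smooth_near_compose) (rule smooth_near_onI[of "{0<..}"], auto simp: smooth_on_def Ck_on_sqrt)

lemma Ck_on_sin_cos: "Ck_on n UNIV (sin :: real \<Rightarrow> real)" "Ck_on n UNIV (cos :: real \<Rightarrow> real)"
proof (induction n)
  case (Suc n)
  show "Ck_on (Suc n) UNIV (sin :: real \<Rightarrow> real)"
    by (rule Ck_on_SucI_real[where f' = cos]) (use Suc in auto)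
  show "Ck_on (Suc n) UNIV (cos :: real \<Rightarrow> real)"
    by (rule Ck_on_SucI_real[where f' = "\<lambda>x. (- 1) * sin x"])
       (intro Ck_on_bilinear[OF bounded_bilinear_mult] Suc Ck_on_const | force intro!: DERIV_cos[THEN DERIV_cong])+
qed (auto intro: continuous_intros)

lemma smooth_near_sin [smooth_intros]: "smooth_near f x \<Longrightarrow> smooth_near (\<lambda>x. sin (f x :: real)) x"
  and smooth_near_cos [smooth_intros]: "smooth_near f x \<Longrightarrow> smooth_near (\<lambda>x. cos (f x :: real)) x"
  by (erule smooth_near_compose, rule smooth_near_onI[of UNIV], auto simp: smooth_on_def Ck_on_sin_cos)+

lemma Ck_on_arctan: "Ck_on n UNIV arctan"
proof (cases n)
  case (Suc m)
  have "Ck_on m UNIV (\<lambda>x::real. inverse (1 + x * x))"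
  proof (rule Ck_on_compose[where f = inverse and T = "- {0}"])
    show "1 + x * x \<in> - {0}" for x :: real by (simp, metis add_pos_nonneg less_irrefl zero_le_square zero_less_one)
  qed (auto intro!: Ck_on_inverse Ck_on_add Ck_on_bilinear[OF bounded_bilinear_mult] Ck_on_const Ck_on_ident)
  then show ?thesis unfolding Suc
    by (intro Ck_on_SucI_real[where f' = "\<lambda>x. inverse (1 + x * x)"]) (auto intro!: DERIV_arctan[THEN DERIV_cong] simp: power2_eq_square)
qed (auto intro: continuous_intros)

lemma smooth_near_arctan [smooth_intros]: "smooth_near f x \<Longrightarrow> smooth_near (\<lambda>x. arctan (f x)) x"
  by (erule smooth_near_compose) (rule smooth_near_onI[of UNIV], auto simp: smooth_on_def Ck_on_arctan)

subsection \<open>Symmetry of second derivatives\<close>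

text \<open>The mean value theorem, applied once in each direction, turns a second difference of \<open>f\<close> over a small
  parallelogram into a mixed derivative at an interior point. The second difference does not
  distinguish the two directions, whence the symmetry of second derivatives.\<close>

lemma second_difference_mvt:
  fixes f :: "'a::euclidean_space \<Rightarrow> real"
  assumes sm: "\<forall>s\<in>{0..h}. \<forall>t\<in>{0..h}. smooth_near f (x + s *\<^sub>R a + t *\<^sub>R b)" and h: "h > 0"
  shows "\<exists>s t. 0 < s \<and> s < h \<and> 0 < t \<and> t < h \<and>
    f (x + h *\<^sub>R a + h *\<^sub>R b) - f (x + h *\<^sub>R a) - f (x + h *\<^sub>R b) + f x
      = h * h * frechet_derivative (\<lambda>y. frechet_derivative f (at y) a) (at (x + s *\<^sub>R a + t *\<^sub>R b)) b"
proof -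
  have f: "smooth_near f (x + s *\<^sub>R a + t *\<^sub>R b)" if "0 \<le> s" "s \<le> h" "0 \<le> t" "t \<le> h" for s t
    using sm that by simp
  have line: "((\<lambda>s. k (z + s *\<^sub>R c)) has_real_derivative frechet_derivative k (at (z + s *\<^sub>R c)) c) (at s)"
    if "smooth_near k (z + s *\<^sub>R c)" for k :: "'a \<Rightarrow> real" and z c s
  proof -
    have "((\<lambda>s. z + s *\<^sub>R c) has_derivative (\<lambda>s. s *\<^sub>R c)) (at s)" by (auto intro!: derivative_eq_intros)
    from has_derivative_compose[OF this smooth_near_has_derivative[OF that]]
    have "((\<lambda>s. k (z + s *\<^sub>R c)) has_derivative (\<lambda>r. frechet_derivative k (at (z + s *\<^sub>R c)) (r *\<^sub>R c))) (at s)" .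
    moreover have "(\<lambda>r. frechet_derivative k (at (z + s *\<^sub>R c)) (r *\<^sub>R c)) = (*) (frechet_derivative k (at (z + s *\<^sub>R c)) c)"
      using linear_scale[OF smooth_near_linear[OF that]] by (simp add: fun_eq_iff)
    ultimately show ?thesis by (simp add: has_field_derivative_def)
  qed
  let ?D = "\<lambda>y. frechet_derivative f (at y) a"
  let ?p = "\<lambda>s. f (x + h *\<^sub>R b + s *\<^sub>R a) - f (x + s *\<^sub>R a)"
  let ?p' = "\<lambda>s. ?D (x + h *\<^sub>R b + s *\<^sub>R a) - ?D (x + s *\<^sub>R a)"
  have p: "(?p has_real_derivative ?p' s) (at s)" if "0 \<le> s" "s \<le> h" for s
  proof (intro DERIV_diff line)
    have "x + h *\<^sub>R b + s *\<^sub>R a = x + s *\<^sub>R a + h *\<^sub>R b" by simp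
    then show "smooth_near f (x + h *\<^sub>R b + s *\<^sub>R a)" using f[of s h] that h by (metis less_imp_le order_refl)
    show "smooth_near f (x + s *\<^sub>R a)" using f[of s 0] that h by simp
  qed
  obtain s where s: "0 < s" "s < h" "?p h - ?p 0 = (h - 0) * ?p' s"
    using MVT2[OF h p] by blast
  let ?q = "\<lambda>t. ?D (x + s *\<^sub>R a + t *\<^sub>R b)"
  have q: "(?q has_real_derivative frechet_derivative ?D (at (x + s *\<^sub>R a + t *\<^sub>R b)) b) (at t)"
    if "0 \<le> t" "t \<le> h" for t
    by (intro line smooth_near_frechet_derivative_const f) (use that s in auto)
  obtain t where t: "0 < t" "t < h" "?q h - ?q 0
     = (h - 0) * frechet_derivative ?D (at (x + s *\<^sub>R a + t *\<^sub>R b)) b"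
    using MVT2[OF h q] by blast
  have sw: "x + h *\<^sub>R b + r *\<^sub>R a = x + r *\<^sub>R a + h *\<^sub>R b" for r by simp
  have "f (x + h *\<^sub>R a + h *\<^sub>R b) - f (x + h *\<^sub>R a) - f (x + h *\<^sub>R b) + f x = ?p h - ?p 0"
    unfolding sw by simp
  also have "\<dots> = h * (?q h - ?q 0)" using s(3) unfolding sw by simp
  also have "\<dots> = h * h * frechet_derivative ?D (at (x + s *\<^sub>R a + t *\<^sub>R b)) b"
    using t(3) by simp
  finally show ?thesis using s t by blast
qed

lemma second_derivative_symmetric_real:
  fixes f :: "'a::euclidean_space \<Rightarrow> real"
  assumes "smooth_near f x"
  shows "frechet_derivative (\<lambda>y. frechet_derivative f (at y) a) (at x) b
       = frechet_derivative (\<lambda>y. frechet_derivative f (at y) b) (at x) a"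
proof -
  let ?A = "\<lambda>z. frechet_derivative (\<lambda>y. frechet_derivative f (at y) a) (at z) b"
  let ?B = "\<lambda>z. frechet_derivative (\<lambda>y. frechet_derivative f (at y) b) (at z) a"
  have "isCont ?A x" "isCont ?B x"
    by (intro smooth_near_isCont smooth_near_frechet_derivative_const assms)+
  then have lim1: "(?A \<longlongrightarrow> ?A x) (nhds x)" and lim2: "(?B \<longlongrightarrow> ?B x) (nhds x)"
    by (simp_all only: isCont_def tendsto_at_iff_tendsto_nhds[of ?A x] tendsto_at_iff_tendsto_nhds[of ?B x])
  have "\<bar>?A x - ?B x\<bar> < e" if e: "e > 0" for e
  proof -
    have "\<forall>\<^sub>F z in nhds x. smooth_near f z \<and> dist (?A z) (?A x) < e/2 \<and> dist (?B z) (?B x) < e/2"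
      using e by (intro eventually_conj smooth_near_eventually[OF assms] tendstoD[OF lim1] tendstoD[OF lim2]) auto
    then obtain d where d: "d > 0" "\<And>z. dist z x < d \<Longrightarrow> smooth_near f z \<and> dist (?A z) (?A x) < e/2 \<and> dist (?B z) (?B x) < e/2"
      unfolding eventually_nhds_metric by blast
    define K where "K = norm a + norm b + 1"
    have K: "K > 0" unfolding K_def using norm_ge_zero[of a] norm_ge_zero[of b] by linarith
    define h where "h = d / (2 * K)"
    have h: "h > 0" using d K by (simp add: h_def)
    have "h * K = d / 2" using K by (simp add: h_def)
    moreover have "h * (norm a + norm b) \<le> h * K" using h by (simp add: K_def mult_left_mono)
    ultimately have hd: "h * (norm a + norm b) < d" using d by linarith
    have near: "dist (x + s *\<^sub>R a + t *\<^sub>R b) x < d" if "0 \<le> s" "s \<le> h" "0 \<le> t" "t \<le> h" for s t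
    proof -
      have "dist (x + s *\<^sub>R a + t *\<^sub>R b) x \<le> s * norm a + t * norm b"
        using that norm_triangle_ineq[of "s *\<^sub>R a" "t *\<^sub>R b"] by (simp add: dist_norm)
      also have "\<dots> \<le> h * norm a + h * norm b" using that by (intro add_mono mult_right_mono) auto
      finally show ?thesis using hd unfolding distrib_left by linarith
    qed
    have sw: "x + s *\<^sub>R b + t *\<^sub>R a = x + t *\<^sub>R a + s *\<^sub>R b" for s t by simp
    have "\<forall>s\<in>{0..h}. \<forall>t\<in>{0..h}. smooth_near f (x + s *\<^sub>R a + t *\<^sub>R b)"
      using d(2)[OF near] by simp
    from second_difference_mvt[OF this h]
    obtain s t where 1: "0 < s" "s < h" "0 < t" "t < h" and
       e1: "f (x + h *\<^sub>R a + h *\<^sub>R b) - f (x + h *\<^sub>R a) - f (x + h *\<^sub>R b) + f x = h * h * ?A (x + s *\<^sub>R a + t *\<^sub>R b)"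
      by blast
    have "\<forall>s\<in>{0..h}. \<forall>t\<in>{0..h}. smooth_near f (x + s *\<^sub>R b + t *\<^sub>R a)"
      unfolding sw using d(2)[OF near] by simp
    from second_difference_mvt[OF this h]
    obtain s' t' where 2: "0 < s'" "s' < h" "0 < t'" "t' < h" and
       e2: "f (x + h *\<^sub>R b + h *\<^sub>R a) - f (x + h *\<^sub>R b) - f (x + h *\<^sub>R a) + f x = h * h * ?B (x + s' *\<^sub>R b + t' *\<^sub>R a)"
      by blast
    have "f (x + h *\<^sub>R a + h *\<^sub>R b) - f (x + h *\<^sub>R b) - f (x + h *\<^sub>R a) + f x = h * h * ?B (x + s' *\<^sub>R b + t' *\<^sub>R a)"
      using e2 unfolding sw[of h h] .
    with e1 have "(h * h) * ?A (x + s *\<^sub>R a + t *\<^sub>R b) = (h * h) * ?B (x + s' *\<^sub>R b + t' *\<^sub>R a)"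
      by linarith
    moreover have "h * h \<noteq> 0" using h by simp
    ultimately have AB: "?A (x + s *\<^sub>R a + t *\<^sub>R b) = ?B (x + s' *\<^sub>R b + t' *\<^sub>R a)"
      by (rule mult_left_cancel[THEN iffD1, rotated])
    have "dist (?A (x + s *\<^sub>R a + t *\<^sub>R b)) (?A x) < e/2"
      using d(2)[OF near] 1 by simp
    moreover have "dist (?A (x + s *\<^sub>R a + t *\<^sub>R b)) (?B x) < e/2"
      unfolding AB sw using d(2)[OF near] 2 by simp
    ultimately have "dist (?A x) (?B x) < e" by (rule dist_triangle_half_r)
    then show ?thesis by (simp only: dist_real_def)
  qed
  then have "\<not> 0 < \<bar>?A x - ?B x\<bar>" by blast
  then show ?thesis by simp
qed

lemma frechet_derivative_eqI: "(f has_derivative f') (at x) \<Longrightarrow> frechet_derivative f (at x) = f'"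
  using frechet_derivative_at by metis

lemma frechet_derivative_inner:
  assumes "smooth_near f x"
  shows "frechet_derivative (\<lambda>y. f y \<bullet> c) (at x) a = frechet_derivative f (at x) a \<bullet> c"
  using frechet_derivative_eqI[OF has_derivative_inner_left[OF smooth_near_has_derivative[OF assms]]] by metis

lemma second_derivative_symmetric:
  fixes f :: "'a::euclidean_space \<Rightarrow> 'b::euclidean_space"
  assumes "smooth_near f x"
  shows "frechet_derivative (\<lambda>y. frechet_derivative f (at y) a) (at x) b
       = frechet_derivative (\<lambda>y. frechet_derivative f (at y) b) (at x) a"
proof (rule euclidean_eqI)
  fix c :: 'b
  have *: "frechet_derivative (\<lambda>y. frechet_derivative f (at y) a) (at x) b \<bullet> c
     = frechet_derivative (\<lambda>y. frechet_derivative (\<lambda>y. f y \<bullet> c) (at y) a) (at x) b" for a b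
  proof -
    have "\<forall>\<^sub>F y in nhds x. frechet_derivative f (at y) a \<bullet> c = frechet_derivative (\<lambda>y. f y \<bullet> c) (at y) a"
      using smooth_near_eventually[OF assms] by eventually_elim (simp add: frechet_derivative_inner)
    from frechet_derivative_cong_eventually[OF this]
      frechet_derivative_inner[OF smooth_near_frechet_derivative_const[OF assms, of a], of c b]
    show ?thesis by simp
  qed
  show "frechet_derivative (\<lambda>y. frechet_derivative f (at y) a) (at x) b \<bullet> c
       = frechet_derivative (\<lambda>y. frechet_derivative f (at y) b) (at x) a \<bullet> c"
    unfolding * by (rule second_derivative_symmetric_real) (intro smooth_intros assms)
qed

subsection \<open>Curves\<close>

lemma smooth_near_has_vector_derivative:
  fixes c :: "real \<Rightarrow> 'a::euclidean_space"
  assumes c: "(c has_vector_derivative d) (at t)" and f: "smooth_near f (c t)"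
  shows "((\<lambda>s. f (c s)) has_vector_derivative frechet_derivative f (at (c t)) d) (at t)"
proof -
  have "((\<lambda>s. f (c s)) has_derivative (\<lambda>r. frechet_derivative f (at (c t)) (r *\<^sub>R d))) (at t)"
    by (rule has_derivative_compose[OF c[unfolded has_vector_derivative_def] smooth_near_has_derivative[OF f]])
  then show ?thesis by (simp add: has_vector_derivative_def linear_scale[OF smooth_near_linear[OF f]])
qed

lemma isCont_nhds: "isCont f x \<longleftrightarrow> (f \<longlongrightarrow> f x) (nhds x)"
  unfolding isCont_def by (rule tendsto_at_iff_tendsto_nhds)

lemma eventually_nhds_isCont:
  assumes "isCont c t" "\<forall>\<^sub>F w in nhds (c t). P w" shows "\<forall>\<^sub>F s in nhds t. P (c s)"
  using filterlim_iff[THEN iffD1, OF assms(1)[unfolded isCont_nhds]] assms(2) by blast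

lemma has_vector_derivative_isCont: "(c has_vector_derivative d) (at t) \<Longrightarrow> isCont c t"
  by (metis has_vector_derivative_continuous)

lemma line_has_vector_derivative: "((\<lambda>t. u + t *\<^sub>R a) has_vector_derivative a) (at t)"
  by (auto intro!: derivative_eq_intros)

lemma has_derivative_eventually_unique:
  assumes "(f has_derivative f') (at x)" "(g has_derivative g') (at x)" "\<forall>\<^sub>F y in nhds x. f y = g y"
  shows "f' c = g' c"
  using frechet_derivative_cong_eventually[OF assms(3)] frechet_derivative_eqI[OF assms(1)] frechet_derivative_eqI[OF assms(2)]
  by simp

section \<open>Tangent vectors of a smooth atlas\<close>

locale atlas =
  fixes A :: "('m, 'e::euclidean_space) atlas"
  assumes smooth_atlas: "smooth_atlas A"
begin

lemma chart_open: "(\<Omega>, x) \<in> A \<Longrightarrow> open \<Omega>"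
  and chart_inj: "(\<Omega>, x) \<in> A \<Longrightarrow> inj_on x \<Omega>"
  using smooth_atlas by (auto simp: smooth_atlas_def)

lemma chart_carrier: "(\<Omega>, x) \<in> A \<Longrightarrow> u \<in> \<Omega> \<Longrightarrow> x u \<in> carrier_of A"
  by (auto simp: carrier_of_def)

lemma carrierE:
  assumes "z \<in> carrier_of A" obtains \<Omega> x u where "(\<Omega>, x) \<in> A" "u \<in> \<Omega>" "z = x u"
  using assms by (auto simp: carrier_of_def)

lemma transition_eqI:
  assumes "(\<Omega>', x') \<in> A" "u' \<in> \<Omega>'" "x' u' = x u"
  shows "transition \<Omega>' x' x u = u'"
  using assms chart_inj[OF assms(1)] by (metis inv_into_f_f transition_def)

lemma transition_near:
  assumes "(\<Omega>, x) \<in> A" "(\<Omega>', x') \<in> A" "u \<in> \<Omega>" "x u \<in> x' ` \<Omega>'"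
  shows "\<forall>\<^sub>F v in nhds u. v \<in> \<Omega> \<and> x v \<in> x' ` \<Omega>' \<and>
           transition \<Omega>' x' x v \<in> \<Omega>' \<and> x' (transition \<Omega>' x' x v) = x v"
proof -
  let ?W = "{u \<in> \<Omega>. x u \<in> x' ` \<Omega>'}"
  have "open ?W" using smooth_atlas assms(1,2) by (fastforce simp: smooth_atlas_def)
  then have "\<forall>\<^sub>F v in nhds u. v \<in> ?W" using assms by (intro eventually_nhds_in_open) auto
  then show ?thesis
    by eventually_elim (auto simp: transition_def inv_into_into f_inv_into_f)
qed

lemma transition_at:
  assumes "(\<Omega>, x) \<in> A" "(\<Omega>', x') \<in> A" "u \<in> \<Omega>" "x u \<in> x' ` \<Omega>'"
  shows "transition \<Omega>' x' x u \<in> \<Omega>'" "x' (transition \<Omega>' x' x u) = x u"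
  using eventually_nhds_x_imp_x[OF transition_near[OF assms]] by auto

lemma transition_smooth:
  assumes "(\<Omega>, x) \<in> A" "(\<Omega>', x') \<in> A" "u \<in> \<Omega>" "x u \<in> x' ` \<Omega>'"
  shows "smooth_near (transition \<Omega>' x' x) u"
  using smooth_atlas assms by (intro smooth_near_onI[of "{u \<in> \<Omega>. x u \<in> x' ` \<Omega>'}"])
     (fastforce simp: smooth_atlas_def)+

text \<open>One parametrization suffices to test smoothness, because transition maps are smooth.\<close>

lemma smooth_at_iff:
  assumes "(\<Omega>, x) \<in> A" "u \<in> \<Omega>"
  shows "smooth_at A (x u) f \<longleftrightarrow> smooth_near (\<lambda>w. f (x w)) u"
proof
  assume "smooth_at A (x u) f"
  then show "smooth_near (\<lambda>w. f (x w)) u"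
    using assms unfolding smooth_at_def smooth_near_def by fastforce
next
  assume *: "smooth_near (\<lambda>w. f (x w)) u"
  show "smooth_at A (x u) f" unfolding smooth_at_def
  proof clarify
    fix \<Omega>' x' u' assume x': "(\<Omega>', x') \<in> A" "u' \<in> \<Omega>'" "x' u' = x u"
    let ?h = "transition \<Omega> x x'"
    have im: "x' u' \<in> x ` \<Omega>" using x' assms by simp
    have hu: "?h u' = u" using transition_eqI assms x' by metis
    have "smooth_near (\<lambda>w. f (x (?h w))) u'"
      by (rule smooth_near_compose[OF transition_smooth[OF x'(1) assms(1) x'(2) im]]) (simp add: hu *)
    moreover have "\<forall>\<^sub>F w in nhds u'. f (x (?h w)) = f (x' w)"
      using transition_near[OF x'(1) assms(1) x'(2) im] by eventually_elim auto
    ultimately have "smooth_near (\<lambda>w. f (x' w)) u'" by (rule smooth_near_cong)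
    then obtain W where "open W" "u' \<in> W" "smooth_on W (\<lambda>w. f (x' w))" by (auto simp: smooth_near_def)
    then show "\<exists>W. open W \<and> u' \<in> W \<and> W \<subseteq> \<Omega>' \<and> smooth_on W (\<lambda>w. f (x' w))"
      using chart_open[OF x'(1)] x'(2) by (intro exI[of _ "W \<inter> \<Omega>'"]) (auto intro: smooth_on_subset)
  qed
qed

lemma velocity_eq:
  assumes "(\<Omega>, x) \<in> A" "c 0 \<in> \<Omega>" "(c has_vector_derivative d) (at 0)"
    and "\<forall>\<^sub>F t in nhds 0. \<sigma> t = x (c t)" and "smooth_at A (x (c 0)) f"
  shows "velocity A \<sigma> f = frechet_derivative (\<lambda>w. f (x w)) (at (c 0)) d"
    and "((\<lambda>t. f (\<sigma> t)) has_real_derivative frechet_derivative (\<lambda>w. f (x w)) (at (c 0)) d) (at 0)"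
proof -
  have sm: "smooth_near (\<lambda>w. f (x w)) (c 0)" using assms smooth_at_iff by blast
  let ?D = "frechet_derivative (\<lambda>w. f (x w)) (at (c 0))"
  have "((\<lambda>t. f (x (c t))) has_real_derivative ?D d) (at 0)"
    using smooth_near_has_vector_derivative[OF assms(3) sm]
    by (simp add: has_real_derivative_iff_has_vector_derivative)
  moreover have "\<forall>\<^sub>F t in nhds 0. f (\<sigma> t) = f (x (c t))" using assms(4) by eventually_elim simp
  ultimately show D: "((\<lambda>t. f (\<sigma> t)) has_real_derivative ?D d) (at 0)"
    using DERIV_cong_ev[OF refl _ refl, of "\<lambda>t. f (\<sigma> t)" "\<lambda>t. f (x (c t))" 0 "?D d"] by blast
  have "\<sigma> 0 = x (c 0)" using eventually_nhds_x_imp_x[OF assms(4)] .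
  then show "velocity A \<sigma> f = ?D d" using assms(5) D by (simp add: velocity_def DERIV_imp_deriv)
qed

lemma coord_vec_apply:
  assumes "(\<Omega>, x) \<in> A" "u \<in> \<Omega>" "smooth_at A (x u) f"
  shows "coord_vec A x u a f = frechet_derivative (\<lambda>w. f (x w)) (at u) a"
proof -
  have "((\<lambda>t. u + t *\<^sub>R a) has_vector_derivative a) (at 0)" by (auto intro!: derivative_eq_intros)
  from velocity_eq(1)[OF assms(1) _ this, of "\<lambda>t. x (u + t *\<^sub>R a)" f] assms
  show ?thesis by (simp add: coord_vec_def)
qed

lemma coord_vec_not_smooth: "\<not> smooth_at A (x u) f \<Longrightarrow> coord_vec A x u a f = 0"
  by (simp add: coord_vec_def velocity_def)

lemma velocity_coord_vec:
  assumes "(\<Omega>, x) \<in> A" "c 0 \<in> \<Omega>" "(c has_vector_derivative d) (at 0)"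
    and "\<forall>\<^sub>F t in nhds 0. \<sigma> t = x (c t)"
  shows "velocity A \<sigma> = coord_vec A x (c 0) d"
proof
  fix f
  have "\<sigma> 0 = x (c 0)" using eventually_nhds_x_imp_x[OF assms(4)] .
  then show "velocity A \<sigma> f = coord_vec A x (c 0) d f"
    using velocity_eq(1)[OF assms, of f] coord_vec_apply[OF assms(1,2), of f d] coord_vec_not_smooth[of x "c 0" f d]
    by (cases "smooth_at A (x (c 0)) f") (auto simp: velocity_def)
qed

text \<open>The chain rule for \<open>f \<circ> x = (f \<circ> x') \<circ> transition \<Omega>' x' x\<close>.\<close>

lemma coord_vec_change:
  assumes "(\<Omega>, x) \<in> A" "(\<Omega>', x') \<in> A" "u \<in> \<Omega>" "x u \<in> x' ` \<Omega>'"
  shows "coord_vec A x u a =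
    coord_vec A x' (transition \<Omega>' x' x u) (frechet_derivative (transition \<Omega>' x' x) (at u) a)"
proof -
  let ?h = "transition \<Omega>' x' x"
  let ?c = "\<lambda>t. ?h (u + t *\<^sub>R a)"
  have sm: "smooth_near ?h (u + 0 *\<^sub>R a)" using transition_smooth[OF assms] by simp
  have "(?c has_vector_derivative frechet_derivative ?h (at u) a) (at 0)"
    using smooth_near_has_vector_derivative[OF line_has_vector_derivative sm] by simp
  moreover have "\<forall>\<^sub>F t in nhds 0. x (u + t *\<^sub>R a) = x' (?c t)"
  proof -
    have "isCont (\<lambda>t. u + t *\<^sub>R a) 0" by (intro continuous_intros)
    moreover have "\<forall>\<^sub>F v in nhds u. x v = x' (?h v)"
      using transition_near[OF assms] by eventually_elim simp
    ultimately show ?thesis using eventually_nhds_isCont[where c = "\<lambda>t. u + t *\<^sub>R a" and t = 0] by simp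
  qed
  moreover have "?c 0 \<in> \<Omega>'" using transition_at[OF assms] by simp
  ultimately have "velocity A (\<lambda>t. x (u + t *\<^sub>R a)) = coord_vec A x' (?c 0) (frechet_derivative ?h (at u) a)"
    by (intro velocity_coord_vec[OF assms(2)])
  then show ?thesis by (simp add: coord_vec_def[of A x])
qed

lemma tangent_space_eq:
  assumes "(\<Omega>, x) \<in> A" "u \<in> \<Omega>"
  shows "tangent_space A (x u) = range (coord_vec A x u)"
proof
  show "tangent_space A (x u) \<subseteq> range (coord_vec A x u)"
  proof
    fix v assume "v \<in> tangent_space A (x u)"
    then obtain \<Omega>' x' u' a where *: "(\<Omega>', x') \<in> A" "u' \<in> \<Omega>'" "x' u' = x u" "v = coord_vec A x' u' a"
      by (auto simp: tangent_space_def)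
    have "transition \<Omega> x x' u' = u" using transition_eqI[OF assms, of x' u'] * by simp
    then show "v \<in> range (coord_vec A x u)"
      using coord_vec_change[OF *(1) assms(1) *(2), of a] * assms by auto
  qed
qed (use assms in \<open>auto simp: tangent_space_def\<close>)

lemma coord_vec_in_tangent_space:
  "(\<Omega>, x) \<in> A \<Longrightarrow> u \<in> \<Omega> \<Longrightarrow> coord_vec A x u a \<in> tangent_space A (x u)"
  by (auto simp: tangent_space_eq)

lemma coord_vec_add:
  assumes "(\<Omega>, x) \<in> A" "u \<in> \<Omega>"
  shows "coord_vec A x u (a + b) = tadd (coord_vec A x u a) (coord_vec A x u b)"
proof
  fix f
  show "coord_vec A x u (a + b) f = tadd (coord_vec A x u a) (coord_vec A x u b) f"
    using smooth_at_iff[OF assms, of f]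
    by (cases "smooth_at A (x u) f")
       (auto simp: coord_vec_apply[OF assms] coord_vec_not_smooth tadd_def dest: smooth_near_linear linear_add)
qed

text \<open>The components of a chart are smooth functions on which a tangent vector takes its coordinates as
  values. They recover coordinates from the abstract action on functions.\<close>

lemma smooth_at_chart_component:
  assumes "(\<Omega>, x) \<in> A" "u \<in> \<Omega>"
  shows "smooth_at A (x u) (\<lambda>z. inv_into \<Omega> x z \<bullet> b)"
    and "coord_vec A x u a (\<lambda>z. inv_into \<Omega> x z \<bullet> b) = a \<bullet> b"
proof -
  have ev: "\<forall>\<^sub>F w in nhds u. w \<bullet> b = inv_into \<Omega> x (x w) \<bullet> b"
    using eventually_nhds_in_open[OF chart_open[OF assms(1)] assms(2)]
    by eventually_elim (simp add: chart_inj[OF assms(1)])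
  then show sm: "smooth_at A (x u) (\<lambda>z. inv_into \<Omega> x z \<bullet> b)"
    unfolding smooth_at_iff[OF assms] by (rule smooth_near_cong[rotated]) (intro smooth_intros)
  have "((\<lambda>w. w \<bullet> b) has_derivative (\<lambda>a. a \<bullet> b)) (at u)" by (auto intro!: derivative_eq_intros)
  then show "coord_vec A x u a (\<lambda>z. inv_into \<Omega> x z \<bullet> b) = a \<bullet> b"
    using coord_vec_apply[OF assms sm] frechet_derivative_cong_eventually[OF ev] frechet_derivative_eqI by metis
qed

lemma coord_vec_inj:
  assumes "(\<Omega>, x) \<in> A" "u \<in> \<Omega>" "coord_vec A x u a = coord_vec A x u b"
  shows "a = b"
  by (rule euclidean_eqI) (metis smooth_at_chart_component(2)[OF assms(1,2)] assms(3))

lemma tangent_space_add: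
  assumes "z \<in> carrier_of A" "v \<in> tangent_space A z" "w \<in> tangent_space A z"
  shows "tadd v w \<in> tangent_space A z"
  using assms by (elim carrierE) (auto simp: tangent_space_eq coord_vec_add[symmetric])

lemma tangent_space_scale:
  assumes "z \<in> carrier_of A" "v \<in> tangent_space A z"
  shows "tscale r v \<in> tangent_space A z"
  using assms by (elim carrierE) (auto simp: tangent_space_eq coord_vec_scaleR[symmetric])

lemma tangent_not_smooth:
  assumes "z \<in> carrier_of A" "v \<in> tangent_space A z" "\<not> smooth_at A z f"
  shows "v f = 0"
  using assms by (elim carrierE) (auto simp: tangent_space_eq coord_vec_not_smooth)

lemma smooth_at_const [simp]: "z \<in> carrier_of A \<Longrightarrow> smooth_at A z (\<lambda>q. c)"
  by (elim carrierE) (simp add: smooth_at_iff)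

lemma smooth_at_add:
  "z \<in> carrier_of A \<Longrightarrow> smooth_at A z f \<Longrightarrow> smooth_at A z g \<Longrightarrow> smooth_at A z (\<lambda>q. f q + g q)"
  by (elim carrierE) (simp add: smooth_at_iff smooth_intros)

lemma smooth_at_diff:
  "z \<in> carrier_of A \<Longrightarrow> smooth_at A z f \<Longrightarrow> smooth_at A z g \<Longrightarrow> smooth_at A z (\<lambda>q. f q - g q)"
  by (elim carrierE) (simp add: smooth_at_iff smooth_intros)

lemma smooth_at_mult:
  "z \<in> carrier_of A \<Longrightarrow> smooth_at A z f \<Longrightarrow> smooth_at A z g \<Longrightarrow> smooth_at A z (\<lambda>q. f q * g q)"
  by (elim carrierE) (simp add: smooth_at_iff smooth_intros)

lemma smooth_at_sum:
  "z \<in> carrier_of A \<Longrightarrow> (\<And>i. i \<in> I \<Longrightarrow> smooth_at A z (f i)) \<Longrightarrow> smooth_at A z (\<lambda>q. \<Sum>i\<in>I. f i q)"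
  by (elim carrierE) (simp add: smooth_at_iff smooth_intros)

lemmas smooth_at_intros = smooth_at_const smooth_at_add smooth_at_diff smooth_at_mult smooth_at_sum

lemma tangent_add:
  assumes "z \<in> carrier_of A" "v \<in> tangent_space A z" "smooth_at A z f" "smooth_at A z g"
  shows "v (\<lambda>q. f q + g q) = v f + v g"
  using assms
proof (elim carrierE)
  fix \<Omega> x u assume x: "(\<Omega>, x) \<in> A" "u \<in> \<Omega>" "z = x u"
  then obtain a where v: "v = coord_vec A x u a" using assms tangent_space_eq by blast
  have "smooth_near (\<lambda>w. f (x w)) u" "smooth_near (\<lambda>w. g (x w)) u" using assms x smooth_at_iff by auto
  from has_derivative_add[OF this[THEN smooth_near_has_derivative]]
  show ?thesis
    using assms x v by (simp add: coord_vec_apply[OF x(1,2)] smooth_at_add frechet_derivative_eqI)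
qed

lemma tangent_mult:
  assumes "z \<in> carrier_of A" "v \<in> tangent_space A z" "smooth_at A z f" "smooth_at A z g"
  shows "v (\<lambda>q. f q * g q) = f z * v g + g z * v f"
  using assms
proof (elim carrierE)
  fix \<Omega> x u assume x: "(\<Omega>, x) \<in> A" "u \<in> \<Omega>" "z = x u"
  then obtain a where v: "v = coord_vec A x u a" using assms tangent_space_eq by blast
  have "smooth_near (\<lambda>w. f (x w)) u" "smooth_near (\<lambda>w. g (x w)) u" using assms x smooth_at_iff by auto
  from has_derivative_mult[OF this[THEN smooth_near_has_derivative]]
  show ?thesis
    using assms x v by (simp add: coord_vec_apply[OF x(1,2)] smooth_at_mult frechet_derivative_eqI mult.commute)
qed

lemma tangent_cong:
  assumes "(\<Omega>, x) \<in> A" "u \<in> \<Omega>" "v \<in> tangent_space A (x u)" "\<forall>\<^sub>F w in nhds u. f (x w) = g (x w)"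
  shows "v f = v g" "smooth_at A (x u) f \<Longrightarrow> smooth_at A (x u) g"
proof -
  obtain a where v: "v = coord_vec A x u a" using assms tangent_space_eq by blast
  have ev: "\<forall>\<^sub>F w in nhds u. g (x w) = f (x w)" using assms(4) by eventually_elim simp
  have "smooth_at A (x u) f \<longleftrightarrow> smooth_at A (x u) g"
    using smooth_near_cong[OF _ assms(4)] smooth_near_cong[OF _ ev] smooth_at_iff[OF assms(1,2)] by blast
  then show "v f = v g" "smooth_at A (x u) f \<Longrightarrow> smooth_at A (x u) g"
    using frechet_derivative_cong_eventually[OF ev] v
    by (cases "smooth_at A (x u) f"; simp add: coord_vec_apply[OF assms(1,2)] coord_vec_not_smooth)+
qed

lemma atlas_open_eventually:
  assumes "atlas_open A U" "(\<Omega>, x) \<in> A" "u \<in> \<Omega>" "x u \<in> U"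
  shows "\<forall>\<^sub>F w in nhds u. w \<in> \<Omega> \<and> x w \<in> U"
proof -
  have "open {u \<in> \<Omega>. x u \<in> U}" using assms by (auto simp: atlas_open_def)
  from eventually_nhds_in_open[OF this, of u] show ?thesis using assms by simp
qed

lemma atlas_openI:
  assumes "U \<subseteq> carrier_of A"
    "\<And>\<Omega> x u. (\<Omega>, x) \<in> A \<Longrightarrow> u \<in> \<Omega> \<Longrightarrow> x u \<in> U \<Longrightarrow> \<forall>\<^sub>F w in nhds u. w \<in> \<Omega> \<longrightarrow> x w \<in> U"
  shows "atlas_open A U"
  unfolding atlas_open_def
proof (intro conjI assms(1) ballI, clarify)
  fix \<Omega> x assume x: "(\<Omega>, x) \<in> A"
  have *: "\<forall>\<^sub>F w in nhds u. w \<in> \<Omega> \<and> x w \<in> U" if "u \<in> \<Omega>" "x u \<in> U" for u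
    using assms(2)[OF x that] eventually_nhds_in_open[OF chart_open[OF x] that(1)]
    by eventually_elim simp
  then have "\<exists>T. open T \<and> v \<in> T \<and> T \<subseteq> {u \<in> \<Omega>. x u \<in> U}" if "v \<in> {u \<in> \<Omega>. x u \<in> U}" for v
  proof -
    from that(1) have "v \<in> \<Omega>" "x v \<in> U" by auto
    from *[OF this] obtain T where "open T" "v \<in> T" "\<forall>w\<in>T. w \<in> \<Omega> \<and> x w \<in> U"
      unfolding eventually_nhds by blast
    then show ?thesis by (intro exI[of _ T]) auto
  qed
  then show "open {u \<in> \<Omega>. x u \<in> U}" by (subst open_subopen) (rule ballI)
qed

lemma topspace_carrier: "topspace (atlas_topology A) = carrier_of A"
  by (rule topspace_atlas_topology[OF smooth_atlas])

lemma atlas_open_smooth_at: "atlas_open A {z \<in> carrier_of A. smooth_at A z f}"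
proof (rule atlas_openI)
  fix \<Omega> x u assume x: "(\<Omega>, x) \<in> A" "u \<in> \<Omega>" "x u \<in> {z \<in> carrier_of A. smooth_at A z f}"
  then have "smooth_near (\<lambda>w. f (x w)) u" using smooth_at_iff by blast
  from smooth_near_eventually[OF this]
  show "\<forall>\<^sub>F w in nhds u. w \<in> \<Omega> \<longrightarrow> x w \<in> {z \<in> carrier_of A. smooth_at A z f}"
    by eventually_elim (use x in \<open>auto simp: smooth_at_iff carrier_of_def\<close>)
qed auto

lemma atlas_open_chart_image:
  assumes "(\<Omega>, x) \<in> A" "open U" "U \<subseteq> \<Omega>" shows "atlas_open A (x ` U)"
proof (rule atlas_openI)
  show "x ` U \<subseteq> carrier_of A" using assms by (auto simp: carrier_of_def)
  fix \<Omega>' x' u' assume x': "(\<Omega>', x') \<in> A" "u' \<in> \<Omega>'" "x' u' \<in> x ` U"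
  then obtain u where u: "u \<in> U" "x u = x' u'" by auto
  let ?h = "transition \<Omega> x x'"
  have im: "x' u' \<in> x ` \<Omega>" using u assms by (metis image_eqI subsetD)
  have hu: "?h u' = u" using transition_eqI[OF assms(1)] u assms(3) by (metis subsetD)
  have "isCont ?h u'" using transition_smooth[OF x'(1) assms(1) x'(2) im] smooth_near_isCont by blast
  then have "(?h \<longlongrightarrow> u) (nhds u')"
    unfolding isCont_nhds hu .
  then have "\<forall>\<^sub>F w in nhds u'. ?h w \<in> U" using assms(2) u(1) by (rule topological_tendstoD)
  then show "\<forall>\<^sub>F w in nhds u'. w \<in> \<Omega>' \<longrightarrow> x' w \<in> x ` U"
    using transition_near[OF x'(1) assms(1) x'(2) im] by eventually_elim (auto, metis image_eqI)
qed

lemma continuous_map_chartsI: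
  fixes f :: "'m \<Rightarrow> real"
  assumes "\<And>\<Omega> x. (\<Omega>, x) \<in> A \<Longrightarrow> continuous_on \<Omega> (\<lambda>w. f (x w))"
  shows "continuous_map (atlas_topology A) euclidean f"
  unfolding continuous_map_def topspace_carrier openin_atlas_topology
proof (intro conjI allI impI)
  fix U :: "real set" assume "openin euclidean U"
  then have U: "open U" by simp
  show "atlas_open A {z \<in> carrier_of A. f z \<in> U}" unfolding atlas_open_def
  proof (intro conjI ballI, blast, clarify)
    fix \<Omega> x assume x: "(\<Omega>, x) \<in> A"
    have "{u \<in> \<Omega>. x u \<in> {z \<in> carrier_of A. f z \<in> U}} = \<Omega> \<inter> (\<lambda>w. f (x w)) -` U"
      using x by (auto simp: carrier_of_def)
    then show "open {u \<in> \<Omega>. x u \<in> {z \<in> carrier_of A. f z \<in> U}}"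
      using continuous_open_preimage[OF assms[OF x] chart_open[OF x] U] by simp
  qed
qed auto

lemma continuous_map_smooth:
  assumes "\<And>z. z \<in> carrier_of A \<Longrightarrow> smooth_at A z f"
  shows "continuous_map (atlas_topology A) euclidean f"
proof (rule continuous_map_chartsI)
  fix \<Omega> x assume x: "(\<Omega>, x) \<in> A"
  show "continuous_on \<Omega> (\<lambda>w. f (x w))"
    using assms x smooth_at_iff[OF x] chart_carrier[OF x]
    by (intro continuous_at_imp_continuous_on ballI smooth_near_isCont) blast
qed

lemma topcontinuous_at_smooth:
  assumes "z \<in> carrier_of A" "smooth_at A z f"
  shows "topcontinuous_at (atlas_topology A) euclidean f z"
  unfolding topcontinuous_at_def topspace_carrier openin_atlas_topology
proof (intro conjI allI impI)
  fix V :: "real set" assume V: "openin euclidean V \<and> f z \<in> V"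
  let ?U = "{q \<in> carrier_of A. smooth_at A q f \<and> f q \<in> V}"
  have "atlas_open A ?U"
  proof (rule atlas_openI)
    fix \<Omega> x u assume x: "(\<Omega>, x) \<in> A" "u \<in> \<Omega>" "x u \<in> ?U"
    then have sm: "smooth_near (\<lambda>w. f (x w)) u" using smooth_at_iff by blast
    then have "((\<lambda>w. f (x w)) \<longlongrightarrow> f (x u)) (nhds u)"
      using smooth_near_isCont[OF sm] by (simp only: isCont_nhds)
    then have "\<forall>\<^sub>F w in nhds u. f (x w) \<in> V" using V x by (intro topological_tendstoD) auto
    with smooth_near_eventually[OF sm]
    show "\<forall>\<^sub>F w in nhds u. w \<in> \<Omega> \<longrightarrow> x w \<in> ?U"
      by eventually_elim (use x in \<open>auto simp: smooth_at_iff carrier_of_def\<close>)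
  qed auto
  then show "\<exists>U. atlas_open A U \<and> z \<in> U \<and> (\<forall>y\<in>U. f y \<in> V)"
    using assms V by (intro exI[of _ ?U]) auto
qed (use assms in auto)

end

section \<open>Riemannian metrics on plane domains\<close>

subsection \<open>Smooth families of linear and bilinear maps\<close>

text \<open>Expanding the argument in a basis reduces joint smoothness to smoothness for fixed arguments.\<close>

lemma linear_family_smooth:
  fixes L :: "'p::euclidean_space \<Rightarrow> 'a::euclidean_space \<Rightarrow> 'b::real_normed_vector"
    and k :: "'z::euclidean_space \<Rightarrow> 'p"
  assumes S: "open S" "\<And>p. p \<in> S \<Longrightarrow> linear (L p)" "\<And>p a. p \<in> S \<Longrightarrow> smooth_near (\<lambda>p. L p a) p"
    and k: "k z \<in> S" "smooth_near k z" "smooth_near f z"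
  shows "smooth_near (\<lambda>z. L (k z) (f z)) z"
proof (rule smooth_near_cong)
  show "smooth_near (\<lambda>z. \<Sum>b\<in>Basis. (f z \<bullet> b) *\<^sub>R L (k z) b) z"
    by (intro smooth_near_sum smooth_near_scaleR smooth_near_inner smooth_near_const k
          smooth_near_compose[OF k(2), where f = "\<lambda>p. L p _"] S(3))
  have "\<forall>\<^sub>F y in nhds z. k y \<in> S"
    using k S(1) by (intro topological_tendstoD[OF smooth_near_isCont[OF k(2), unfolded isCont_nhds]])
  then show "\<forall>\<^sub>F y in nhds z. (\<Sum>b\<in>Basis. (f y \<bullet> b) *\<^sub>R L (k y) b) = L (k y) (f y)"
    by eventually_elim (simp flip: linear_euclidean_expand[OF S(2)])
qed

lemma linear_family_has_derivative:
  fixes L :: "'p::euclidean_space \<Rightarrow> 'a::euclidean_space \<Rightarrow> 'b::real_normed_vector"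
    and k :: "'z::euclidean_space \<Rightarrow> 'p"
  assumes S: "open S" "\<And>p. p \<in> S \<Longrightarrow> linear (L p)" "\<And>p a. p \<in> S \<Longrightarrow> smooth_near (\<lambda>p. L p a) p"
    and k: "k z \<in> S" "(k has_derivative k') (at z)" "(f has_derivative f') (at z)"
  shows "((\<lambda>z. L (k z) (f z)) has_derivative
     (\<lambda>c. frechet_derivative (\<lambda>p. L p (f z)) (at (k z)) (k' c) + L (k z) (f' c))) (at z)"
proof -
  let ?p = "k z"
  have D: "((\<lambda>p. L p b) has_derivative frechet_derivative (\<lambda>p. L p b) (at ?p)) (at ?p)" for b
    using S(3)[OF k(1)] by (rule smooth_near_has_derivative)
  have ev: "\<forall>\<^sub>F p in nhds ?p. (\<Sum>b\<in>Basis. (a \<bullet> b) *\<^sub>R L p b) = L p a" for a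
    using eventually_nhds_in_open[OF S(1) k(1)]
    by eventually_elim (simp flip: linear_euclidean_expand[OF S(2)])
  have F: "frechet_derivative (\<lambda>p. L p a) (at ?p) c = (\<Sum>b\<in>Basis. (a \<bullet> b) *\<^sub>R frechet_derivative (\<lambda>p. L p b) (at ?p) c)" for a c
  proof -
    have "((\<lambda>p. \<Sum>b\<in>Basis. (a \<bullet> b) *\<^sub>R L p b) has_derivative (\<lambda>c. \<Sum>b\<in>Basis. (a \<bullet> b) *\<^sub>R frechet_derivative (\<lambda>p. L p b) (at ?p) c)) (at ?p)"
      by (intro has_derivative_sum has_derivative_scaleR_right D)
    from frechet_derivative_eqI[OF this] show ?thesis
      using frechet_derivative_cong_eventually[OF ev] by metis
  qed
  have "((\<lambda>z. \<Sum>b\<in>Basis. (f z \<bullet> b) *\<^sub>R L (k z) b) has_derivative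
     (\<lambda>c. \<Sum>b\<in>Basis. (f z \<bullet> b) *\<^sub>R frechet_derivative (\<lambda>p. L p b) (at ?p) (k' c) + (f' c \<bullet> b) *\<^sub>R L ?p b)) (at z)"
    by (intro has_derivative_sum has_derivative_scaleR has_derivative_inner_left k has_derivative_compose[OF k(2) D])
  also have "(\<lambda>c. \<Sum>b\<in>Basis. (f z \<bullet> b) *\<^sub>R frechet_derivative (\<lambda>p. L p b) (at ?p) (k' c) + (f' c \<bullet> b) *\<^sub>R L ?p b)
    = (\<lambda>c. frechet_derivative (\<lambda>p. L p (f z)) (at ?p) (k' c) + L ?p (f' c))"
  proof (rule ext)
    fix c show "(\<Sum>b\<in>Basis. (f z \<bullet> b) *\<^sub>R frechet_derivative (\<lambda>p. L p b) (at ?p) (k' c) + (f' c \<bullet> b) *\<^sub>R L ?p b)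
      = frechet_derivative (\<lambda>p. L p (f z)) (at ?p) (k' c) + L ?p (f' c)"
      by (subst (2) linear_euclidean_expand[OF S(2)[OF k(1)]]) (simp add: F[of "f z"] sum.distrib)
  qed
  finally have D2: "((\<lambda>z. \<Sum>b\<in>Basis. (f z \<bullet> b) *\<^sub>R L (k z) b) has_derivative
     (\<lambda>c. frechet_derivative (\<lambda>p. L p (f z)) (at ?p) (k' c) + L ?p (f' c))) (at z)" .
  have "isCont k z" using k(2) has_derivative_continuous by blast
  then have "\<forall>\<^sub>F y in nhds z. k y \<in> S"
    using k S(1) by (intro topological_tendstoD) (auto simp: isCont_nhds)
  then obtain W where W: "open W" "z \<in> W" "\<forall>y\<in>W. k y \<in> S" unfolding eventually_nhds by blast
  show ?thesis
    by (rule has_derivative_transform_within_open[OF D2 W(1,2)]) (simp add: W(3) linear_euclidean_expand[OF S(2), symmetric])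
qed

lemma bilinear_family_smooth:
  fixes B :: "'p::euclidean_space \<Rightarrow> 'a::euclidean_space \<Rightarrow> 'c::euclidean_space \<Rightarrow> 'b::real_normed_vector"
    and k :: "'z::euclidean_space \<Rightarrow> 'p"
  assumes S: "open S" "\<And>p. p \<in> S \<Longrightarrow> bilinear (B p)" "\<And>p a b. p \<in> S \<Longrightarrow> smooth_near (\<lambda>p. B p a b) p"
    and k: "k z \<in> S" "smooth_near k z" "smooth_near f z" "smooth_near g z"
  shows "smooth_near (\<lambda>z. B (k z) (f z) (g z)) z"
proof -
  have "smooth_near (\<lambda>z. (\<lambda>p a. B (fst p) a (snd p)) (k z, g z) (f z)) z"
  proof (rule linear_family_smooth[where S = "S \<times> UNIV"])
    show "linear (\<lambda>a. B (fst p) a (snd p))" if "p \<in> S \<times> UNIV" for p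
      using S(2)[of "fst p"] that by (auto simp: bilinear_def)
    show "smooth_near (\<lambda>p. B (fst p) a (snd p)) p" if "p \<in> S \<times> UNIV" for p a
      by (rule linear_family_smooth[where S = S and L = "\<lambda>q. B q a"])
        (use S that in \<open>auto simp: bilinear_def intro: smooth_intros\<close>)
  qed (use S k in \<open>auto intro: open_Times smooth_intros\<close>)
  then show ?thesis by simp
qed

lemma bilinear_family_has_derivative:
  fixes B :: "'p::euclidean_space \<Rightarrow> 'a::euclidean_space \<Rightarrow> 'c::euclidean_space \<Rightarrow> 'b::real_normed_vector"
    and k :: "'z::euclidean_space \<Rightarrow> 'p"
  assumes S: "open S" "\<And>p. p \<in> S \<Longrightarrow> bilinear (B p)" "\<And>p a b. p \<in> S \<Longrightarrow> smooth_near (\<lambda>p. B p a b) p"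
    and k: "k z \<in> S" "(k has_derivative k') (at z)" "(f has_derivative f') (at z)" "(g has_derivative g') (at z)"
  shows "((\<lambda>z. B (k z) (f z) (g z)) has_derivative
    (\<lambda>c. frechet_derivative (\<lambda>p. B p (f z) (g z)) (at (k z)) (k' c) + B (k z) (f' c) (g z) + B (k z) (f z) (g' c))) (at z)"
proof -
  let ?L = "\<lambda>p a. B (fst p) a (snd p)"
  have sm: "smooth_near (\<lambda>p. B (fst p) a (snd p)) p" if "p \<in> S \<times> UNIV" for p a
      by (rule linear_family_smooth[where S = S and L = "\<lambda>q. B q a"])
        (use S that in \<open>auto simp: bilinear_def intro: smooth_intros\<close>)
  have *: "((\<lambda>z. ?L (k z, g z) (f z)) has_derivative
     (\<lambda>c. frechet_derivative (\<lambda>p. ?L p (f z)) (at (k z, g z)) (k' c, g' c) + ?L (k z, g z) (f' c))) (at z)"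
  proof (rule linear_family_has_derivative[where S = "S \<times> UNIV"])
    show "linear (\<lambda>a. B (fst p) a (snd p))" if "p \<in> S \<times> UNIV" for p
      using S(2)[of "fst p"] that by (auto simp: bilinear_def)
  qed (use S k sm in \<open>auto intro: open_Times has_derivative_Pair\<close>)
  have "((\<lambda>p. B (fst p) (f z) (snd p)) has_derivative
    (\<lambda>c. frechet_derivative (\<lambda>p. B p (f z) (snd (k z, g z))) (at (fst (k z, g z))) (fst c) + B (fst (k z, g z)) (f z) (snd c))) (at (k z, g z))"
    by (rule linear_family_has_derivative[where S = S and L = "\<lambda>q. B q (f z)" and z = "(k z, g z)"])
       (use S k in \<open>auto simp: bilinear_def intro: has_derivative_fst has_derivative_snd\<close>)
  from frechet_derivative_eqI[OF this] show ?thesis using * by (simp add: add_ac)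
qed

subsection \<open>Levi-Civita connection and rotation\<close>

lemma linear_combinationI:
  assumes "\<And>r a s b. f (r *\<^sub>R a + s *\<^sub>R b) = r *\<^sub>R f a + s *\<^sub>R f b" shows "linear f"
proof (rule linearI)
  show "f (a + b) = f a + f b" for a b using assms[of 1 a 1 b] by simp
  show "f (r *\<^sub>R a) = r *\<^sub>R f a" for r a using assms[of r a 0 a] by simp
qed

lemma linear_sum_Basis:
  fixes c :: "'z::euclidean_space" and L :: "'z \<Rightarrow> real"
  assumes "linear L" shows "L c = (\<Sum>b\<in>Basis. L b * (c \<bullet> b))"
  using linear_euclidean_expand[OF assms, of c] by (simp add: mult.commute)

definition wedge :: "real^2 \<Rightarrow> real^2 \<Rightarrow> real"
  where "wedge a b = a$1 * b$2 - a$2 * b$1"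

locale surface_metric =
  fixes \<Omega> :: "(real^2) set" and \<gamma> :: "real^2 \<Rightarrow> real^2 \<Rightarrow> real^2 \<Rightarrow> real"
  assumes open_dom: "open \<Omega>"
    and metric_linear: "u \<in> \<Omega> \<Longrightarrow> \<gamma> u (r *\<^sub>R a + s *\<^sub>R b) e = r * \<gamma> u a e + s * \<gamma> u b e"
    and metric_sym: "u \<in> \<Omega> \<Longrightarrow> \<gamma> u a b = \<gamma> u b a"
    and metric_pos: "u \<in> \<Omega> \<Longrightarrow> a \<noteq> 0 \<Longrightarrow> \<gamma> u a a > 0"
    and metric_smooth_on: "smooth_on \<Omega> (\<lambda>u. \<gamma> u a b)"
begin

lemma metric_bilinear: assumes "u \<in> \<Omega>" shows "bilinear (\<gamma> u)"
proof -
  have 1: "linear (\<lambda>a. \<gamma> u a e)" for e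
    by (rule linear_combinationI) (simp add: metric_linear[OF assms])
  have "(\<lambda>a. \<gamma> u a e) = \<gamma> u e" for e by (rule ext) (rule metric_sym[OF assms])
  then have "linear (\<gamma> u e)" for e using 1[of e] by simp
  then show ?thesis using 1 unfolding bilinear_def by blast
qed

lemma metric_smooth: "u \<in> \<Omega> \<Longrightarrow> smooth_near (\<lambda>u. \<gamma> u a b) u"
  using smooth_on_iff_near[OF open_dom] metric_smooth_on by blast

context fixes u assumes u: "u \<in> \<Omega>" begin
lemmas metric_simps = bilinear_ladd[OF metric_bilinear[OF u]] bilinear_radd[OF metric_bilinear[OF u]]
  bilinear_lmul[OF metric_bilinear[OF u]] bilinear_rmul[OF metric_bilinear[OF u]]
  bilinear_lneg[OF metric_bilinear[OF u]] bilinear_rneg[OF metric_bilinear[OF u]]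
  bilinear_lsub[OF metric_bilinear[OF u]] bilinear_rsub[OF metric_bilinear[OF u]]
  bilinear_lzero[OF metric_bilinear[OF u]] bilinear_rzero[OF metric_bilinear[OF u]]
end

abbreviation e1 :: "real^2" where "e1 \<equiv> axis 1 1"
abbreviation e2 :: "real^2" where "e2 \<equiv> axis 2 1"

definition gdet :: "real^2 \<Rightarrow> real"
  where "gdet u = \<gamma> u e1 e1 * \<gamma> u e2 e2 - (\<gamma> u e1 e2)\<^sup>2"

lemma vec2_expand: "(a::real^2) = a$1 *\<^sub>R e1 + a$2 *\<^sub>R e2"
  by (simp add: vec_eq_iff forall_2 axis_def)

lemma metric_expand:
  assumes "u \<in> \<Omega>"
  shows "\<gamma> u a b = \<gamma> u e1 e1 * (a$1 * b$1) + \<gamma> u e1 e2 * (a$1 * b$2 + a$2 * b$1) + \<gamma> u e2 e2 * (a$2 * b$2)"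
proof -
  have "\<gamma> u a b = \<gamma> u (a$1 *\<^sub>R e1 + a$2 *\<^sub>R e2) (b$1 *\<^sub>R e1 + b$2 *\<^sub>R e2)" by (simp flip: vec2_expand)
  then show ?thesis using metric_sym[OF assms, of e2 e1]
    by (simp add: metric_simps[OF assms] algebra_simps)
qed

lemma gdet_pos: assumes "u \<in> \<Omega>" shows "gdet u > 0"
proof -
  let ?E = "\<gamma> u e1 e1" and ?F = "\<gamma> u e1 e2" and ?G = "\<gamma> u e2 e2"
  \<comment> \<open>a vector orthogonal to \<open>e1\<close>, whose square is \<open>gdet u\<close> up to the factor \<open>?E\<close>\<close>
  let ?w = "?F *\<^sub>R e1 - ?E *\<^sub>R e2"
  have E: "?E > 0" by (intro metric_pos[OF assms]) (simp add: axis_eq_0_iff)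
  then have "?w $ 2 \<noteq> 0" by (simp add: axis_def)
  then have "?w \<noteq> 0" by (metis zero_index)
  then have "\<gamma> u ?w ?w > 0" by (rule metric_pos[OF assms])
  moreover have "\<gamma> u ?w ?w = ?E * gdet u"
    using metric_sym[OF assms, of e2 e1]
    by (simp add: metric_simps[OF assms] gdet_def algebra_simps power2_eq_square)
  ultimately show ?thesis using E by (simp add: zero_less_mult_iff)
qed

lemma gdet_smooth: "u \<in> \<Omega> \<Longrightarrow> smooth_near gdet u"
  unfolding gdet_def[abs_def] by (intro smooth_intros metric_smooth)

lemma metric_nondegenerate:
  assumes "u \<in> \<Omega>" "\<And>e. \<gamma> u w e = \<gamma> u w' e" shows "w = w'"
  using metric_pos[OF assms(1), of "w - w'"] assms(2)[of "w - w'"]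
  by (metis bilinear_lsub[OF metric_bilinear[OF assms(1)]] less_irrefl right_minus_eq)

text \<open>The vector representing a covector \<open>l\<close>: Cramer's rule for the Gram matrix of \<open>\<gamma> u\<close>.\<close>

definition raise :: "real^2 \<Rightarrow> (real^2 \<Rightarrow> real) \<Rightarrow> real^2"
  where "raise u l = vector [(\<gamma> u e2 e2 * l e1 - \<gamma> u e1 e2 * l e2) / gdet u,
                             (\<gamma> u e1 e1 * l e2 - \<gamma> u e1 e2 * l e1) / gdet u]"

lemma metric_raise:
  assumes "u \<in> \<Omega>" "linear l" shows "\<gamma> u (raise u l) e = l e"
proof -
  have "l e = l (e$1 *\<^sub>R e1 + e$2 *\<^sub>R e2)" by (simp flip: vec2_expand)
  also have "\<dots> = e$1 * l e1 + e$2 * l e2" using assms(2) by (simp add: linear_add linear_scale)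
  finally have l: "l e = e$1 * l e1 + e$2 * l e2" .
  have D: "gdet u \<noteq> 0" using gdet_pos[OF assms(1)] by simp
  have c: "gdet u * raise u l $ 1 = \<gamma> u e2 e2 * l e1 - \<gamma> u e1 e2 * l e2"
       "gdet u * raise u l $ 2 = \<gamma> u e1 e1 * l e2 - \<gamma> u e1 e2 * l e1"
    using D by (simp_all add: raise_def)
  have "gdet u * \<gamma> u (raise u l) e = \<gamma> u e1 e1 * ((gdet u * raise u l $ 1) * e$1)
     + \<gamma> u e1 e2 * ((gdet u * raise u l $ 1) * e$2 + (gdet u * raise u l $ 2) * e$1) + \<gamma> u e2 e2 * ((gdet u * raise u l $ 2) * e$2)"
    unfolding metric_expand[OF assms(1), of "raise u l" e] by (simp add: algebra_simps)
  also have "\<dots> = gdet u * l e" unfolding l c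
    by (simp add: gdet_def power2_eq_square algebra_simps)
  finally have "gdet u * \<gamma> u (raise u l) e = gdet u * l e" .
  then show ?thesis using D by simp
qed

definition dmetric :: "real^2 \<Rightarrow> real^2 \<Rightarrow> real^2 \<Rightarrow> real^2 \<Rightarrow> real"
  where "dmetric u c a b = frechet_derivative (\<lambda>u. \<gamma> u a b) (at u) c"

lemma dmetric_linear1: "u \<in> \<Omega> \<Longrightarrow> linear (\<lambda>c. dmetric u c a b)"
  unfolding dmetric_def using smooth_near_linear[OF metric_smooth] by blast

lemma dmetric_sym: assumes "u \<in> \<Omega>" shows "dmetric u c a b = dmetric u c b a"
proof -
  have "\<forall>\<^sub>F v in nhds u. \<gamma> v a b = \<gamma> v b a"
    using eventually_nhds_in_open[OF open_dom assms] by eventually_elim (rule metric_sym)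
  from frechet_derivative_cong_eventually[OF this] show ?thesis by (simp add: dmetric_def)
qed

lemma dmetric_linear2: assumes "u \<in> \<Omega>" shows "linear (\<lambda>a. dmetric u c a b)"
proof -
  have ev: "\<forall>\<^sub>F v in nhds u. \<gamma> v (r *\<^sub>R a + s *\<^sub>R a') b = r * \<gamma> v a b + s * \<gamma> v a' b" for r s a a'
    using eventually_nhds_in_open[OF open_dom assms] by eventually_elim (rule metric_linear)
  have "dmetric u c (r *\<^sub>R a + s *\<^sub>R a') b = r * dmetric u c a b + s * dmetric u c a' b" for r s a a'
  proof -
    have "((\<lambda>v. r * \<gamma> v a b + s * \<gamma> v a' b) has_derivative (\<lambda>c. r * dmetric u c a b + s * dmetric u c a' b)) (at u)"
      unfolding dmetric_def
      by (intro has_derivative_add has_derivative_mult_right smooth_near_has_derivative metric_smooth assms)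
    from frechet_derivative_eqI[OF this] show ?thesis
      unfolding dmetric_def frechet_derivative_cong_eventually[OF ev] by metis
  qed
  then show ?thesis by (intro linear_combinationI) simp
qed

lemma dmetric_linear3: "u \<in> \<Omega> \<Longrightarrow> linear (\<lambda>b. dmetric u c a b)"
  using dmetric_linear2[of u c a] by (simp add: dmetric_sym[of u c a])

text \<open>This repeats the Koszul formula that defines \<open>christoffel\<close>, so that both agree in every chart.\<close>

definition chr :: "real^2 \<Rightarrow> real^2 \<Rightarrow> real^2 \<Rightarrow> real^2"
  where "chr u a b = (THE w. \<forall>e. 2 * \<gamma> u w e =
      frechet_derivative (\<lambda>y. \<gamma> y b e) (at u) a
    + frechet_derivative (\<lambda>y. \<gamma> y a e) (at u) b
    - frechet_derivative (\<lambda>y. \<gamma> y a b) (at u) e)"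

lemma koszul_exists:
  assumes "u \<in> \<Omega>"
  shows "2 * \<gamma> u (raise u (\<lambda>e. (dmetric u a b e + dmetric u b a e - dmetric u e a b) / 2)) e = dmetric u a b e + dmetric u b a e - dmetric u e a b"
proof -
  have lin: "linear (\<lambda>e. (dmetric u a b e + dmetric u b a e - dmetric u e a b) / 2)"
    by (rule linear_combinationI)
      (simp add: linear_add[OF dmetric_linear1[OF assms(1)]] linear_scale[OF dmetric_linear1[OF assms(1)]]
         linear_add[OF dmetric_linear3[OF assms(1)]] linear_scale[OF dmetric_linear3[OF assms(1)]] field_simps)
  show ?thesis unfolding metric_raise[OF assms(1) lin, of e] by simp
qed

lemma chr_eq_raise:
  assumes "u \<in> \<Omega>"
  shows "chr u a b = raise u (\<lambda>e. (dmetric u a b e + dmetric u b a e - dmetric u e a b) / 2)"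
  unfolding chr_def dmetric_def[symmetric]
proof (rule the_equality)
  fix w assume w: "\<forall>e. 2 * \<gamma> u w e = dmetric u a b e + dmetric u b a e - dmetric u e a b"
  show "w = raise u (\<lambda>e. (dmetric u a b e + dmetric u b a e - dmetric u e a b) / 2)"
  proof (rule metric_nondegenerate[OF assms])
    fix e
    show "\<gamma> u w e = \<gamma> u (raise u (\<lambda>e. (dmetric u a b e + dmetric u b a e - dmetric u e a b) / 2)) e"
      using w[rule_format, of e] koszul_exists[OF assms, of a b e] by linarith
  qed
qed (use koszul_exists[OF assms] in blast)

lemma koszul:
  assumes "u \<in> \<Omega>"
  shows "2 * \<gamma> u (chr u a b) e = dmetric u a b e + dmetric u b a e - dmetric u e a b"
  unfolding chr_eq_raise[OF assms] by (rule koszul_exists[OF assms])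

lemma chr_sym: assumes "u \<in> \<Omega>" shows "chr u a b = chr u b a"
proof (rule metric_nondegenerate[OF assms])
  fix e show "\<gamma> u (chr u a b) e = \<gamma> u (chr u b a) e"
    using koszul[OF assms, of a b e] koszul[OF assms, of b a e] dmetric_sym[OF assms, of e a b] by linarith
qed

lemma metric_compatible:
  assumes "u \<in> \<Omega>" shows "dmetric u c a b = \<gamma> u (chr u c a) b + \<gamma> u a (chr u c b)"
  using koszul[OF assms, of c a b] koszul[OF assms, of c b a] metric_sym[OF assms, of a "chr u c b"]
    dmetric_sym[OF assms, of c b a] dmetric_sym[OF assms, of a c b] dmetric_sym[OF assms, of b c a] by simp

lemma chr_bilinear: assumes "u \<in> \<Omega>" shows "bilinear (chr u)"
proof -
  have "chr u (r *\<^sub>R a + s *\<^sub>R a') b = r *\<^sub>R chr u a b + s *\<^sub>R chr u a' b" for r s a a' b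
  proof (rule metric_nondegenerate[OF assms])
    fix e
    have "2 * \<gamma> u (chr u (r *\<^sub>R a + s *\<^sub>R a') b) e
       = r * (2 * \<gamma> u (chr u a b) e) + s * (2 * \<gamma> u (chr u a' b) e)"
      unfolding koszul[OF assms]
      by (simp add: linear_add[OF dmetric_linear1[OF assms]] linear_scale[OF dmetric_linear1[OF assms]]
            linear_add[OF dmetric_linear2[OF assms]] linear_scale[OF dmetric_linear2[OF assms]] algebra_simps)
    then show "\<gamma> u (chr u (r *\<^sub>R a + s *\<^sub>R a') b) e = \<gamma> u (r *\<^sub>R chr u a b + s *\<^sub>R chr u a' b) e"
      by (simp add: metric_simps[OF assms])
  qed
  note * = this
  have 1: "linear (\<lambda>a. chr u a b)" for b
    using * by (intro linear_combinationI)
  have "(\<lambda>a. chr u a e) = chr u e" for e by (rule ext) (rule chr_sym[OF assms])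
  then have "linear (chr u e)" for e using 1[of e] by simp
  then show ?thesis using 1 unfolding bilinear_def by blast
qed

lemma dmetric_smooth: "u \<in> \<Omega> \<Longrightarrow> smooth_near (\<lambda>u. dmetric u c a b) u"
  unfolding dmetric_def by (intro smooth_near_frechet_derivative_const metric_smooth)

lemma chr_smooth: assumes "u \<in> \<Omega>" shows "smooth_near (\<lambda>u. chr u a b) u"
proof (rule smooth_near_cong)
  show "\<forall>\<^sub>F v in nhds u. raise v (\<lambda>e. (dmetric v a b e + dmetric v b a e - dmetric v e a b) / 2) = chr v a b"
    using eventually_nhds_in_open[OF open_dom assms] by eventually_elim (simp add: chr_eq_raise)
  show "smooth_near (\<lambda>v. raise v (\<lambda>e. (dmetric v a b e + dmetric v b a e - dmetric v e a b) / 2)) u"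
    unfolding raise_def using gdet_pos[OF assms]
    by (intro smooth_intros metric_smooth dmetric_smooth gdet_smooth assms) auto
qed

text \<open>The formula is the solution of \<open>\<gamma>(Ja, b) = area(a, b)\<close>, the area form being
  \<open>sqrt (gdet u) * wedge a b\<close>.\<close>

definition J :: "real^2 \<Rightarrow> real^2 \<Rightarrow> real^2"
  where "J u a = inverse (sqrt (gdet u)) *\<^sub>R
     vector [- \<gamma> u e1 e2 * a$1 - \<gamma> u e2 e2 * a$2, \<gamma> u e1 e1 * a$1 + \<gamma> u e1 e2 * a$2]"

lemma J_linear: "linear (J u)"
  unfolding J_def by (rule linear_combinationI) (simp add: vec_eq_iff forall_2 algebra_simps)

lemma J_smooth: "u \<in> \<Omega> \<Longrightarrow> smooth_near (\<lambda>u. J u a) u"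
  unfolding J_def using gdet_pos[of u]
  by (intro smooth_intros metric_smooth gdet_smooth) auto

lemma J_components:
  assumes "u \<in> \<Omega>"
  shows "sqrt (gdet u) * J u a $ 1 = - \<gamma> u e1 e2 * a$1 - \<gamma> u e2 e2 * a$2"
    "sqrt (gdet u) * J u a $ 2 = \<gamma> u e1 e1 * a$1 + \<gamma> u e1 e2 * a$2"
  using gdet_pos[OF assms] by (simp_all add: J_def)

lemma metric_J:
  assumes "u \<in> \<Omega>" shows "\<gamma> u (J u a) b = sqrt (gdet u) * wedge a b"
proof -
  have D: "gdet u > 0" by (rule gdet_pos[OF assms])
  note c = J_components[OF assms, of a]
  have "sqrt (gdet u) * \<gamma> u (J u a) b = \<gamma> u e1 e1 * ((sqrt (gdet u) * J u a $ 1) * b$1)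
     + \<gamma> u e1 e2 * ((sqrt (gdet u) * J u a $ 1) * b$2 + (sqrt (gdet u) * J u a $ 2) * b$1) + \<gamma> u e2 e2 * ((sqrt (gdet u) * J u a $ 2) * b$2)"
    unfolding metric_expand[OF assms(1), of "J u a" b] by (simp add: algebra_simps)
  also have "\<dots> = gdet u * wedge a b" unfolding c
    by (simp add: gdet_def wedge_def power2_eq_square algebra_simps)
  finally have "sqrt (gdet u) * \<gamma> u (J u a) b = gdet u * wedge a b" .
  moreover have "gdet u * wedge a b = sqrt (gdet u) * (sqrt (gdet u) * wedge a b)"
    using D by (simp flip: mult.assoc)
  ultimately show ?thesis using D by simp
qed

lemma wedge_J: assumes "u \<in> \<Omega>" shows "sqrt (gdet u) * wedge a (J u b) = \<gamma> u a b"
proof -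
  have "sqrt (gdet u) * wedge a (J u b) = a$1 * (sqrt (gdet u) * J u b $ 2) - a$2 * (sqrt (gdet u) * J u b $ 1)"
    by (simp add: wedge_def algebra_simps)
  then show ?thesis unfolding metric_expand[OF assms, of a b] J_components[OF assms]
    by (simp add: algebra_simps)
qed

lemma wedge_alt: "wedge a b = - wedge b a" by (simp add: wedge_def)

lemma J_skew: "u \<in> \<Omega> \<Longrightarrow> \<gamma> u (J u a) b = - \<gamma> u a (J u b)"
  using metric_J[of u a b] metric_J[of u b a] metric_sym[of u "J u b" a] by (simp add: wedge_alt[of a b])

lemma J_orth: "u \<in> \<Omega> \<Longrightarrow> \<gamma> u (J u a) a = 0"
  by (simp add: metric_J wedge_def)

lemma J_isometry: "u \<in> \<Omega> \<Longrightarrow> \<gamma> u (J u a) (J u b) = \<gamma> u a b"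
  by (simp add: metric_J wedge_J)

lemma J_J: assumes "u \<in> \<Omega>" shows "J u (J u a) = - a"
proof (rule metric_nondegenerate[OF assms])
  fix e show "\<gamma> u (J u (J u a)) e = \<gamma> u (- a) e"
    using J_skew[OF assms, of "J u a" e] J_isometry[OF assms, of a e] by (simp add: metric_simps[OF assms])
qed

lemma orthogonal_zero:
  assumes "u \<in> \<Omega>" "a \<noteq> 0" "\<gamma> u w a = 0" "\<gamma> u w (J u a) = 0" shows "w = 0"
proof -
  have "wedge a w = 0"
    using assms(4) metric_J[OF assms(1), of a w] metric_sym[OF assms(1), of w] gdet_pos[OF assms(1)] by simp
  then have w: "a$1 * w$2 = a$2 * w$1" by (simp add: wedge_def)
  obtain t where "w = t *\<^sub>R a"
  proof (cases "a$1 = 0")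
    case False
    then have "w = (w$1 / a$1) *\<^sub>R a" using w by (simp add: vec_eq_iff forall_2 field_simps)
    then show ?thesis using that by blast
  next
    case True
    then have "a$2 \<noteq> 0" using assms(2) by (auto simp: vec_eq_iff forall_2)
    then have "w = (w$2 / a$2) *\<^sub>R a" using w True by (simp add: vec_eq_iff forall_2 field_simps)
    then show ?thesis using that by blast
  qed
  then show ?thesis using assms(3) metric_pos[OF assms(1,2)] by (simp add: metric_simps[OF assms(1)])
qed

lemma orthonormal_expand:
  assumes "u \<in> \<Omega>" "\<gamma> u a a = 1" shows "w = \<gamma> u a w *\<^sub>R a + \<gamma> u (J u a) w *\<^sub>R J u a"
proof -
  have "a \<noteq> 0" using assms bilinear_lzero[OF metric_bilinear[OF assms(1)]] by (metis zero_neq_one)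
  have "w - (\<gamma> u a w *\<^sub>R a + \<gamma> u (J u a) w *\<^sub>R J u a) = 0"
    by (rule orthogonal_zero[OF assms(1) \<open>a \<noteq> 0\<close>])
      (use assms J_orth[OF assms(1), of a] J_isometry[OF assms(1), of a a] metric_sym[OF assms(1)] in \<open>simp_all add: metric_simps\<close>)
  then show ?thesis by simp
qed

definition dJ :: "real^2 \<Rightarrow> real^2 \<Rightarrow> real^2 \<Rightarrow> real^2"
  where "dJ u c a = frechet_derivative (\<lambda>u. J u a) (at u) c"

lemma metric_has_derivative:
  fixes k :: "'z::euclidean_space \<Rightarrow> real^2"
  assumes "k z \<in> \<Omega>" "(k has_derivative k') (at z)" "(f has_derivative f') (at z)" "(g has_derivative g') (at z)"
  shows "((\<lambda>z. \<gamma> (k z) (f z) (g z)) has_derivative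
    (\<lambda>c. dmetric (k z) (k' c) (f z) (g z) + \<gamma> (k z) (f' c) (g z) + \<gamma> (k z) (f z) (g' c))) (at z)"
  unfolding dmetric_def
  by (rule bilinear_family_has_derivative[where B = \<gamma> and S = \<Omega>])
    (use open_dom metric_bilinear metric_smooth assms in auto)

lemma J_has_derivative:
  fixes k :: "'z::euclidean_space \<Rightarrow> real^2"
  assumes "k z \<in> \<Omega>" "(k has_derivative k') (at z)" "(f has_derivative f') (at z)"
  shows "((\<lambda>z. J (k z) (f z)) has_derivative (\<lambda>c. dJ (k z) (k' c) (f z) + J (k z) (f' c))) (at z)"
  unfolding dJ_def
  by (rule linear_family_has_derivative[where L = J and S = \<Omega>])
    (use open_dom J_linear J_smooth assms in auto)

text \<open>This is \<open>\<nabla>J = 0\<close>. Differentiating the skew symmetry of \<open>J\<close> and \<open>J\<^sup>2 = -1\<close>, one finds that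
  \<open>\<nabla>J\<close> is skew and anticommutes with \<open>J\<close>. Hence it maps \<open>a\<close> to a vector orthogonal to both \<open>a\<close> and \<open>Ja\<close>.\<close>

lemma J_parallel:
  assumes u: "u \<in> \<Omega>" shows "dJ u c a = J u (chr u c a) - chr u c (J u a)"
proof -
  \<comment> \<open>\<open>N\<close> is \<open>\<nabla>\<^sub>c J\<close>\<close>
  define N where "N a = dJ u c a + chr u c (J u a) - J u (chr u c a)" for a
  have id: "((\<lambda>v. v) has_derivative (\<lambda>c. c)) (at u)" by simp
  have const: "((\<lambda>v. b) has_derivative (\<lambda>c. 0)) (at u)" for b :: "real^2" by simp
  have J': "((\<lambda>v. J v b) has_derivative (\<lambda>c. dJ u c b)) (at u)" for b
    using J_has_derivative[where k = "\<lambda>v. v", OF _ id const] u by (simp add: linear_0[OF J_linear])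
  have ev: "\<forall>\<^sub>F v in nhds u. v \<in> \<Omega>" using eventually_nhds_in_open[OF open_dom u] .
  have skew: "\<gamma> u (N a) b = - \<gamma> u a (N b)" for a b
  proof -
    have "((\<lambda>v. \<gamma> v (J v a) b + \<gamma> v a (J v b)) has_derivative
        (\<lambda>c. dmetric u c (J u a) b + \<gamma> u (dJ u c a) b + \<gamma> u (J u a) 0 + (dmetric u c a (J u b) + \<gamma> u 0 (J u b) + \<gamma> u a (dJ u c b)))) (at u)"
      by (intro has_derivative_add metric_has_derivative[where k = "\<lambda>v. v"] id const J' u)
    moreover have "\<forall>\<^sub>F v in nhds u. \<gamma> v (J v a) b + \<gamma> v a (J v b) = 0"
      using ev by eventually_elim (simp add: J_skew)
    ultimately have "dmetric u c (J u a) b + \<gamma> u (dJ u c a) b + \<gamma> u (J u a) 0 + (dmetric u c a (J u b) + \<gamma> u 0 (J u b) + \<gamma> u a (dJ u c b)) = 0"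
      using has_derivative_eventually_unique[OF _ has_derivative_const] by fast
    then show ?thesis unfolding N_def metric_simps[OF u] metric_compatible[OF u]
      using J_skew[OF u, of a "chr u c b"] J_skew[OF u, of "chr u c a" b] by simp
  qed
  have anti: "N (J u a) = - J u (N a)" for a
  proof -
    have "((\<lambda>v. J v (J v a)) has_derivative (\<lambda>c. dJ u c (J u a) + J u (dJ u c a))) (at u)"
      by (rule J_has_derivative[where k = "\<lambda>v. v", OF u id J'])
    moreover have "\<forall>\<^sub>F v in nhds u. J v (J v a) = - a"
      using ev by eventually_elim (simp add: J_J)
    ultimately have "dJ u c (J u a) + J u (dJ u c a) = 0"
      using has_derivative_eventually_unique[OF _ has_derivative_const] by fast
    then show ?thesis unfolding N_def
      by (simp add: linear_add[OF J_linear] linear_diff[OF J_linear] J_J[OF u] bilinear_rneg[OF chr_bilinear[OF u]] algebra_simps add_eq_0_iff)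
  qed
  have "N a = 0"
  proof (cases "a = 0")
    case True
    have "\<gamma> u (N 0) b = 0" for b using skew[of 0 b] by (simp add: metric_simps[OF u])
    then show ?thesis using True metric_nondegenerate[OF u, of "N 0" 0] by (simp add: metric_simps[OF u])
  next
    case False
    have 1: "\<gamma> u (N a) a = 0" using skew[of a a] metric_sym[OF u, of a "N a"] by simp
    have "\<gamma> u (N a) (J u a) = \<gamma> u a (J u (N a))" using skew[of a "J u a"] anti by (simp add: metric_simps[OF u])
    also have "\<dots> = - \<gamma> u (N a) (J u a)" using J_skew[OF u, of a "N a"] metric_sym[OF u] by simp
    finally show ?thesis using orthogonal_zero[OF u False 1] by simp
  qed
  then show ?thesis by (simp add: N_def algebra_simps eq_diff_eq)
qed

end

subsection \<open>Curvature\<close>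

context surface_metric begin

definition dchr :: "real^2 \<Rightarrow> real^2 \<Rightarrow> real^2 \<Rightarrow> real^2 \<Rightarrow> real^2"
  where "dchr u c a b = frechet_derivative (\<lambda>y. chr y a b) (at u) c"

definition curv :: "real^2 \<Rightarrow> real^2 \<Rightarrow> real^2 \<Rightarrow> real^2 \<Rightarrow> real^2"
  where "curv u a b c = dchr u a b c - dchr u b a c + chr u a (chr u b c) - chr u b (chr u a c)"

definition gauss :: "real^2 \<Rightarrow> real"
  where "gauss u = \<gamma> u (curv u e1 e2 e2) e1 / gdet u"

lemma chr_has_derivative:
  fixes k :: "'z::euclidean_space \<Rightarrow> real^2"
  assumes "k z \<in> \<Omega>" "(k has_derivative k') (at z)" "(f has_derivative f') (at z)" "(g has_derivative g') (at z)"
  shows "((\<lambda>z. chr (k z) (f z) (g z)) has_derivative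
    (\<lambda>c. dchr (k z) (k' c) (f z) (g z) + chr (k z) (f' c) (g z) + chr (k z) (f z) (g' c))) (at z)"
  unfolding dchr_def
  by (rule bilinear_family_has_derivative[where B = chr and S = \<Omega>])
    (use open_dom chr_bilinear chr_smooth assms in auto)

lemma chr_smooth_near:
  fixes k :: "'z::euclidean_space \<Rightarrow> real^2"
  assumes "k z \<in> \<Omega>" "smooth_near k z" "smooth_near f z" "smooth_near g z"
  shows "smooth_near (\<lambda>z. chr (k z) (f z) (g z)) z"
  by (rule bilinear_family_smooth[where B = chr and S = \<Omega>])
    (use open_dom chr_bilinear chr_smooth assms in auto)

lemma metric_smooth_near:
  fixes k :: "'z::euclidean_space \<Rightarrow> real^2"
  assumes "k z \<in> \<Omega>" "smooth_near k z" "smooth_near f z" "smooth_near g z"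
  shows "smooth_near (\<lambda>z. \<gamma> (k z) (f z) (g z)) z"
  by (rule bilinear_family_smooth[where B = \<gamma> and S = \<Omega>])
    (use open_dom metric_bilinear metric_smooth assms in auto)

lemma J_smooth_near:
  fixes k :: "'z::euclidean_space \<Rightarrow> real^2"
  assumes "k z \<in> \<Omega>" "smooth_near k z" "smooth_near f z"
  shows "smooth_near (\<lambda>z. J (k z) (f z)) z"
  by (rule linear_family_smooth[where L = J and S = \<Omega>])
    (use open_dom J_linear J_smooth assms in auto)

lemma dchr_linear1: "u \<in> \<Omega> \<Longrightarrow> linear (\<lambda>c. dchr u c a b)"
  unfolding dchr_def using smooth_near_linear[OF chr_smooth] by blast

lemma dchr_linear2: assumes u: "u \<in> \<Omega>" shows "linear (\<lambda>a. dchr u c a b)"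
proof (rule linear_combinationI)
  fix r s a a'
  have "((\<lambda>v. chr v (r *\<^sub>R a + s *\<^sub>R a') b) has_derivative (\<lambda>c. dchr u c (r *\<^sub>R a + s *\<^sub>R a') b)) (at u)"
    unfolding dchr_def by (intro smooth_near_has_derivative chr_smooth u)
  moreover have "((\<lambda>v. r *\<^sub>R chr v a b + s *\<^sub>R chr v a' b) has_derivative (\<lambda>c. r *\<^sub>R dchr u c a b + s *\<^sub>R dchr u c a' b)) (at u)"
    unfolding dchr_def by (intro has_derivative_add has_derivative_scaleR_right smooth_near_has_derivative chr_smooth u)
  moreover have "\<forall>\<^sub>F v in nhds u. chr v (r *\<^sub>R a + s *\<^sub>R a') b = r *\<^sub>R chr v a b + s *\<^sub>R chr v a' b"
    using eventually_nhds_in_open[OF open_dom u]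
    by eventually_elim (simp add: bilinear_ladd[OF chr_bilinear] bilinear_lmul[OF chr_bilinear])
  ultimately show "dchr u c (r *\<^sub>R a + s *\<^sub>R a') b = r *\<^sub>R dchr u c a b + s *\<^sub>R dchr u c a' b"
    by (rule has_derivative_eventually_unique)
qed

lemma dchr_sym: assumes u: "u \<in> \<Omega>" shows "dchr u c a b = dchr u c b a"
proof -
  have "\<forall>\<^sub>F v in nhds u. chr v a b = chr v b a"
    using eventually_nhds_in_open[OF open_dom u] by eventually_elim (rule chr_sym)
  from frechet_derivative_cong_eventually[OF this] show ?thesis by (simp add: dchr_def)
qed

lemma dchr_linear3: "u \<in> \<Omega> \<Longrightarrow> linear (\<lambda>b. dchr u c a b)"
  using dchr_linear2[of u c a] by (simp add: dchr_sym[of u c a])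

lemma curv_linear: assumes u: "u \<in> \<Omega>"
  shows "linear (\<lambda>a. curv u a b c)" "linear (\<lambda>b. curv u a b c)" "linear (\<lambda>c. curv u a b c)"
proof -
  note L = linear_add[OF dchr_linear1[OF u]] linear_scale[OF dchr_linear1[OF u]]
    linear_add[OF dchr_linear2[OF u]] linear_scale[OF dchr_linear2[OF u]]
    linear_add[OF dchr_linear3[OF u]] linear_scale[OF dchr_linear3[OF u]]
    bilinear_ladd[OF chr_bilinear[OF u]] bilinear_lmul[OF chr_bilinear[OF u]]
    bilinear_radd[OF chr_bilinear[OF u]] bilinear_rmul[OF chr_bilinear[OF u]]
  show "linear (\<lambda>a. curv u a b c)" "linear (\<lambda>b. curv u a b c)" "linear (\<lambda>c. curv u a b c)"
    by (rule linear_combinationI, simp add: curv_def L algebra_simps)+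
qed

lemma curv_alt: "curv u a b c = - curv u b a c"
  by (simp add: curv_def)

text \<open>The commutator of second derivatives of \<open>\<gamma>(c, c)\<close> vanishes; by compatibility of the metric it is also
  twice the left-hand side.\<close>

lemma curv_skew_diag: assumes u: "u \<in> \<Omega>" shows "\<gamma> u (curv u a b c) c = 0"
proof -
  have id: "((\<lambda>v. v) has_derivative (\<lambda>c. c)) (at u)" by simp
  have const: "((\<lambda>v. b) has_derivative (\<lambda>c. 0)) (at u)" for b :: "real^2" by simp
  have D: "frechet_derivative (\<lambda>v. dmetric v b c c) (at u) a =
      2 * (\<gamma> u (chr u a (chr u b c)) c + \<gamma> u (chr u b c) (chr u a c) + \<gamma> u (dchr u a b c) c)" for a b
  proof -
    have 1: "((\<lambda>v. chr v b c) has_derivative (\<lambda>a. dchr u a b c)) (at u)"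
      unfolding dchr_def by (intro smooth_near_has_derivative chr_smooth u)
    have "((\<lambda>v. 2 * \<gamma> v (chr v b c) c) has_derivative
       (\<lambda>a. 2 * (dmetric u a (chr u b c) c + \<gamma> u (dchr u a b c) c + \<gamma> u (chr u b c) 0))) (at u)"
      by (intro has_derivative_mult_right metric_has_derivative[where k = "\<lambda>v. v"] id const 1 u)
    note A = this
    have B: "((\<lambda>v. dmetric v b c c) has_derivative frechet_derivative (\<lambda>v. dmetric v b c c) (at u)) (at u)"
      by (intro smooth_near_has_derivative dmetric_smooth u)
    have "\<forall>\<^sub>F v in nhds u. dmetric v b c c = 2 * \<gamma> v (chr v b c) c"
      using eventually_nhds_in_open[OF open_dom u]
      by eventually_elim (simp add: metric_compatible metric_sym)
    from has_derivative_eventually_unique[OF B A this, of a] show ?thesis by (simp add: metric_compatible[OF u] metric_simps[OF u])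
  qed
  have "frechet_derivative (\<lambda>v. dmetric v b c c) (at u) a = frechet_derivative (\<lambda>v. dmetric v a c c) (at u) b"
    unfolding dmetric_def by (rule second_derivative_symmetric_real[OF metric_smooth[OF u]])
  then show ?thesis unfolding D curv_def metric_simps[OF u]
    using metric_sym[OF u, of "chr u b c" "chr u a c"] by simp
qed

lemma curv_skew: assumes u: "u \<in> \<Omega>" shows "\<gamma> u (curv u a b c) d = - \<gamma> u (curv u a b d) c"
  using curv_skew_diag[OF u, of a b "c + d"] curv_skew_diag[OF u, of a b c] curv_skew_diag[OF u, of a b d]
  by (simp add: linear_add[OF curv_linear(3)[OF u]] metric_simps[OF u])

text \<open>The curvature tensor is alternating in its first two arguments and skew in the last two, so that in
  dimension two it is determined by one number.\<close>

lemma curv_J: assumes u: "u \<in> \<Omega>" shows "curv u a (J u a) a = - (gauss u * \<gamma> u a a) *\<^sub>R J u a"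
proof (rule metric_nondegenerate[OF u])
  fix b
  have diag: "curv u x x c = 0" for x c by (simp add: curv_def)
  have wedge: "curv u a a' c = wedge a a' *\<^sub>R curv u e1 e2 c" for a a' c
  proof -
    have "curv u a a' c = curv u (a$1 *\<^sub>R e1 + a$2 *\<^sub>R e2) (a'$1 *\<^sub>R e1 + a'$2 *\<^sub>R e2) c"
      by (simp flip: vec2_expand)
    also have "\<dots> = wedge a a' *\<^sub>R curv u e1 e2 c"
      using curv_alt[of u e2 e1 c] diag[of e1] diag[of e2]
      by (simp add: linear_add[OF curv_linear(1)[OF u]] linear_scale[OF curv_linear(1)[OF u]]
         linear_add[OF curv_linear(2)[OF u]] linear_scale[OF curv_linear(2)[OF u]] wedge_def algebra_simps)
    finally show ?thesis .
  qed
  have 12: "\<gamma> u (curv u e1 e2 c) d = - (gauss u * gdet u) * wedge c d" for c d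
  proof -
    let ?S = "curv u e1 e2"
    have "\<gamma> u (?S c) d = \<gamma> u (?S (c$1 *\<^sub>R e1 + c$2 *\<^sub>R e2)) (d$1 *\<^sub>R e1 + d$2 *\<^sub>R e2)"
      by (simp flip: vec2_expand)
    also have "\<dots> = - \<gamma> u (?S e2) e1 * wedge c d"
      using curv_skew_diag[OF u, of e1 e2 e1] curv_skew_diag[OF u, of e1 e2 e2] curv_skew[OF u, of e1 e2 e1 e2]
      by (simp add: linear_add[OF curv_linear(3)[OF u]] linear_scale[OF curv_linear(3)[OF u]] metric_simps[OF u] wedge_def algebra_simps)
    finally show ?thesis using gdet_pos[OF u] by (simp add: gauss_def)
  qed
  have D: "gdet u = sqrt (gdet u) * sqrt (gdet u)" using gdet_pos[OF u] by simp
  have "\<gamma> u (curv u a (J u a) a) b = wedge a (J u a) * (- (gauss u * gdet u) * wedge a b)"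
    by (simp add: wedge[of a "J u a"] metric_simps[OF u] 12)
  also have "\<dots> = - gauss u * (sqrt (gdet u) * wedge a (J u a)) * (sqrt (gdet u) * wedge a b)"
    by (subst D) (simp add: algebra_simps)
  also have "\<dots> = - gauss u * \<gamma> u a a * \<gamma> u (J u a) b"
    by (simp only: wedge_J[OF u] metric_J[OF u])
  finally show "\<gamma> u (curv u a (J u a) a) b = \<gamma> u (- (gauss u * \<gamma> u a a) *\<^sub>R J u a) b"
    by (simp add: metric_simps[OF u])
qed

subsection \<open>The frame on the tangent bundle\<close>

text \<open>The fields \<open>X\<close>, \<open>V\<close> and \<open>H\<close> in the coordinates \<open>(u, a)\<close> of the tangent bundle. On the open set
  \<open>a \<noteq> 0\<close>, rather than on the unit circle bundle alone, brackets are computed by plain derivatives.\<close>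

definition geo :: "(real^2) \<times> (real^2) \<Rightarrow> (real^2) \<times> (real^2)"
  where "geo z = (snd z, - chr (fst z) (snd z) (snd z))"
definition ver :: "(real^2) \<times> (real^2) \<Rightarrow> (real^2) \<times> (real^2)"
  where "ver z = (0, J (fst z) (snd z))"
definition hor :: "(real^2) \<times> (real^2) \<Rightarrow> (real^2) \<times> (real^2)"
  where "hor z = (J (fst z) (snd z), - chr (fst z) (snd z) (J (fst z) (snd z)))"

lemma frame_smooth:
  assumes "fst z \<in> \<Omega>" shows "smooth_near geo z" "smooth_near ver z" "smooth_near hor z"
  unfolding geo_def[abs_def] ver_def[abs_def] hor_def[abs_def]
  by (intro smooth_intros chr_smooth_near J_smooth_near assms)+

lemma frame_has_derivative:
  assumes u: "u \<in> \<Omega>"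
  shows "(geo has_derivative (\<lambda>c. (snd c, - (dchr u (fst c) a a + chr u (snd c) a + chr u a (snd c))))) (at (u, a))"
    and "(ver has_derivative (\<lambda>c. (0, dJ u (fst c) a + J u (snd c)))) (at (u, a))"
    and "(hor has_derivative (\<lambda>c. (dJ u (fst c) a + J u (snd c),
        - (dchr u (fst c) a (J u a) + chr u (snd c) (J u a) + chr u a (dJ u (fst c) a + J u (snd c)))))) (at (u, a))"
proof -
  have f: "(fst has_derivative fst) (at (u, a))" and s: "(snd has_derivative snd) (at (u, a))"
    by (auto intro: has_derivative_fst has_derivative_snd)
  have J: "((\<lambda>z. J (fst z) (snd z)) has_derivative (\<lambda>c. dJ u (fst c) a + J u (snd c))) (at (u, a))"
    using J_has_derivative[OF _ f s] u by simp
  show "(geo has_derivative (\<lambda>c. (snd c, - (dchr u (fst c) a a + chr u (snd c) a + chr u a (snd c))))) (at (u, a))"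
    unfolding geo_def[abs_def] using chr_has_derivative[OF _ f s s] u
    by (intro has_derivative_Pair has_derivative_minus s) simp
  show "(ver has_derivative (\<lambda>c. (0, dJ u (fst c) a + J u (snd c)))) (at (u, a))"
    unfolding ver_def[abs_def] by (intro has_derivative_Pair J) simp
  show "(hor has_derivative (\<lambda>c. (dJ u (fst c) a + J u (snd c),
        - (dchr u (fst c) a (J u a) + chr u (snd c) (J u a) + chr u a (dJ u (fst c) a + J u (snd c)))))) (at (u, a))"
    unfolding hor_def[abs_def] using chr_has_derivative[OF _ f s J] u
    by (intro has_derivative_Pair has_derivative_minus J) simp
qed

definition bracket :: "('z::euclidean_space \<Rightarrow> 'z) \<Rightarrow> ('z \<Rightarrow> 'z) \<Rightarrow> 'z \<Rightarrow> 'z"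
  where "bracket Y Z z = frechet_derivative Z (at z) (Y z) - frechet_derivative Y (at z) (Z z)"

text \<open>Since \<open>J\<close> is parallel, derivatives of \<open>J\<close> turn into Christoffel terms, which cancel or combine
  with the derivatives of \<open>chr\<close> to the curvature.\<close>

lemma frame_brackets:
  assumes u: "u \<in> \<Omega>"
  shows "bracket ver geo (u, a) = hor (u, a)"
    and "bracket ver hor (u, a) = - geo (u, a)"
    and "bracket geo hor (u, a) = (gauss u * \<gamma> u a a) *\<^sub>R ver (u, a)"
proof -
  note D = frechet_derivative_eqI[OF frame_has_derivative(1)[OF u]] frechet_derivative_eqI[OF frame_has_derivative(2)[OF u]]
    frechet_derivative_eqI[OF frame_has_derivative(3)[OF u]]
  note L = bilinear_radd[OF chr_bilinear[OF u]] bilinear_rneg[OF chr_bilinear[OF u]] bilinear_rsub[OF chr_bilinear[OF u]]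
    bilinear_ladd[OF chr_bilinear[OF u]] bilinear_lneg[OF chr_bilinear[OF u]]
    bilinear_lzero[OF chr_bilinear[OF u]] bilinear_rzero[OF chr_bilinear[OF u]]
    linear_add[OF J_linear] linear_neg[OF J_linear] linear_diff[OF J_linear] linear_0[OF J_linear]
    linear_0[OF dchr_linear1[OF u]] J_J[OF u]
  have dJ0: "dJ u 0 a = 0" for a by (simp add: J_parallel[OF u] L)
  show "bracket ver geo (u, a) = hor (u, a)"
    unfolding bracket_def D by (simp add: ver_def geo_def hor_def J_parallel[OF u] L chr_sym[OF u, of "J u a" a])
  show "bracket ver hor (u, a) = - geo (u, a)"
    unfolding bracket_def D by (simp add: ver_def geo_def hor_def J_parallel[OF u] L dJ0 chr_sym[OF u, of "J u a" a])
  have "bracket geo hor (u, a) = (0, - curv u a (J u a) a)"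
    unfolding bracket_def D curv_def
    by (simp add: geo_def hor_def J_parallel[OF u] L
         chr_sym[OF u, of "chr u a a"] chr_sym[OF u, of "chr u a (J u a)"] chr_sym[OF u, of "J u a" a]
         dchr_sym[OF u, of a "J u a" a])
  then show "bracket geo hor (u, a) = (gauss u * \<gamma> u a a) *\<^sub>R ver (u, a)"
    by (simp add: curv_J[OF u] ver_def)
qed

text \<open>The linearization of the equation \<open>\<gamma>(a, a) = 1\<close> of the unit circle bundle.\<close>

definition unit_tangent :: "(real^2) \<times> (real^2) \<Rightarrow> (real^2) \<times> (real^2) \<Rightarrow> bool"
  where "unit_tangent z c \<longleftrightarrow> dmetric (fst z) (fst c) (snd z) (snd z) + 2 * \<gamma> (fst z) (snd z) (snd c) = 0"

lemma frame_tangent: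
  assumes u: "u \<in> \<Omega>"
  shows "unit_tangent (u, a) (geo (u, a))" "unit_tangent (u, a) (ver (u, a))" "unit_tangent (u, a) (hor (u, a))"
  using metric_sym[OF u, of a] J_orth[OF u, of a] linear_0[OF dmetric_linear1[OF u]]
  by (simp_all add: unit_tangent_def geo_def ver_def hor_def metric_compatible[OF u] metric_simps[OF u] chr_sym[OF u, of "J u a" a] bilinear_lzero[OF chr_bilinear[OF u]])

text \<open>The coefficients are the forms dual to \<open>X\<close>, \<open>H\<close>, \<open>V\<close>: the components of the base vector along \<open>a\<close>
  and \<open>Ja\<close>, and the connection form.\<close>

lemma tangent_expand:
  assumes u: "u \<in> \<Omega>" and unit: "\<gamma> u a a = 1" and t: "unit_tangent (u, a) c"
  shows "c = \<gamma> u a (fst c) *\<^sub>R geo (u, a) + \<gamma> u (J u a) (fst c) *\<^sub>R hor (u, a)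
     + \<gamma> u (J u a) (snd c + chr u a (fst c)) *\<^sub>R ver (u, a)"
proof -
  let ?w = "snd c + chr u a (fst c)"
  have b: "fst c = \<gamma> u a (fst c) *\<^sub>R a + \<gamma> u (J u a) (fst c) *\<^sub>R J u a" by (rule orthonormal_expand[OF u unit])
  have "\<gamma> u a ?w = 0"
    using t metric_sym[OF u, of "chr u a (fst c)" a] chr_sym[OF u, of "fst c" a]
    by (simp add: unit_tangent_def metric_compatible[OF u] metric_simps[OF u])
  then have w: "?w = \<gamma> u (J u a) ?w *\<^sub>R J u a" using orthonormal_expand[OF u unit, of ?w] by simp
  have "chr u a (fst c) = \<gamma> u a (fst c) *\<^sub>R chr u a a + \<gamma> u (J u a) (fst c) *\<^sub>R chr u a (J u a)"
    by (subst b) (simp only: bilinear_radd[OF chr_bilinear[OF u]] bilinear_rmul[OF chr_bilinear[OF u]])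
  then have s: "snd c = \<gamma> u (J u a) ?w *\<^sub>R J u a - (\<gamma> u a (fst c) *\<^sub>R chr u a a + \<gamma> u (J u a) (fst c) *\<^sub>R chr u a (J u a))"
    using w by (metis add_diff_cancel_right')
  define r where "r = \<gamma> u (J u a) ?w"
  define s where "s = \<gamma> u (J u a) (fst c)"
  define t where "t = \<gamma> u a (fst c)"
  show ?thesis unfolding r_def[symmetric] s_def[symmetric] t_def[symmetric]
  proof (rule prod_eqI)
    show "fst c = fst (t *\<^sub>R geo (u, a) + s *\<^sub>R hor (u, a) + r *\<^sub>R ver (u, a))"
      using b unfolding s_def[symmetric] t_def[symmetric] by (simp add: geo_def hor_def ver_def)
    show "snd c = snd (t *\<^sub>R geo (u, a) + s *\<^sub>R hor (u, a) + r *\<^sub>R ver (u, a))"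
      using s unfolding r_def[symmetric] s_def[symmetric] t_def[symmetric]
      by (simp add: geo_def hor_def ver_def algebra_simps)
  qed
qed

end

text \<open>Both sides satisfy the Koszul formula for \<open>\<gamma>'\<close>. The second derivative of \<open>h\<close> enters when the
  isometry condition is differentiated.\<close>

lemma chr_transform:
  assumes S: "surface_metric \<Omega> \<gamma>" "surface_metric \<Omega>' \<gamma>'"
    and u: "u \<in> \<Omega>" "h u \<in> \<Omega>'" and h: "smooth_near h u"
    and surj: "surj (frechet_derivative h (at u))"
    and iso: "\<forall>\<^sub>F v in nhds u. \<forall>a b. \<gamma> v a b = \<gamma>' (h v) (frechet_derivative h (at v) a) (frechet_derivative h (at v) b)"
  shows "frechet_derivative h (at u) (surface_metric.chr \<gamma> u a a) =
     surface_metric.chr \<gamma>' (h u) (frechet_derivative h (at u) a) (frechet_derivative h (at u) a)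
     + frechet_derivative (\<lambda>v. frechet_derivative h (at v) a) (at u) a"
proof -
  interpret G: surface_metric \<Omega> \<gamma> by fact
  interpret G': surface_metric \<Omega>' \<gamma>' by fact
  let ?H = "frechet_derivative h (at u)"
  let ?H2 = "\<lambda>b c. frechet_derivative (\<lambda>v. frechet_derivative h (at v) b) (at u) c"
  have H2_sym: "?H2 b c = ?H2 c b" for b c by (rule second_derivative_symmetric[OF h])
  have D: "G.dmetric u c a b = G'.dmetric (h u) (?H c) (?H a) (?H b) + \<gamma>' (h u) (?H2 a c) (?H b) + \<gamma>' (h u) (?H a) (?H2 b c)" for a b c
  proof -
    have P: "((\<lambda>v. \<gamma>' (h v) (frechet_derivative h (at v) a) (frechet_derivative h (at v) b)) has_derivative
      (\<lambda>c. G'.dmetric (h u) (?H c) (?H a) (?H b) + \<gamma>' (h u) (?H2 a c) (?H b) + \<gamma>' (h u) (?H a) (?H2 b c))) (at u)"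
      by (intro G'.metric_has_derivative smooth_near_has_derivative smooth_near_frechet_derivative_const h u)
    have Q: "((\<lambda>v. \<gamma> v a b) has_derivative (\<lambda>c. G.dmetric u c a b)) (at u)"
      unfolding G.dmetric_def by (intro smooth_near_has_derivative G.metric_smooth u)
    have R: "\<forall>\<^sub>F v in nhds u. \<gamma> v a b = \<gamma>' (h v) (frechet_derivative h (at v) a) (frechet_derivative h (at v) b)"
      using iso by eventually_elim blast
    show ?thesis by (rule has_derivative_eventually_unique[OF Q P R])
  qed
  show ?thesis
  proof (rule G'.metric_nondegenerate[OF u(2)])
    fix e'
    obtain e where e: "e' = ?H e" using surj by (metis surjD)
    have "2 * \<gamma>' (h u) (?H (G.chr u a a)) e' = 2 * \<gamma> u (G.chr u a a) e"
      using eventually_nhds_x_imp_x[OF iso] e by simp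
    also have "\<dots> = G.dmetric u a a e + G.dmetric u a a e - G.dmetric u e a a" by (rule G.koszul[OF u(1)])
    also have "\<dots> = 2 * \<gamma>' (h u) (G'.chr (h u) (?H a) (?H a)) e' + 2 * \<gamma>' (h u) (?H2 a a) e'"
    proof -
      have "\<gamma>' (h u) (?H2 a e) (?H a) = \<gamma>' (h u) (?H a) (?H2 e a)"
        unfolding H2_sym[of e a] by (rule G'.metric_sym[OF u(2)])
      moreover have "\<gamma>' (h u) (?H a) (?H2 a e) = \<gamma>' (h u) (?H a) (?H2 e a)"
        unfolding H2_sym[of e a] ..
      ultimately show ?thesis
        using D[of a a e] D[of e a a] G'.koszul[OF u(2), of "?H a" "?H a" "?H e"] unfolding e by linarith
    qed
    finally show "\<gamma>' (h u) (?H (G.chr u a a)) e' = \<gamma>' (h u) (G'.chr (h u) (?H a) (?H a) + ?H2 a a) e'"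
      by (simp add: G'.metric_simps[OF u(2)])
  qed
qed

section \<open>The unit tangent bundle as a smooth atlas\<close>

subsection \<open>Polar angles\<close>

abbreviation ecirc :: "real \<Rightarrow> real^2" where "ecirc \<theta> \<equiv> vector [cos \<theta>, sin \<theta>]"
abbreviation ecirc' :: "real \<Rightarrow> real^2" where "ecirc' \<theta> \<equiv> vector [- sin \<theta>, cos \<theta>]"

text \<open>The branch of the polar angle that equals \<open>\<theta>\<close> at \<open>ecirc \<theta>\<close>. It is smooth on the half plane around
  \<open>ecirc \<theta>\<close>.\<close>

definition angle_near :: "real \<Rightarrow> real^2 \<Rightarrow> real"
  where "angle_near \<theta> a = \<theta> + arctan ((ecirc' \<theta> \<bullet> a) / (ecirc \<theta> \<bullet> a))"

lemma inner_vec2: "(a::real^2) \<bullet> b = a$1 * b$1 + a$2 * b$2"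
  by (simp add: inner_vec_def sum_2)

lemma ecirc_nonzero: "ecirc \<theta> \<noteq> 0"
proof
  assume "ecirc \<theta> = 0"
  then have "cos \<theta> = 0" "sin \<theta> = 0" by (metis vector_2 zero_index)+
  then show False using sin_cos_squared_add[of \<theta>] by simp
qed

lemma ecirc_unit: "ecirc \<theta> \<bullet> ecirc \<theta> = 1" "ecirc' \<theta> \<bullet> ecirc \<theta> = 0"
  using sin_cos_squared_add3[of \<theta>] by (simp_all add: inner_vec2)

lemma angle_near_polar:
  assumes "ecirc \<theta> \<bullet> a > 0"
  shows "\<exists>s>0. a = s *\<^sub>R ecirc (angle_near \<theta> a)"
proof -
  define c where "c = ecirc \<theta> \<bullet> a"
  define d where "d = ecirc' \<theta> \<bullet> a"
  define b where "b = arctan (d / c)"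
  have c: "c > 0" using assms by (simp add: c_def)
  have cb: "cos b > 0" by (simp add: b_def cos_arctan add_pos_nonneg)
  have "tan b = d / c" by (simp add: b_def tan_arctan)
  then have t: "sin b = d / c * cos b" using cb by (simp add: tan_def field_simps)
  have cs: "cos \<theta> * cos \<theta> + sin \<theta> * sin \<theta> = 1" using sin_cos_squared_add3[of \<theta>] by simp
  have 1: "c * cos \<theta> - d * sin \<theta> = a$1"
  proof -
    have "c * cos \<theta> - d * sin \<theta> = a$1 * (cos \<theta> * cos \<theta> + sin \<theta> * sin \<theta>)"
      by (simp add: c_def d_def inner_vec2 algebra_simps del: sin_cos_squared_add3)
    then show ?thesis by (simp only: cs mult_1_right)
  qed
  have 2: "c * sin \<theta> + d * cos \<theta> = a$2"
  proof -
    have "c * sin \<theta> + d * cos \<theta> = a$2 * (cos \<theta> * cos \<theta> + sin \<theta> * sin \<theta>)"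
      by (simp add: c_def d_def inner_vec2 algebra_simps del: sin_cos_squared_add3)
    then show ?thesis by (simp only: cs mult_1_right)
  qed
  have "a = (c / cos b) *\<^sub>R ecirc (\<theta> + b)"
    using c cb by (simp add: vec_eq_iff forall_2 cos_add sin_add t 1[symmetric] 2[symmetric] field_simps)
  moreover have "angle_near \<theta> a = \<theta> + b" by (simp add: angle_near_def b_def c_def d_def)
  ultimately show ?thesis using c cb by (metis divide_pos_pos)
qed

lemma angle_near_ecirc: "s > 0 \<Longrightarrow> angle_near \<theta> (s *\<^sub>R ecirc \<theta>) = \<theta>"
  by (simp add: angle_near_def ecirc_unit)

lemma angle_near_smooth:
  assumes "smooth_near f z" "ecirc \<theta> \<bullet> f z \<noteq> 0" shows "smooth_near (\<lambda>z. angle_near \<theta> (f z)) z"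
  unfolding angle_near_def using assms
  by (intro smooth_near_add smooth_near_const smooth_near_arctan smooth_near_divide smooth_near_inner)

lemma ecirc_eq_scaled:
  assumes "ecirc \<theta> = s *\<^sub>R ecirc \<theta>'" "s > 0" "\<alpha> < \<theta>" "\<theta> < \<alpha> + 2 * pi" "\<alpha> < \<theta>'" "\<theta>' < \<alpha> + 2 * pi"
  shows "\<theta> = \<theta>'"
proof -
  have "ecirc \<theta> \<bullet> ecirc \<theta> = s\<^sup>2 * (ecirc \<theta>' \<bullet> ecirc \<theta>')" unfolding assms(1) by (simp add: power2_eq_square)
  then have "s = 1" using assms(2) unfolding ecirc_unit by (simp add: power2_eq_1_iff)
  then have "sin \<theta> = sin \<theta>' \<and> cos \<theta> = cos \<theta>'" using assms(1) by (metis vector_2 scaleR_one)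
  then obtain n :: int where n: "\<theta> = \<theta>' + 2 * pi * real_of_int n" using sin_cos_eq_iff by blast
  have "\<bar>\<theta> - \<theta>'\<bar> < 2 * pi" using assms by linarith
  then have "\<bar>2 * pi * real_of_int n\<bar> < 2 * pi * 1" using n by simp
  then have "\<bar>real_of_int n\<bar> < 1" by (simp add: abs_mult)
  then have "n = 0" by linarith
  then show ?thesis using n by simp
qed

lemma polar_angle_exists:
  fixes a :: "real^2"
  assumes "a \<noteq> 0" shows "\<exists>s \<theta>. s > 0 \<and> a = s *\<^sub>R ecirc \<theta>"
proof -
  have r: "norm a > 0" using assms by simp
  have "(a$1)\<^sup>2 + (a$2)\<^sup>2 = (norm a)\<^sup>2"
    by (simp add: power2_norm_eq_inner inner_vec2 flip: power2_eq_square)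
  then have "(a$1 / norm a)\<^sup>2 + (a$2 / norm a)\<^sup>2 = 1"
    using r by (simp add: power_divide flip: add_divide_distrib)
  then obtain \<theta> where \<theta>: "a$1 / norm a = cos \<theta>" "a$2 / norm a = sin \<theta>"
    using sincos_total_2pi by metis
  have "a = norm a *\<^sub>R ecirc \<theta>" using r unfolding \<theta>[symmetric] by (simp add: vec_eq_iff forall_2)
  then show ?thesis using r by blast
qed

subsection \<open>Homogeneous coordinates on the unit tangent bundle\<close>

locale surface =
  fixes A :: "('m, real^2) atlas" and g :: "'m metric"
  assumes surface: "closed_oriented_riemannian_surface A g"

sublocale surface \<subseteq> atlas A
  using surface by unfold_locales
    (simp add: closed_oriented_riemannian_surface_def closed_manifold_def smooth_manifold_def)

context surface begin

lemma riemannian: "riemannian_metric A g"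
  using surface by (simp add: closed_oriented_riemannian_surface_def)

lemma metric_chart:
  assumes x: "(\<Omega>, x) \<in> A" shows "surface_metric \<Omega> (gcoord A g x)"
proof
  show "open \<Omega>" by (rule chart_open[OF x])
  fix u assume u: "u \<in> \<Omega>"
  have p: "x u \<in> carrier_of A" by (rule chart_carrier[OF x u])
  note T = coord_vec_in_tangent_space[OF x u]
  show "gcoord A g x u (r *\<^sub>R a + s *\<^sub>R b) e = r * gcoord A g x u a e + s * gcoord A g x u b e" for r a s b e
    using riemannian p T unfolding riemannian_metric_def gcoord_def coord_vec_add[OF x u] coord_vec_scaleR[OF x u] by blast
  show "gcoord A g x u a b = gcoord A g x u b a" for a b
    using riemannian p T unfolding riemannian_metric_def gcoord_def by blast
  show "gcoord A g x u a a > 0" if "a \<noteq> 0" for a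
    using riemannian p T coord_vec_nonzero[OF smooth_atlas x u that] unfolding riemannian_metric_def gcoord_def by blast
next
  show "smooth_on \<Omega> (\<lambda>u. gcoord A g x u a b)" for a b
    using riemannian x unfolding riemannian_metric_def gcoord_def by fast
qed

abbreviation SM :: "('m tpoint, (real^2) \<times> real) atlas" where "SM \<equiv> SM_atlas A g"

text \<open>Homogeneous coordinates: a point of \<open>SM\<close> is given by base coordinates and a nonzero vector, which
  matters only up to a positive factor. Here the fields have the simple form above, which they do not
  have in the angle coordinate.\<close>

definition unit_point :: "(real^2 \<Rightarrow> 'm) \<Rightarrow> (real^2) \<times> (real^2) \<Rightarrow> 'm tpoint"
  where "unit_point x z = (x (fst z), unit_vec A g x (fst z) (snd z))"

text \<open>The retraction of homogeneous coordinates onto the unit vectors.\<close>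

definition unitize :: "(real^2 \<Rightarrow> 'm) \<Rightarrow> (real^2) \<times> (real^2) \<Rightarrow> (real^2) \<times> (real^2)"
  where "unitize x z = (fst z, (1 / sqrt (gcoord A g x (fst z) (snd z) (snd z))) *\<^sub>R snd z)"

lemma gcoord_scale:
  assumes "(\<Omega>, x) \<in> A" "u \<in> \<Omega>" shows "gcoord A g x u (s *\<^sub>R a) (s *\<^sub>R a) = s\<^sup>2 * gcoord A g x u a a"
  using surface_metric.metric_simps[OF metric_chart[OF assms(1)] assms(2)] by (simp add: power2_eq_square)

lemma unitize_scale:
  assumes "(\<Omega>, x) \<in> A" "u \<in> \<Omega>" "s > 0" shows "unitize x (u, s *\<^sub>R a) = unitize x (u, a)"
  using assms by (simp add: unitize_def gcoord_scale real_sqrt_mult)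

lemma unitize_unit: "gcoord A g x u a a = 1 \<Longrightarrow> unitize x (u, a) = (u, a)"
  by (simp add: unitize_def)

lemma gcoord_unitize:
  assumes "(\<Omega>, x) \<in> A" "fst z \<in> \<Omega>" "snd z \<noteq> 0"
  shows "gcoord A g x (fst (unitize x z)) (snd (unitize x z)) (snd (unitize x z)) = 1"
    "fst (unitize x z) = fst z" "snd (unitize x z) \<noteq> 0"
proof -
  have "gcoord A g x (fst z) (snd z) (snd z) > 0"
    using surface_metric.metric_pos[OF metric_chart[OF assms(1)]] assms by blast
  then show "gcoord A g x (fst (unitize x z)) (snd (unitize x z)) (snd (unitize x z)) = 1"
    "fst (unitize x z) = fst z" "snd (unitize x z) \<noteq> 0" using assms
    by (simp_all add: unitize_def gcoord_scale[OF assms(1,2)] power_divide)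
qed

lemma unitize_pos:
  assumes "(\<Omega>, x) \<in> A" "u \<in> \<Omega>" "a \<noteq> 0" shows "\<exists>s>0. unitize x (u, a) = (u, s *\<^sub>R a)"
  using surface_metric.metric_pos[OF metric_chart[OF assms(1)] assms(2,3)]
  by (auto simp: unitize_def intro!: exI[of _ "1 / sqrt (gcoord A g x u a a)"])

lemma unit_point_eq_unitize: "unit_point x z = (x (fst z), coord_vec A x (fst z) (snd (unitize x z)))"
  by (simp add: unit_point_def unit_vec_def unitize_def)

lemma unit_point_scale:
  assumes "(\<Omega>, x) \<in> A" "u \<in> \<Omega>" "s > 0" shows "unit_point x (u, s *\<^sub>R a) = unit_point x (u, a)"
  using unitize_scale[OF assms, of a] by (simp add: unit_point_eq_unitize)

lemma unit_point_unit: "gcoord A g x u a a = 1 \<Longrightarrow> unit_point x (u, a) = (x u, coord_vec A x u a)"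
  by (simp add: unit_point_eq_unitize unitize_unit)

lemma unit_point_unitize:
  assumes "(\<Omega>, x) \<in> A" "fst z \<in> \<Omega>" "snd z \<noteq> 0" shows "unit_point x (unitize x z) = unit_point x z"
proof -
  obtain s where "s > 0" "unitize x z = (fst z, s *\<^sub>R snd z)" using unitize_pos[OF assms] by auto
  then show ?thesis using unit_point_scale[OF assms(1,2), of s "snd z"] by simp
qed

lemma unit_point_inj:
  assumes "(\<Omega>, x) \<in> A" "fst z \<in> \<Omega>" "snd z \<noteq> 0" "fst z' \<in> \<Omega>" "snd z' \<noteq> 0" "unit_point x z = unit_point x z'"
  shows "unitize x z = unitize x z'"
proof -
  have "fst z = fst z'" using assms(6) chart_inj[OF assms(1)] assms(2,4) by (auto simp: unit_point_def inj_on_def)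
  moreover have "snd (unitize x z) = snd (unitize x z')"
    using assms(6) coord_vec_inj[OF assms(1,2)] calculation by (auto simp: unit_point_eq_unitize)
  ultimately show ?thesis by (simp add: unitize_def)
qed

lemma unit_point_eq_imp_scaled:
  assumes "(\<Omega>, x) \<in> A" "u \<in> \<Omega>" "a \<noteq> 0" "b \<noteq> 0" "unit_point x (u, a) = unit_point x (u, b)"
  shows "\<exists>s>0. a = s *\<^sub>R b"
proof -
  obtain s t where st: "s > 0" "unitize x (u, a) = (u, s *\<^sub>R a)" "t > 0" "unitize x (u, b) = (u, t *\<^sub>R b)"
    using unitize_pos[OF assms(1,2)] assms(3,4) by metis
  then have "s *\<^sub>R a = t *\<^sub>R b" using unit_point_inj[OF assms(1), of "(u, a)" "(u, b)"] assms by simp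
  then have "a = (t / s) *\<^sub>R b" using st by (simp add: divideR_right divide_inverse_commute flip: scaleR_scaleR)
  then show ?thesis using st by (metis divide_pos_pos)
qed

lemma unitize_smooth:
  assumes "(\<Omega>, x) \<in> A" "fst z \<in> \<Omega>" "snd z \<noteq> 0" shows "smooth_near (unitize x) z"
proof -
  interpret G: surface_metric \<Omega> "gcoord A g x" by (rule metric_chart[OF assms(1)])
  have "gcoord A g x (fst z) (snd z) (snd z) > 0" using G.metric_pos assms by blast
  then show ?thesis unfolding unitize_def[abs_def]
    by (intro smooth_intros G.metric_smooth_near assms) auto
qed

subsection \<open>Changes of coordinates\<close>

lemma transition_derivative_bij:
  assumes "(\<Omega>, x) \<in> A" "(\<Omega>', x') \<in> A" "u \<in> \<Omega>" "x u \<in> x' ` \<Omega>'"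
  shows "bij (frechet_derivative (transition \<Omega>' x' x) (at u))"
proof (rule bijI)
  let ?H = "frechet_derivative (transition \<Omega>' x' x) (at u)"
  show "inj ?H"
  proof (rule injI)
    fix a b assume "?H a = ?H b"
    then have "coord_vec A x u a = coord_vec A x u b" by (simp add: coord_vec_change[OF assms])
    then show "a = b" by (rule coord_vec_inj[OF assms(1,3)])
  qed
  show "surj ?H"
    by (rule linear_inj_imp_surj[OF smooth_near_linear[OF transition_smooth[OF assms]] \<open>inj ?H\<close>])
qed

definition lift_transition :: "(real^2) set \<Rightarrow> (real^2 \<Rightarrow> 'm) \<Rightarrow> (real^2 \<Rightarrow> 'm) \<Rightarrow> (real^2) \<times> (real^2) \<Rightarrow> (real^2) \<times> (real^2)"
  where "lift_transition \<Omega>' x' x z = (transition \<Omega>' x' x (fst z), frechet_derivative (transition \<Omega>' x' x) (at (fst z)) (snd z))"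

lemma gcoord_transition:
  assumes "(\<Omega>, x) \<in> A" "(\<Omega>', x') \<in> A" "u \<in> \<Omega>" "x u \<in> x' ` \<Omega>'"
  shows "gcoord A g x u a b = gcoord A g x' (transition \<Omega>' x' x u)
     (frechet_derivative (transition \<Omega>' x' x) (at u) a) (frechet_derivative (transition \<Omega>' x' x) (at u) b)"
  using transition_at(2)[OF assms] by (simp add: gcoord_def coord_vec_change[OF assms])

lemma unit_point_lift_transition:
  assumes "(\<Omega>, x) \<in> A" "(\<Omega>', x') \<in> A" "fst z \<in> \<Omega>" "x (fst z) \<in> x' ` \<Omega>'"
  shows "unit_point x' (lift_transition \<Omega>' x' x z) = unit_point x z"
proof -
  let ?h = "transition \<Omega>' x' x"
  let ?H = "frechet_derivative ?h (at (fst z))"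
  have "linear ?H" by (rule smooth_near_linear[OF transition_smooth[OF assms]])
  then have "?H (r *\<^sub>R snd z) = r *\<^sub>R ?H (snd z)" for r by (rule linear_scale)
  then show ?thesis
    using transition_at(2)[OF assms]
    by (simp add: unit_point_def lift_transition_def unit_vec_def coord_vec_change[OF assms] gcoord_transition[OF assms])
qed

lemma lift_transition_smooth:
  assumes "(\<Omega>, x) \<in> A" "(\<Omega>', x') \<in> A" "fst z \<in> \<Omega>" "x (fst z) \<in> x' ` \<Omega>'"
  shows "smooth_near (lift_transition \<Omega>' x' x) z"
  unfolding lift_transition_def[abs_def]
  by (intro smooth_near_Pair smooth_near_compose[of fst z "transition \<Omega>' x' x"] smooth_near_frechet_derivative transition_smooth[OF assms] smooth_intros)

text \<open>The fibre coordinate of a second chart as a smooth function of homogeneous coordinates of the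
  first: apply the lifted transition map, then take the angle. The transition maps of \<open>SM\<close> are
  smooth for this reason.\<close>

lemma polar_lift:
  assumes x: "(\<Omega>, x) \<in> A" "(\<Omega>', x') \<in> A" and u: "fst z \<in> \<Omega>" "snd z \<noteq> 0" and u': "u' \<in> \<Omega>'"
    and eq: "unit_point x z = unit_point x' (u', ecirc \<theta>')"
  obtains \<tau> where "smooth_near \<tau> z" "\<tau> z = (u', \<theta>')"
    "\<forall>\<^sub>F w in nhds z. unit_point x w = unit_point x' (fst (\<tau> w), ecirc (snd (\<tau> w)))"
proof -
  let ?k = "lift_transition \<Omega>' x' x"
  let ?\<tau> = "\<lambda>w. (fst (?k w), angle_near \<theta>' (snd (?k w)))"
  have xu: "x (fst z) = x' u'" using eq by (simp add: unit_point_def)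
  then have im: "x (fst z) \<in> x' ` \<Omega>'" using u' by simp
  have hu: "fst (?k z) = u'" unfolding lift_transition_def using transition_eqI[OF x(2) u'] xu by simp
  have nz: "snd (?k z) \<noteq> 0"
  proof -
    have "inj (frechet_derivative (transition \<Omega>' x' x) (at (fst z)))"
      using transition_derivative_bij[OF x u(1) im] by (simp add: bij_def)
    then show ?thesis using u(2) linear_0[OF smooth_near_linear[OF transition_smooth[OF x u(1) im]]]
      unfolding lift_transition_def by (metis injD snd_conv)
  qed
  have "unit_point x' (u', snd (?k z)) = unit_point x' (u', ecirc \<theta>')"
    using unit_point_lift_transition[OF x u(1) im] eq hu by (metis prod.collapse)
  then obtain s where s: "s > 0" "snd (?k z) = s *\<^sub>R ecirc \<theta>'"
    using unit_point_eq_imp_scaled[OF x(2) u' nz ecirc_nonzero] by blast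
  have pos: "ecirc \<theta>' \<bullet> snd (?k z) > 0" using s by (simp add: ecirc_unit)
  have sm: "smooth_near ?k z" by (rule lift_transition_smooth[OF x u(1) im])
  show ?thesis
  proof
    show "smooth_near ?\<tau> z"
      using pos by (intro smooth_near_Pair angle_near_smooth smooth_near_fst smooth_near_snd sm) simp
    show "?\<tau> z = (u', \<theta>')" using hu s angle_near_ecirc by simp
    have "isCont fst z" by (intro continuous_intros)
    from eventually_nhds_isCont[OF this transition_near[OF x u(1) im]]
    have 1: "\<forall>\<^sub>F w in nhds z. fst w \<in> \<Omega> \<and> x (fst w) \<in> x' ` \<Omega>' \<and> transition \<Omega>' x' x (fst w) \<in> \<Omega>'"
      by (auto elim: eventually_mono)
    have "isCont (\<lambda>w. ecirc \<theta>' \<bullet> snd (?k w)) z"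
      by (intro smooth_near_isCont smooth_near_inner smooth_near_const smooth_near_snd sm)
    then have 2: "\<forall>\<^sub>F w in nhds z. ecirc \<theta>' \<bullet> snd (?k w) > 0"
      using pos by (intro order_tendstoD) (auto simp: isCont_nhds)
    show "\<forall>\<^sub>F w in nhds z. unit_point x w = unit_point x' (fst (?\<tau> w), ecirc (snd (?\<tau> w)))"
      using 1 2
    proof eventually_elim
      case (elim w)
      obtain s where s: "s > 0" "snd (?k w) = s *\<^sub>R ecirc (angle_near \<theta>' (snd (?k w)))"
        using angle_near_polar[of \<theta>' "snd (?k w)"] elim by blast
      have "unit_point x w = unit_point x' (fst (?k w), snd (?k w))"
        using unit_point_lift_transition[OF x] elim by simp
      also have "\<dots> = unit_point x' (fst (?k w), s *\<^sub>R ecirc (angle_near \<theta>' (snd (?k w))))" using s by simp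
      also have "\<dots> = unit_point x' (fst (?k w), ecirc (angle_near \<theta>' (snd (?k w))))"
        using elim s(1) by (intro unit_point_scale[OF x(2)]) (auto simp: lift_transition_def)
      finally show ?case by simp
    qed
  qed
qed

definition SM_param :: "(real^2 \<Rightarrow> 'm) \<Rightarrow> (real^2) \<times> real \<Rightarrow> 'm tpoint"
  where "SM_param x w = unit_point x (fst w, ecirc (snd w))"

lemma SM_atlas_eq: "SM = {(\<Omega> \<times> {\<alpha><..<\<alpha> + 2 * pi}, SM_param x) | \<Omega> x \<alpha>. (\<Omega>, x) \<in> A}"
proof -
  have "(\<lambda>(u, \<theta>). (x u, unit_vec A g x u (ecirc \<theta>))) = SM_param x" for x
    by (auto simp: SM_param_def unit_point_def)
  then show ?thesis unfolding SM_atlas_def by simp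
qed

lemma SM_chartI: "(\<Omega>, x) \<in> A \<Longrightarrow> (\<Omega> \<times> {\<alpha><..<\<alpha> + 2 * pi}, SM_param x) \<in> SM"
  unfolding SM_atlas_eq by blast

lemma ecirc_smooth: "smooth_near (\<lambda>w. (fst w, ecirc (snd w)) :: (real^2) \<times> (real^2)) w"
  by (intro smooth_intros)

lemma SM_param_inj:
  assumes "(\<Omega>, x) \<in> A" shows "inj_on (SM_param x) (\<Omega> \<times> {\<alpha><..<\<alpha> + 2 * pi})"
proof (rule inj_onI)
  fix w w' assume w: "w \<in> \<Omega> \<times> {\<alpha><..<\<alpha> + 2 * pi}" "w' \<in> \<Omega> \<times> {\<alpha><..<\<alpha> + 2 * pi}" "SM_param x w = SM_param x w'"
  have "x (fst w) = x (fst w')" using w(3) by (simp add: SM_param_def unit_point_def)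
  then have 1: "fst w = fst w'" using inj_onD[OF chart_inj[OF assms], of "fst w" "fst w'"] w(1,2) by (simp add: mem_Times_iff)
  then have "unit_point x (fst w', ecirc (snd w)) = unit_point x (fst w', ecirc (snd w'))" using w(3) by (simp add: SM_param_def)
  then obtain s where "s > 0" "ecirc (snd w) = s *\<^sub>R ecirc (snd w')"
    using unit_point_eq_imp_scaled[OF assms _ ecirc_nonzero ecirc_nonzero] w by (metis mem_Times_iff)
  then have "snd w = snd w'" using w by (intro ecirc_eq_scaled[of _ s _ \<alpha>]) (auto simp: mem_Times_iff)
  then show "w = w'" using 1 by (simp add: prod_eq_iff)
qed

lemma SM_transition:
  assumes x: "(\<Omega>, x) \<in> A" "(\<Omega>', x') \<in> A" and I: "open I" "open I'" and w: "w \<in> \<Omega> \<times> I" "w' \<in> \<Omega>' \<times> I'"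
    and eq: "SM_param x w = SM_param x' w'"
  obtains \<tau> where "smooth_near \<tau> w" "\<forall>\<^sub>F v in nhds w. v \<in> \<Omega> \<times> I \<and> \<tau> v \<in> \<Omega>' \<times> I' \<and> SM_param x v = SM_param x' (\<tau> v)"
proof -
  let ?e = "\<lambda>w. (fst w, ecirc (snd w)) :: (real^2) \<times> (real^2)"
  obtain \<sigma> where \<sigma>: "smooth_near \<sigma> (?e w)" "\<sigma> (?e w) = (fst w', snd w')"
    "\<forall>\<^sub>F v in nhds (?e w). unit_point x v = unit_point x' (fst (\<sigma> v), ecirc (snd (\<sigma> v)))"
  proof -
    have "fst (?e w) \<in> \<Omega>" "snd (?e w) \<noteq> 0" "fst w' \<in> \<Omega>'" "unit_point x (?e w) = unit_point x' (fst w', ecirc (snd w'))"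
      using w eq ecirc_nonzero by (simp_all add: SM_param_def mem_Times_iff)
    from polar_lift[OF x this] that show thesis by blast
  qed
  show ?thesis
  proof
    show sm: "smooth_near (\<lambda>w. \<sigma> (?e w)) w" using smooth_near_compose[OF ecirc_smooth \<sigma>(1)] .
    have "open (\<Omega> \<times> I)" "open (\<Omega>' \<times> I')" using chart_open x I by (auto intro: open_Times)
    then have "\<forall>\<^sub>F v in nhds w. v \<in> \<Omega> \<times> I" "\<forall>\<^sub>F v in nhds (\<sigma> (?e w)). v \<in> \<Omega>' \<times> I'"
      using w \<sigma>(2) by (auto intro!: eventually_nhds_in_open)
    note e1 = this
    have e2: "\<forall>\<^sub>F v in nhds w. SM_param x v = SM_param x' (\<sigma> (?e v))"
      using eventually_nhds_isCont[OF smooth_near_isCont[OF ecirc_smooth] \<sigma>(3)] by (simp add: SM_param_def)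
    have e3: "\<forall>\<^sub>F v in nhds w. \<sigma> (?e v) \<in> \<Omega>' \<times> I'"
      by (rule eventually_nhds_isCont[OF smooth_near_isCont[OF sm] e1(2)])
    show "\<forall>\<^sub>F v in nhds w. v \<in> \<Omega> \<times> I \<and> \<sigma> (?e v) \<in> \<Omega>' \<times> I' \<and> SM_param x v = SM_param x' (\<sigma> (?e v))"
      using e1(1) e2 e3 by eventually_elim blast
  qed
qed

lemma SM_smooth_atlas: "smooth_atlas SM"
  unfolding smooth_atlas_def
proof (intro conjI ballI; clarify)
  fix D y assume "(D, y) \<in> SM"
  then obtain \<Omega> x \<alpha> where *: "(\<Omega>, x) \<in> A" "D = \<Omega> \<times> {\<alpha><..<\<alpha> + 2 * pi}" "y = SM_param x"
    unfolding SM_atlas_eq by blast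
  then show "open D \<and> inj_on y D" using SM_param_inj chart_open by (auto intro: open_Times)
next
  fix D y D' y' assume "(D, y) \<in> SM" "(D', y') \<in> SM"
  then obtain \<Omega> x \<alpha> \<Omega>' x' \<alpha>' where x: "(\<Omega>, x) \<in> A" "D = \<Omega> \<times> {\<alpha><..<\<alpha> + 2 * pi}" "y = SM_param x"
    "(\<Omega>', x') \<in> A" "D' = \<Omega>' \<times> {\<alpha>'<..<\<alpha>' + 2 * pi}" "y' = SM_param x'"
    unfolding SM_atlas_eq by blast
  let ?W = "{w \<in> D. y w \<in> y' ` D'}"
  have *: "\<exists>\<tau>. smooth_near \<tau> w \<and> (\<forall>\<^sub>F v in nhds w. v \<in> D \<and> \<tau> v \<in> D' \<and> y v = y' (\<tau> v))" if w: "w \<in> ?W" for w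
  proof -
    obtain w' where w': "w' \<in> D'" "y w = y' w'" using w by blast
    have "w \<in> \<Omega> \<times> {\<alpha><..<\<alpha> + 2 * pi}" using w x by simp
    from SM_transition[OF x(1,4) open_greaterThanLessThan open_greaterThanLessThan this w'(1)[unfolded x] w'(2)[unfolded x]]
    show ?thesis unfolding x by blast
  qed
  have op: "open ?W"
  proof (subst open_subopen, rule ballI)
    fix w assume "w \<in> ?W"
    from *[OF this] obtain \<tau> where "\<forall>\<^sub>F v in nhds w. v \<in> D \<and> \<tau> v \<in> D' \<and> y v = y' (\<tau> v)" by blast
    then have "\<forall>\<^sub>F v in nhds w. v \<in> ?W" by eventually_elim auto
    then show "\<exists>T. open T \<and> w \<in> T \<and> T \<subseteq> ?W" unfolding eventually_nhds by blast
  qed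
  moreover have "smooth_near (transition D' y' y) w" if w: "w \<in> ?W" for w
  proof -
    obtain \<tau> where \<tau>: "smooth_near \<tau> w" "\<forall>\<^sub>F v in nhds w. v \<in> D \<and> \<tau> v \<in> D' \<and> y v = y' (\<tau> v)" using *[OF w] by blast
    have "\<forall>\<^sub>F v in nhds w. \<tau> v = transition D' y' y v"
      using \<tau>(2) by eventually_elim (use SM_param_inj x in \<open>auto simp: transition_def inv_into_f_f\<close>)
    with \<tau>(1) show ?thesis by (rule smooth_near_cong)
  qed
  ultimately show "open ?W \<and> smooth_on ?W (transition D' y' y)" using smooth_on_iff_near[OF op] by blast
qed

end

subsection \<open>Tangent vectors in homogeneous coordinates\<close>

sublocale surface \<subseteq> SM: atlas "SM_atlas A g"
  by unfold_locales (rule SM_smooth_atlas)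

context surface begin

lemma SM_carrier: "carrier_of SM = unit_tangent_bundle A g"
  by (rule carrier_of_SM_atlas[OF smooth_atlas riemannian])

lemma SM_point:
  assumes "z \<in> carrier_of SM" "(\<Omega>, x) \<in> A" "u \<in> \<Omega>" "x u = fst z"
  obtains a where "gcoord A g x u a a = 1" "z = unit_point x (u, a)" "snd z = coord_vec A x u a"
proof -
  have "snd z \<in> tangent_space A (x u)" "g (x u) (snd z) (snd z) = 1"
    using assms by (auto simp: SM_carrier unit_tangent_bundle_def)
  then obtain a where a: "snd z = coord_vec A x u a" "gcoord A g x u a a = 1"
    using tangent_space_eq[OF assms(2,3)] by (auto simp: gcoord_def)
  then have "z = unit_point x (u, a)" using unit_point_unit[of x u a] assms(4) by (simp add: prod_eq_iff)
  then show thesis using that a by blast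
qed

lemma SM_chart_point:
  assumes "z \<in> carrier_of SM"
  obtains \<Omega> x u a where "(\<Omega>, x) \<in> A" "u \<in> \<Omega>" "gcoord A g x u a a = 1" "z = unit_point x (u, a)"
proof -
  have "fst z \<in> carrier_of A" using assms by (auto simp: SM_carrier unit_tangent_bundle_def)
  then obtain \<Omega> x u where x: "(\<Omega>, x) \<in> A" "u \<in> \<Omega>" "fst z = x u" by (rule carrierE)
  then show thesis using SM_point[OF assms x(1,2)] that by metis
qed

lemma unit_nonzero: assumes "(\<Omega>, x) \<in> A" "u \<in> \<Omega>" "gcoord A g x u a a = 1" shows "a \<noteq> 0"
  using assms surface_metric.metric_simps(9)[OF metric_chart[OF assms(1)] assms(2)] by auto

lemma polar_chart:
  assumes x: "(\<Omega>, x) \<in> A" "fst z \<in> \<Omega>" "snd z \<noteq> 0"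
  obtains D \<theta> s \<tau> where "(D, SM_param x) \<in> SM" "(fst z, \<theta>) \<in> D" "s > 0" "snd z = s *\<^sub>R ecirc \<theta>"
    "unit_point x z = SM_param x (fst z, \<theta>)"
    "smooth_near \<tau> z" "\<tau> z = (fst z, \<theta>)" "\<forall>\<^sub>F w in nhds z. unit_point x w = SM_param x (\<tau> w)"
proof -
  obtain s \<theta> where s: "s > 0" "snd z = s *\<^sub>R ecirc \<theta>" using polar_angle_exists[OF x(3)] by blast
  have eq: "unit_point x z = unit_point x (fst z, ecirc \<theta>)"
    using unit_point_scale[OF x(1,2) s(1), of "ecirc \<theta>"] s(2) by (metis prod.collapse)
  obtain \<tau> where "smooth_near \<tau> z" "\<tau> z = (fst z, \<theta>)"
    "\<forall>\<^sub>F w in nhds z. unit_point x w = unit_point x (fst (\<tau> w), ecirc (snd (\<tau> w)))"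
    using polar_lift[OF x(1,1,2,3,2) eq] by blast
  then show thesis
    using that[OF SM_chartI[OF x(1), of "\<theta> - pi"] _ s, of \<tau>] x eq by (simp add: SM_param_def)
qed

text \<open>Homogeneous coordinates test smoothness on \<open>SM\<close>: they factor smoothly through an angle chart, and the
  angle chart is their restriction to Euclidean unit vectors.\<close>

lemma smooth_at_unit_point:
  assumes x: "(\<Omega>, x) \<in> A" "fst z \<in> \<Omega>" "snd z \<noteq> 0"
  shows "smooth_at SM (unit_point x z) f \<longleftrightarrow> smooth_near (\<lambda>w. f (unit_point x w)) z"
proof -
  obtain D \<theta> s \<tau> where *: "(D, SM_param x) \<in> SM" "(fst z, \<theta>) \<in> D" "s > 0" "snd z = s *\<^sub>R ecirc \<theta>"
    "unit_point x z = SM_param x (fst z, \<theta>)"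
    "smooth_near \<tau> z" "\<tau> z = (fst z, \<theta>)" "\<forall>\<^sub>F w in nhds z. unit_point x w = SM_param x (\<tau> w)"
    using polar_chart[OF x] .
  have "smooth_near (\<lambda>w. f (unit_point x w)) z \<longleftrightarrow> smooth_near (\<lambda>w. f (SM_param x w)) (fst z, \<theta>)"
  proof
    assume "smooth_near (\<lambda>w. f (SM_param x w)) (fst z, \<theta>)"
    then have "smooth_near (\<lambda>w. f (SM_param x (\<tau> w))) z"
      using smooth_near_compose[OF *(6), of "\<lambda>w. f (SM_param x w)"] *(7) by simp
    moreover have "\<forall>\<^sub>F w in nhds z. f (SM_param x (\<tau> w)) = f (unit_point x w)"
      using *(8) by eventually_elim simp
    ultimately show "smooth_near (\<lambda>w. f (unit_point x w)) z" by (rule smooth_near_cong)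
  next
    assume sm: "smooth_near (\<lambda>w. f (unit_point x w)) z"
    let ?k = "\<lambda>w. (fst w, s *\<^sub>R ecirc (snd w)) :: (real^2) \<times> (real^2)"
    have "smooth_near ?k (fst z, \<theta>)" by (intro smooth_intros)
    moreover have "?k (fst z, \<theta>) = z" using *(4) by (simp add: prod_eq_iff)
    ultimately have "smooth_near (\<lambda>w. f (unit_point x (?k w))) (fst z, \<theta>)"
      using smooth_near_compose[of ?k "(fst z, \<theta>)" "\<lambda>w. f (unit_point x w)"] sm by simp
    moreover have "\<forall>\<^sub>F w in nhds (fst z, \<theta>). w \<in> \<Omega> \<times> UNIV"
      using chart_open[OF x(1)] x by (intro eventually_nhds_in_open open_Times) auto
    then have "\<forall>\<^sub>F w in nhds (fst z, \<theta>). f (unit_point x (?k w)) = f (SM_param x w)"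
      by eventually_elim (use unit_point_scale[OF x(1) _ *(3)] in \<open>auto simp: SM_param_def\<close>)
    ultimately show "smooth_near (\<lambda>w. f (SM_param x w)) (fst z, \<theta>)" by (rule smooth_near_cong)
  qed
  then show ?thesis using SM.smooth_at_iff[OF *(1,2), of f] *(5) by simp
qed

text \<open>The tangent vector of \<open>SM\<close> represented by a vector in homogeneous coordinates. Radial directions
  represent \<open>0\<close>, so that uniqueness holds only among vectors that are \<open>unit_tangent\<close>.\<close>

definition tvec_at :: "(real^2 \<Rightarrow> 'm) \<Rightarrow> (real^2) \<times> (real^2) \<Rightarrow> (real^2) \<times> (real^2) \<Rightarrow> 'm tpoint tvec"
  where "tvec_at x z c = (\<lambda>f. if smooth_at SM (unit_point x z) f
     then frechet_derivative (\<lambda>w. f (unit_point x w)) (at z) c else 0)"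

lemma velocity_unit_point:
  assumes x: "(\<Omega>, x) \<in> A" "fst (c 0) \<in> \<Omega>" "snd (c 0) \<noteq> 0"
    and c: "(c has_vector_derivative d) (at 0)" "\<forall>\<^sub>F t in nhds 0. \<sigma> t = unit_point x (c t)"
  shows "velocity SM \<sigma> = tvec_at x (c 0) d"
    and "tvec_at x (c 0) d \<in> tangent_space SM (unit_point x (c 0))"
proof -
  obtain D \<theta> s \<tau> where *: "(D, SM_param x) \<in> SM" "(fst (c 0), \<theta>) \<in> D" "s > 0" "snd (c 0) = s *\<^sub>R ecirc \<theta>"
    "unit_point x (c 0) = SM_param x (fst (c 0), \<theta>)"
    "smooth_near \<tau> (c 0)" "\<tau> (c 0) = (fst (c 0), \<theta>)" "\<forall>\<^sub>F w in nhds (c 0). unit_point x w = SM_param x (\<tau> w)"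
    using polar_chart[OF x] .
  have "\<forall>\<^sub>F t in nhds 0. unit_point x (c t) = SM_param x (\<tau> (c t))"
    by (rule eventually_nhds_isCont[OF has_vector_derivative_isCont[OF c(1)] *(8)])
  with c(2) have "\<forall>\<^sub>F t in nhds 0. \<sigma> t = SM_param x (\<tau> (c t))" by eventually_elim simp
  then have v: "velocity SM \<sigma> = coord_vec SM (SM_param x) (\<tau> (c 0)) (frechet_derivative \<tau> (at (c 0)) d)"
    by (intro SM.velocity_coord_vec[OF *(1)] smooth_near_has_vector_derivative c *(6)) (use * in auto)
  also have "\<dots> = tvec_at x (c 0) d"
  proof
    fix f
    show "coord_vec SM (SM_param x) (\<tau> (c 0)) (frechet_derivative \<tau> (at (c 0)) d) f = tvec_at x (c 0) d f"
    proof (cases "smooth_at SM (unit_point x (c 0)) f")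
      case True
      then have sm: "smooth_near (\<lambda>w. f (SM_param x w)) (\<tau> (c 0))" using SM.smooth_at_iff[OF *(1,2)] *(5,7) by simp
      have "((\<lambda>w. f (SM_param x (\<tau> w))) has_derivative
         (\<lambda>d. frechet_derivative (\<lambda>w. f (SM_param x w)) (at (\<tau> (c 0))) (frechet_derivative \<tau> (at (c 0)) d))) (at (c 0))"
        by (rule has_derivative_compose[OF smooth_near_has_derivative[OF *(6)] smooth_near_has_derivative[OF sm]])
      note D = frechet_derivative_eqI[OF this]
      have "\<forall>\<^sub>F w in nhds (c 0). f (unit_point x w) = f (SM_param x (\<tau> w))"
        using *(8) by eventually_elim simp
      from frechet_derivative_cong_eventually[OF this]
      have "frechet_derivative (\<lambda>w. f (unit_point x w)) (at (c 0)) d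
         = frechet_derivative (\<lambda>w. f (SM_param x w)) (at (\<tau> (c 0))) (frechet_derivative \<tau> (at (c 0)) d)"
        by (simp add: D)
      then show ?thesis using True SM.coord_vec_apply[OF *(1), of "\<tau> (c 0)" f] * by (simp add: tvec_at_def)
    next
      case False
      then show ?thesis using SM.coord_vec_not_smooth[of "SM_param x" "\<tau> (c 0)" f] *(5,7) by (simp add: tvec_at_def)
    qed
  qed
  finally show "velocity SM \<sigma> = tvec_at x (c 0) d" .
  show "tvec_at x (c 0) d \<in> tangent_space SM (unit_point x (c 0))"
    unfolding \<open>coord_vec SM (SM_param x) (\<tau> (c 0)) (frechet_derivative \<tau> (at (c 0)) d) = tvec_at x (c 0) d\<close>[symmetric]
    using SM.coord_vec_in_tangent_space[OF *(1,2)] *(5,7) by simp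
qed

lemma tvec_at_in_tangent_space:
  assumes x: "(\<Omega>, x) \<in> A" "fst z \<in> \<Omega>" "snd z \<noteq> 0"
  shows "tvec_at x z c \<in> tangent_space SM (unit_point x z)"
  using velocity_unit_point(2)[OF x(1), of "\<lambda>t. z + t *\<^sub>R c" c "\<lambda>t. unit_point x (z + t *\<^sub>R c)"] x line_has_vector_derivative[of z c 0]
  by simp

lemma tvec_at_apply:
  assumes x: "(\<Omega>, x) \<in> A" "fst z \<in> \<Omega>" "snd z \<noteq> 0" and f: "smooth_at SM (unit_point x z) f"
  shows "tvec_at x z c f = frechet_derivative (\<lambda>w. f (unit_point x w)) (at z) c"
  using f by (simp add: tvec_at_def)

lemma tvec_at_linear:
  assumes x: "(\<Omega>, x) \<in> A" "fst z \<in> \<Omega>" "snd z \<noteq> 0"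
  shows "tvec_at x z (r *\<^sub>R c + s *\<^sub>R d) = tadd (tscale r (tvec_at x z c)) (tscale s (tvec_at x z d))"
proof
  fix f show "tvec_at x z (r *\<^sub>R c + s *\<^sub>R d) f = tadd (tscale r (tvec_at x z c)) (tscale s (tvec_at x z d)) f"
    using smooth_near_linear[of "\<lambda>w. f (unit_point x w)" z] smooth_at_unit_point[OF x, of f]
    by (cases "smooth_at SM (unit_point x z) f")
       (simp_all add: tvec_at_def tadd_def tscale_def linear_add linear_scale)
qed

abbreviation "unit_tangent x \<equiv> surface_metric.unit_tangent (gcoord A g x)"

lemma unitize_derivative:
  assumes x: "(\<Omega>, x) \<in> A" "u \<in> \<Omega>" "gcoord A g x u a a = 1" and c: "unit_tangent x (u, a) c"
  shows "frechet_derivative (unitize x) (at (u, a)) c = c"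
proof -
  interpret G: surface_metric \<Omega> "gcoord A g x" by (rule metric_chart[OF x(1)])
  have f: "(fst has_derivative fst) (at (u, a))" and s: "(snd has_derivative snd) (at (u, a))"
    by (auto intro: has_derivative_fst has_derivative_snd)
  let ?q = "\<lambda>z. gcoord A g x (fst z) (snd z) (snd z)"
  let ?q' = "\<lambda>c. G.dmetric u (fst c) a a + gcoord A g x u (snd c) a + gcoord A g x u a (snd c)"
  have q: "(?q has_derivative ?q') (at (u, a))" using G.metric_has_derivative[OF _ f s s] x(2) by simp
  have "((\<lambda>r. 1 / sqrt r) has_real_derivative (- 1 / 2)) (at 1)"
    by (auto intro!: derivative_eq_intros)
  then have "((\<lambda>r. 1 / sqrt r) has_derivative (*) (- 1 / 2)) (at (?q (u, a)))"
    using x(3) by (simp add: has_field_derivative_def)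
  from has_derivative_compose[OF q this]
  have i: "((\<lambda>z. 1 / sqrt (?q z)) has_derivative (\<lambda>c. - 1 / 2 * ?q' c)) (at (u, a))" .
  have "(unitize x has_derivative (\<lambda>c. (fst c, (1 / sqrt (?q (u, a))) *\<^sub>R snd c + (- 1 / 2 * ?q' c) *\<^sub>R snd (u, a)))) (at (u, a))"
    unfolding unitize_def[abs_def]
    by (intro has_derivative_Pair has_derivative_scaleR i f s)
  from frechet_derivative_eqI[OF this]
  have "frechet_derivative (unitize x) (at (u, a)) c = (fst c, snd c + (- 1 / 2 * ?q' c) *\<^sub>R a)"
    using x(3) by simp
  moreover have "?q' c = 0"
    using c G.metric_sym[OF x(2), of "snd c" a] by (simp add: G.unit_tangent_def)
  ultimately show ?thesis by simp
qed

lemma unitize_derivative_tangent: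
  assumes x: "(\<Omega>, x) \<in> A" "fst z \<in> \<Omega>" "snd z \<noteq> 0"
  shows "unit_tangent x (unitize x z) (frechet_derivative (unitize x) (at z) d)"
proof -
  interpret G: surface_metric \<Omega> "gcoord A g x" by (rule metric_chart[OF x(1)])
  let ?n = "unitize x" and ?n' = "frechet_derivative (unitize x) (at z)"
  have n: "(?n has_derivative ?n') (at z)" by (intro smooth_near_has_derivative unitize_smooth[OF x])
  note fn = has_derivative_fst[OF n] and sn = has_derivative_snd[OF n]
  have "((\<lambda>z. gcoord A g x (fst (?n z)) (snd (?n z)) (snd (?n z))) has_derivative
    (\<lambda>c. G.dmetric (fst (?n z)) (fst (?n' c)) (snd (?n z)) (snd (?n z)) + gcoord A g x (fst (?n z)) (snd (?n' c)) (snd (?n z))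
       + gcoord A g x (fst (?n z)) (snd (?n z)) (snd (?n' c)))) (at z)"
    by (rule G.metric_has_derivative[OF _ fn sn sn]) (simp add: gcoord_unitize[OF x] x)
  moreover have "\<forall>\<^sub>F w in nhds z. w \<in> \<Omega> \<times> (- {0})"
    using chart_open[OF x(1)] x by (intro eventually_nhds_in_open open_Times) (auto simp: mem_Times_iff)
  then have "\<forall>\<^sub>F w in nhds z. gcoord A g x (fst (?n w)) (snd (?n w)) (snd (?n w)) = 1"
    by eventually_elim (auto intro: gcoord_unitize[OF x(1)])
  ultimately have "G.dmetric (fst (?n z)) (fst (?n' d)) (snd (?n z)) (snd (?n z)) + gcoord A g x (fst (?n z)) (snd (?n' d)) (snd (?n z))
       + gcoord A g x (fst (?n z)) (snd (?n z)) (snd (?n' d)) = 0"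
    using has_derivative_eventually_unique[OF _ has_derivative_const] by fast
  then show ?thesis
    using G.metric_sym[of "fst (?n z)" "snd (?n' d)"] x gcoord_unitize(2)[OF x] by (simp add: G.unit_tangent_def)
qed

lemma unit_point_unitize_near:
  assumes x: "(\<Omega>, x) \<in> A" "fst z \<in> \<Omega>" "snd z \<noteq> 0"
  shows "\<forall>\<^sub>F w in nhds z. fst w \<in> \<Omega> \<and> snd w \<noteq> 0 \<and> unit_point x (unitize x w) = unit_point x w"
proof -
  have "\<forall>\<^sub>F w in nhds z. w \<in> \<Omega> \<times> (- {0})"
    using chart_open[OF x(1)] x by (intro eventually_nhds_in_open open_Times) (auto simp: mem_Times_iff)
  then show ?thesis by eventually_elim (auto intro: unit_point_unitize[OF x(1)])
qed

lemma tvec_at_unitize: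
  assumes x: "(\<Omega>, x) \<in> A" "fst z \<in> \<Omega>" "snd z \<noteq> 0"
  shows "tvec_at x z d = tvec_at x (unitize x z) (frechet_derivative (unitize x) (at z) d)"
proof
  fix f
  have e: "unit_point x (unitize x z) = unit_point x z" by (rule unit_point_unitize[OF x])
  show "tvec_at x z d f = tvec_at x (unitize x z) (frechet_derivative (unitize x) (at z) d) f"
  proof (cases "smooth_at SM (unit_point x z) f")
    case True
    have sm: "smooth_near (\<lambda>w. f (unit_point x w)) (unitize x z)"
      using True smooth_at_unit_point[OF x(1), of "unitize x z" f] gcoord_unitize[OF x] x e by simp
    have "((\<lambda>w. f (unit_point x (unitize x w))) has_derivative
         (\<lambda>d. frechet_derivative (\<lambda>w. f (unit_point x w)) (at (unitize x z)) (frechet_derivative (unitize x) (at z) d))) (at z)"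
      by (rule has_derivative_compose[OF smooth_near_has_derivative[OF unitize_smooth[OF x]] smooth_near_has_derivative[OF sm]])
    note D = frechet_derivative_eqI[OF this]
    have "\<forall>\<^sub>F w in nhds z. f (unit_point x w) = f (unit_point x (unitize x w))"
      using unit_point_unitize_near[OF x] by eventually_elim simp
    from frechet_derivative_cong_eventually[OF this]
    have "frechet_derivative (\<lambda>w. f (unit_point x w)) (at z) d
      = frechet_derivative (\<lambda>w. f (unit_point x w)) (at (unitize x z)) (frechet_derivative (unitize x) (at z) d)"
      by (simp add: D)
    then show ?thesis using True e by (simp add: tvec_at_def)
  qed (simp add: tvec_at_def e)
qed

lemma tangent_space_SM:
  assumes x: "(\<Omega>, x) \<in> A" "u \<in> \<Omega>" "gcoord A g x u a a = 1" and v: "v \<in> tangent_space SM (unit_point x (u, a))"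
  obtains c where "unit_tangent x (u, a) c" "v = tvec_at x (u, a) c"
proof -
  have a: "a \<noteq> 0" by (rule unit_nonzero[OF x])
  obtain D \<theta> s \<tau> where *: "(D, SM_param x) \<in> SM" "(u, \<theta>) \<in> D" "s > 0" "a = s *\<^sub>R ecirc \<theta>"
    "unit_point x (u, a) = SM_param x (u, \<theta>)"
  proof -
    have "fst (u, a) \<in> \<Omega>" "snd (u, a) \<noteq> 0" using x a by auto
    from polar_chart[OF x(1) this, unfolded fst_conv snd_conv] that show thesis by blast
  qed
  obtain b where v: "v = coord_vec SM (SM_param x) (u, \<theta>) b"
    using v SM.tangent_space_eq[OF *(1,2)] *(5) by auto
  let ?e = "\<lambda>w. (fst w, ecirc (snd w)) :: (real^2) \<times> (real^2)"
  let ?c = "\<lambda>t. ?e ((u, \<theta>) + t *\<^sub>R b)"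
  let ?d = "frechet_derivative ?e (at (u, \<theta>)) b"
  have c: "(?c has_vector_derivative ?d) (at 0)"
    using smooth_near_has_vector_derivative[OF line_has_vector_derivative, of ?e "(u, \<theta>)" 0 b] ecirc_smooth by simp
  have "v = velocity SM (\<lambda>t. SM_param x ((u, \<theta>) + t *\<^sub>R b))" using v by (simp add: coord_vec_def)
  also have "\<dots> = tvec_at x (?c 0) ?d"
    by (rule velocity_unit_point(1)[OF x(1) _ _ c]) (use x ecirc_nonzero in \<open>auto simp: SM_param_def\<close>)
  also have "\<dots> = tvec_at x (unitize x (?c 0)) (frechet_derivative (unitize x) (at (?c 0)) ?d)"
    by (rule tvec_at_unitize[OF x(1)]) (use x ecirc_nonzero in auto)
  finally have v': "v = tvec_at x (unitize x (?c 0)) (frechet_derivative (unitize x) (at (?c 0)) ?d)" .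
  have "unitize x (?c 0) = (u, a)"
    using unitize_scale[OF x(1,2) *(3), of "ecirc \<theta>"] *(4) unitize_unit[OF x(3)] by simp
  moreover have "unit_tangent x (unitize x (?c 0)) (frechet_derivative (unitize x) (at (?c 0)) ?d)"
    by (rule unitize_derivative_tangent[OF x(1)]) (use x ecirc_nonzero in auto)
  ultimately show thesis using v' by (intro that) simp_all
qed

text \<open>Homogeneous coordinates as functions on \<open>SM\<close>. The choice is among representatives that differ by a
  positive factor, and \<open>unitize\<close> removes the ambiguity.\<close>

definition point_coords :: "(real^2) set \<Rightarrow> (real^2 \<Rightarrow> 'm) \<Rightarrow> 'm tpoint \<Rightarrow> (real^2) \<times> (real^2)"
  where "point_coords \<Omega> x q = unitize x (SOME z. fst z \<in> \<Omega> \<and> snd z \<noteq> 0 \<and> unit_point x z = q)"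

lemma point_coords_unit_point:
  assumes x: "(\<Omega>, x) \<in> A" "fst z \<in> \<Omega>" "snd z \<noteq> 0"
  shows "point_coords \<Omega> x (unit_point x z) = unitize x z"
proof -
  let ?z = "SOME w. fst w \<in> \<Omega> \<and> snd w \<noteq> 0 \<and> unit_point x w = unit_point x z"
  have "fst ?z \<in> \<Omega> \<and> snd ?z \<noteq> 0 \<and> unit_point x ?z = unit_point x z"
    by (rule someI[of _ z]) (use x in auto)
  then show ?thesis unfolding point_coords_def using unit_point_inj[OF x(1), of ?z z] x by blast
qed

lemma point_coords_smooth:
  assumes x: "(\<Omega>, x) \<in> A" "u \<in> \<Omega>" "gcoord A g x u a a = 1"
  shows "smooth_at SM (unit_point x (u, a)) (\<lambda>q. F (point_coords \<Omega> x q)) \<longleftrightarrow> smooth_near (\<lambda>z. F (unitize x z)) (u, a)"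
    and "smooth_near F (u, a) \<Longrightarrow> smooth_at SM (unit_point x (u, a)) (\<lambda>q. F (point_coords \<Omega> x q))"
    and "smooth_near F (u, a) \<Longrightarrow> unit_tangent x (u, a) c \<Longrightarrow>
      tvec_at x (u, a) c (\<lambda>q. F (point_coords \<Omega> x q)) = frechet_derivative F (at (u, a)) c"
proof -
  have a: "a \<noteq> 0" by (rule unit_nonzero[OF x])
  have z: "fst (u, a) \<in> \<Omega>" "snd (u, a) \<noteq> 0" using x a by auto
  have "\<forall>\<^sub>F w in nhds (u, a). F (point_coords \<Omega> x (unit_point x w)) = F (unitize x w)"
    using unit_point_unitize_near[OF x(1) z] by eventually_elim (simp add: point_coords_unit_point[OF x(1)])
  note ev = this
  have ev': "\<forall>\<^sub>F w in nhds (u, a). F (unitize x w) = F (point_coords \<Omega> x (unit_point x w))"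
    using ev by eventually_elim simp
  show 1: "smooth_at SM (unit_point x (u, a)) (\<lambda>q. F (point_coords \<Omega> x q)) \<longleftrightarrow> smooth_near (\<lambda>z. F (unitize x z)) (u, a)"
    unfolding smooth_at_unit_point[OF x(1) z] using smooth_near_cong[OF _ ev] smooth_near_cong[OF _ ev'] by blast
  have sm: "smooth_near (unitize x) (u, a)" by (rule unitize_smooth[OF x(1) z])
  have n: "unitize x (u, a) = (u, a)" by (rule unitize_unit[OF x(3)])
  show 2: "smooth_at SM (unit_point x (u, a)) (\<lambda>q. F (point_coords \<Omega> x q))" if "smooth_near F (u, a)"
    unfolding 1 using smooth_near_compose[OF sm, of F] that n by simp
  assume F: "smooth_near F (u, a)" and c: "unit_tangent x (u, a) c"
  have "((\<lambda>w. F (unitize x w)) has_derivative (\<lambda>d. frechet_derivative F (at (u, a)) (frechet_derivative (unitize x) (at (u, a)) d))) (at (u, a))"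
    using has_derivative_compose[OF smooth_near_has_derivative[OF sm], of F] smooth_near_has_derivative[OF F] n by simp
  from frechet_derivative_eqI[OF this]
  show "tvec_at x (u, a) c (\<lambda>q. F (point_coords \<Omega> x q)) = frechet_derivative F (at (u, a)) c"
    unfolding tvec_at_apply[OF x(1) z 2[OF F]] frechet_derivative_cong_eventually[OF ev]
    by (simp add: unitize_derivative[OF x c])
qed

lemma tvec_at_component:
  assumes x: "(\<Omega>, x) \<in> A" "u \<in> \<Omega>" "gcoord A g x u a a = 1" and c: "unit_tangent x (u, a) c"
  shows "tvec_at x (u, a) c (\<lambda>q. point_coords \<Omega> x q \<bullet> b) = c \<bullet> b"
proof -
  have "((\<lambda>z. z \<bullet> b) has_derivative (\<lambda>c. c \<bullet> b)) (at (u, a))" by (auto intro!: derivative_eq_intros)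
  from frechet_derivative_eqI[OF this] show ?thesis
    using point_coords_smooth(3)[OF x, of "\<lambda>z. z \<bullet> b" c] c by (simp add: smooth_intros)
qed

subsection \<open>Vector fields and their brackets\<close>

text \<open>The field \<open>Y'\<close> is smooth on an open set of homogeneous coordinates, not only along the unit circle
  bundle, to which it is tangent. Thus it can be differentiated in all directions.\<close>

definition represents :: "'m tpoint vfield \<Rightarrow> (real^2) set \<Rightarrow> (real^2 \<Rightarrow> 'm) \<Rightarrow> ((real^2) \<times> (real^2) \<Rightarrow> (real^2) \<times> (real^2)) \<Rightarrow> bool"
  where "represents Y \<Omega> x Y' \<longleftrightarrow> (\<forall>u\<in>\<Omega>. \<forall>a. gcoord A g x u a a = 1 \<longrightarrow>
     Y (unit_point x (u, a)) = tvec_at x (u, a) (Y' (u, a)) \<and> unit_tangent x (u, a) (Y' (u, a)) \<and> smooth_near Y' (u, a))"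

lemma represents_apply:
  assumes x: "(\<Omega>, x) \<in> A" "u \<in> \<Omega>" "gcoord A g x u a a = 1"
    and Y: "represents Y \<Omega> x Y'" and f: "smooth_at SM (unit_point x (u, a)) f"
  defines "F \<equiv> \<lambda>z. frechet_derivative (\<lambda>w. f (unit_point x w)) (at z) (Y' z)"
  shows "smooth_near F (u, a)"
    and "smooth_at SM (unit_point x (u, a)) (\<lambda>q. Y q f)"
    and "unit_tangent x (u, a) c \<Longrightarrow> tvec_at x (u, a) c (\<lambda>q. Y q f) = frechet_derivative F (at (u, a)) c"
proof -
  have a: "a \<noteq> 0" by (rule unit_nonzero[OF x])
  have z: "fst (u, a) \<in> \<Omega>" "snd (u, a) \<noteq> 0" using x a by auto
  have sf: "smooth_near (\<lambda>w. f (unit_point x w)) (u, a)" using f smooth_at_unit_point[OF x(1) z] by blast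
  show F: "smooth_near F (u, a)" unfolding F_def
    by (intro smooth_near_frechet_derivative smooth_near_ident sf) (use Y x in \<open>auto simp: represents_def\<close>)
  have n: "unitize x (u, a) = (u, a)" by (rule unitize_unit[OF x(3)])
  have "\<forall>\<^sub>F w in nhds (u, a). smooth_near (\<lambda>w. f (unit_point x w)) (unitize x w)"
    using eventually_nhds_isCont[OF smooth_near_isCont[OF unitize_smooth[OF x(1) z]], of "smooth_near (\<lambda>w. f (unit_point x w))"]
      smooth_near_eventually[OF sf] n by simp
  then have ev: "\<forall>\<^sub>F w in nhds (u, a). Y (unit_point x w) f = F (point_coords \<Omega> x (unit_point x w))"
    using unit_point_unitize_near[OF x(1) z]
  proof eventually_elim
    case (elim w)
    have w: "fst w \<in> \<Omega>" "snd w \<noteq> 0" using elim by auto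
    let ?n = "unitize x w"
    note nw = gcoord_unitize[OF x(1) w]
    have n: "fst ?n \<in> \<Omega>" "snd ?n \<noteq> 0" using nw w by auto
    have "Y (unit_point x w) = Y (unit_point x (fst ?n, snd ?n))" using elim by simp
    also have "\<dots> = tvec_at x ?n (Y' ?n)" using Y n(1) nw(1) unfolding represents_def by (metis prod.collapse)
    finally have "Y (unit_point x w) f = tvec_at x ?n (Y' ?n) f" by simp
    also have "\<dots> = F ?n" using tvec_at_apply[OF x(1) n] smooth_at_unit_point[OF x(1) n] elim by (simp add: F_def)
    finally show ?case using point_coords_unit_point[OF x(1) w] by simp
  qed
  have ev': "\<forall>\<^sub>F w in nhds (u, a). F (point_coords \<Omega> x (unit_point x w)) = Y (unit_point x w) f"
    using ev by eventually_elim simp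
  show 2: "smooth_at SM (unit_point x (u, a)) (\<lambda>q. Y q f)"
    using point_coords_smooth(2)[OF x F] smooth_near_cong[OF _ ev'] unfolding smooth_at_unit_point[OF x(1) z] by blast
  assume c: "unit_tangent x (u, a) c"
  show "tvec_at x (u, a) c (\<lambda>q. Y q f) = frechet_derivative F (at (u, a)) c"
    unfolding tvec_at_apply[OF x(1) z 2] frechet_derivative_cong_eventually[OF ev]
    using point_coords_smooth(3)[OF x F c] unfolding tvec_at_apply[OF x(1) z point_coords_smooth(2)[OF x F]] .
qed

text \<open>Second derivatives of \<open>f\<close> cancel by symmetry, and what is left is the bracket of the representing
  fields, whichever extensions off the unit circle bundle they are.\<close>

lemma represents_commutator:
  assumes x: "(\<Omega>, x) \<in> A" "u \<in> \<Omega>" "gcoord A g x u a a = 1"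
    and Y: "represents Y \<Omega> x Y'" and Z: "represents Z \<Omega> x Z'" and f: "smooth_at SM (unit_point x (u, a)) f"
  shows "Y (unit_point x (u, a)) (\<lambda>q. Z q f) - Z (unit_point x (u, a)) (\<lambda>q. Y q f)
    = tvec_at x (u, a) (surface_metric.bracket Y' Z' (u, a)) f"
proof -
  have a: "a \<noteq> 0" by (rule unit_nonzero[OF x])
  have z: "fst (u, a) \<in> \<Omega>" "snd (u, a) \<noteq> 0" using x a by auto
  interpret G: surface_metric \<Omega> "gcoord A g x" by (rule metric_chart[OF x(1)])
  let ?f = "\<lambda>w. f (unit_point x w)" let ?z = "(u, a)"
  have sf: "smooth_near ?f ?z" using f smooth_at_unit_point[OF x(1) z] by blast
  obtain S where S: "open S" "?z \<in> S" "smooth_on S ?f" using sf by (auto simp: smooth_near_def)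
  have D: "frechet_derivative (\<lambda>z. frechet_derivative ?f (at z) (Y' z)) (at ?z) c
      = frechet_derivative (\<lambda>z. frechet_derivative ?f (at z) (Y' ?z)) (at ?z) c + frechet_derivative ?f (at ?z) (frechet_derivative Y' (at ?z) c)"
    if "represents Y \<Omega> x Y'" for Y Y' c
  proof -
    have "((\<lambda>z. frechet_derivative ?f (at z) (Y' z)) has_derivative
      (\<lambda>c. frechet_derivative (\<lambda>z. frechet_derivative ?f (at z) (Y' ?z)) (at ?z) c + frechet_derivative ?f (at ?z) (frechet_derivative Y' (at ?z) c))) (at ?z)"
    proof (rule linear_family_has_derivative[where S = S and k = "\<lambda>z. z" and L = "\<lambda>z. frechet_derivative ?f (at z)"])
      show "linear (frechet_derivative ?f (at p))" if "p \<in> S" for p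
        using S that by (intro smooth_near_linear) (auto simp: smooth_near_def)
      show "smooth_near (\<lambda>p. frechet_derivative ?f (at p) c) p" if "p \<in> S" for p c
        using S that by (intro smooth_near_frechet_derivative_const) (auto simp: smooth_near_def)
      show "(Y' has_derivative frechet_derivative Y' (at ?z)) (at ?z)"
        using that x by (intro smooth_near_has_derivative) (auto simp: represents_def)
    qed (use S in auto)
    from frechet_derivative_eqI[OF this] show ?thesis by simp
  qed
  have Yz: "Y (unit_point x ?z) = tvec_at x ?z (Y' ?z)" "unit_tangent x ?z (Y' ?z)"
    and Zz: "Z (unit_point x ?z) = tvec_at x ?z (Z' ?z)" "unit_tangent x ?z (Z' ?z)"
    using Y Z x by (auto simp: represents_def)
  show ?thesis
    unfolding Yz(1) Zz(1) represents_apply(3)[OF x Y f Zz(2)] represents_apply(3)[OF x Z f Yz(2)] D[OF Y] D[OF Z]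
      tvec_at_apply[OF x(1) z f] G.bracket_def linear_diff[OF smooth_near_linear[OF sf]]
    using second_derivative_symmetric_real[OF sf, of "Y' ?z" "Z' ?z"] by simp
qed

end

subsection \<open>The geodesic, vertical and horizontal fields\<close>

context surface begin

lemma christoffel_eq_chr: "(\<Omega>, x) \<in> A \<Longrightarrow> christoffel A g x u a b = surface_metric.chr (gcoord A g x) u a b"
  using surface_metric.chr_def[OF metric_chart] by (simp add: christoffel_def)

lemma tvec_at_change:
  assumes x: "(\<Omega>, x) \<in> A" "(\<Omega>', x') \<in> A" "u \<in> \<Omega>" "x u \<in> x' ` \<Omega>'" and a: "a \<noteq> 0"
  defines "h \<equiv> transition \<Omega>' x' x"
  shows "tvec_at x (u, a) (b, d) = tvec_at x' (h u, frechet_derivative h (at u) a)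
     (frechet_derivative h (at u) b, frechet_derivative (\<lambda>v. frechet_derivative h (at v) a) (at u) b + frechet_derivative h (at u) d)"
proof -
  let ?k = "lift_transition \<Omega>' x' x"
  let ?H = "frechet_derivative h (at u)"
  let ?d = "(?H b, frechet_derivative (\<lambda>v. frechet_derivative h (at v) a) (at u) b + ?H d)"
  let ?c = "\<lambda>t. ?k ((u, a) + t *\<^sub>R (b, d))"
  have hs: "smooth_near h u" unfolding h_def by (rule transition_smooth[OF x])
  have k: "?k (u, a) = (h u, ?H a)" by (simp add: lift_transition_def h_def)
  have ks: "smooth_near ?k (u, a)" using lift_transition_smooth[OF x(1,2), of "(u, a)"] x by simp
  obtain S where S: "open S" "u \<in> S" "smooth_on S h" using hs by (auto simp: smooth_near_def)
  have f: "(fst has_derivative fst) (at (u, a))" and s: "(snd has_derivative snd) (at (u, a))"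
    by (auto intro: has_derivative_fst has_derivative_snd)
  have "((\<lambda>z. frechet_derivative h (at (fst z)) (snd z)) has_derivative
     (\<lambda>c. frechet_derivative (\<lambda>v. frechet_derivative h (at v) (snd (u, a))) (at (fst (u, a))) (fst c) + frechet_derivative h (at (fst (u, a))) (snd c))) (at (u, a))"
  proof (rule linear_family_has_derivative[where S = S and L = "\<lambda>v. frechet_derivative h (at v)"])
    show "linear (frechet_derivative h (at p))" if "p \<in> S" for p
      using S that by (intro smooth_near_linear) (auto simp: smooth_near_def)
    show "smooth_near (\<lambda>p. frechet_derivative h (at p) c) p" if "p \<in> S" for p c
      using S that by (intro smooth_near_frechet_derivative_const) (auto simp: smooth_near_def)
  qed (use S f s in auto)
  moreover have "((\<lambda>z. h (fst z)) has_derivative (\<lambda>c. ?H (fst c))) (at (u, a))"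
    using has_derivative_compose[OF f, of h ?H] smooth_near_has_derivative[OF hs] by simp
  ultimately have "(?k has_derivative (\<lambda>c. (?H (fst c), frechet_derivative (\<lambda>v. frechet_derivative h (at v) a) (at u) (fst c) + ?H (snd c)))) (at (u, a))"
    unfolding lift_transition_def[abs_def] h_def[symmetric] by (intro has_derivative_Pair) simp_all
  from frechet_derivative_eqI[OF this]
  have c: "(?c has_vector_derivative ?d) (at 0)"
    using smooth_near_has_vector_derivative[OF line_has_vector_derivative, of ?k "(u, a)" 0 "(b, d)"] ks by simp
  have "isCont (\<lambda>t. fst ((u, a) + t *\<^sub>R (b, d))) 0" by (intro continuous_intros)
  from eventually_nhds_isCont[OF this, of "\<lambda>v. v \<in> \<Omega> \<and> x v \<in> x' ` \<Omega>' \<and> transition \<Omega>' x' x v \<in> \<Omega>' \<and> x' (transition \<Omega>' x' x v) = x v"]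
  have "\<forall>\<^sub>F t in nhds 0. fst ((u, a) + t *\<^sub>R (b, d)) \<in> \<Omega> \<and> x (fst ((u, a) + t *\<^sub>R (b, d))) \<in> x' ` \<Omega>'"
    using transition_near[OF x] by (auto elim: eventually_mono)
  then have "\<forall>\<^sub>F t in nhds 0. unit_point x ((u, a) + t *\<^sub>R (b, d)) = unit_point x' (?c t)"
    by eventually_elim (use unit_point_lift_transition[OF x(1,2)] in metis)
  note v = velocity_unit_point(1)[OF x(2) _ _ c this]
  have "inj ?H" unfolding h_def using transition_derivative_bij[OF x] by (simp add: bij_def)
  then have "?H a \<noteq> 0" using a linear_0[OF smooth_near_linear[OF hs]] by (metis injD)
  then have "velocity SM (\<lambda>t. unit_point x ((u, a) + t *\<^sub>R (b, d))) = tvec_at x' (?c 0) ?d"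
    using v k transition_at(1)[OF x] by (simp add: h_def)
  moreover have "velocity SM (\<lambda>t. unit_point x ((u, a) + t *\<^sub>R (b, d))) = tvec_at x (u, a) (b, d)"
    using velocity_unit_point(1)[OF x(1), of "\<lambda>t. (u, a) + t *\<^sub>R (b, d)" "(b, d)"] x a line_has_vector_derivative[of "(u, a)" "(b, d)" 0]
    by simp
  ultimately show ?thesis using k by simp
qed

lemma coords_at_chart:
  assumes "p \<in> carrier_of A"
  obtains \<Omega> x u where "coords_at A p = (x, u)" "(\<Omega>, x) \<in> A" "u \<in> \<Omega>" "x u = p"
proof -
  have "\<exists>xu. case xu of (x, u) \<Rightarrow> \<exists>\<Omega>. (\<Omega>, x) \<in> A \<and> u \<in> \<Omega> \<and> x u = p"
    using assms by (auto simp: carrier_of_def)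
  from someI_ex[OF this]
  have "case coords_at A p of (x, u) \<Rightarrow> \<exists>\<Omega>. (\<Omega>, x) \<in> A \<and> u \<in> \<Omega> \<and> x u = p"
    unfolding coords_at_def .
  then show thesis using that by (cases "coords_at A p") auto
qed

lemma unit_tangent_unit: assumes "(\<Omega>, x) \<in> A" "u \<in> \<Omega>"
  shows "unit_tangent x (u, a) (surface_metric.geo (gcoord A g x) (u, a))"
    "unit_tangent x (u, a) (surface_metric.ver (gcoord A g x) (u, a))"
    "unit_tangent x (u, a) (surface_metric.hor (gcoord A g x) (u, a))"
  using surface_metric.frame_tangent[OF metric_chart[OF assms(1)] assms(2)] by auto

text \<open>The geodesic field is defined in one chosen chart. By \<open>chr_transform\<close> the spray has the same form
  in any other chart.\<close>

lemma geodesic_represents: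
  assumes x: "(\<Omega>, x) \<in> A"
  shows "represents (geodesic_vfield A g) \<Omega> x (surface_metric.geo (gcoord A g x))"
  unfolding represents_def
proof (intro ballI allI impI conjI)
  fix u a assume u: "u \<in> \<Omega>" and a: "gcoord A g x u a a = 1"
  interpret G: surface_metric \<Omega> "gcoord A g x" by (rule metric_chart[OF x])
  show "unit_tangent x (u, a) (G.geo (u, a))" by (rule unit_tangent_unit[OF x u])
  show "smooth_near G.geo (u, a)" by (rule G.frame_smooth) (simp add: u)
  obtain \<Omega>1 x1 u1 where c: "coords_at A (x u) = (x1, u1)" and x1: "(\<Omega>1, x1) \<in> A" "u1 \<in> \<Omega>1" "x1 u1 = x u"
    using coords_at_chart[OF chart_carrier[OF x u]] .
  interpret G1: surface_metric \<Omega>1 "gcoord A g x1" by (rule metric_chart[OF x1(1)])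
  let ?h = "transition \<Omega>1 x1 x" let ?H = "frechet_derivative ?h (at u)"
  have im: "x u \<in> x1 ` \<Omega>1" using x1 by (metis image_eqI)
  note X = x x1(1) u im
  have hu: "?h u = u1" by (rule transition_eqI[OF x1(1,2)]) (rule x1(3))
  have a0: "a \<noteq> 0" by (rule unit_nonzero[OF x u a])
  have bij: "bij ?H" by (rule transition_derivative_bij[OF X])
  have Ha0: "?H a \<noteq> 0"
    using a0 bij linear_0[OF smooth_near_linear[OF transition_smooth[OF X]]] by (metis bij_def injD)
  have ca: "coord_vec A x u a = coord_vec A x1 u1 (?H a)" using coord_vec_change[OF X, of a] hu by simp
  have the: "(THE b. coord_vec A x1 u1 b = coord_vec A x u a) = ?H a"
    unfolding ca by (rule the_equality) (auto dest: coord_vec_inj[OF x1(1,2)])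
  let ?b = "?H a" let ?G = "christoffel A g x1 u1 ?b ?b"
  let ?c = "\<lambda>t. (u1 + t *\<^sub>R ?b, ?b - t *\<^sub>R ?G)"
  have c': "(?c has_vector_derivative (?b, - ?G)) (at 0)"
    by (auto intro!: derivative_eq_intros has_vector_derivative_Pair)
  have "geodesic_vfield A g (unit_point x (u, a)) = velocity SM (\<lambda>t. (x1 (u1 + t *\<^sub>R ?b), unit_vec A g x1 (u1 + t *\<^sub>R ?b) (?b - t *\<^sub>R ?G)))"
    unfolding geodesic_vfield_def unit_point_unit[OF a] by (simp add: c the Let_def)
  also have "\<dots> = velocity SM (\<lambda>t. unit_point x1 (?c t))" by (simp add: unit_point_def)
  also have "\<dots> = tvec_at x1 (?c 0) (?b, - ?G)"
    by (rule velocity_unit_point(1)[OF x1(1) _ _ c']) (use x1 Ha0 in auto)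
  also have "\<dots> = tvec_at x (u, a) (G.geo (u, a))"
  proof -
    have "\<forall>\<^sub>F v in nhds u. \<forall>a b. gcoord A g x v a b = gcoord A g x1 (?h v) (frechet_derivative ?h (at v) a) (frechet_derivative ?h (at v) b)"
      using transition_near[OF X] by eventually_elim (use gcoord_transition[OF x x1(1)] in blast)
    then have "?H (G.chr u a a) = G1.chr (?h u) ?b ?b + frechet_derivative (\<lambda>v. frechet_derivative ?h (at v) a) (at u) a"
      by (intro chr_transform[OF metric_chart[OF x] metric_chart[OF x1(1)] u _ transition_smooth[OF X]])
        (use x1 hu bij in \<open>auto simp: bij_def\<close>)
    then have "- ?G = frechet_derivative (\<lambda>v. frechet_derivative ?h (at v) a) (at u) a + ?H (- G.chr u a a)"
      by (simp add: christoffel_eq_chr[OF x1(1)] hu linear_neg[OF smooth_near_linear[OF transition_smooth[OF X]]])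
    then show ?thesis using tvec_at_change[OF X a0, of a "- G.chr u a a"] hu by (simp add: G.geo_def)
  qed
  finally show "geodesic_vfield A g (unit_point x (u, a)) = tvec_at x (u, a) (G.geo (u, a))" .
qed

lemma orientation_transition:
  assumes "(\<Omega>, x) \<in> A" "(\<Omega>', x') \<in> A" "u \<in> \<Omega>" "x u \<in> x' ` \<Omega>'"
  shows "\<exists>d>0. \<forall>a b. wedge (frechet_derivative (transition \<Omega>' x' x) (at u) a) (frechet_derivative (transition \<Omega>' x' x) (at u) b) = d * wedge a b"
proof -
  let ?H = "frechet_derivative (transition \<Omega>' x' x) (at u)"
  let ?M = "matrix ?H"
  have "oriented_atlas A" using surface by (simp add: closed_oriented_riemannian_surface_def)
  then have d: "det ?M > 0" using assms unfolding oriented_atlas_def by blast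
  have "?H a = ?M *v a" for a
    using fun_cong[OF matrix_vector_mul(2)[OF smooth_near_linear[OF transition_smooth[OF assms]]], of a] by simp
  then have "wedge (?H a) (?H b) = det ?M * wedge a b" for a b
    by (simp add: wedge_def matrix_vector_mult_def sum_2 det_2 algebra_simps)
  then show ?thesis using d by blast
qed

text \<open>A vector orthogonal to the unit vector \<open>a\<close> and of the same length is \<open>Ja\<close> or \<open>- Ja\<close>, and the
  orientation of the atlas decides between the two.\<close>

lemma rot90_coord_vec:
  assumes x: "(\<Omega>, x) \<in> A" "u \<in> \<Omega>" and a: "gcoord A g x u a a = 1"
  shows "rot90 A g (x u) (coord_vec A x u a) = coord_vec A x u (surface_metric.J (gcoord A g x) u a)"
proof -
  interpret G: surface_metric \<Omega> "gcoord A g x" by (rule metric_chart[OF x(1)])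
  have D: "G.gdet u > 0" by (rule G.gdet_pos[OF x(2)])
  have wJ: "wedge a (G.J u a) > 0" using G.wedge_J[OF x(2), of a a] D a by (metis zero_less_mult_pos zero_less_one real_sqrt_gt_zero)
  show ?thesis unfolding rot90_def
  proof (rule the_equality)
    have "positively_oriented A (x u) (coord_vec A x u a) (coord_vec A x u (G.J u a))"
      unfolding positively_oriented_def using x wJ unfolding wedge_def by blast
    then show "coord_vec A x u (G.J u a) \<in> tangent_space A (x u) \<and> g (x u) (coord_vec A x u a) (coord_vec A x u (G.J u a)) = 0 \<and>
      g (x u) (coord_vec A x u (G.J u a)) (coord_vec A x u (G.J u a)) = g (x u) (coord_vec A x u a) (coord_vec A x u a) \<and>
      positively_oriented A (x u) (coord_vec A x u a) (coord_vec A x u (G.J u a))"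
      using coord_vec_in_tangent_space[OF x] G.J_orth[OF x(2), of a] G.metric_sym[OF x(2), of a "G.J u a"] G.J_isometry[OF x(2), of a a]
      unfolding gcoord_def by simp
  next
    fix w assume w: "w \<in> tangent_space A (x u) \<and> g (x u) (coord_vec A x u a) w = 0 \<and> g (x u) w w = g (x u) (coord_vec A x u a) (coord_vec A x u a) \<and>
      positively_oriented A (x u) (coord_vec A x u a) w"
    then obtain b where b: "w = coord_vec A x u b" using tangent_space_eq[OF x] by auto
    have ab: "gcoord A g x u a b = 0" "gcoord A g x u b b = 1" using w b a by (auto simp: gcoord_def)
    define t where "t = gcoord A g x u (G.J u a) b"
    have bt: "b = t *\<^sub>R G.J u a" using G.orthonormal_expand[OF x(2) a, of b] ab by (simp add: t_def)
    then have "t * t = 1" using ab(2) a by (simp add: G.metric_simps[OF x(2)] G.J_isometry[OF x(2)])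
    obtain \<Omega>1 x1 u1 a1 b1 where x1: "(\<Omega>1, x1) \<in> A" "u1 \<in> \<Omega>1" "x1 u1 = x u" "coord_vec A x u a = coord_vec A x1 u1 a1"
      "w = coord_vec A x1 u1 b1" "wedge a1 b1 > 0"
      using w unfolding positively_oriented_def wedge_def by blast
    have im: "x u \<in> x1 ` \<Omega>1" using x1 by (metis image_eqI)
    note X = x(1) x1(1) x(2) im
    let ?H = "frechet_derivative (transition \<Omega>1 x1 x) (at u)"
    have hu: "transition \<Omega>1 x1 x u = u1" by (rule transition_eqI[OF x1(1,2)]) (rule x1(3))
    have "a1 = ?H a" "b1 = ?H b"
      using coord_vec_inj[OF x1(1,2)] coord_vec_change[OF X, of a] coord_vec_change[OF X, of b] x1 b hu by metis+
    moreover obtain d where "d > 0" "wedge (?H a) (?H b) = d * wedge a b" using orientation_transition[OF X] by blast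
    ultimately have "wedge a b > 0" using x1(6) by (simp add: zero_less_mult_iff)
    moreover have "wedge a b = t * wedge a (G.J u a)" by (simp add: bt wedge_def algebra_simps)
    ultimately have "t > 0" using wJ by (simp add: zero_less_mult_iff)
    then have "t = 1" using \<open>t * t = 1\<close> by (simp add: square_eq_1_iff)
    then show "w = coord_vec A x u (G.J u a)" using b bt by simp
  qed
qed

lemma vertical_represents:
  assumes x: "(\<Omega>, x) \<in> A"
  shows "represents (vertical_vfield A g) \<Omega> x (surface_metric.ver (gcoord A g x))"
  unfolding represents_def
proof (intro ballI allI impI conjI)
  fix u a assume u: "u \<in> \<Omega>" and a: "gcoord A g x u a a = 1"
  interpret G: surface_metric \<Omega> "gcoord A g x" by (rule metric_chart[OF x])
  show "unit_tangent x (u, a) (G.ver (u, a))" by (rule unit_tangent_unit[OF x u])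
  show "smooth_near G.ver (u, a)" by (rule G.frame_smooth) (simp add: u)
  let ?c = "\<lambda>t. (u, cos t *\<^sub>R a + sin t *\<^sub>R G.J u a)"
  have c: "(?c has_vector_derivative (0, G.J u a)) (at 0)"
    by (rule has_vector_derivative_Pair) (auto intro!: derivative_eq_intros)
  have "gcoord A g x u (cos t *\<^sub>R a + sin t *\<^sub>R G.J u a) (cos t *\<^sub>R a + sin t *\<^sub>R G.J u a) = 1" for t
    using a G.J_orth[OF u, of a] G.metric_sym[OF u, of a "G.J u a"] G.J_isometry[OF u, of a a] sin_cos_squared_add3[of t]
    by (simp add: G.metric_simps[OF u])
  then have p: "unit_point x (?c t) = (x u, tadd (tscale (cos t) (coord_vec A x u a)) (tscale (sin t) (coord_vec A x u (G.J u a))))" for t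
    by (simp add: unit_point_unit coord_vec_add[OF x u] coord_vec_scaleR[OF x u])
  have "vertical_vfield A g (unit_point x (u, a)) = velocity SM (\<lambda>t. unit_point x (?c t))"
    unfolding p unfolding vertical_vfield_def unit_point_unit[OF a] by (simp add: rot90_coord_vec[OF x u a])
  also have "\<dots> = tvec_at x (?c 0) (0, G.J u a)"
    by (rule velocity_unit_point(1)[OF x _ _ c]) (use u unit_nonzero[OF x u a] in auto)
  finally show "vertical_vfield A g (unit_point x (u, a)) = tvec_at x (u, a) (G.ver (u, a))" by (simp add: G.ver_def)
qed

lemma horizontal_represents:
  assumes x: "(\<Omega>, x) \<in> A"
  shows "represents (horizontal_vfield A g) \<Omega> x (surface_metric.hor (gcoord A g x))"
  unfolding represents_def
proof (intro ballI allI impI conjI)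
  fix u a assume u: "u \<in> \<Omega>" and a: "gcoord A g x u a a = 1"
  interpret G: surface_metric \<Omega> "gcoord A g x" by (rule metric_chart[OF x])
  show "unit_tangent x (u, a) (G.hor (u, a))" by (rule unit_tangent_unit[OF x u])
  show "smooth_near G.hor (u, a)" by (rule G.frame_smooth) (simp add: u)
  show "horizontal_vfield A g (unit_point x (u, a)) = tvec_at x (u, a) (G.hor (u, a))"
  proof
    fix f show "horizontal_vfield A g (unit_point x (u, a)) f = tvec_at x (u, a) (G.hor (u, a)) f"
      using represents_commutator[OF x u a vertical_represents[OF x] geodesic_represents[OF x], of f] G.frame_brackets(1)[OF u, of a]
      by (auto simp: horizontal_vfield_def lie_bracket_def tvec_at_def)
  qed
qed

abbreviation "XX \<equiv> geodesic_vfield A g"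
abbreviation "VV \<equiv> vertical_vfield A g"
abbreviation "HH \<equiv> horizontal_vfield A g"

lemma represents_smooth:
  assumes Y: "\<And>\<Omega> x. (\<Omega>, x) \<in> A \<Longrightarrow> represents Y \<Omega> x (Y' x)" and z: "z \<in> carrier_of SM"
  shows "Y z \<in> tangent_space SM z" and "smooth_at SM z f \<Longrightarrow> smooth_at SM z (\<lambda>q. Y q f)"
proof -
  obtain \<Omega> x u a where x: "(\<Omega>, x) \<in> A" "u \<in> \<Omega>" "gcoord A g x u a a = 1" "z = unit_point x (u, a)"
    using SM_chart_point[OF z] .
  then have "Y z = tvec_at x (u, a) (Y' x (u, a))" using Y unfolding represents_def by blast
  then show "Y z \<in> tangent_space SM z" using tvec_at_in_tangent_space[OF x(1)] x unit_nonzero by simp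
  show "smooth_at SM z f \<Longrightarrow> smooth_at SM z (\<lambda>q. Y q f)"
    using represents_apply(2)[OF x(1,2,3) Y[OF x(1)]] x(4) by simp
qed

lemma XX_smooth:
  "z \<in> carrier_of SM \<Longrightarrow> XX z \<in> tangent_space SM z"
  "z \<in> carrier_of SM \<Longrightarrow> smooth_at SM z f \<Longrightarrow> smooth_at SM z (\<lambda>q. XX q f)"
  by (rule represents_smooth[OF geodesic_represents]; assumption)+

lemma VV_smooth:
  "z \<in> carrier_of SM \<Longrightarrow> VV z \<in> tangent_space SM z"
  "z \<in> carrier_of SM \<Longrightarrow> smooth_at SM z f \<Longrightarrow> smooth_at SM z (\<lambda>q. VV q f)"
  by (rule represents_smooth[OF vertical_represents]; assumption)+

lemma HH_smooth:
  "z \<in> carrier_of SM \<Longrightarrow> HH z \<in> tangent_space SM z"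
  "z \<in> carrier_of SM \<Longrightarrow> smooth_at SM z f \<Longrightarrow> smooth_at SM z (\<lambda>q. HH q f)"
  by (rule represents_smooth[OF horizontal_represents]; assumption)+

lemma gauss_curvature_eq:
  assumes "(\<Omega>, x) \<in> A" "u \<in> \<Omega>" "coords_at A (x u) = (x, u)"
  shows "gauss_curvature A g (x u) = surface_metric.gauss (gcoord A g x) u"
proof -
  interpret G: surface_metric \<Omega> "gcoord A g x" by (rule metric_chart[OF assms(1)])
  have ch: "christoffel A g x = G.chr" by (intro ext christoffel_eq_chr[OF assms(1)])
  have "curvature_coord A g x = G.curv"
    by (intro ext) (simp add: curvature_coord_def G.curv_def G.dchr_def ch)
  then show ?thesis using assms(3)
    by (simp add: gauss_curvature_def Let_def G.gauss_def G.gdet_def power2_eq_square)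
qed

text \<open>The brackets computed in homogeneous coordinates, read as identities between derivations. The factor
  \<open>\<gamma>(a, a)\<close> of the curvature is \<open>1\<close> at unit vectors.\<close>

lemma structure_equations:
  assumes z: "z \<in> carrier_of SM" and f: "smooth_at SM z f"
  shows "VV z (\<lambda>q. XX q f) - XX z (\<lambda>q. VV q f) = HH z f"
    and "VV z (\<lambda>q. HH q f) - HH z (\<lambda>q. VV q f) = - XX z f"
    and "XX z (\<lambda>q. HH q f) - HH z (\<lambda>q. XX q f) = gauss_curvature A g (fst z) * VV z f"
proof -
  have "fst z \<in> carrier_of A" using z by (auto simp: SM_carrier unit_tangent_bundle_def)
  then obtain \<Omega> x u where c: "coords_at A (fst z) = (x, u)" and x: "(\<Omega>, x) \<in> A" "u \<in> \<Omega>" "x u = fst z"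
    by (rule coords_at_chart)
  obtain a where a: "gcoord A g x u a a = 1" and za: "z = unit_point x (u, a)" using SM_point[OF z x] by blast
  interpret G: surface_metric \<Omega> "gcoord A g x" by (rule metric_chart[OF x(1)])
  have a0: "fst (u, a) \<in> \<Omega>" "snd (u, a) \<noteq> 0" using unit_nonzero[OF x(1,2) a] x(2) by auto
  have f': "smooth_at SM (unit_point x (u, a)) f" using f za by simp
  note R = geodesic_represents[OF x(1)] vertical_represents[OF x(1)] horizontal_represents[OF x(1)]
  have at: "XX z = tvec_at x (u, a) (G.geo (u, a))" "VV z = tvec_at x (u, a) (G.ver (u, a))" "HH z = tvec_at x (u, a) (G.hor (u, a))"
    using R x(2) a za by (auto simp: represents_def)
  have lin: "linear (frechet_derivative (\<lambda>w. f (unit_point x w)) (at (u, a)))"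
    using f' smooth_at_unit_point[OF x(1) a0] smooth_near_linear by blast
  show "VV z (\<lambda>q. XX q f) - XX z (\<lambda>q. VV q f) = HH z f"
    unfolding za represents_commutator[OF x(1,2) a R(2) R(1) f'] using G.frame_brackets(1)[OF x(2)] at za by simp
  show "VV z (\<lambda>q. HH q f) - HH z (\<lambda>q. VV q f) = - XX z f"
    unfolding za represents_commutator[OF x(1,2) a R(2) R(3) f'] using G.frame_brackets(2)[OF x(2)] at za
    by (simp add: tvec_at_def linear_neg[OF lin])
  show "XX z (\<lambda>q. HH q f) - HH z (\<lambda>q. XX q f) = gauss_curvature A g (fst z) * VV z f"
  proof -
    have k: "gauss_curvature A g (fst z) = G.gauss u" using gauss_curvature_eq[OF x(1,2)] c x(3) by simp
    have "XX z (\<lambda>q. HH q f) - HH z (\<lambda>q. XX q f) = tvec_at x (u, a) (G.gauss u *\<^sub>R G.ver (u, a)) f"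
      unfolding za represents_commutator[OF x(1,2) a R(1) R(3) f'] using G.frame_brackets(3)[OF x(2), of a] a by simp
    also have "\<dots> = G.gauss u * VV z f" unfolding at by (simp add: tvec_at_def linear_scale[OF lin])
    finally show ?thesis using k by simp
  qed
qed

lemma SM_open_over_chart:
  assumes x: "(\<Omega>, x) \<in> A" shows "atlas_open SM {z \<in> carrier_of SM. fst z \<in> x ` \<Omega>}"
proof (rule SM.atlas_openI)
  fix D y w assume y: "(D, y) \<in> SM" and w: "w \<in> D" "y w \<in> {z \<in> carrier_of SM. fst z \<in> x ` \<Omega>}"
  obtain \<Omega>' x' \<alpha> where *: "(\<Omega>', x') \<in> A" "D = \<Omega>' \<times> {\<alpha><..<\<alpha> + 2 * pi}" "y = SM_param x'"
    using y unfolding SM_atlas_eq by blast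
  have fy: "fst (y v) = x' (fst v)" for v by (simp add: * SM_param_def unit_point_def)
  have "isCont fst w" by (intro continuous_intros)
  moreover have "\<forall>\<^sub>F v in nhds (fst w). x' v \<in> x ` \<Omega>"
    using transition_near[OF *(1) x, of "fst w"] w * fy by (auto elim: eventually_mono)
  ultimately have "\<forall>\<^sub>F v in nhds w. x' (fst v) \<in> x ` \<Omega>" by (rule eventually_nhds_isCont)
  then show "\<forall>\<^sub>F v in nhds w. v \<in> D \<longrightarrow> y v \<in> {z \<in> carrier_of SM. fst z \<in> x ` \<Omega>}"
    by eventually_elim (use fy SM.chart_carrier[OF y] in auto)
qed auto

text \<open>The coefficients of a tangent vector \<open>v\<close> in the frame \<open>X\<close>, \<open>H\<close>, \<open>V\<close> are obtained from finitely many
  values \<open>v (e i)\<close> with smooth weights. When \<open>v\<close> varies with a parameter, this transfers smoothness in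
  the parameter from \<open>v (e i)\<close> to the coefficients.\<close>

lemma SM_coframe:
  assumes z0: "z0 \<in> carrier_of SM"
  obtains U and I :: "((real^2) \<times> (real^2)) set" and e a b c
  where "atlas_open SM U" "z0 \<in> U" "finite I"
    "\<And>i. i \<in> I \<Longrightarrow> smooth_at SM z0 (e i) \<and> smooth_at SM z0 (a i) \<and> smooth_at SM z0 (b i) \<and> smooth_at SM z0 (c i)"
    "\<And>z v. z \<in> U \<Longrightarrow> v \<in> tangent_space SM z \<Longrightarrow> v = tadd (tscale (\<Sum>i\<in>I. a i z * v (e i)) (XX z))
      (tadd (tscale (\<Sum>i\<in>I. b i z * v (e i)) (HH z)) (tscale (\<Sum>i\<in>I. c i z * v (e i)) (VV z)))"
proof -
  obtain \<Omega> x u0 a0 where x: "(\<Omega>, x) \<in> A" and u0: "u0 \<in> \<Omega>" "gcoord A g x u0 a0 a0 = 1" "z0 = unit_point x (u0, a0)"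
    using SM_chart_point[OF z0] .
  interpret G: surface_metric \<Omega> "gcoord A g x" by (rule metric_chart[OF x])
  let ?p = "point_coords \<Omega> x"
  let ?\<gamma> = "gcoord A g x"
  let ?\<alpha> = "\<lambda>z c. ?\<gamma> (fst z) (snd z) (fst c)"
  let ?\<beta> = "\<lambda>z c. ?\<gamma> (fst z) (G.J (fst z) (snd z)) (fst c)"
  let ?\<psi> = "\<lambda>z c. ?\<gamma> (fst z) (G.J (fst z) (snd z)) (snd c + G.chr (fst z) (snd z) (fst c))"
  show thesis
  proof
    show "atlas_open SM {z \<in> carrier_of SM. fst z \<in> x ` \<Omega>}" by (rule SM_open_over_chart[OF x])
    show "z0 \<in> {z \<in> carrier_of SM. fst z \<in> x ` \<Omega>}" using z0 u0 by (simp add: unit_point_def)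
    show "finite (Basis :: ((real^2) \<times> (real^2)) set)" by simp
    show "smooth_at SM z0 (\<lambda>q. ?p q \<bullet> i) \<and> smooth_at SM z0 (\<lambda>q. ?\<alpha> (?p q) i) \<and> smooth_at SM z0 (\<lambda>q. ?\<beta> (?p q) i)
       \<and> smooth_at SM z0 (\<lambda>q. ?\<psi> (?p q) i)" for i
      unfolding u0(3) using u0(1)
      by (intro conjI point_coords_smooth(2)[OF x u0(1,2), where F = "\<lambda>z. z \<bullet> i"]
          point_coords_smooth(2)[OF x u0(1,2), where F = "\<lambda>z. ?\<alpha> z i"]
          point_coords_smooth(2)[OF x u0(1,2), where F = "\<lambda>z. ?\<beta> z i"]
          point_coords_smooth(2)[OF x u0(1,2), where F = "\<lambda>z. ?\<psi> z i"]
          G.metric_smooth_near G.J_smooth_near G.chr_smooth_near smooth_near_inner smooth_near_add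
          smooth_near_const smooth_near_fst smooth_near_snd smooth_near_ident) auto
    fix z v assume z: "z \<in> {z \<in> carrier_of SM. fst z \<in> x ` \<Omega>}" and v: "v \<in> tangent_space SM z"
    then obtain u where u: "u \<in> \<Omega>" "x u = fst z" by auto
    obtain a where a: "?\<gamma> u a a = 1" "z = unit_point x (u, a)" using SM_point[OF _ x u] z by blast
    obtain d where d: "unit_tangent x (u, a) d" "v = tvec_at x (u, a) d"
      using tangent_space_SM[OF x u(1) a(1)] v a(2) by blast
    have a0: "fst (u, a) \<in> \<Omega>" "snd (u, a) \<noteq> 0" using unit_nonzero[OF x u(1) a(1)] u(1) by auto
    have pz: "?p z = (u, a)" unfolding a(2) point_coords_unit_point[OF x a0] by (rule unitize_unit[OF a(1)])
    have vi: "v (\<lambda>q. ?p q \<bullet> i) = d \<bullet> i" for i unfolding d(2) by (rule tvec_at_component[OF x u(1) a(1) d(1)])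
    have at: "XX z = tvec_at x (u, a) (G.geo (u, a))" "VV z = tvec_at x (u, a) (G.ver (u, a))" "HH z = tvec_at x (u, a) (G.hor (u, a))"
      using geodesic_represents[OF x] vertical_represents[OF x] horizontal_represents[OF x] u(1) a by (auto simp: represents_def)
    have L: "linear (?\<alpha> (u, a))" "linear (?\<beta> (u, a))" "linear (?\<psi> (u, a))"
      by (rule linear_combinationI, simp add: G.metric_simps[OF u(1)] bilinear_radd[OF G.chr_bilinear[OF u(1)]]
          bilinear_rmul[OF G.chr_bilinear[OF u(1)]] algebra_simps)+
    have S: "(\<Sum>i\<in>Basis. ?\<alpha> (?p z) i * v (\<lambda>q. ?p q \<bullet> i)) = ?\<alpha> (u, a) d" "(\<Sum>i\<in>Basis. ?\<beta> (?p z) i * v (\<lambda>q. ?p q \<bullet> i)) = ?\<beta> (u, a) d"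
      "(\<Sum>i\<in>Basis. ?\<psi> (?p z) i * v (\<lambda>q. ?p q \<bullet> i)) = ?\<psi> (u, a) d"
      unfolding pz vi using linear_sum_Basis[OF L(1), of d] linear_sum_Basis[OF L(2), of d] linear_sum_Basis[OF L(3), of d] by simp_all
    have "d = ?\<alpha> (u, a) d *\<^sub>R G.geo (u, a) + 1 *\<^sub>R (?\<beta> (u, a) d *\<^sub>R G.hor (u, a) + ?\<psi> (u, a) d *\<^sub>R G.ver (u, a))"
      using G.tangent_expand[OF u(1) a(1) d(1)] by (simp add: add.assoc)
    then have "v = tvec_at x (u, a) (?\<alpha> (u, a) d *\<^sub>R G.geo (u, a) + 1 *\<^sub>R (?\<beta> (u, a) d *\<^sub>R G.hor (u, a) + ?\<psi> (u, a) d *\<^sub>R G.ver (u, a)))"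
      using d(2) by simp
    then show "v = tadd (tscale (\<Sum>i\<in>Basis. ?\<alpha> (?p z) i * v (\<lambda>q. ?p q \<bullet> i)) (XX z))
      (tadd (tscale (\<Sum>i\<in>Basis. ?\<beta> (?p z) i * v (\<lambda>q. ?p q \<bullet> i)) (HH z)) (tscale (\<Sum>i\<in>Basis. ?\<psi> (?p z) i * v (\<lambda>q. ?p q \<bullet> i)) (VV z)))"
      unfolding S tvec_at_linear[OF x a0] at by (simp add: tscale_def)
  qed
qed

lemma SM_frame_independent:
  assumes z: "z \<in> carrier_of SM"
    and eq: "\<And>f. smooth_at SM z f \<Longrightarrow> r * XX z f + s * HH z f + t * VV z f = 0"
  shows "r = 0 \<and> s = 0 \<and> t = 0"
proof -
  obtain \<Omega> x u a where x: "(\<Omega>, x) \<in> A" "u \<in> \<Omega>" "gcoord A g x u a a = 1" "z = unit_point x (u, a)"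
    using SM_chart_point[OF z] .
  interpret G: surface_metric \<Omega> "gcoord A g x" by (rule metric_chart[OF x(1)])
  have at: "XX z = tvec_at x (u, a) (G.geo (u, a))" "VV z = tvec_at x (u, a) (G.ver (u, a))" "HH z = tvec_at x (u, a) (G.hor (u, a))"
    using geodesic_represents[OF x(1)] vertical_represents[OF x(1)] horizontal_represents[OF x(1)] x by (auto simp: represents_def)
  let ?c = "r *\<^sub>R G.geo (u, a) + s *\<^sub>R G.hor (u, a) + t *\<^sub>R G.ver (u, a)"
  note T = unit_tangent_unit[OF x(1,2), of a]
  have "?c \<bullet> b = 0" for b
  proof -
    have "smooth_at SM z (\<lambda>q. point_coords \<Omega> x q \<bullet> b)"
      unfolding x(4) by (rule point_coords_smooth(2)[OF x(1,2,3), where F = "\<lambda>z. z \<bullet> b"]) (intro smooth_intros)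
    from eq[OF this] show ?thesis
      unfolding at tvec_at_component[OF x(1,2,3) T(1)] tvec_at_component[OF x(1,2,3) T(2)] tvec_at_component[OF x(1,2,3) T(3)]
      by (simp add: inner_add_left)
  qed
  then have c: "?c = 0" by (metis inner_eq_zero_iff)
  have "fst ?c = r *\<^sub>R a + s *\<^sub>R G.J u a" by (simp add: G.geo_def G.hor_def G.ver_def)
  then have f: "r *\<^sub>R a + s *\<^sub>R G.J u a = 0" using c by (metis fst_zero)
  have JJ: "gcoord A g x u (G.J u a) (G.J u a) = 1" using G.J_isometry[OF x(2), of a a] x(3) by simp
  have p: "gcoord A g x u (r *\<^sub>R a + s *\<^sub>R G.J u a) a = r" "gcoord A g x u (r *\<^sub>R a + s *\<^sub>R G.J u a) (G.J u a) = s"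
    using x(3) JJ G.J_orth[OF x(2), of a] G.metric_sym[OF x(2), of a "G.J u a"] by (simp_all add: G.metric_simps[OF x(2)])
  then have rs: "r = 0" "s = 0" using G.metric_simps(9)[OF x(2)] unfolding p[unfolded f, symmetric] by simp_all
  then have "t *\<^sub>R G.J u a = 0" using c by (simp add: G.ver_def prod_eq_iff)
  moreover have "G.J u a \<noteq> 0" using JJ by (auto simp: G.metric_simps[OF x(2)])
  ultimately show ?thesis using rs by simp
qed

end

section \<open>The linearization of a flow\<close>

locale smooth_flow = atlas A for A :: "('m, 'e::euclidean_space) atlas" +
  fixes Y :: "'m vfield" and \<phi> :: "real \<Rightarrow> 'm \<Rightarrow> 'm"
  assumes flow: "flow_generated_by A Y \<phi>"
begin

abbreviation "M \<equiv> carrier_of A"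

lemma flow_carrier: "z \<in> M \<Longrightarrow> \<phi> t z \<in> M"
  and flow_0: "z \<in> M \<Longrightarrow> \<phi> 0 z = z"
  and flow_add: "z \<in> M \<Longrightarrow> \<phi> (s + t) z = \<phi> s (\<phi> t z)"
  and flow_velocity: "z \<in> M \<Longrightarrow> velocity A (\<lambda>t. \<phi> t z) = Y z"
  using flow unfolding flow_generated_by_def by blast+

lemma flow_smooth_near:
  assumes x: "(\<Omega>, x) \<in> A" "u \<in> \<Omega>" and f: "smooth_at A (\<phi> t (x u)) f"
  shows "smooth_near (\<lambda>p. f (\<phi> (fst p) (x (snd p)))) (t, u)"
proof -
  have "smooth_at (product_with_line A) (t, x u) (\<lambda>(s, w). f (\<phi> s w))"
    using flow chart_carrier[OF x] f unfolding flow_generated_by_def by blast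
  moreover have "(UNIV \<times> \<Omega>, \<lambda>(t, u). (t, x u)) \<in> product_with_line A"
    using x(1) unfolding product_with_line_def by blast
  ultimately obtain W where "open W" "(t, u) \<in> W" "smooth_on W (\<lambda>w. (\<lambda>(s, w). f (\<phi> s w)) ((\<lambda>(t, u). (t, x u)) w))"
    using x(2) unfolding smooth_at_def by force
  moreover have "(\<lambda>w. (\<lambda>(s, w). f (\<phi> s w)) ((\<lambda>(t, u). (t, x u)) w)) = (\<lambda>p. f (\<phi> (fst p) (x (snd p))))"
    by (auto simp: split_def)
  ultimately show ?thesis by (auto simp: smooth_near_def)
qed

lemma smooth_at_cong:
  assumes "(\<Omega>, x) \<in> A" "u \<in> \<Omega>" "\<forall>\<^sub>F w in nhds u. f (x w) = h (x w)" "smooth_at A (x u) f"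
  shows "smooth_at A (x u) h"
  using smooth_near_cong[OF _ assms(3)] assms(4) smooth_at_iff[OF assms(1,2)] by blast

text \<open>A flow is continuous because it pulls smooth germs back to smooth germs: the indicator function of
  an open set is smooth at the points of that set.\<close>

lemma flow_eventually_in:
  assumes x: "(\<Omega>, x) \<in> A" "u \<in> \<Omega>" and U: "atlas_open A U" "\<phi> t (x u) \<in> U"
  shows "\<forall>\<^sub>F p in nhds (t, u). \<phi> (fst p) (x (snd p)) \<in> U"
proof -
  let ?f = "\<lambda>q. if q \<in> U then 1 else (0::real)"
  have "\<phi> t (x u) \<in> M" by (intro flow_carrier chart_carrier[OF x])
  then obtain \<Omega>1 x1 u1 where x1: "(\<Omega>1, x1) \<in> A" "u1 \<in> \<Omega>1" "\<phi> t (x u) = x1 u1" by (rule carrierE)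
  have "\<forall>\<^sub>F w in nhds u1. 1 = ?f (x1 w)"
    using atlas_open_eventually[OF U(1) x1(1,2)] U(2) x1(3) by (auto elim: eventually_mono)
  then have "smooth_at A (x1 u1) ?f"
    unfolding smooth_at_iff[OF x1(1,2)] by (rule smooth_near_cong[OF smooth_near_const])
  then have "smooth_near (\<lambda>p. ?f (\<phi> (fst p) (x (snd p)))) (t, u)"
    using flow_smooth_near[OF x, of t ?f] x1(3) by simp
  from smooth_near_isCont[OF this]
  have "((\<lambda>p. ?f (\<phi> (fst p) (x (snd p)))) \<longlongrightarrow> ?f (\<phi> t (x u))) (nhds (t, u))"
    by (simp add: isCont_nhds)
  then have "\<forall>\<^sub>F p in nhds (t, u). ?f (\<phi> (fst p) (x (snd p))) > 1 / 2"
    using U(2) by (intro order_tendstoD) auto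
  then show ?thesis by eventually_elim (auto split: if_splits)
qed

lemma flow_eventually_time:
  assumes "z \<in> M" "atlas_open A U" "\<phi> t z \<in> U" shows "\<forall>\<^sub>F s in nhds t. \<phi> s z \<in> U"
proof -
  obtain \<Omega> x u where x: "(\<Omega>, x) \<in> A" "u \<in> \<Omega>" "z = x u" using carrierE[OF assms(1)] .
  have "isCont (\<lambda>s. (s, u)) t" by (intro continuous_intros)
  from eventually_nhds_isCont[OF this, of "\<lambda>p. \<phi> (fst p) (x (snd p)) \<in> U"] flow_eventually_in[OF x(1,2) assms(2)] assms(3) x(3)
  show ?thesis by simp
qed

lemma flow_eventually_space:
  assumes "(\<Omega>, x) \<in> A" "u \<in> \<Omega>" "atlas_open A U" "\<phi> t (x u) \<in> U" shows "\<forall>\<^sub>F w in nhds u. \<phi> t (x w) \<in> U"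
proof -
  have "isCont (\<lambda>w. (t, w)) u" by (intro continuous_intros)
  from eventually_nhds_isCont[OF this, of "\<lambda>p. \<phi> (fst p) (x (snd p)) \<in> U"] flow_eventually_in[OF assms]
  show ?thesis by simp
qed

lemma flow_pullback_smooth:
  assumes "z \<in> M" "smooth_at A (\<phi> t z) f" shows "smooth_at A z (\<lambda>q. f (\<phi> t q))"
proof -
  obtain \<Omega> x u where x: "(\<Omega>, x) \<in> A" "u \<in> \<Omega>" "z = x u" using carrierE[OF assms(1)] .
  have "smooth_near (\<lambda>w. (t, w)) u" by (intro smooth_intros)
  from smooth_near_compose[OF this, of "\<lambda>p. f (\<phi> (fst p) (x (snd p)))"] flow_smooth_near[OF x(1,2), of t f] assms(2) x(3)
  show ?thesis by (simp add: smooth_at_iff[OF x(1,2)])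
qed

lemma pushforward_tangent:
  assumes z: "z \<in> M" and v: "v \<in> tangent_space A z"
  shows "pushforward A (\<phi> t) z v \<in> tangent_space A (\<phi> t z)"
proof -
  obtain \<Omega> x u where x: "(\<Omega>, x) \<in> A" "u \<in> \<Omega>" "z = x u" using carrierE[OF z] .
  obtain \<Omega>1 x1 u1 where x1: "(\<Omega>1, x1) \<in> A" "u1 \<in> \<Omega>1" "\<phi> t z = x1 u1" using carrierE[OF flow_carrier[OF z]] .
  obtain a where a: "v = coord_vec A x u a" using v tangent_space_eq[OF x(1,2)] x(3) by auto
  define \<Phi> where "\<Phi> w = inv_into \<Omega>1 x1 (\<phi> t (x w))" for w
  have \<Phi>u: "\<Phi> u = u1" using x x1 chart_inj[OF x1(1)] by (simp add: \<Phi>_def)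
  have "smooth_near (\<lambda>w. \<Phi> w \<bullet> b) u" for b
    using flow_pullback_smooth[OF z, of t "\<lambda>q. inv_into \<Omega>1 x1 q \<bullet> b"] smooth_at_chart_component(1)[OF x1(1,2)] x x1(3)
      smooth_at_iff[OF x(1,2)] by (simp add: \<Phi>_def)
  then have \<Phi>: "smooth_near \<Phi> u" by (rule smooth_near_euclideanI)
  have "atlas_open A (x1 ` \<Omega>1)" by (rule atlas_open_chart_image[OF x1(1) chart_open[OF x1(1)] order_refl])
  from flow_eventually_space[OF x(1,2) this, of t]
  have ev: "\<forall>\<^sub>F w in nhds u. \<phi> t (x w) = x1 (\<Phi> w)"
    using x1 x(3) by (auto simp: \<Phi>_def f_inv_into_f elim: eventually_mono)
  have "pushforward A (\<phi> t) z v = coord_vec A x1 u1 (frechet_derivative \<Phi> (at u) a)"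
  proof
    fix f
    show "pushforward A (\<phi> t) z v f = coord_vec A x1 u1 (frechet_derivative \<Phi> (at u) a) f"
    proof (cases "smooth_at A (\<phi> t z) f")
      case True
      have sf: "smooth_near (\<lambda>w. f (x1 w)) (\<Phi> u)" using True x1 smooth_at_iff[OF x1(1,2)] \<Phi>u by simp
      have D: "((\<lambda>w. f (x1 (\<Phi> w))) has_derivative (\<lambda>a. frechet_derivative (\<lambda>w. f (x1 w)) (at (\<Phi> u)) (frechet_derivative \<Phi> (at u) a))) (at u)"
        by (rule has_derivative_compose[OF smooth_near_has_derivative[OF \<Phi>] smooth_near_has_derivative[OF sf]])
      have e: "\<forall>\<^sub>F w in nhds u. f (\<phi> t (x w)) = f (x1 (\<Phi> w))" using ev by eventually_elim simp
      have "pushforward A (\<phi> t) z v f = frechet_derivative (\<lambda>w. f (\<phi> t (x w))) (at u) a"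
        using True a coord_vec_apply[OF x(1,2)] flow_pullback_smooth[OF z True] x(3) by (simp add: pushforward_def)
      also have "\<dots> = frechet_derivative (\<lambda>w. f (x1 w)) (at u1) (frechet_derivative \<Phi> (at u) a)"
        using frechet_derivative_cong_eventually[OF e] frechet_derivative_eqI[OF D] \<Phi>u by simp
      also have "\<dots> = coord_vec A x1 u1 (frechet_derivative \<Phi> (at u) a) f"
        using coord_vec_apply[OF x1(1,2)] True x1(3) by simp
      finally show ?thesis .
    qed (simp add: pushforward_def coord_vec_not_smooth x1(3))
  qed
  then show ?thesis using coord_vec_in_tangent_space[OF x1(1,2)] x1(3) by simp
qed

lemma pushforward_add: "pushforward A h z (tadd v w) = tadd (pushforward A h z v) (pushforward A h z w)"
  by (auto simp: pushforward_def tadd_def)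

lemma pushforward_scale: "pushforward A h z (tscale r v) = tscale r (pushforward A h z v)"
  by (auto simp: pushforward_def tscale_def)

lemma pushforward_0:
  assumes z: "z \<in> M" and v: "v \<in> tangent_space A z" shows "pushforward A (\<phi> 0) z v = v"
proof
  fix f :: "'m \<Rightarrow> real"
  obtain \<Omega> x u where x: "(\<Omega>, x) \<in> A" "u \<in> \<Omega>" "z = x u" using carrierE[OF z] .
  have "\<forall>\<^sub>F w in nhds u. f (\<phi> 0 (x w)) = f (x w)"
    using eventually_nhds_in_open[OF chart_open[OF x(1)] x(2)] by eventually_elim (simp add: flow_0 chart_carrier[OF x(1)])
  then have "v (\<lambda>q. f (\<phi> 0 q)) = v f" using tangent_cong(1)[OF x(1,2), of v "\<lambda>q. f (\<phi> 0 q)" f] v x(3) by simp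
  then show "pushforward A (\<phi> 0) z v f = v f"
    using tangent_not_smooth[OF z v, of f] by (simp add: pushforward_def flow_0[OF z])
qed

lemma pushforward_compose:
  assumes z: "z \<in> M" and v: "v \<in> tangent_space A z"
  shows "pushforward A (\<phi> (s + t)) z v = pushforward A (\<phi> s) (\<phi> t z) (pushforward A (\<phi> t) z v)"
proof
  fix f :: "'m \<Rightarrow> real"
  obtain \<Omega> x u where x: "(\<Omega>, x) \<in> A" "u \<in> \<Omega>" "z = x u" using carrierE[OF z] .
  have "\<forall>\<^sub>F w in nhds u. f (\<phi> (s + t) (x w)) = f (\<phi> s (\<phi> t (x w)))"
    using eventually_nhds_in_open[OF chart_open[OF x(1)] x(2)] by eventually_elim (simp add: flow_add chart_carrier[OF x(1)])
  then have "v (\<lambda>q. f (\<phi> (s + t) q)) = v (\<lambda>q. f (\<phi> s (\<phi> t q)))"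
    using tangent_cong(1)[OF x(1,2), of v "\<lambda>q. f (\<phi> (s + t) q)"] v x(3) by simp
  moreover have "smooth_at A (\<phi> t z) (\<lambda>q. f (\<phi> s q))" if "smooth_at A (\<phi> s (\<phi> t z)) f"
    by (rule flow_pullback_smooth[OF flow_carrier[OF z] that])
  ultimately show "pushforward A (\<phi> (s + t)) z v f = pushforward A (\<phi> s) (\<phi> t z) (pushforward A (\<phi> t) z v) f"
    using flow_add[OF z, of s t] by (simp add: pushforward_def)
qed

lemma flow_derivative:
  assumes z: "z \<in> M" and f: "smooth_at A z f"
  shows "((\<lambda>t. f (\<phi> t z)) has_real_derivative Y z f) (at 0)"
proof -
  obtain \<Omega> x u where x: "(\<Omega>, x) \<in> A" "u \<in> \<Omega>" "z = x u" using carrierE[OF z] .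
  have "smooth_near (\<lambda>p. f (\<phi> (fst p) (x (snd p)))) (0, u)"
    using flow_smooth_near[OF x(1,2), of 0 f] f x(3) flow_0[OF z] by simp
  moreover have "smooth_near (\<lambda>t. (t, u)) (0::real)" by (intro smooth_intros)
  ultimately have "smooth_near (\<lambda>t. f (\<phi> t z)) 0"
    using smooth_near_compose[of "\<lambda>t. (t, u)" 0 "\<lambda>p. f (\<phi> (fst p) (x (snd p)))"] x(3) by simp
  then have "(\<lambda>t. f (\<phi> t z)) field_differentiable (at 0)"
    using smooth_near_differentiable by (metis differentiable_def real_differentiable_def field_differentiable_def has_real_derivative)
  then have "((\<lambda>t. f (\<phi> t z)) has_real_derivative deriv (\<lambda>t. f (\<phi> t z)) 0) (at 0)"
    by (simp add: field_differentiable_derivI)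
  moreover have "Y z f = deriv (\<lambda>t. f (\<phi> t z)) 0"
    using flow_velocity[OF z, symmetric] f flow_0[OF z] by (simp add: velocity_def)
  ultimately show ?thesis by simp
qed

lemma pushforward_generator:
  assumes z: "z \<in> M" shows "pushforward A (\<phi> t) z (Y z) = Y (\<phi> t z)"
proof
  fix f show "pushforward A (\<phi> t) z (Y z) f = Y (\<phi> t z) f"
  proof (cases "smooth_at A (\<phi> t z) f")
    case True
    have "((\<lambda>s. f (\<phi> t (\<phi> s z))) has_real_derivative Y z (\<lambda>q. f (\<phi> t q))) (at 0)"
      by (rule flow_derivative[OF z flow_pullback_smooth[OF z True]])
    moreover have "((\<lambda>s. f (\<phi> s (\<phi> t z))) has_real_derivative Y (\<phi> t z) f) (at 0)"
      by (rule flow_derivative[OF flow_carrier[OF z] True])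
    moreover have "\<phi> t (\<phi> s z) = \<phi> s (\<phi> t z)" for s
      using flow_add[OF z, of t s] flow_add[OF z, of s t] by (simp add: add.commute)
    ultimately show ?thesis using True DERIV_unique by (simp add: pushforward_def)
  next
    case False
    then show ?thesis using flow_velocity[OF flow_carrier[OF z], of t, symmetric] flow_0[OF flow_carrier[OF z]]
      by (simp add: pushforward_def velocity_def)
  qed
qed

text \<open>In a chart \<open>f (\<phi> t q)\<close> is a smooth function of \<open>(t, q)\<close>, and its derivatives in \<open>t\<close> and along \<open>v\<close>
  commute.\<close>

lemma flow_mixed_derivative:
  assumes z: "z \<in> M" and v: "v \<in> tangent_space A z" and f: "smooth_at A z f"
  shows "((\<lambda>t. v (\<lambda>q. f (\<phi> t q))) has_real_derivative v (\<lambda>q. Y q f)) (at 0)"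
    and "smooth_at A z (\<lambda>q. Y q f)"
proof -
  obtain \<Omega> x u where x: "(\<Omega>, x) \<in> A" "u \<in> \<Omega>" "z = x u" using carrierE[OF z] .
  obtain a where a: "v = coord_vec A x u a" using v tangent_space_eq[OF x(1,2)] x(3) by auto
  let ?F = "\<lambda>p. f (\<phi> (fst p) (x (snd p)))"
  have F: "smooth_near ?F (0, u)" using flow_smooth_near[OF x(1,2), of 0 f] f x(3) flow_0[OF z] by simp
  let ?G = "\<lambda>p. frechet_derivative ?F (at p) (1, 0)"
  have G: "smooth_near ?G (0, u)" by (intro smooth_near_frechet_derivative_const F)
  have i: "smooth_near (\<lambda>w. (0::real, w)) u" by (intro smooth_intros)
  have evF: "\<forall>\<^sub>F w in nhds u. smooth_near ?F (0, w)"
    using eventually_nhds_isCont[OF smooth_near_isCont[OF i], of "smooth_near ?F"] smooth_near_eventually[OF F] by simp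
  have evS: "\<forall>\<^sub>F w in nhds u. smooth_at A (x w) f"
    using smooth_near_eventually[of "\<lambda>w. f (x w)" u] f x(3) smooth_at_iff[OF x(1,2)]
      eventually_nhds_in_open[OF chart_open[OF x(1)] x(2)] by (auto simp: smooth_at_iff[OF x(1)] elim: eventually_elim2)
  have evY: "\<forall>\<^sub>F w in nhds u. ?G (0, w) = Y (x w) f"
    using evF evS eventually_nhds_in_open[OF chart_open[OF x(1)] x(2)]
  proof eventually_elim
    case (elim w)
    have "((\<lambda>s. (s, w)) has_vector_derivative (1, 0)) (at (0::real))"
      by (rule has_vector_derivative_Pair) (auto intro!: derivative_eq_intros)
    from smooth_near_has_vector_derivative[OF this, of ?F] elim
    have "((\<lambda>s. f (\<phi> s (x w))) has_real_derivative ?G (0, w)) (at 0)"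
      by (simp add: has_real_derivative_iff_has_vector_derivative)
    then show ?case using flow_derivative[OF chart_carrier[OF x(1)], of w f] elim DERIV_unique by blast
  qed
  have "smooth_near (\<lambda>w. ?G (0, w)) u" using smooth_near_compose[OF i, of ?G] G by simp
  then show 1: "smooth_at A z (\<lambda>q. Y q f)"
    unfolding x(3) smooth_at_iff[OF x(1,2)] using smooth_near_cong[OF _ evY] by blast
  have Yv: "v (\<lambda>q. Y q f) = frechet_derivative ?G (at (0, u)) (0, a)"
  proof -
    have "((\<lambda>w. (0::real, w)) has_derivative (\<lambda>a. (0, a))) (at u)" by (auto intro!: derivative_eq_intros)
    from has_derivative_compose[OF this, of ?G] smooth_near_has_derivative[OF G]
    have D: "((\<lambda>w. ?G (0, w)) has_derivative (\<lambda>a. frechet_derivative ?G (at (0, u)) (0, a))) (at u)" by simp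
    have "frechet_derivative (\<lambda>w. Y (x w) f) (at u) a = frechet_derivative ?G (at (0, u)) (0, a)"
      unfolding frechet_derivative_cong_eventually[OF evY, symmetric] frechet_derivative_eqI[OF D] ..
    then show ?thesis using coord_vec_apply[OF x(1,2), of "\<lambda>q. Y q f" a] 1 a x(3) by simp
  qed
  let ?H = "\<lambda>p. frechet_derivative ?F (at p) (0, a)"
  have H: "smooth_near ?H (0, u)" by (intro smooth_near_frechet_derivative_const F)
  have j: "smooth_near (\<lambda>t. (t, u)) (0::real)" by (intro smooth_intros)
  have "\<forall>\<^sub>F t in nhds (0::real). smooth_near ?F (t, u)"
    using eventually_nhds_isCont[OF smooth_near_isCont[OF j], of "smooth_near ?F"] smooth_near_eventually[OF F] by simp
  moreover have "\<forall>\<^sub>F t in nhds 0. \<phi> t z \<in> {q \<in> M. smooth_at A q f}"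
    by (rule flow_eventually_time[OF z atlas_open_smooth_at]) (simp add: flow_0[OF z] z f)
  ultimately have evH: "\<forall>\<^sub>F t in nhds 0. v (\<lambda>q. f (\<phi> t q)) = ?H (t, u)"
  proof eventually_elim
    case (elim t)
    have "((\<lambda>w. (t, w)) has_derivative (\<lambda>a. (0, a))) (at u)" by (auto intro!: derivative_eq_intros)
    from has_derivative_compose[OF this, of ?F] smooth_near_has_derivative[OF elim(1)]
    have D: "((\<lambda>w. f (\<phi> t (x w))) has_derivative (\<lambda>a. frechet_derivative ?F (at (t, u)) (0, a))) (at u)" by simp
    show ?case
      using coord_vec_apply[OF x(1,2), of "\<lambda>q. f (\<phi> t q)" a] flow_pullback_smooth[OF z, of t f] elim(2) a x(3)
       frechet_derivative_eqI[OF D] by simp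
  qed
  have "((\<lambda>s. (s, u)) has_vector_derivative (1, 0)) (at (0::real))"
    by (rule has_vector_derivative_Pair) (auto intro!: derivative_eq_intros)
  from smooth_near_has_vector_derivative[OF this H]
  have "((\<lambda>t. ?H (t, u)) has_real_derivative frechet_derivative ?H (at (0, u)) (1, 0)) (at 0)"
    by (simp add: has_real_derivative_iff_has_vector_derivative)
  moreover have "frechet_derivative ?H (at (0, u)) (1, 0) = v (\<lambda>q. Y q f)"
    unfolding Yv by (rule second_derivative_symmetric_real[OF F])
  ultimately show "((\<lambda>t. v (\<lambda>q. f (\<phi> t q))) has_real_derivative v (\<lambda>q. Y q f)) (at 0)"
    using DERIV_cong_ev[OF refl evH refl, of "v (\<lambda>q. Y q f)"] by simp
qed

end

subsection \<open>The linearized flow in a moving frame\<close>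

text \<open>The generator is completed by \<open>e2\<close>, \<open>e3\<close> to a frame. The coefficients \<open>l\<close>, \<open>p\<close>, \<open>k\<close>, \<open>q\<close> of the
  brackets \<open>[e2, Y]\<close> and \<open>[e3, Y]\<close> will be those of the linearized flow. The parameter \<open>index\<close> carries
  the index type of the coframe sums, which occurs in no other parameter.\<close>

locale framed_flow = smooth_flow A Y \<phi>
  for A :: "('m, 'e::euclidean_space) atlas" and Y :: "'m vfield" and \<phi> :: "real \<Rightarrow> 'm \<Rightarrow> 'm" +
  fixes e2 e3 :: "'m vfield" and l p k q :: "'m \<Rightarrow> real" and index :: "'i itself"
  assumes frame_tangent: "z \<in> M \<Longrightarrow> Y z \<in> tangent_space A z" "z \<in> M \<Longrightarrow> e2 z \<in> tangent_space A z" "z \<in> M \<Longrightarrow> e3 z \<in> tangent_space A z"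
    and frame_smooth: "z \<in> M \<Longrightarrow> smooth_at A z f \<Longrightarrow> smooth_at A z (\<lambda>w. e2 w f)" "z \<in> M \<Longrightarrow> smooth_at A z f \<Longrightarrow> smooth_at A z (\<lambda>w. e3 w f)"
    and frame_independent: "z \<in> M \<Longrightarrow> (\<And>f. smooth_at A z f \<Longrightarrow> r * Y z f + s * e2 z f + t * e3 z f = 0) \<Longrightarrow> r = 0 \<and> s = 0 \<and> t = 0"
    and coframe: "z0 \<in> M \<Longrightarrow> \<exists>U (I :: 'i set) e a b c. atlas_open A U \<and> z0 \<in> U \<and> finite I \<and>
      (\<forall>i\<in>I. smooth_at A z0 (e i) \<and> smooth_at A z0 (a i) \<and> smooth_at A z0 (b i) \<and> smooth_at A z0 (c i)) \<and>
      (\<forall>z\<in>U. \<forall>v\<in>tangent_space A z. v = tadd (tscale (\<Sum>i\<in>I. a i z * v (e i)) (Y z))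
        (tadd (tscale (\<Sum>i\<in>I. b i z * v (e i)) (e2 z)) (tscale (\<Sum>i\<in>I. c i z * v (e i)) (e3 z))))"
    and bracket2: "z \<in> M \<Longrightarrow> smooth_at A z f \<Longrightarrow>
      e2 z (\<lambda>w. Y w f) - Y z (\<lambda>w. e2 w f) = l z * Y z f + p z * e2 z f + k z * e3 z f"
    and bracket3: "z \<in> M \<Longrightarrow> smooth_at A z f \<Longrightarrow> e3 z (\<lambda>w. Y w f) - Y z (\<lambda>w. e3 w f) = e2 z f + q z * e3 z f"
begin

definition frame :: "'m \<Rightarrow> real \<times> real \<times> real \<Rightarrow> 'm tvec"
  where "frame z c = tadd (tscale (fst c) (Y z)) (tadd (tscale (fst (snd c)) (e2 z)) (tscale (snd (snd c)) (e3 z)))"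

definition comps :: "'m \<Rightarrow> 'm tvec \<Rightarrow> real \<times> real \<times> real"
  where "comps z v = (SOME c. v = frame z c)"

definition cocycle :: "real \<Rightarrow> 'm \<Rightarrow> real \<times> real \<times> real \<Rightarrow> real \<times> real \<times> real"
  where "cocycle t z c = comps (\<phi> t z) (pushforward A (\<phi> t) z (frame z c))"

lemma frame_apply: "frame z c f = fst c * Y z f + fst (snd c) * e2 z f + snd (snd c) * e3 z f"
  by (simp add: frame_def tadd_def tscale_def)

lemma frame_Pair: "frame z (r, s, t) = tadd (tscale r (Y z)) (tadd (tscale s (e2 z)) (tscale t (e3 z)))"
  by (simp add: frame_def)

lemma frame_in_tangent_space: "z \<in> M \<Longrightarrow> frame z c \<in> tangent_space A z"
  unfolding frame_def by (intro tangent_space_add tangent_space_scale frame_tangent)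

lemma frame_linear: "frame z (r *\<^sub>R c + s *\<^sub>R d) = tadd (tscale r (frame z c)) (tscale s (frame z d))"
  by (auto simp: frame_apply tadd_def tscale_def algebra_simps)

lemma frame_inj: assumes "z \<in> M" "frame z c = frame z d" shows "c = d"
proof -
  have "(fst c - fst d) * Y z f + (fst (snd c) - fst (snd d)) * e2 z f + (snd (snd c) - snd (snd d)) * e3 z f = 0" for f
    using fun_cong[OF assms(2), of f] by (simp add: frame_apply algebra_simps)
  then have "fst c - fst d = 0 \<and> fst (snd c) - fst (snd d) = 0 \<and> snd (snd c) - snd (snd d) = 0"
    by (intro frame_independent[OF assms(1)])
  then show ?thesis by (auto simp: prod_eq_iff)
qed

lemma frame_surj: assumes "z \<in> M" "v \<in> tangent_space A z" obtains c where "v = frame z c"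
proof -
  from coframe[OF assms(1)] obtain r s t where "v = tadd (tscale r (Y z)) (tadd (tscale s (e2 z)) (tscale t (e3 z)))"
    using assms(2) by blast
  then have "v = frame z (r, s, t)" by (simp add: frame_def)
  then show thesis by (rule that)
qed

lemma comps_frame: "z \<in> M \<Longrightarrow> comps z (frame z c) = c"
  unfolding comps_def by (rule some_equality) (auto dest: frame_inj)

lemma frame_comps: "z \<in> M \<Longrightarrow> v \<in> tangent_space A z \<Longrightarrow> frame z (comps z v) = v"
  by (metis frame_surj comps_frame)

lemma pushforward_frame:
  assumes "z \<in> M" shows "pushforward A (\<phi> t) z (frame z c) = frame (\<phi> t z) (cocycle t z c)"
  unfolding cocycle_def
  by (rule frame_comps[symmetric]) (intro flow_carrier assms pushforward_tangent frame_in_tangent_space)+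

lemma cocycle_eqI: "z \<in> M \<Longrightarrow> pushforward A (\<phi> t) z (frame z c) = frame (\<phi> t z) d \<Longrightarrow> cocycle t z c = d"
  using pushforward_frame frame_inj flow_carrier by metis

lemma cocycle_linear: assumes "z \<in> M" shows "linear (cocycle t z)"
proof (rule linear_combinationI)
  show "cocycle t z (r *\<^sub>R c + s *\<^sub>R d) = r *\<^sub>R cocycle t z c + s *\<^sub>R cocycle t z d" for r c s d
    by (rule cocycle_eqI[OF assms])
      (simp only: frame_linear pushforward_add pushforward_scale pushforward_frame[OF assms])
qed

lemma cocycle_0: "z \<in> M \<Longrightarrow> cocycle 0 z c = c"
  by (rule cocycle_eqI) (simp_all add: pushforward_0 frame_in_tangent_space flow_0)

lemma cocycle_add: assumes "z \<in> M" shows "cocycle (s + t) z c = cocycle s (\<phi> t z) (cocycle t z c)"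
proof (rule cocycle_eqI[OF assms])
  have "pushforward A (\<phi> (s + t)) z (frame z c) = pushforward A (\<phi> s) (\<phi> t z) (pushforward A (\<phi> t) z (frame z c))"
    by (rule pushforward_compose[OF assms frame_in_tangent_space[OF assms]])
  also have "\<dots> = frame (\<phi> s (\<phi> t z)) (cocycle s (\<phi> t z) (cocycle t z c))"
    by (simp only: pushforward_frame[OF assms] pushforward_frame[OF flow_carrier[OF assms]])
  finally show "pushforward A (\<phi> (s + t)) z (frame z c) = frame (\<phi> (s + t) z) (cocycle s (\<phi> t z) (cocycle t z c))"
    by (simp only: flow_add[OF assms])
qed

lemma frame_generator: "frame z (1, 0, 0) = Y z"
  by (auto simp: frame_apply)

lemma cocycle_generator: "z \<in> M \<Longrightarrow> cocycle t z (1, 0, 0) = (1, 0, 0)"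
  by (rule cocycle_eqI) (simp_all only: frame_generator pushforward_generator)

lemma frame_smooth_at: "z \<in> M \<Longrightarrow> smooth_at A z f \<Longrightarrow> smooth_at A z (\<lambda>w. frame w c f)"
  unfolding frame_apply
  by (intro smooth_at_intros flow_mixed_derivative(2)[OF _ frame_tangent(1)] frame_smooth)

lemma cocycle_coframe:
  assumes z0: "z0 \<in> M"
  obtains U and I :: "'i set" and e a b c where "atlas_open A U" "\<phi> t z0 \<in> U" "finite I" "U \<subseteq> M"
    "\<And>i. i \<in> I \<Longrightarrow> smooth_at A (\<phi> t z0) (e i) \<and> smooth_at A (\<phi> t z0) (a i) \<and> smooth_at A (\<phi> t z0) (b i) \<and> smooth_at A (\<phi> t z0) (c i)"
    "\<And>s z d. z \<in> M \<Longrightarrow> \<phi> s z \<in> U \<Longrightarrow> cocycle s z d =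
      ((\<Sum>i\<in>I. a i (\<phi> s z) * frame z d (\<lambda>w. e i (\<phi> s w))),
       (\<Sum>i\<in>I. b i (\<phi> s z) * frame z d (\<lambda>w. e i (\<phi> s w))),
       (\<Sum>i\<in>I. c i (\<phi> s z) * frame z d (\<lambda>w. e i (\<phi> s w))))"
proof -
  obtain U and I :: "'i set" and e a b c where U: "atlas_open A U" "\<phi> t z0 \<in> U" "finite I"
    and sm: "\<forall>i\<in>I. smooth_at A (\<phi> t z0) (e i) \<and> smooth_at A (\<phi> t z0) (a i) \<and> smooth_at A (\<phi> t z0) (b i) \<and> smooth_at A (\<phi> t z0) (c i)"
    and rep: "\<forall>z\<in>U. \<forall>v\<in>tangent_space A z. v = tadd (tscale (\<Sum>i\<in>I. a i z * v (e i)) (Y z))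
        (tadd (tscale (\<Sum>i\<in>I. b i z * v (e i)) (e2 z)) (tscale (\<Sum>i\<in>I. c i z * v (e i)) (e3 z)))"
    using coframe[OF flow_carrier[OF z0], of t] by blast
  let ?U = "U \<inter> (M \<inter> (\<Inter>i\<in>I. {z \<in> M. smooth_at A z (e i)}))"
  have "openin (atlas_topology A) (M \<inter> (\<Inter>i\<in>I. {z \<in> M. smooth_at A z (e i)}))"
    using U(3)
  proof (induction I rule: finite_induct)
    case empty
    show ?case using topspace_carrier openin_topspace[of "atlas_topology A"] by simp
  next
    case (insert i I)
    have "M \<inter> (\<Inter>i\<in>insert i I. {z \<in> M. smooth_at A z (e i)}) = {z \<in> M. smooth_at A z (e i)} \<inter> (M \<inter> (\<Inter>i\<in>I. {z \<in> M. smooth_at A z (e i)}))"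
      by auto
    then show ?case using openin_Int[OF atlas_open_smooth_at[of "e i", folded openin_atlas_topology] insert.IH]
      by (simp only:)
  qed
  from openin_Int[OF U(1)[folded openin_atlas_topology] this]
  have op: "atlas_open A ?U" by (simp only: openin_atlas_topology)
  show thesis
  proof
    show "atlas_open A ?U" by (rule op)
    show "\<phi> t z0 \<in> ?U" using U sm flow_carrier[OF z0] by auto
    show "finite I" "?U \<subseteq> M" using U by auto
    show "smooth_at A (\<phi> t z0) (e i) \<and> smooth_at A (\<phi> t z0) (a i) \<and> smooth_at A (\<phi> t z0) (b i) \<and> smooth_at A (\<phi> t z0) (c i)" if "i \<in> I" for i
      using sm that by blast
    fix s z d assume z: "z \<in> M" "\<phi> s z \<in> ?U"
    let ?v = "pushforward A (\<phi> s) z (frame z d)"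
    have v: "?v (e i) = frame z d (\<lambda>w. e i (\<phi> s w))" if "i \<in> I" for i
      using z that by (simp add: pushforward_def)
    have "?v = frame (\<phi> s z) ((\<Sum>i\<in>I. a i (\<phi> s z) * ?v (e i)), (\<Sum>i\<in>I. b i (\<phi> s z) * ?v (e i)), (\<Sum>i\<in>I. c i (\<phi> s z) * ?v (e i)))"
      unfolding frame_Pair
      by (rule rep[rule_format, OF _ pushforward_tangent[OF z(1) frame_in_tangent_space[OF z(1)]]]) (use z(2) in blast)
    then have "cocycle s z d = ((\<Sum>i\<in>I. a i (\<phi> s z) * ?v (e i)), (\<Sum>i\<in>I. b i (\<phi> s z) * ?v (e i)), (\<Sum>i\<in>I. c i (\<phi> s z) * ?v (e i)))"
      by (rule cocycle_eqI[OF z(1)])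
    then show "cocycle s z d =
      ((\<Sum>i\<in>I. a i (\<phi> s z) * frame z d (\<lambda>w. e i (\<phi> s w))),
       (\<Sum>i\<in>I. b i (\<phi> s z) * frame z d (\<lambda>w. e i (\<phi> s w))),
       (\<Sum>i\<in>I. c i (\<phi> s z) * frame z d (\<lambda>w. e i (\<phi> s w))))"
      using v by simp
  qed
qed

lemma cocycle_smooth:
  assumes z0: "z0 \<in> M"
  shows "smooth_at A z0 (\<lambda>z. fst (cocycle t z d))" "smooth_at A z0 (\<lambda>z. fst (snd (cocycle t z d)))" "smooth_at A z0 (\<lambda>z. snd (snd (cocycle t z d)))"
proof -
  obtain U and I :: "'i set" and e a b c where U: "atlas_open A U" "\<phi> t z0 \<in> U" "finite I" "U \<subseteq> M"
    and sm: "\<And>i. i \<in> I \<Longrightarrow> smooth_at A (\<phi> t z0) (e i) \<and> smooth_at A (\<phi> t z0) (a i) \<and> smooth_at A (\<phi> t z0) (b i) \<and> smooth_at A (\<phi> t z0) (c i)"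
    and rep: "\<And>s z d. z \<in> M \<Longrightarrow> \<phi> s z \<in> U \<Longrightarrow> cocycle s z d =
      ((\<Sum>i\<in>I. a i (\<phi> s z) * frame z d (\<lambda>w. e i (\<phi> s w))),
       (\<Sum>i\<in>I. b i (\<phi> s z) * frame z d (\<lambda>w. e i (\<phi> s w))),
       (\<Sum>i\<in>I. c i (\<phi> s z) * frame z d (\<lambda>w. e i (\<phi> s w))))"
    using cocycle_coframe[OF z0, of t] by blast
  obtain \<Omega> x u where x: "(\<Omega>, x) \<in> A" "u \<in> \<Omega>" "z0 = x u" using carrierE[OF z0] .
  have ev: "\<forall>\<^sub>F w in nhds u. x w \<in> M \<and> \<phi> t (x w) \<in> U"
    using flow_eventually_space[OF x(1,2) U(1), of t] U(2) x(3) eventually_nhds_in_open[OF chart_open[OF x(1)] x(2)]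
    by (auto elim: eventually_elim2 intro: chart_carrier[OF x(1)])
  have S: "smooth_at A z0 (\<lambda>z. \<Sum>i\<in>I. h i (\<phi> t z) * frame z d (\<lambda>w. e i (\<phi> t w)))"
    if "\<And>i. i \<in> I \<Longrightarrow> smooth_at A (\<phi> t z0) (h i)" for h
    using that sm by (intro smooth_at_sum smooth_at_mult flow_pullback_smooth frame_smooth_at z0) auto
  have ev': "\<forall>\<^sub>F v in nhds u. cocycle t (x v) d =
      ((\<Sum>i\<in>I. a i (\<phi> t (x v)) * frame (x v) d (\<lambda>w. e i (\<phi> t w))),
       (\<Sum>i\<in>I. b i (\<phi> t (x v)) * frame (x v) d (\<lambda>w. e i (\<phi> t w))),
       (\<Sum>i\<in>I. c i (\<phi> t (x v)) * frame (x v) d (\<lambda>w. e i (\<phi> t w))))"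
    using ev by eventually_elim (rule rep, auto)
  have *: "smooth_at A z0 (\<lambda>z. F (cocycle t z d))"
    if "\<And>i. i \<in> I \<Longrightarrow> smooth_at A (\<phi> t z0) (h i)"
      and "\<forall>\<^sub>F v in nhds u. F (cocycle t (x v) d) = (\<Sum>i\<in>I. h i (\<phi> t (x v)) * frame (x v) d (\<lambda>w. e i (\<phi> t w)))"
    for h and F :: "real \<times> real \<times> real \<Rightarrow> real"
    unfolding x(3)
  proof (rule smooth_at_cong[OF x(1,2) _ S[of h, unfolded x(3)]])
    show "\<forall>\<^sub>F v in nhds u. (\<Sum>i\<in>I. h i (\<phi> t (x v)) * frame (x v) d (\<lambda>w. e i (\<phi> t w))) = F (cocycle t (x v) d)"
      using that(2) by eventually_elim simp
  qed (use that(1) x(3) in simp)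
  show "smooth_at A z0 (\<lambda>z. fst (cocycle t z d))"
    by (rule *[of a]) (use sm ev' in \<open>auto elim: eventually_mono\<close>)
  show "smooth_at A z0 (\<lambda>z. fst (snd (cocycle t z d)))"
    by (rule *[of b "\<lambda>c. fst (snd c)"]) (use sm ev' in \<open>auto elim: eventually_mono\<close>)
  show "smooth_at A z0 (\<lambda>z. snd (snd (cocycle t z d)))"
    by (rule *[of c "\<lambda>c. snd (snd c)"]) (use sm ev' in \<open>auto elim: eventually_mono\<close>)
qed

text \<open>Near time \<open>0\<close> the components of a transported frame vector are given by the coframe. Their derivative
  at \<open>0\<close> is the bracket of that frame vector with the generator, by \<open>flow_mixed_derivative\<close>.\<close>

lemma cocycle_derivative:
  assumes z: "z \<in> M"
  shows "((\<lambda>t. cocycle t z (x, y, w)) has_vector_derivative (l z * y, p z * y + w, k z * y + q z * w)) (at 0)"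
proof -
  obtain U and I :: "'i set" and e a b c where U: "atlas_open A U" "\<phi> 0 z \<in> U" "finite I" "U \<subseteq> M"
    and sm: "\<And>i. i \<in> I \<Longrightarrow> smooth_at A (\<phi> 0 z) (e i) \<and> smooth_at A (\<phi> 0 z) (a i) \<and> smooth_at A (\<phi> 0 z) (b i) \<and> smooth_at A (\<phi> 0 z) (c i)"
    and rep: "\<And>s z d. z \<in> M \<Longrightarrow> \<phi> s z \<in> U \<Longrightarrow> cocycle s z d =
      ((\<Sum>i\<in>I. a i (\<phi> s z) * frame z d (\<lambda>w. e i (\<phi> s w))),
       (\<Sum>i\<in>I. b i (\<phi> s z) * frame z d (\<lambda>w. e i (\<phi> s w))),
       (\<Sum>i\<in>I. c i (\<phi> s z) * frame z d (\<lambda>w. e i (\<phi> s w))))"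
    using cocycle_coframe[OF z, of 0] by blast
  let ?d = "(x, y, w)"
  have sm': "smooth_at A z (e i)" "smooth_at A z (a i)" "smooth_at A z (b i)" "smooth_at A z (c i)" if "i \<in> I" for i
    using sm[OF that] flow_0[OF z] by auto
  have ev: "\<forall>\<^sub>F t in nhds 0. \<phi> t z \<in> U" by (rule flow_eventually_time[OF z U(1,2)])
  note fd = flow_mixed_derivative(1)[OF z frame_in_tangent_space[OF z]]
  have D: "\<exists>r. ((\<lambda>t. \<Sum>i\<in>I. h i (\<phi> t z) * frame z ?d (\<lambda>w. e i (\<phi> t w))) has_real_derivative r) (at 0)"
    if "\<And>i. i \<in> I \<Longrightarrow> smooth_at A z (h i)" for h
    by (rule exI, rule DERIV_sum, rule DERIV_mult, rule flow_derivative[OF z that], assumption, rule fd, rule sm')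
  have comp: "\<exists>r. ((\<lambda>t. f (cocycle t z ?d)) has_real_derivative r) (at 0)"
    if h: "\<And>i. i \<in> I \<Longrightarrow> smooth_at A z (h i)" and F: "\<And>t. \<phi> t z \<in> U \<Longrightarrow> f (cocycle t z ?d) = (\<Sum>i\<in>I. h i (\<phi> t z) * frame z ?d (\<lambda>w. e i (\<phi> t w)))"
    for f :: "real \<times> real \<times> real \<Rightarrow> real" and h
  proof -
    have "\<forall>\<^sub>F t in nhds 0. f (cocycle t z ?d) = (\<Sum>i\<in>I. h i (\<phi> t z) * frame z ?d (\<lambda>w. e i (\<phi> t w)))"
      using ev by eventually_elim (rule F)
    note cong = DERIV_cong_ev[OF refl this refl]
    obtain r where "((\<lambda>t. \<Sum>i\<in>I. h i (\<phi> t z) * frame z ?d (\<lambda>w. e i (\<phi> t w))) has_real_derivative r) (at 0)"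
      using D[of h] h by blast
    then show ?thesis using cong[of r] by blast
  qed
  obtain X' where X: "((\<lambda>t. fst (cocycle t z ?d)) has_real_derivative X') (at 0)"
    using comp[of a fst] sm' rep[OF z] by auto
  obtain Y' where Y': "((\<lambda>t. fst (snd (cocycle t z ?d))) has_real_derivative Y') (at 0)"
    using comp[of b "\<lambda>c. fst (snd c)"] sm' rep[OF z] by auto
  obtain W' where W: "((\<lambda>t. snd (snd (cocycle t z ?d))) has_real_derivative W') (at 0)"
    using comp[of c "\<lambda>c. snd (snd c)"] sm' rep[OF z] by auto
  have "(X' - l z * y) * Y z f + (Y' - (p z * y + w)) * e2 z f + (W' - (k z * y + q z * w)) * e3 z f = 0"
    if f: "smooth_at A z f" for f
  proof -
    note Yf = flow_mixed_derivative(2)[OF z frame_tangent(1)[OF z] f] and e2f = frame_smooth(1)[OF z f] and e3f = frame_smooth(2)[OF z f]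
    have "((\<lambda>t. fst (cocycle t z ?d) * Y (\<phi> t z) f + fst (snd (cocycle t z ?d)) * e2 (\<phi> t z) f + snd (snd (cocycle t z ?d)) * e3 (\<phi> t z) f)
      has_real_derivative (X' * Y (\<phi> 0 z) f + Y z (\<lambda>w. Y w f) * fst (cocycle 0 z ?d)
         + (Y' * e2 (\<phi> 0 z) f + Y z (\<lambda>w. e2 w f) * fst (snd (cocycle 0 z ?d)))
         + (W' * e3 (\<phi> 0 z) f + Y z (\<lambda>w. e3 w f) * snd (snd (cocycle 0 z ?d))))) (at 0)"
      by (intro DERIV_add DERIV_mult X Y' W flow_derivative[OF z, of "\<lambda>w. Y w f"] flow_derivative[OF z, of "\<lambda>w. e2 w f"]
           flow_derivative[OF z, of "\<lambda>w. e3 w f"] Yf e2f e3f)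
    moreover have "((\<lambda>t. frame z ?d (\<lambda>q. f (\<phi> t q))) has_real_derivative frame z ?d (\<lambda>q. Y q f)) (at 0)" by (rule fd[OF f])
    moreover have "\<forall>\<^sub>F t in nhds 0. \<phi> t z \<in> {q \<in> M. smooth_at A q f}"
      by (rule flow_eventually_time[OF z atlas_open_smooth_at]) (simp add: flow_0[OF z] z f)
    then have "\<forall>\<^sub>F t in nhds 0. frame z ?d (\<lambda>q. f (\<phi> t q)) =
       fst (cocycle t z ?d) * Y (\<phi> t z) f + fst (snd (cocycle t z ?d)) * e2 (\<phi> t z) f + snd (snd (cocycle t z ?d)) * e3 (\<phi> t z) f"
    proof eventually_elim
      case (elim t)
      then have "frame z ?d (\<lambda>q. f (\<phi> t q)) = pushforward A (\<phi> t) z (frame z ?d) f" by (simp add: pushforward_def)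
      also have "\<dots> = frame (\<phi> t z) (cocycle t z ?d) f" by (simp only: pushforward_frame[OF z])
      finally show ?case by (simp only: frame_apply)
    qed
    ultimately have "frame z ?d (\<lambda>q. Y q f) = X' * Y (\<phi> 0 z) f + Y z (\<lambda>w. Y w f) * fst (cocycle 0 z ?d)
         + (Y' * e2 (\<phi> 0 z) f + Y z (\<lambda>w. e2 w f) * fst (snd (cocycle 0 z ?d)))
         + (W' * e3 (\<phi> 0 z) f + Y z (\<lambda>w. e3 w f) * snd (snd (cocycle 0 z ?d)))"
      using DERIV_cong_ev[OF refl _ refl] DERIV_unique by fast
    then have *: "X' * Y z f + Y' * e2 z f + W' * e3 z f
       = y * (e2 z (\<lambda>w. Y w f) - Y z (\<lambda>w. e2 w f)) + w * (e3 z (\<lambda>w. Y w f) - Y z (\<lambda>w. e3 w f))"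
      unfolding frame_apply flow_0[OF z] cocycle_0[OF z] by (simp add: algebra_simps)
    show ?thesis using *[unfolded bracket2[OF z f] bracket3[OF z f]] by (simp add: algebra_simps)
  qed
  from frame_independent[OF z this]
  have "X' = l z * y" "Y' = p z * y + w" "W' = k z * y + q z * w" by auto
  moreover have "((\<lambda>t. (fst (cocycle t z ?d), fst (snd (cocycle t z ?d)), snd (snd (cocycle t z ?d)))) has_vector_derivative (X', Y', W')) (at 0)"
    using X Y' W by (intro has_vector_derivative_Pair) (simp_all add: has_real_derivative_iff_has_vector_derivative)
  ultimately show ?thesis by simp
qed

end

section \<open>Invariant directions of a cone-preserving cocycle\<close>

subsection \<open>Differential inequalities\<close>

lemma exp_decay:
  fixes f :: "real \<Rightarrow> real"
  assumes "0 \<le> T" "\<And>t. 0 \<le> t \<Longrightarrow> t \<le> T \<Longrightarrow> (f has_real_derivative f' t) (at t)"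
    and "\<And>t. 0 \<le> t \<Longrightarrow> t \<le> T \<Longrightarrow> f' t \<le> - c * f t"
  shows "f T \<le> f 0 * exp (- c * T)"
proof -
  have "f T * exp (c * T) \<le> f 0 * exp (c * 0)"
  proof (rule DERIV_nonpos_imp_nonincreasing[OF assms(1)])
    fix t assume t: "0 \<le> t" "t \<le> T"
    have "((\<lambda>t. f t * exp (c * t)) has_real_derivative (f' t + c * f t) * exp (c * t)) (at t)"
      using assms(2)[OF t] by (auto intro!: derivative_eq_intros simp: algebra_simps)
    moreover have "(f' t + c * f t) * exp (c * t) \<le> 0"
      using assms(3)[OF t] by (intro mult_nonpos_nonneg) auto
    ultimately show "\<exists>y. ((\<lambda>t. f t * exp (c * t)) has_real_derivative y) (at t) \<and> y \<le> 0" by blast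
  qed
  then have "f T * exp (c * T) * exp (- c * T) \<le> f 0 * exp (- c * T)" by (simp add: mult_right_mono)
  then show ?thesis by (simp add: mult.assoc flip: exp_add)
qed

text \<open>After the last time at which \<open>f\<close> is nonnegative, \<open>f\<close> would be negative while \<open>f t * exp (- C * t)\<close> does
  not decrease.\<close>

lemma nonneg_invariant:
  fixes f :: "real \<Rightarrow> real"
  assumes T: "0 \<le> T" and d: "\<And>t. 0 \<le> t \<Longrightarrow> t \<le> T \<Longrightarrow> (f has_real_derivative f' t) (at t)"
    and f: "\<And>t. 0 \<le> t \<Longrightarrow> t \<le> T \<Longrightarrow> f' t \<ge> c t * f t" and c: "\<And>t. 0 \<le> t \<Longrightarrow> t \<le> T \<Longrightarrow> \<bar>c t\<bar> \<le> C"
    and 0: "f 0 \<ge> 0"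
  shows "f T \<ge> 0"
proof (rule ccontr)
  assume "\<not> f T \<ge> 0"
  let ?S = "{t \<in> {0..T}. f t \<ge> 0}"
  have cont: "continuous_on {0..T} f"
    by (intro continuous_at_imp_continuous_on ballI DERIV_isCont[OF d]) auto
  have "?S = {0..T} \<inter> f -` {0..}" by auto
  then have "closed ?S" using continuous_closed_preimage[OF cont] by simp
  moreover have "bounded ?S" by (rule bounded_subset[of "{0..T}"]) auto
  ultimately have "compact ?S" by (simp add: compact_eq_bounded_closed)
  moreover have "0 \<in> ?S" using 0 T by simp
  ultimately obtain s where s: "s \<in> ?S" "\<And>t. t \<in> ?S \<Longrightarrow> t \<le> s"
    using compact_attains_sup[of ?S] by blast
  have sT: "s < T" using s(1) \<open>\<not> f T \<ge> 0\<close> by (auto simp: le_less)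
  have neg: "f t < 0" if "s < t" "t \<le> T" for t using s(2)[of t] s(1) that by (auto simp: not_le[symmetric])
  have "f s * exp (- C * s) \<le> f T * exp (- C * T)"
  proof (rule DERIV_nonneg_imp_increasing_open[OF less_imp_le[OF sT]])
    fix t assume t: "s < t" "t < T"
    then have t': "0 \<le> t" "t \<le> T" using s(1) by auto
    have "((\<lambda>t. f t * exp (- C * t)) has_real_derivative (f' t - C * f t) * exp (- C * t)) (at t)"
      using d[OF t'] by (auto intro!: derivative_eq_intros simp: algebra_simps)
    moreover have "c t * f t \<ge> C * f t" using c[OF t'] neg[of t] t by (intro mult_right_mono_neg) auto
    then have "(f' t - C * f t) * exp (- C * t) \<ge> 0" using f[OF t'] by (intro mult_nonneg_nonneg) auto
    ultimately show "\<exists>y. ((\<lambda>t. f t * exp (- C * t)) has_real_derivative y) (at t) \<and> 0 \<le> y" by blast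
  next
    show "continuous_on {s..T} (\<lambda>t. f t * exp (- C * t))"
      using continuous_on_subset[OF cont, of "{s..T}"] s(1) by (intro continuous_intros) auto
  qed
  moreover have "f s * exp (- C * s) \<ge> 0" using s(1) by simp
  moreover have "f T * exp (- C * T) < 0" using \<open>\<not> f T \<ge> 0\<close> by (simp add: mult_neg_pos)
  ultimately show False by linarith
qed

lemma exp_cauchy_limit:
  fixes s :: "real \<Rightarrow> 'n \<Rightarrow> real"
  assumes cont: "\<And>T. T \<ge> 0 \<Longrightarrow> continuous_map X euclidean (s T)" and c: "c > 0"
    and cauchy: "\<And>T T' z. z \<in> topspace X \<Longrightarrow> 0 \<le> T \<Longrightarrow> T \<le> T' \<Longrightarrow> \<bar>s T' z - s T z\<bar> \<le> K * exp (- c * T)"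
  obtains w where "continuous_map X euclidean w"
    "\<And>z t. z \<in> topspace X \<Longrightarrow> 0 \<le> t \<Longrightarrow> (\<lambda>n. s (real n + t) z) \<longlonglongrightarrow> w z"
proof -
  have lim0: "(\<lambda>n. L * exp (- c * real n)) \<longlonglongrightarrow> 0" for L
  proof -
    have "(\<lambda>n. exp (- c) ^ n) \<longlonglongrightarrow> 0" using c by (intro LIMSEQ_power_zero) simp
    then have "(\<lambda>n. L * exp (- c) ^ n) \<longlonglongrightarrow> L * 0" by (intro tendsto_mult_left)
    then show ?thesis by (simp add: mult.commute flip: exp_of_nat_mult)
  qed
  have conv: "convergent (\<lambda>n. s (real n) z)" if z: "z \<in> topspace X" for z
  proof -
    have "Cauchy (\<lambda>n. s (real n) z)"
    proof (rule metric_CauchyI)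
      fix e :: real assume "e > 0"
      then obtain N where N: "\<And>n. n \<ge> N \<Longrightarrow> \<bar>K * exp (- c * real n)\<bar> < e / 2"
        using LIMSEQ_D[OF lim0, of "e / 2"] by auto
      have *: "dist (s (real n) z) (s (real N) z) < e / 2" if "n \<ge> N" for n
        using cauchy[OF z, of "real N" "real n"] N[of N] that by (simp add: dist_real_def)
      show "\<exists>M. \<forall>m\<ge>M. \<forall>n\<ge>M. dist (s (real m) z) (s (real n) z) < e"
        using * dist_triangle_half_l by blast
    qed
    then show ?thesis by (simp add: Cauchy_convergent_iff)
  qed
  define w where "w z = lim (\<lambda>n. s (real n) z)" for z
  have wl: "(\<lambda>n. s (real n) z) \<longlonglongrightarrow> w z" if "z \<in> topspace X" for z
    using conv[OF that] unfolding w_def by (simp add: convergent_LIMSEQ_iff)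
  have est: "\<bar>w z - s T z\<bar> \<le> K * exp (- c * T)" if "z \<in> topspace X" "0 \<le> T" for z T
  proof (rule tendsto_upperbound)
    show "(\<lambda>n. \<bar>s (real n) z - s T z\<bar>) \<longlonglongrightarrow> \<bar>w z - s T z\<bar>" by (intro tendsto_intros wl that)
    have "\<forall>\<^sub>F n in sequentially. T \<le> real n"
      using eventually_ge_at_top[of "nat \<lceil>T\<rceil>"] by eventually_elim linarith
    then show "\<forall>\<^sub>F n in sequentially. \<bar>s (real n) z - s T z\<bar> \<le> K * exp (- c * T)"
      by eventually_elim (use cauchy that in auto)
  qed simp
  have "continuous_map X (Met_TC.mtopology :: real topology) w"
  proof (rule Met_TC.continuous_map_uniform_limit[where F = sequentially and f = "\<lambda>n. s (real n)"])
    show "\<forall>\<^sub>F n in sequentially. continuous_map X (Met_TC.mtopology :: real topology) (s (real n))"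
      using cont by simp
    fix e :: real assume "e > 0"
    then have "\<forall>\<^sub>F n in sequentially. K * exp (- c * real n) < e" using order_tendstoD(2)[OF lim0] by blast
    then show "\<forall>\<^sub>F n in sequentially. \<forall>x\<in>topspace X. w x \<in> UNIV \<and> dist (s (real n) x) (w x) < e"
    proof eventually_elim
      case (elim n)
      show ?case
      proof
        fix z assume "z \<in> topspace X"
        from est[OF this, of "real n"] elim show "w z \<in> UNIV \<and> dist (s (real n) z) (w z) < e"
          by (simp add: dist_real_def abs_minus_commute)
      qed
    qed
  qed simp
  then have w: "continuous_map X euclidean w" by simp
  have "(\<lambda>n. s (real n + t) z) \<longlonglongrightarrow> w z" if z: "z \<in> topspace X" and t: "0 \<le> t" for z t
  proof (rule LIM_zero_cancel, rule Lim_null_comparison[OF _ lim0])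
    have "norm (s (real n + t) z - w z) \<le> \<bar>K\<bar> * exp (- c * real n)" for n
    proof -
      have "norm (s (real n + t) z - w z) \<le> K * exp (- c * (real n + t))"
        using est[OF z, of "real n + t"] t by (simp add: abs_minus_commute)
      also have "\<dots> \<le> \<bar>K\<bar> * exp (- c * real n)"
        using c t by (intro mult_mono) (auto simp: algebra_simps)
      finally show ?thesis .
    qed
    then show "\<forall>\<^sub>F n in sequentially. norm (s (real n + t) z - w z) \<le> \<bar>K\<bar> * exp (- c * real n)"
      by simp
  qed
  then show thesis by (rule that[OF w])
qed

subsection \<open>The cocycle of the Jacobi equation\<close>

text \<open>The operators \<open>S t z\<close> solve \<open>x' = l y\<close>, \<open>y' = p y + v\<close>, \<open>v' = k y + q v\<close> along the orbit of \<open>z\<close>. For the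
  geodesic flow, with \<open>l = p = q = 0\<close> and \<open>k = - K\<close>, the last two are the Jacobi equation.\<close>

locale cone_cocycle =
  fixes X :: "'n topology" and \<phi> :: "real \<Rightarrow> 'n \<Rightarrow> 'n"
    and S :: "real \<Rightarrow> 'n \<Rightarrow> real \<times> real \<times> real \<Rightarrow> real \<times> real \<times> real"
    and l p k q :: "'n \<Rightarrow> real" and B k0 :: real
  assumes flow_cont: "\<And>t. continuous_map X X (\<phi> t)"
    and flow_zero: "\<And>z. z \<in> topspace X \<Longrightarrow> \<phi> 0 z = z"
    and flow_plus: "\<And>z s t. z \<in> topspace X \<Longrightarrow> \<phi> (s + t) z = \<phi> s (\<phi> t z)"
    and S_linear: "\<And>z t. z \<in> topspace X \<Longrightarrow> linear (S t z)"
    and S_0: "\<And>z d. z \<in> topspace X \<Longrightarrow> S 0 z d = d"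
    and S_add: "\<And>z s t d. z \<in> topspace X \<Longrightarrow> S (s + t) z d = S s (\<phi> t z) (S t z d)"
    and S_generator: "\<And>z t. z \<in> topspace X \<Longrightarrow> S t z (1, 0, 0) = (1, 0, 0)"
    and S_derivative: "\<And>z x y v. z \<in> topspace X \<Longrightarrow>
       ((\<lambda>t. S t z (x, y, v)) has_vector_derivative (l z * y, p z * y + v, k z * y + q z * v)) (at 0)"
    and S_cont: "\<And>t d. continuous_map X euclidean (\<lambda>z. fst (S t z d))"
       "\<And>t d. continuous_map X euclidean (\<lambda>z. fst (snd (S t z d)))"
       "\<And>t d. continuous_map X euclidean (\<lambda>z. snd (snd (S t z d)))"
    and bounds: "\<And>z. z \<in> topspace X \<Longrightarrow> \<bar>l z\<bar> \<le> B" "\<And>z. z \<in> topspace X \<Longrightarrow> \<bar>p z\<bar> \<le> B"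
       "\<And>z. z \<in> topspace X \<Longrightarrow> \<bar>q z\<bar> \<le> B" "\<And>z. z \<in> topspace X \<Longrightarrow> k0 \<le> k z" "\<And>z. z \<in> topspace X \<Longrightarrow> k z \<le> B"
    and k0: "k0 > 0" and B: "B \<ge> 0"
begin

abbreviation "N \<equiv> topspace X"

lemma flow_in: "z \<in> N \<Longrightarrow> \<phi> t z \<in> N"
  using flow_cont[of t] by (auto simp: continuous_map_def)

lemma flow_cancel: "z \<in> N \<Longrightarrow> \<phi> t (\<phi> (- t) z) = z" "z \<in> N \<Longrightarrow> \<phi> (- t) (\<phi> t z) = z"
  using flow_plus[of z t "- t"] flow_plus[of z "- t" t] flow_zero[of z] by auto

lemma S_cancel: "z \<in> N \<Longrightarrow> S (- t) (\<phi> t z) (S t z d) = d"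
  using S_add[of z "- t" t d] S_0[of z d] by simp

lemma S_derivative_at:
  fixes z t and d :: "real \<times> real \<times> real"
  assumes z: "z \<in> N"
  defines "c \<equiv> \<lambda>t. S t z d" and "w \<equiv> \<lambda>t. \<phi> t z"
  shows "((\<lambda>t. fst (c t)) has_real_derivative l (w t) * fst (snd (c t))) (at t)"
    and "((\<lambda>t. fst (snd (c t))) has_real_derivative p (w t) * fst (snd (c t)) + snd (snd (c t))) (at t)"
    and "((\<lambda>t. snd (snd (c t))) has_real_derivative k (w t) * fst (snd (c t)) + q (w t) * snd (snd (c t))) (at t)"
proof -
  let ?D = "(l (w t) * fst (snd (c t)), p (w t) * fst (snd (c t)) + snd (snd (c t)), k (w t) * fst (snd (c t)) + q (w t) * snd (snd (c t)))"
  have "((\<lambda>s. S s (w t) (c t)) has_vector_derivative ?D) (at 0)"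
    using S_derivative[OF flow_in[OF z], of t "fst (c t)" "fst (snd (c t))" "snd (snd (c t))"] by (simp add: w_def)
  moreover have "((\<lambda>s. s - t) has_real_derivative 1) (at t)" by (auto intro!: derivative_eq_intros)
  ultimately have "((\<lambda>s. S (s - t) (w t) (c t)) has_vector_derivative ?D) (at t)"
    using vector_diff_chain_at[of "\<lambda>s. s - t" 1 t "\<lambda>s. S s (w t) (c t)" ?D]
    by (simp add: has_real_derivative_iff_has_vector_derivative o_def)
  moreover have "S (s - t) (w t) (c t) = c s" for s
    using S_add[OF z, of "s - t" t d] by (simp add: c_def w_def)
  ultimately have D: "(c has_vector_derivative ?D) (at t)" by simp
  from bounded_linear.has_vector_derivative[OF bounded_linear_fst D]
  show "((\<lambda>t. fst (c t)) has_real_derivative l (w t) * fst (snd (c t))) (at t)"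
    by (simp add: has_real_derivative_iff_has_vector_derivative)
  note D2 = bounded_linear.has_vector_derivative[OF bounded_linear_snd D]
  from bounded_linear.has_vector_derivative[OF bounded_linear_fst D2]
  show "((\<lambda>t. fst (snd (c t))) has_real_derivative p (w t) * fst (snd (c t)) + snd (snd (c t))) (at t)"
    by (simp add: has_real_derivative_iff_has_vector_derivative)
  from bounded_linear.has_vector_derivative[OF bounded_linear_snd D2]
  show "((\<lambda>t. snd (snd (c t))) has_real_derivative k (w t) * fst (snd (c t)) + q (w t) * snd (snd (c t))) (at t)"
    by (simp add: has_real_derivative_iff_has_vector_derivative)
qed

text \<open>The slope \<open>s = v / y\<close> satisfies the Riccati equation \<open>s' = k + (q - p) s - s\<^sup>2\<close>. For \<open>k \<ge> k0 > 0\<close> and the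
  values \<open>m\<close> and \<open>W\<close> its right-hand side is nonnegative at \<open>s = m\<close> and nonpositive at \<open>s = W\<close>.\<close>

definition m :: real where "m = min 1 (k0 / (2 * B + 1))"
definition W :: real where "W = 2 * B + 2"

lemma mW: "0 < m" "m < W" "m \<le> 1" using k0 B by (auto simp: m_def W_def)

lemma slope_barriers:
  assumes "z \<in> N" shows "k z + (q z - p z) * m - m\<^sup>2 \<ge> 0" "W\<^sup>2 - (q z - p z) * W - k z \<ge> 0"
proof -
  have qp: "\<bar>q z - p z\<bar> \<le> 2 * B" using bounds(2,3)[OF assms] by linarith
  have "m \<le> k0 / (2 * B + 1)" by (simp add: m_def)
  then have "m * (2 * B + 1) \<le> k0" using B by (simp add: pos_le_divide_eq)
  moreover have "\<bar>(q z - p z) * m\<bar> \<le> 2 * B * m" using qp mW by (simp add: abs_mult mult_right_mono)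
  moreover have "m\<^sup>2 \<le> m" using mW by (simp add: power2_eq_square mult_left_le)
  ultimately show "k z + (q z - p z) * m - m\<^sup>2 \<ge> 0" using bounds(4)[OF assms] by (simp add: algebra_simps abs_le_iff)
  have "W > 0" using mW by linarith
  then have "(q z - p z) * W \<le> 2 * B * W" using qp by (intro mult_right_mono) auto
  moreover have "W\<^sup>2 = 2 * B * W + 2 * W" by (simp add: W_def power2_eq_square algebra_simps)
  moreover have "B \<le> 2 * W" using B by (simp add: W_def)
  ultimately show "W\<^sup>2 - (q z - p z) * W - k z \<ge> 0" using bounds(5)[OF assms] by linarith
qed

definition in_cone :: "real \<times> real \<times> real \<Rightarrow> bool"
  where "in_cone d \<longleftrightarrow> fst (snd d) \<noteq> 0 \<and> m \<le> snd (snd d) / fst (snd d) \<and> snd (snd d) / fst (snd d) \<le> W"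

lemma in_cone_iff: "in_cone d \<longleftrightarrow> fst (snd d) \<noteq> 0 \<and> (snd (snd d) - m * fst (snd d)) * (W * fst (snd d) - snd (snd d)) \<ge> 0"
proof (cases "fst (snd d) = 0")
  case False
  let ?y = "fst (snd d)" and ?w = "snd (snd d) / fst (snd d)"
  have "(snd (snd d) - m * ?y) * (W * ?y - snd (snd d)) = ?y\<^sup>2 * ((?w - m) * (W - ?w))"
    using False by (simp add: field_simps power2_eq_square)
  moreover have "?y\<^sup>2 > 0" using False by simp
  ultimately have "(snd (snd d) - m * ?y) * (W * ?y - snd (snd d)) \<ge> 0 \<longleftrightarrow> (?w - m) * (W - ?w) \<ge> 0"
    by (simp add: zero_le_mult_iff)
  also have "\<dots> \<longleftrightarrow> m \<le> ?w \<and> ?w \<le> W" using mW(2) by (auto simp: zero_le_mult_iff)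
  finally show ?thesis using False by (simp add: in_cone_def)
qed (simp add: in_cone_def)

text \<open>The cone is \<open>Q \<ge> 0\<close> for \<open>Q = (v - m y) (W y - v)\<close>, and \<open>Q' \<ge> (p + q) Q\<close> by the barriers. The component
  \<open>y\<close> cannot vanish on the way: \<open>v\<close> would vanish with it, leaving a multiple of the generator, which
  is transported to itself.\<close>

lemma in_cone_invariant:
  assumes z: "z \<in> N" and d: "in_cone d" and T: "0 \<le> T" shows "in_cone (S T z d)"
proof -
  let ?y = "\<lambda>t. fst (snd (S t z d))" and ?v = "\<lambda>t. snd (snd (S t z d))"
  let ?Q = "\<lambda>t. (?v t - m * ?y t) * (W * ?y t - ?v t)"
  have "?Q T \<ge> 0"
  proof (rule nonneg_invariant[OF T, where c = "\<lambda>t. p (\<phi> t z) + q (\<phi> t z)" and C = "2 * B"])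
    fix t
    let ?p = "p (\<phi> t z)" and ?q = "q (\<phi> t z)" and ?k = "k (\<phi> t z)"
    let ?Q' = "(?k * ?y t + ?q * ?v t - m * (?p * ?y t + ?v t)) * (W * ?y t - ?v t)
       + (?v t - m * ?y t) * (W * (?p * ?y t + ?v t) - (?k * ?y t + ?q * ?v t))"
    show "(?Q has_real_derivative ?Q') (at t)"
      using S_derivative_at(2,3)[OF z, where d = d and t = t]
      by (auto intro!: derivative_eq_intros simp: algebra_simps)
    \<comment> \<open>a sum of squares whose weights are the two barriers\<close>
    have "(W - m) * (?Q' - (?p + ?q) * ?Q t) = (?k + (?q - ?p) * m - m\<^sup>2) * (W * ?y t - ?v t)\<^sup>2
        + (W\<^sup>2 - (?q - ?p) * W - ?k) * (?v t - m * ?y t)\<^sup>2"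
      by (simp add: power2_eq_square algebra_simps)
    also have "\<dots> \<ge> 0" using slope_barriers[OF flow_in[OF z, of t]] by (intro add_nonneg_nonneg mult_nonneg_nonneg) auto
    finally show "(?p + ?q) * ?Q t \<le> ?Q'" using mW(2) by (simp add: zero_le_mult_iff)
    show "\<bar>?p + ?q\<bar> \<le> 2 * B" using bounds(2,3)[OF flow_in[OF z, of t]] by linarith
    show "?Q 0 \<ge> 0" using d S_0[OF z] by (simp add: in_cone_iff)
  qed
  moreover have "?y T \<noteq> 0"
  proof
    assume y: "?y T = 0"
    then have "(?v T)\<^sup>2 \<le> 0" using \<open>?Q T \<ge> 0\<close> by (simp add: power2_eq_square)
    then have v: "?v T = 0" by simp
    have "S T z d = fst (S T z d) *\<^sub>R (1, 0, 0)" using y v by (simp add: prod_eq_iff)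
    then have "d = S (- T) (\<phi> T z) (fst (S T z d) *\<^sub>R (1, 0, 0))" using S_cancel[OF z, of T d] by metis
    also have "\<dots> = fst (S T z d) *\<^sub>R (1, 0, 0)"
      by (simp only: linear_scale[OF S_linear[OF flow_in[OF z]]] S_generator[OF flow_in[OF z]])
    finally have "fst (snd d) = 0" by (metis fst_conv mult_zero_right scaleR_Pair snd_conv real_scaleR_def)
    then show False using d by (simp add: in_cone_def)
  qed
  ultimately show ?thesis by (simp add: in_cone_iff)
qed

definition slope :: "real \<times> real \<times> real \<Rightarrow> real"
  where "slope d = snd (snd d) / fst (snd d)"

lemma slope_derivative:
  fixes z t and d :: "real \<times> real \<times> real"
  assumes z: "z \<in> N" and y: "fst (snd (S t z d)) \<noteq> 0"
  defines "w \<equiv> slope (S t z d)"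
  shows "((\<lambda>t. slope (S t z d)) has_real_derivative k (\<phi> t z) + (q (\<phi> t z) - p (\<phi> t z)) * w - w\<^sup>2) (at t)"
proof -
  let ?y = "fst (snd (S t z d))" and ?v = "snd (snd (S t z d))"
  have "((\<lambda>t. slope (S t z d)) has_real_derivative
     ((k (\<phi> t z) * ?y + q (\<phi> t z) * ?v) * ?y - ?v * (p (\<phi> t z) * ?y + ?v)) / (?y * ?y)) (at t)"
    unfolding slope_def by (rule DERIV_divide[OF S_derivative_at(3,2)[OF z] y])
  also have "((k (\<phi> t z) * ?y + q (\<phi> t z) * ?v) * ?y - ?v * (p (\<phi> t z) * ?y + ?v)) / (?y * ?y)
     = k (\<phi> t z) + (q (\<phi> t z) - p (\<phi> t z)) * w - w\<^sup>2"
    using y by (simp add: w_def slope_def field_simps power2_eq_square)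
  finally show ?thesis .
qed

text \<open>The distance of two slopes \<open>a\<close>, \<open>b\<close> is measured by \<open>R = (a - b)\<^sup>2 / (a b)\<close>. The coefficient \<open>q - p\<close> cancels
  in its derivative, which is \<open>- R (a + b + k / a + k / b)\<close>.\<close>

lemma slope_contraction:
  assumes z: "z \<in> N" and d: "in_cone d" "in_cone d'" and T: "0 \<le> T"
  shows "\<bar>slope (S T z d) - slope (S T z d')\<bar> \<le> W\<^sup>2 / m * exp (- m * T)"
proof -
  let ?w = "\<lambda>t. slope (S t z d)" and ?w' = "\<lambda>t. slope (S t z d')"
  let ?R = "\<lambda>t. (?w t - ?w' t)\<^sup>2 / (?w t * ?w' t)"
  have W0: "W > 0" using mW by linarith
  have w: "m \<le> ?w t" "?w t \<le> W" "m \<le> ?w' t" "?w' t \<le> W" if "0 \<le> t" for t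
    using in_cone_invariant[OF z d(1) that] in_cone_invariant[OF z d(2) that] by (auto simp: in_cone_def slope_def)
  have R: "?R T \<le> ?R 0 * exp (- (2 * m) * T)"
  proof (rule exp_decay[OF T])
    fix t :: real assume t: "0 \<le> t" "t \<le> T"
    let ?k = "k (\<phi> t z)" and ?r = "q (\<phi> t z) - p (\<phi> t z)"
    note pos = w[OF t(1)]
    have nz: "fst (snd (S t z d)) \<noteq> 0" "fst (snd (S t z d')) \<noteq> 0"
      using in_cone_invariant[OF z d(1) t(1)] in_cone_invariant[OF z d(2) t(1)] by (auto simp: in_cone_def)
    have p0: "?w t > 0" "?w' t > 0" using pos mW(1) by linarith+
    define a b where "a = ?w t" and "b = ?w' t"
    have ab: "a > 0" "b > 0" "m \<le> a" "m \<le> b" using p0 pos by (auto simp: a_def b_def)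
    have der: "(?R has_real_derivative
        (2 * (a - b) * ((?k + ?r * a - a\<^sup>2) - (?k + ?r * b - b\<^sup>2)) * (a * b)
         - (a - b)\<^sup>2 * ((?k + ?r * a - a\<^sup>2) * b + (?k + ?r * b - b\<^sup>2) * a)) / ((a * b) * (a * b))) (at t)"
    proof (rule DERIV_cong[OF DERIV_divide[OF DERIV_power[OF DERIV_diff[OF slope_derivative[OF z nz(1)] slope_derivative[OF z nz(2)]]]
            DERIV_mult[OF slope_derivative[OF z nz(1)] slope_derivative[OF z nz(2)]]]])
      show "?w t * ?w' t \<noteq> 0" using p0 by simp
    qed (simp add: a_def b_def power2_eq_square algebra_simps)
    have "(2 * (a - b) * ((?k + ?r * a - a\<^sup>2) - (?k + ?r * b - b\<^sup>2)) * (a * b)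
         - (a - b)\<^sup>2 * ((?k + ?r * a - a\<^sup>2) * b + (?k + ?r * b - b\<^sup>2) * a)) / ((a * b) * (a * b))
       = - ((a - b)\<^sup>2 / (a * b)) * (a + b + ?k / a + ?k / b)"
      using ab(1,2) by (simp add: field_simps) (simp add: power2_eq_square algebra_simps)
    note der' = der[unfolded this]
    show "(?R has_real_derivative - ((a - b)\<^sup>2 / (a * b)) * (a + b + ?k / a + ?k / b)) (at t)"
      by (rule der')
    have "?k > 0" using bounds(4)[OF flow_in[OF z, of t]] k0 by linarith
    then have "2 * m \<le> a + b + ?k / a + ?k / b" using ab by (simp add: add_increasing2)
    then have "(a - b)\<^sup>2 / (a * b) * (2 * m) \<le> (a - b)\<^sup>2 / (a * b) * (a + b + ?k / a + ?k / b)"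
      using ab by (intro mult_left_mono) auto
    then show "- ((a - b)\<^sup>2 / (a * b)) * (a + b + ?k / a + ?k / b) \<le> - (2 * m) * ?R t"
      by (simp add: a_def b_def mult.commute)
  qed
  have "(?w T - ?w' T)\<^sup>2 = ?R T * (?w T * ?w' T)" using w[OF T] mW(1) by (simp add: less_le_trans)
  also have "\<dots> \<le> ?R T * (W * W)"
    using w[OF T] mW(1) W0 by (intro mult_left_mono mult_mono divide_nonneg_nonneg mult_nonneg_nonneg) auto
  also have "\<dots> \<le> (?R 0 * exp (- (2 * m) * T)) * (W * W)" using R W0 by (intro mult_right_mono) auto
  also have "?R 0 \<le> W\<^sup>2 / (m * m)"
  proof (rule frac_le)
    have "\<bar>?w 0 - ?w' 0\<bar> \<le> W" using w[of 0] mW(1) by linarith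
    then show "(?w 0 - ?w' 0)\<^sup>2 \<le> W\<^sup>2" by (simp add: abs_le_square_iff[symmetric] W0 less_imp_le)
    show "m * m \<le> ?w 0 * ?w' 0" using w[of 0] mW(1) by (intro mult_mono) auto
  qed (use mW(1) W0 in auto)
  finally have "(?w T - ?w' T)\<^sup>2 \<le> W\<^sup>2 / (m * m) * exp (- (2 * m) * T) * (W * W)"
    using W0 by (simp add: mult_right_mono)
  also have "exp (- (2 * m) * T) = (exp (- m * T))\<^sup>2" by (simp add: power2_eq_square flip: exp_add)
  also have "W\<^sup>2 / (m * m) * (exp (- m * T))\<^sup>2 * (W * W) = (W\<^sup>2 / m * exp (- m * T))\<^sup>2"
    by (simp add: power2_eq_square)
  finally show ?thesis using mW(1) W0 by (simp add: abs_le_square_iff[symmetric] abs_mult)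
qed

end

subsection \<open>Invariant line fields\<close>

context cone_cocycle begin

lemma in_coneI: "m \<le> a \<Longrightarrow> a \<le> W \<Longrightarrow> in_cone (x, 1, a)"
  by (simp add: in_cone_def)

lemma S_cont_pullback:
  "continuous_map X euclideanreal (\<lambda>z. fst (S t (\<phi> s z) d))"
  "continuous_map X euclideanreal (\<lambda>z. fst (snd (S t (\<phi> s z) d)))"
  "continuous_map X euclideanreal (\<lambda>z. snd (snd (S t (\<phi> s z) d)))"
  using continuous_map_compose[OF flow_cont S_cont(1)] continuous_map_compose[OF flow_cont S_cont(2)]
    continuous_map_compose[OF flow_cont S_cont(3)] by (simp_all add: o_def)

lemma S_affine:
  assumes "z \<in> N" "y \<noteq> 0" shows "S t z (x, y, v) = (x, 0, 0) + y *\<^sub>R S t z (0, 1, v / y)"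
proof -
  have "(x, y, v) = x *\<^sub>R (1, 0, 0) + y *\<^sub>R (0, 1, v / y)" using assms by simp
  then have "S t z (x, y, v) = x *\<^sub>R S t z (1, 0, 0) + y *\<^sub>R S t z (0, 1, v / y)"
    by (simp only: linear_add[OF S_linear[OF assms(1)]] linear_scale[OF S_linear[OF assms(1)]])
  then show ?thesis by (simp add: S_generator[OF assms(1)])
qed

lemma S_split: "z \<in> N \<Longrightarrow> S t z (0, 1, a) = S t z (0, 1, 0) + a *\<^sub>R S t z (0, 0, 1)"
  using linear_add[OF S_linear, of z t "(0, 1, 0)" "(0, 0, a)"] linear_scale[OF S_linear, of z t a "(0, 0, 1)"] by simp

lemma slope_S: "z \<in> N \<Longrightarrow> fst (snd d) \<noteq> 0 \<Longrightarrow> slope (S t z d) = slope (S t z (0, 1, slope d))"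
  using S_affine[of z "fst (snd d)" t "fst d" "snd (snd d)"] by (simp add: slope_def)

text \<open>The vector on the edge \<open>v = m y\<close> of the cone is pushed forward from ever earlier times. By
  \<open>slope_contraction\<close> its slopes converge uniformly, so that the limit is continuous.\<close>

lemma unstable_slope:
  obtains w where "continuous_map X euclideanreal w" "\<And>z. z \<in> N \<Longrightarrow> m \<le> w z \<and> w z \<le> W"
    "\<And>z t. z \<in> N \<Longrightarrow> 0 \<le> t \<Longrightarrow> slope (S t z (0, 1, w z)) = w (\<phi> t z)"
proof -
  let ?s = "\<lambda>T z. slope (S T (\<phi> (- T) z) (0, 1, m))"
  let ?K = "W\<^sup>2 / m"
  have cone: "in_cone (S T (\<phi> (- T) z) (0, 1, m))" if "z \<in> N" "0 \<le> T" for z T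
    using mW by (intro in_cone_invariant[OF flow_in[OF that(1)] in_coneI that(2)]) auto
  have cont: "continuous_map X euclideanreal (?s T)" if "T \<ge> 0" for T
    unfolding slope_def using cone that by (intro continuous_map_real_divide S_cont_pullback) (auto simp: in_cone_def)
  have cauchy: "\<bar>?s T' z - ?s T z\<bar> \<le> ?K * exp (- m * T)" if z: "z \<in> N" and T: "0 \<le> T" "T \<le> T'" for T T' z
  proof -
    let ?e = "S (T' - T) (\<phi> (- T') z) (0, 1, m)"
    have e: "in_cone ?e" using mW T by (intro in_cone_invariant[OF flow_in[OF z] in_coneI]) auto
    have f: "\<phi> (T' - T) (\<phi> (- T') z) = \<phi> (- T) z" using flow_plus[OF z, of "T' - T" "- T'"] by simp
    have "S T' (\<phi> (- T') z) (0, 1, m) = S T (\<phi> (- T) z) ?e"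
      using S_add[OF flow_in[OF z], of T "T' - T" "- T'" "(0, 1, m)"] f by simp
    then show ?thesis
      using slope_contraction[OF flow_in[OF z] e in_coneI[of m 0] T(1), of "- T"] mW by simp
  qed
  obtain w where w: "continuous_map X euclideanreal w"
    and lim: "\<And>z t. z \<in> N \<Longrightarrow> 0 \<le> t \<Longrightarrow> (\<lambda>n. ?s (real n + t) z) \<longlonglongrightarrow> w z"
    using exp_cauchy_limit[of X ?s m ?K, OF cont mW(1) cauchy] by blast
  have bnd: "m \<le> w z \<and> w z \<le> W" if z: "z \<in> N" for z
  proof
    have c: "m \<le> ?s (real n + 0) z" "?s (real n + 0) z \<le> W" for n using cone[OF z, of "real n"] by (auto simp: in_cone_def slope_def)
    show "m \<le> w z" by (rule LIMSEQ_le_const[OF lim[OF z order_refl]]) (use c in blast)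
    show "w z \<le> W" by (rule LIMSEQ_le_const2[OF lim[OF z order_refl]]) (use c in blast)
  qed
  have inv: "slope (S t z (0, 1, w z)) = w (\<phi> t z)" if z: "z \<in> N" and t: "0 \<le> t" for z t
  proof -
    let ?a = "\<lambda>n. ?s (real n + 0) z"
    \<comment> \<open>the approximation from time \<open>- n\<close>, transported by \<open>t\<close>, is the one from time \<open>- (n + t)\<close>\<close>
    have a: "slope (S t z (0, 1, ?a n)) = ?s (real n + t) (\<phi> t z)" for n
    proof -
      let ?c = "S (real n) (\<phi> (- real n) z) (0, 1, m)"
      have "fst (snd ?c) \<noteq> 0" using cone[OF z, of "real n"] by (simp add: in_cone_def)
      then have "slope (S t z ?c) = slope (S t z (0, 1, ?a n))" using slope_S[OF z, of ?c t] by simp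
      moreover have "S t z ?c = S (real n + t) (\<phi> (- (real n + t)) (\<phi> t z)) (0, 1, m)"
        using S_add[OF flow_in[OF z], of t "real n" "- real n" "(0, 1, m)"] flow_cancel(1)[OF z, of "real n"]
          flow_plus[OF z, of "- (real n + t)" t] by (simp add: add.commute)
      ultimately show ?thesis by simp
    qed
    have "in_cone (S t z (0, 1, w z))" using bnd[OF z] by (intro in_cone_invariant[OF z in_coneI t]) auto
    then have nz: "fst (snd (S t z (0, 1, w z))) \<noteq> 0" by (simp add: in_cone_def)
    define y0 y1 v0 v1 where "y0 = fst (snd (S t z (0, 1, 0)))" and "y1 = fst (snd (S t z (0, 0, 1)))"
      and "v0 = snd (snd (S t z (0, 1, 0)))" and "v1 = snd (snd (S t z (0, 0, 1)))"
    have sl: "slope (S t z (0, 1, a)) = (v0 + a * v1) / (y0 + a * y1)" for a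
      by (subst S_split[OF z, of t a]) (simp add: slope_def y0_def y1_def v0_def v1_def)
    have nz': "y0 + w z * y1 \<noteq> 0"
      using nz by (subst (asm) S_split[OF z, of t "w z"]) (simp add: y0_def y1_def)
    have "(\<lambda>n. (v0 + ?a n * v1) / (y0 + ?a n * y1)) \<longlonglongrightarrow> (v0 + w z * v1) / (y0 + w z * y1)"
      by (intro tendsto_intros lim[OF z order_refl] nz')
    then have "(\<lambda>n. slope (S t z (0, 1, ?a n))) \<longlonglongrightarrow> slope (S t z (0, 1, w z))"
      by (simp only: sl)
    then show ?thesis
      unfolding a using lim[OF flow_in[OF z] t] LIMSEQ_unique by blast
  qed
  show thesis by (rule that[OF w bnd inv])
qed

lemma line_field_group:
  assumes P: "\<And>z. z \<in> N \<Longrightarrow> fst (snd (P z)) = 1"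
    and pos: "\<And>z t. z \<in> N \<Longrightarrow> 0 \<le> t \<Longrightarrow> \<exists>x r. r \<noteq> 0 \<and> S t z (P z) = (x, 0, 0) + r *\<^sub>R P (\<phi> t z)"
    and z: "z \<in> N"
  shows "\<exists>x r. r \<noteq> 0 \<and> S t z (P z) = (x, 0, 0) + r *\<^sub>R P (\<phi> t z)"
proof (cases "0 \<le> t")
  case False
  let ?z = "\<phi> t z"
  obtain x r where r: "r \<noteq> 0" "S (- t) ?z (P ?z) = (x, 0, 0) + r *\<^sub>R P z"
    using pos[OF flow_in[OF z, of t], of "- t"] False flow_cancel(2)[OF z, of t] by auto
  have "S t z (x, 0, 0) = (x, 0, 0)"
    using linear_scale[OF S_linear[OF z], of t x "(1, 0, 0)"] S_generator[OF z] by simp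
  then have "S t z ((x, 0, 0) + r *\<^sub>R P z) = (x, 0, 0) + r *\<^sub>R S t z (P z)"
    by (simp only: linear_add[OF S_linear[OF z]] linear_scale[OF S_linear[OF z]])
  moreover have "S t z ((x, 0, 0) + r *\<^sub>R P z) = P ?z"
    using S_cancel[OF flow_in[OF z, of t], of "- t" "P ?z"] r(2) flow_cancel(2)[OF z, of t] by simp
  ultimately have e: "r *\<^sub>R S t z (P z) = P ?z - (x, 0, 0)" by (simp add: algebra_simps)
  have "S t z (P z) = (1 / r) *\<^sub>R (r *\<^sub>R S t z (P z))" using r(1) by simp
  also have "\<dots> = (- x / r, 0, 0) + (1 / r) *\<^sub>R P ?z" unfolding e by (simp add: prod_eq_iff algebra_simps)
  finally show ?thesis using r(1) by (metis divide_eq_0_iff zero_neq_one)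
qed (use pos[OF z] in blast)

lemma unstable_line:
  obtains w where "continuous_map X euclideanreal w" "\<And>z. z \<in> N \<Longrightarrow> m \<le> w z \<and> w z \<le> W"
    "\<And>z t. z \<in> N \<Longrightarrow> \<exists>x r. r \<noteq> 0 \<and> S t z (0, 1, w z) = (x, 0, 0) + r *\<^sub>R (0, 1, w (\<phi> t z))"
proof -
  obtain w where w: "continuous_map X euclideanreal w" "\<And>z. z \<in> N \<Longrightarrow> m \<le> w z \<and> w z \<le> W"
    "\<And>z t. z \<in> N \<Longrightarrow> 0 \<le> t \<Longrightarrow> slope (S t z (0, 1, w z)) = w (\<phi> t z)"
    using unstable_slope by blast
  have "\<exists>x r. r \<noteq> 0 \<and> S t z (0, 1, w z) = (x, 0, 0) + r *\<^sub>R (0, 1, w (\<phi> t z))" if z: "z \<in> N" and t: "0 \<le> t" for z t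
  proof -
    let ?c = "S t z (0, 1, w z)"
    have "in_cone ?c" using w(2)[OF z] by (intro in_cone_invariant[OF z in_coneI t]) auto
    then have "fst (snd ?c) \<noteq> 0" by (simp add: in_cone_def)
    moreover from this have "?c = (fst ?c, 0, 0) + fst (snd ?c) *\<^sub>R (0, 1, w (\<phi> t z))"
      using w(3)[OF z t] by (simp add: prod_eq_iff slope_def field_simps)
    ultimately show ?thesis by blast
  qed
  then show thesis
    using line_field_group[of "\<lambda>z. (0, 1, w z)"] by (intro that[OF w(1,2)]) auto
qed

text \<open>The ratio of the two \<open>y\<close>-components has the difference of the slopes as its logarithmic derivative.\<close>

lemma growth_gap:
  assumes z: "z \<in> N" and T: "0 \<le> T"
    and u: "\<And>t. 0 \<le> t \<Longrightarrow> fst (snd (S t z (x, 1, a))) \<noteq> 0 \<and> m \<le> slope (S t z (x, 1, a))"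
    and s: "\<And>t. 0 \<le> t \<Longrightarrow> fst (snd (S t z (x', 1, b))) \<noteq> 0 \<and> slope (S t z (x', 1, b)) \<le> - m"
  shows "\<bar>fst (snd (S T z (x', 1, b)))\<bar> \<le> \<bar>fst (snd (S T z (x, 1, a)))\<bar> * exp (- (2 * m) * T)"
proof -
  let ?u = "\<lambda>t. fst (snd (S t z (x, 1, a)))" and ?s = "\<lambda>t. fst (snd (S t z (x', 1, b)))"
  let ?\<sigma> = "\<lambda>t. slope (S t z (x', 1, b)) - slope (S t z (x, 1, a))"
  have "(?s T / ?u T)\<^sup>2 \<le> (?s 0 / ?u 0)\<^sup>2 * exp (- (4 * m) * T)"
  proof (rule exp_decay[OF T])
    fix t :: real assume t: "0 \<le> t" "t \<le> T"
    have nz: "?u t \<noteq> 0" "?s t \<noteq> 0" using u[OF t(1)] s[OF t(1)] by auto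
    show "((\<lambda>t. (?s t / ?u t)\<^sup>2) has_real_derivative 2 * ?\<sigma> t * (?s t / ?u t)\<^sup>2) (at t)"
      using nz
      by (auto intro!: derivative_eq_intros S_derivative_at(2)[OF z] simp: slope_def field_simps power2_eq_square)
    have "?\<sigma> t \<le> - (2 * m)" using u[OF t(1)] s[OF t(1)] by linarith
    then have "2 * ?\<sigma> t * (?s t / ?u t)\<^sup>2 \<le> - (4 * m) * (?s t / ?u t)\<^sup>2" by (intro mult_right_mono) auto
    then show "2 * ?\<sigma> t * (?s t / ?u t)\<^sup>2 \<le> - (4 * m) * (?s t / ?u t)\<^sup>2" .
  qed
  also have "?s 0 / ?u 0 = 1" by (simp add: S_0[OF z])
  also have "1\<^sup>2 * exp (- (4 * m) * T) = (exp (- (2 * m) * T))\<^sup>2" by (simp add: power2_eq_square flip: exp_add)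
  finally have "\<bar>?s T / ?u T\<bar> \<le> exp (- (2 * m) * T)" by (simp add: abs_le_square_iff[symmetric])
  then show ?thesis using u[OF T] by (simp add: field_simps)
qed

text \<open>The form in the hypothesis is the derivative of \<open>y v\<close>. On the cone \<open>y v\<close> is comparable to \<open>y\<^sup>2\<close>, so both
  grow exponentially. The derivative \<open>l y\<close> of \<open>x\<close> is then bounded by that of a multiple of
  \<open>sqrt (y v)\<close>.\<close>

lemma unstable_growth:
  assumes e: "e > 0" "\<And>z y v. z \<in> N \<Longrightarrow> v\<^sup>2 + (p z + q z) * y * v + k z * y\<^sup>2 \<ge> e * y\<^sup>2"
    and z: "z \<in> N" and a: "m \<le> a" "a \<le> W" and T: "0 \<le> T"
  shows "(fst (snd (S T z (x, 1, a))))\<^sup>2 \<ge> m / W * exp (e / W * T)"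
    and "\<bar>fst (S T z (x, 1, a)) - x\<bar> \<le> 2 * B * W / e * \<bar>fst (snd (S T z (x, 1, a)))\<bar>"
proof -
  let ?x = "\<lambda>t. fst (S t z (x, 1, a))" and ?y = "\<lambda>t. fst (snd (S t z (x, 1, a)))" and ?v = "\<lambda>t. snd (snd (S t z (x, 1, a)))"
  let ?Q = "\<lambda>t. ?y t * ?v t"
  let ?Q' = "\<lambda>t. (?v t)\<^sup>2 + (p (\<phi> t z) + q (\<phi> t z)) * ?y t * ?v t + k (\<phi> t z) * (?y t)\<^sup>2"
  have W0: "W > 0" using mW by linarith
  have cone: "in_cone (S t z (x, 1, a))" if "0 \<le> t" for t by (rule in_cone_invariant[OF z in_coneI[OF a] that])
  have Q: "m * (?y t)\<^sup>2 \<le> ?Q t" "?Q t \<le> W * (?y t)\<^sup>2" "(?y t)\<^sup>2 > 0" if "0 \<le> t" for t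
  proof -
    have c: "?y t \<noteq> 0" "m \<le> ?v t / ?y t" "?v t / ?y t \<le> W" using cone[OF that] by (auto simp: in_cone_def)
    define r where "r = ?v t / ?y t"
    have Q: "?Q t = r * (?y t)\<^sup>2" using c(1) by (simp add: r_def power2_eq_square)
    show "m * (?y t)\<^sup>2 \<le> ?Q t" "?Q t \<le> W * (?y t)\<^sup>2"
      unfolding Q using c(2,3) unfolding r_def[symmetric] by (auto intro: mult_right_mono)
    show "(?y t)\<^sup>2 > 0" using c by simp
  qed
  have Qpos: "?Q t > 0" if "0 \<le> t" for t using Q[OF that] mW(1) by (metis less_le_trans mult_pos_pos)
  have dQ: "(?Q has_real_derivative ?Q' t) (at t)" for t
    using S_derivative_at(2,3)[OF z, where d = "(x, 1, a)" and t = t]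
    by (auto intro!: derivative_eq_intros simp: algebra_simps power2_eq_square)
  have Q': "?Q' t \<ge> e * (?y t)\<^sup>2" for t by (rule e(2)[OF flow_in[OF z]])
  have Q'Q: "?Q' t \<ge> e / W * ?Q t" if "0 \<le> t" for t
  proof -
    have "e / W * ?Q t \<le> e / W * (W * (?y t)\<^sup>2)" using Q(2)[OF that] e(1) W0 by (intro mult_left_mono) auto
    then show ?thesis using Q'[of t] W0 by simp
  qed
  have "- ?Q T \<le> - ?Q 0 * exp (- (- (e / W)) * T)"
  proof (rule exp_decay[OF T])
    fix t assume t: "0 \<le> t" "t \<le> T"
    show "((\<lambda>t. - ?Q t) has_real_derivative - ?Q' t) (at t)" by (rule DERIV_minus[OF dQ])
    have "- (- (e / W)) * - ?Q t = - (e / W * ?Q t)" by simp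
    then show "- ?Q' t \<le> - (- (e / W)) * - ?Q t" using Q'Q[OF t(1)] by linarith
  qed
  moreover define E where "E = exp (e / W * T)"
  ultimately have "a * E \<le> W * (?y T)\<^sup>2" using Q(2)[OF T] by (simp add: S_0[OF z])
  moreover have "m * E \<le> a * E" using a by (intro mult_right_mono) (auto simp: E_def)
  ultimately have "m * E \<le> W * (?y T)\<^sup>2" by linarith
  then show "(?y T)\<^sup>2 \<ge> m / W * exp (e / W * T)" using W0 unfolding E_def[symmetric] by (simp add: field_simps)
  let ?C = "2 * B * sqrt W / e"
  have dR: "((\<lambda>t. sqrt (?Q t)) has_real_derivative ?Q' t / (2 * sqrt (?Q t))) (at t)" if "0 \<le> t" for t
  proof -
    have "((\<lambda>t. sqrt (?Q t)) has_real_derivative inverse (sqrt (?Q t)) / 2 * ?Q' t) (at t)"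
      by (rule DERIV_chain2[OF DERIV_real_sqrt[OF Qpos[OF that]] dQ])
    moreover have "inverse r / 2 * r' = r' / (2 * r)" for r r' :: real by (simp add: field_simps)
    ultimately show ?thesis by (simp only:)
  qed
  have R': "B * \<bar>?y t\<bar> \<le> ?C * (?Q' t / (2 * sqrt (?Q t)))" if t: "0 \<le> t" for t
  proof -
    have "sqrt (?Q t) \<le> sqrt (W * (?y t)\<^sup>2)" using Q(2)[OF t] by simp
    then have s: "sqrt (?Q t) \<le> sqrt W * \<bar>?y t\<bar>" by (simp add: real_sqrt_mult)
    have sp: "sqrt (?Q t) > 0" using Qpos[OF t] by simp
    have "B * \<bar>?y t\<bar> * (e * sqrt (?Q t)) \<le> B * \<bar>?y t\<bar> * (e * (sqrt W * \<bar>?y t\<bar>))"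
      using s e(1) B by (intro mult_left_mono) auto
    also have "\<dots> = B * sqrt W * (e * (?y t)\<^sup>2)" by (simp add: power2_eq_square)
    also have "\<dots> \<le> B * sqrt W * ?Q' t" using Q'[of t] B W0 by (intro mult_left_mono) auto
    finally show ?thesis using e(1) sp by (simp add: field_simps)
  qed
  have *: "\<sigma> * (?x T - x) \<le> ?C * sqrt (?Q T)" if \<sigma>: "\<bar>\<sigma>\<bar> = 1" for \<sigma> :: real
  proof -
    have "\<sigma> * ?x T - ?C * sqrt (?Q T) \<le> \<sigma> * ?x 0 - ?C * sqrt (?Q 0)"
    proof (rule DERIV_nonpos_imp_nonincreasing[OF T])
      fix t :: real assume t: "0 \<le> t" "t \<le> T"
      have "((\<lambda>t. \<sigma> * ?x t - ?C * sqrt (?Q t)) has_real_derivative \<sigma> * (l (\<phi> t z) * ?y t) - ?C * (?Q' t / (2 * sqrt (?Q t)))) (at t)"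
        by (intro DERIV_diff DERIV_cmult S_derivative_at(1)[OF z] dR[OF t(1)])
      moreover have "\<sigma> * (l (\<phi> t z) * ?y t) \<le> \<bar>\<sigma>\<bar> * (\<bar>l (\<phi> t z)\<bar> * \<bar>?y t\<bar>)" by (metis abs_ge_self abs_mult)
      moreover have "\<bar>\<sigma>\<bar> * (\<bar>l (\<phi> t z)\<bar> * \<bar>?y t\<bar>) \<le> B * \<bar>?y t\<bar>"
        using bounds(1)[OF flow_in[OF z, of t]] \<sigma> by (simp add: mult_right_mono)
      ultimately show "\<exists>y. ((\<lambda>t. \<sigma> * ?x t - ?C * sqrt (?Q t)) has_real_derivative y) (at t) \<and> y \<le> 0"
        using R'[OF t(1)] by (intro exI conjI) (assumption, linarith)
    qed
    moreover have "?C * sqrt (?Q 0) \<ge> 0" using e(1) B W0 Qpos[of 0] by simp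
    ultimately show ?thesis by (simp add: S_0[OF z] algebra_simps)
  qed
  have "\<bar>?x T - x\<bar> \<le> ?C * sqrt (?Q T)" using *[of 1] *[of "-1"] by simp
  also have "\<dots> \<le> ?C * (sqrt W * \<bar>?y T\<bar>)"
  proof (rule mult_left_mono)
    have "sqrt (?Q T) \<le> sqrt (W * (?y T)\<^sup>2)" using Q(2)[OF T] by simp
    then show "sqrt (?Q T) \<le> sqrt W * \<bar>?y T\<bar>" by (simp add: real_sqrt_mult)
  qed (use e(1) B W0 in auto)
  also have "\<dots> = 2 * B * W / e * \<bar>?y T\<bar>" using W0 by (simp add: mult.assoc)
  finally show "\<bar>?x T - x\<bar> \<le> 2 * B * W / e * \<bar>?y T\<bar>" .
qed

text \<open>A line in the quotient by the generator is lifted by pushing forward vectors with \<open>x = 0\<close> from ever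
  earlier times. The ratios \<open>x / y\<close> form a Cauchy family, since earlier contributions to them have been
  divided by the growth of \<open>y\<close>.\<close>

lemma unstable_lift:
  assumes e: "e > 0" "\<And>z y v. z \<in> N \<Longrightarrow> v\<^sup>2 + (p z + q z) * y * v + k z * y\<^sup>2 \<ge> e * y\<^sup>2"
  obtains w h where "continuous_map X euclideanreal w" "continuous_map X euclideanreal h"
    "\<And>z. z \<in> N \<Longrightarrow> m \<le> w z \<and> w z \<le> W"
    "\<And>z t. z \<in> N \<Longrightarrow> 0 \<le> t \<Longrightarrow> \<exists>r. S t z (h z, 1, w z) = r *\<^sub>R (h (\<phi> t z), 1, w (\<phi> t z)) \<and> \<bar>r\<bar> \<ge> sqrt (m / W) * exp (e / (2 * W) * t)"
proof -
  obtain w where w: "continuous_map X euclideanreal w" "\<And>z. z \<in> N \<Longrightarrow> m \<le> w z \<and> w z \<le> W"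
    "\<And>z t. z \<in> N \<Longrightarrow> \<exists>x r. r \<noteq> 0 \<and> S t z (0, 1, w z) = (x, 0, 0) + r *\<^sub>R (0, 1, w (\<phi> t z))"
    using unstable_line by blast
  have W0: "W > 0" using mW by linarith
  let ?c = "e / (2 * W)" and ?b = "sqrt (m / W)" and ?K = "2 * B * W / e"
  define Y where "Y t z = fst (snd (S t z (0, 1, w z)))" for t z
  define H where "H t z = fst (S t z (0, 1, w z)) / Y t z" for t z
  have Y: "\<bar>Y t z\<bar> \<ge> ?b * exp (?c * t)" if "z \<in> N" "0 \<le> t" for t z
  proof -
    have "(?b * exp (?c * t))\<^sup>2 = m / W * exp (e / W * t)"
      using mW W0 by (simp add: power_mult_distrib power2_eq_square[of "exp _"] flip: exp_add)
    also have "\<dots> \<le> (Y t z)\<^sup>2"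
      unfolding Y_def using unstable_growth(1)[OF e that(1) _ _ that(2)] w(2)[OF that(1)] by blast
    finally show ?thesis using mW W0 by (simp add: abs_le_square_iff[symmetric] abs_mult)
  qed
  have b: "?b > 0" using mW W0 by simp
  have Ynz: "Y t z \<noteq> 0" if "z \<in> N" "0 \<le> t" for t z
  proof -
    have "0 < ?b * exp (?c * t)" using b by simp
    then have "0 < \<bar>Y t z\<bar>" using Y[OF that] by linarith
    then show ?thesis by simp
  qed
  have c: "?c > 0" using e(1) W0 by simp
  have Hb: "\<bar>H t z\<bar> \<le> ?K" if "z \<in> N" "0 \<le> t" for t z
  proof -
    have "\<bar>fst (S t z (0, 1, w z))\<bar> \<le> ?K * \<bar>Y t z\<bar>"
      unfolding Y_def using unstable_growth(2)[OF e that(1) _ _ that(2), of "w z" 0] w(2)[OF that(1)] by simp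
    then show ?thesis using Ynz[OF that] by (simp add: H_def abs_divide pos_divide_le_eq)
  qed
  have SY: "S t z (0, 1, w z) = Y t z *\<^sub>R (H t z, 1, w (\<phi> t z))" if zt: "z \<in> N" "0 \<le> t" for t z
  proof -
    obtain x r where r: "r \<noteq> 0" "S t z (0, 1, w z) = (x, 0, 0) + r *\<^sub>R (0, 1, w (\<phi> t z))" using w(3)[OF zt(1)] by blast
    have "Y t z = r" "H t z = x / r" unfolding H_def Y_def r(2) by simp_all
    then show ?thesis using r by simp
  qed
  have SH: "S t z (x, 1, w z) = (x + Y t z * H t z, Y t z, Y t z * w (\<phi> t z))" if "z \<in> N" "0 \<le> t" for t z x
    using S_affine[OF that(1), of 1 t x "w z"] SY[OF that] by simp
  \<comment> \<open>the lift of the direction pushed forward from time \<open>- T\<close>\<close>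
  let ?s = "\<lambda>T z. H T (\<phi> (- T) z)"
  have add: "Y (s + t) z = Y s (\<phi> t z) * Y t z \<and> H (s + t) z = H s (\<phi> t z) + H t z / Y s (\<phi> t z)"
    if z: "z \<in> N" and st: "0 \<le> s" "0 \<le> t" for s t z
  proof -
    have "S (s + t) z (0, 1, w z) = S s (\<phi> t z) (Y t z *\<^sub>R (H t z, 1, w (\<phi> t z)))"
      using S_add[OF z, of s t] SY[OF z st(2)] by simp
    also have "\<dots> = Y t z *\<^sub>R S s (\<phi> t z) (H t z, 1, w (\<phi> t z))"
      by (rule linear_scale[OF S_linear[OF flow_in[OF z]]])
    also have "\<dots> = Y t z *\<^sub>R (H t z + Y s (\<phi> t z) * H s (\<phi> t z), Y s (\<phi> t z), Y s (\<phi> t z) * w (\<phi> s (\<phi> t z)))"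
      by (simp only: SH[OF flow_in[OF z] st(1)])
    finally have E: "S (s + t) z (0, 1, w z) = Y t z *\<^sub>R (H t z + Y s (\<phi> t z) * H s (\<phi> t z), Y s (\<phi> t z), Y s (\<phi> t z) * w (\<phi> s (\<phi> t z)))" .
    have Y1: "Y (s + t) z = Y s (\<phi> t z) * Y t z" unfolding Y_def[of "s + t"] E by simp
    moreover have "H (s + t) z = H s (\<phi> t z) + H t z / Y s (\<phi> t z)"
      unfolding H_def[of "s + t"] Y1 unfolding E using Ynz[OF z st(2)] Ynz[OF flow_in[OF z] st(1), of t] by (simp add: field_simps)
    ultimately show ?thesis by blast
  qed
  have cont: "continuous_map X euclideanreal (?s T)" if T: "T \<ge> 0" for T
  proof -
    have wc: "continuous_map X euclideanreal (\<lambda>z. w (\<phi> (- T) z))"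
      using continuous_map_compose[OF flow_cont w(1), of "- T"] by (simp add: o_def)
    have "continuous_map X euclideanreal (\<lambda>z. (fst (S T (\<phi> (- T) z) (0, 1, 0)) + w (\<phi> (- T) z) * fst (S T (\<phi> (- T) z) (0, 0, 1)))
      / (fst (snd (S T (\<phi> (- T) z) (0, 1, 0))) + w (\<phi> (- T) z) * fst (snd (S T (\<phi> (- T) z) (0, 0, 1)))))"
    proof (intro continuous_map_real_divide continuous_map_add continuous_map_real_mult S_cont_pullback wc)
      fix z assume z: "z \<in> N"
      show "fst (snd (S T (\<phi> (- T) z) (0, 1, 0))) + w (\<phi> (- T) z) * fst (snd (S T (\<phi> (- T) z) (0, 0, 1))) \<noteq> 0"
        using Ynz[OF flow_in[OF z] T, of "- T"] unfolding Y_def S_split[OF flow_in[OF z], of T "- T" "w (\<phi> (- T) z)"] by simp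
    qed
    then show ?thesis
    proof (rule continuous_map_eq)
      fix z assume z: "z \<in> N"
      show "(fst (S T (\<phi> (- T) z) (0, 1, 0)) + w (\<phi> (- T) z) * fst (S T (\<phi> (- T) z) (0, 0, 1)))
        / (fst (snd (S T (\<phi> (- T) z) (0, 1, 0))) + w (\<phi> (- T) z) * fst (snd (S T (\<phi> (- T) z) (0, 0, 1)))) = ?s T z"
        unfolding H_def Y_def S_split[OF flow_in[OF z], of T "- T" "w (\<phi> (- T) z)"] by simp
    qed
  qed
  have cauchy: "\<bar>?s T' z - ?s T z\<bar> \<le> ?K / ?b * exp (- ?c * T)" if z: "z \<in> N" and T: "0 \<le> T" "T \<le> T'" for T T' z
  proof -
    have f: "\<phi> (T' - T) (\<phi> (- T') z) = \<phi> (- T) z" using flow_plus[OF z, of "T' - T" "- T'"] by simp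
    have "?s T' z = ?s T z + H (T' - T) (\<phi> (- T') z) / Y T (\<phi> (- T) z)"
      using add[OF flow_in[OF z], of T "T' - T" "- T'"] T f by simp
    then have "\<bar>?s T' z - ?s T z\<bar> = \<bar>H (T' - T) (\<phi> (- T') z)\<bar> / \<bar>Y T (\<phi> (- T) z)\<bar>" by simp
    also have "\<dots> \<le> ?K / (?b * exp (?c * T))"
      using Hb[OF flow_in[OF z], of "T' - T" "- T'"] Y[OF flow_in[OF z] T(1), of "- T"] T b
      by (intro frac_le) auto
    also have "\<dots> = ?K / ?b * exp (- ?c * T)"
      unfolding minus_mult_left[symmetric] exp_minus by (simp only: divide_inverse inverse_mult_distrib mult.assoc)
    finally show ?thesis .
  qed
  obtain h where h: "continuous_map X euclideanreal h"
    and lim: "\<And>z t. z \<in> N \<Longrightarrow> 0 \<le> t \<Longrightarrow> (\<lambda>n. ?s (real n + t) z) \<longlonglongrightarrow> h z"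
    using exp_cauchy_limit[of X ?s ?c "?K / ?b", OF cont c cauchy] by blast
  have inv: "h (\<phi> t z) = H t z + h z / Y t z" if z: "z \<in> N" and t: "0 \<le> t" for z t
  proof -
    have "?s (real n + t) (\<phi> t z) = H t z + ?s (real n + 0) z / Y t z" for n
    proof -
      have f: "\<phi> (- (real n + t)) (\<phi> t z) = \<phi> (- real n) z" using flow_plus[OF z, of "- (real n + t)" t] by simp
      show ?thesis using add[OF flow_in[OF z, of "- real n"] t, of "real n"] flow_cancel(1)[OF z, of "real n"]
        unfolding f by (simp add: add.commute)
    qed
    moreover have "(\<lambda>n. H t z + ?s (real n + 0) z / Y t z) \<longlonglongrightarrow> H t z + h z / Y t z"
      using Ynz[OF z t] by (intro tendsto_intros lim[OF z order_refl])
    ultimately show ?thesis using lim[OF flow_in[OF z] t, of t] LIMSEQ_unique by simp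
  qed
  have "\<exists>r. S t z (h z, 1, w z) = r *\<^sub>R (h (\<phi> t z), 1, w (\<phi> t z)) \<and> \<bar>r\<bar> \<ge> ?b * exp (?c * t)" if z: "z \<in> N" and t: "0 \<le> t" for z t
    using SH[OF z t, of "h z"] inv[OF z t] Y[OF z t] Ynz[OF z t] by (intro exI[of _ "Y t z"]) (simp add: field_simps)
  then show thesis using that[OF w(1) h w(2)] by blast
qed

end

subsection \<open>Time reversal and the two invariant splittings\<close>

abbreviation flip3 :: "real \<times> real \<times> real \<Rightarrow> real \<times> real \<times> real"
  where "flip3 \<equiv> \<lambda>d. (fst d, fst (snd d), - snd (snd d))"

lemma linear_flip3: "linear flip3"
  by (rule linearI) (auto simp: algebra_simps)

context cone_cocycle begin

text \<open>Reversing time together with the sign of \<open>v\<close> preserves the form of the system and the bounds, and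
  exchanges unstable and stable directions.\<close>

lemma reversed:
  "cone_cocycle X (\<lambda>t. \<phi> (- t)) (\<lambda>t z d. flip3 (S (- t) z (flip3 d)))
     (\<lambda>z. - l z) (\<lambda>z. - p z) k (\<lambda>z. - q z) B k0"
proof (rule cone_cocycle.intro)
  show "linear (\<lambda>d. flip3 (S (- t) z (flip3 d)))" if "z \<in> N" for z t
    using linear_compose[OF linear_compose[OF linear_flip3 S_linear[OF that]] linear_flip3, of "- t"] by (simp add: o_def)
  show "((\<lambda>t. flip3 (S (- t) z (flip3 (x, y, v)))) has_vector_derivative
      (- l z * y, - p z * y + v, k z * y + - q z * v)) (at 0)" if z: "z \<in> N" for z x y v
  proof -
    have "((\<lambda>t. S t z (x, y, - v)) has_vector_derivative (l z * y, p z * y - v, k z * y - q z * v)) (at (- 0))"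
      using S_derivative[OF z, of x y "- v"] by simp
    note D1 = this
    have D2: "(uminus has_vector_derivative (- 1 :: real)) (at 0)"
      by (auto intro!: derivative_eq_intros simp flip: has_real_derivative_iff_has_vector_derivative)
    have "((\<lambda>t. S (- t) z (x, y, - v)) has_vector_derivative (- 1) *\<^sub>R (l z * y, p z * y - v, k z * y - q z * v)) (at 0)"
      using vector_diff_chain_at[OF D2 D1] by (simp add: o_def)
    from bounded_linear.has_vector_derivative[OF _ this, of flip3] linear_flip3
    show ?thesis by (simp add: linear_conv_bounded_linear[symmetric] add.commute)
  qed
  show "continuous_map X X (\<phi> (- t))" for t by (rule flow_cont)
  show "\<phi> (- 0) z = z" if "z \<in> N" for z using flow_zero[OF that] by simp
  show "\<phi> (- (s + t)) z = \<phi> (- s) (\<phi> (- t) z)" if "z \<in> N" for z s t using flow_plus[OF that, of "- s" "- t"] by simp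
  show "flip3 (S (- 0) z (flip3 d)) = d" if "z \<in> N" for z d using S_0[OF that] by simp
  show "flip3 (S (- (s + t)) z (flip3 d)) = flip3 (S (- s) (\<phi> (- t) z) (flip3 (flip3 (S (- t) z (flip3 d)))))" if "z \<in> N" for z s t d
    using S_add[OF that, of "- s" "- t"] by simp
  show "flip3 (S (- t) z (flip3 (1, 0, 0))) = (1, 0, 0)" if "z \<in> N" for z t using S_generator[OF that] by simp
  show "continuous_map X euclideanreal (\<lambda>z. fst (flip3 (S (- t) z (flip3 d))))"
    "continuous_map X euclideanreal (\<lambda>z. fst (snd (flip3 (S (- t) z (flip3 d)))))"
    "continuous_map X euclideanreal (\<lambda>z. snd (snd (flip3 (S (- t) z (flip3 d)))))" for t d
    using S_cont by (auto intro: continuous_map_minus)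
qed (use bounds k0 B in auto)

theorem dominated_lines:
  obtains wu ws where "continuous_map X euclideanreal wu" "continuous_map X euclideanreal ws"
    "\<And>z. z \<in> N \<Longrightarrow> m \<le> wu z \<and> wu z \<le> W" "\<And>z. z \<in> N \<Longrightarrow> - W \<le> ws z \<and> ws z \<le> - m"
    "\<And>z t. z \<in> N \<Longrightarrow> \<exists>x r. r \<noteq> 0 \<and> S t z (0, 1, wu z) = (x, 0, 0) + r *\<^sub>R (0, 1, wu (\<phi> t z))"
    "\<And>z t. z \<in> N \<Longrightarrow> \<exists>x r. r \<noteq> 0 \<and> S t z (0, 1, ws z) = (x, 0, 0) + r *\<^sub>R (0, 1, ws (\<phi> t z))"
    "\<And>z t. z \<in> N \<Longrightarrow> 0 \<le> t \<Longrightarrow> \<bar>fst (snd (S t z (0, 1, ws z)))\<bar> \<le> \<bar>fst (snd (S t z (0, 1, wu z)))\<bar> * exp (- (2 * m) * t)"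
proof -
  interpret R: cone_cocycle X "\<lambda>t. \<phi> (- t)" "\<lambda>t z d. flip3 (S (- t) z (flip3 d))"
     "\<lambda>z. - l z" "\<lambda>z. - p z" k "\<lambda>z. - q z" B k0 by (rule reversed)
  obtain wu where u: "continuous_map X euclideanreal wu" "\<And>z. z \<in> N \<Longrightarrow> m \<le> wu z \<and> wu z \<le> W"
    "\<And>z t. z \<in> N \<Longrightarrow> \<exists>x r. r \<noteq> 0 \<and> S t z (0, 1, wu z) = (x, 0, 0) + r *\<^sub>R (0, 1, wu (\<phi> t z))"
    using unstable_line by blast
  obtain w where w: "continuous_map X euclideanreal w" "\<And>z. z \<in> N \<Longrightarrow> m \<le> w z \<and> w z \<le> W"
    "\<And>z t. z \<in> N \<Longrightarrow> \<exists>x r. r \<noteq> 0 \<and> flip3 (S (- t) z (flip3 (0, 1, w z))) = (x, 0, 0) + r *\<^sub>R (0, 1, w (\<phi> (- t) z))"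
    using R.unstable_line by blast
  let ?ws = "\<lambda>z. - w z"
  have s: "\<exists>x r. r \<noteq> 0 \<and> S t z (0, 1, ?ws z) = (x, 0, 0) + r *\<^sub>R (0, 1, ?ws (\<phi> t z))" if z: "z \<in> N" for z t
  proof -
    obtain x r where r: "r \<noteq> 0" "flip3 (S t z (flip3 (0, 1, w z))) = (x, 0, 0) + r *\<^sub>R (0, 1, w (\<phi> t z))"
      using w(3)[OF z, of "- t"] by auto
    from arg_cong[OF r(2), of flip3] have "S t z (0, 1, ?ws z) = (x, 0, 0) + r *\<^sub>R (0, 1, ?ws (\<phi> t z))" by simp
    then show ?thesis using r(1) by blast
  qed
  have wsb: "- W \<le> ?ws z \<and> ?ws z \<le> - m" if "z \<in> N" for z using w(2)[OF that] by simp
  have "\<bar>fst (snd (S t z (0, 1, ?ws z)))\<bar> \<le> \<bar>fst (snd (S t z (0, 1, wu z)))\<bar> * exp (- (2 * m) * t)"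
    if z: "z \<in> N" and t: "0 \<le> t" for z t
  proof (rule growth_gap[OF z t])
    fix t
    obtain x r where r: "r \<noteq> 0" "S t z (0, 1, wu z) = (x, 0, 0) + r *\<^sub>R (0, 1, wu (\<phi> t z))" using u(3)[OF z] by blast
    show "fst (snd (S t z (0, 1, wu z))) \<noteq> 0 \<and> m \<le> slope (S t z (0, 1, wu z))"
      unfolding r(2) slope_def using r(1) u(2)[OF flow_in[OF z]] by simp
    obtain x r where r: "r \<noteq> 0" "S t z (0, 1, ?ws z) = (x, 0, 0) + r *\<^sub>R (0, 1, ?ws (\<phi> t z))" using s[OF z] by blast
    show "fst (snd (S t z (0, 1, ?ws z))) \<noteq> 0 \<and> slope (S t z (0, 1, ?ws z)) \<le> - m"
      unfolding r(2) slope_def using r(1) wsb[OF flow_in[OF z]] by simp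
  qed
  then show thesis
    using that[OF u(1) continuous_map_minus[OF w(1)] u(2) wsb u(3) s] by blast
qed

lemma invariant_line_inverse:
  assumes z: "z \<in> N" and r: "r \<noteq> 0" "S (- t) (\<phi> t z) d' = r *\<^sub>R d"
  shows "S t z d = (1 / r) *\<^sub>R d'"
proof -
  have "S t z (r *\<^sub>R d) = d'"
    using S_cancel[OF flow_in[OF z, of t], of "- t" d'] r(2) flow_cancel(2)[OF z, of t] by simp
  then have "r *\<^sub>R S t z d = d'" by (simp only: linear_scale[OF S_linear[OF z]])
  then show ?thesis using r(1) by (metis scaleR_scaleR scaleR_one nonzero_eq_divide_eq)
qed

theorem hyperbolic_lines:
  assumes e: "e > 0" "\<And>z y v. z \<in> N \<Longrightarrow> v\<^sup>2 + (p z + q z) * y * v + k z * y\<^sup>2 \<ge> e * y\<^sup>2"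
  obtains wu hu ws hs where
    "continuous_map X euclideanreal wu" "continuous_map X euclideanreal hu"
    "continuous_map X euclideanreal ws" "continuous_map X euclideanreal hs"
    "\<And>z. z \<in> N \<Longrightarrow> m \<le> wu z \<and> wu z \<le> W" "\<And>z. z \<in> N \<Longrightarrow> - W \<le> ws z \<and> ws z \<le> - m"
    "\<And>z t. z \<in> N \<Longrightarrow> \<exists>r. r \<noteq> 0 \<and> S t z (hu z, 1, wu z) = r *\<^sub>R (hu (\<phi> t z), 1, wu (\<phi> t z))
        \<and> (t \<le> 0 \<longrightarrow> \<bar>r\<bar> \<le> sqrt (W / m) * exp (e / (2 * W) * t))"
    "\<And>z t. z \<in> N \<Longrightarrow> \<exists>r. r \<noteq> 0 \<and> S t z (hs z, 1, ws z) = r *\<^sub>R (hs (\<phi> t z), 1, ws (\<phi> t z))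
        \<and> (t \<ge> 0 \<longrightarrow> \<bar>r\<bar> \<le> sqrt (W / m) * exp (- (e / (2 * W)) * t))"
proof -
  interpret R: cone_cocycle X "\<lambda>t. \<phi> (- t)" "\<lambda>t z d. flip3 (S (- t) z (flip3 d))"
     "\<lambda>z. - l z" "\<lambda>z. - p z" k "\<lambda>z. - q z" B k0 by (rule reversed)
  have W0: "W > 0" using mW by linarith
  let ?c = "e / (2 * W)"
  have inv: "1 / \<bar>r\<bar> \<le> sqrt (W / m) * exp (- ?c * t) \<and> r \<noteq> 0" if "\<bar>r\<bar> \<ge> sqrt (m / W) * exp (?c * t)" for r t
  proof
    have pos: "0 < sqrt (m / W) * exp (?c * t)" using mW(1) W0 by simp
    have r: "\<bar>r\<bar> > 0" by (rule less_le_trans[OF pos that])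
    then show "r \<noteq> 0" by simp
    have "1 / \<bar>r\<bar> \<le> 1 / (sqrt (m / W) * exp (?c * t))"
      by (rule divide_left_mono[OF that zero_le_one mult_pos_pos[OF r pos]])
    also have "\<dots> = sqrt (W / m) * exp (- ?c * t)" by (simp add: real_sqrt_divide exp_minus field_simps)
    finally show "1 / \<bar>r\<bar> \<le> sqrt (W / m) * exp (- ?c * t)" .
  qed
  obtain wu hu where u: "continuous_map X euclideanreal wu" "continuous_map X euclideanreal hu"
    "\<And>z. z \<in> N \<Longrightarrow> m \<le> wu z \<and> wu z \<le> W"
    "\<And>z t. z \<in> N \<Longrightarrow> 0 \<le> t \<Longrightarrow> \<exists>r. S t z (hu z, 1, wu z) = r *\<^sub>R (hu (\<phi> t z), 1, wu (\<phi> t z)) \<and> \<bar>r\<bar> \<ge> sqrt (m / W) * exp (?c * t)"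
    using unstable_lift[OF e] by blast
  have u': "\<exists>r. r \<noteq> 0 \<and> S t z (hu z, 1, wu z) = r *\<^sub>R (hu (\<phi> t z), 1, wu (\<phi> t z))
        \<and> (t \<le> 0 \<longrightarrow> \<bar>r\<bar> \<le> sqrt (W / m) * exp (?c * t))" if z: "z \<in> N" for z t
  proof (cases "t > 0")
    case True
    then show ?thesis using u(4)[OF z, of t] inv[of t] by auto
  next
    case False
    obtain r where r: "S (- t) (\<phi> t z) (hu (\<phi> t z), 1, wu (\<phi> t z)) = r *\<^sub>R (hu z, 1, wu z)"
      and b: "\<bar>r\<bar> \<ge> sqrt (m / W) * exp (?c * - t)"
      using u(4)[OF flow_in[OF z, of t], of "- t"] False flow_cancel(2)[OF z, of t] by auto
    have r0: "r \<noteq> 0" "1 / \<bar>r\<bar> \<le> sqrt (W / m) * exp (?c * t)" using inv[OF b] by auto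
    show ?thesis using invariant_line_inverse[OF z r0(1) r] r0 by (intro exI[of _ "1 / r"]) simp
  qed
  have e': "\<And>z y v. z \<in> N \<Longrightarrow> v\<^sup>2 + (- p z + - q z) * y * v + k z * y\<^sup>2 \<ge> e * y\<^sup>2"
  proof -
    fix z y v assume z: "z \<in> N"
    show "v\<^sup>2 + (- p z + - q z) * y * v + k z * y\<^sup>2 \<ge> e * y\<^sup>2" using e(2)[OF z, where v = "- v" and y = y] by (simp add: algebra_simps)
  qed
  obtain w h where s: "continuous_map X euclideanreal w" "continuous_map X euclideanreal h"
    "\<And>z. z \<in> N \<Longrightarrow> m \<le> w z \<and> w z \<le> W"
    "\<And>z t. z \<in> N \<Longrightarrow> 0 \<le> t \<Longrightarrow> \<exists>r. flip3 (S (- t) z (flip3 (h z, 1, w z))) = r *\<^sub>R (h (\<phi> (- t) z), 1, w (\<phi> (- t) z))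
        \<and> \<bar>r\<bar> \<ge> sqrt (m / W) * exp (?c * t)"
    using R.unstable_lift[OF e(1) e'] by blast
  let ?ws = "\<lambda>z. - w z"
  have s4: "\<exists>r. S (- t) z (h z, 1, ?ws z) = r *\<^sub>R (h (\<phi> (- t) z), 1, ?ws (\<phi> (- t) z)) \<and> \<bar>r\<bar> \<ge> sqrt (m / W) * exp (?c * t)"
    if zt: "z \<in> N" "0 \<le> t" for z t
  proof -
    obtain r where r: "flip3 (S (- t) z (flip3 (h z, 1, w z))) = r *\<^sub>R (h (\<phi> (- t) z), 1, w (\<phi> (- t) z))"
        "\<bar>r\<bar> \<ge> sqrt (m / W) * exp (?c * t)" using s(4)[OF zt] by blast
    from arg_cong[OF r(1), of flip3] have "S (- t) z (h z, 1, ?ws z) = r *\<^sub>R (h (\<phi> (- t) z), 1, ?ws (\<phi> (- t) z))" by simp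
    then show ?thesis using r(2) by blast
  qed
  have s': "\<exists>r. r \<noteq> 0 \<and> S t z (h z, 1, ?ws z) = r *\<^sub>R (h (\<phi> t z), 1, ?ws (\<phi> t z))
        \<and> (t \<ge> 0 \<longrightarrow> \<bar>r\<bar> \<le> sqrt (W / m) * exp (- ?c * t))" if z: "z \<in> N" for z t
  proof (cases "t < 0")
    case True
    then show ?thesis using s4[OF z, of "- t"] inv[of "- t"] by auto
  next
    case False
    obtain r where r: "S (- t) (\<phi> t z) (h (\<phi> t z), 1, ?ws (\<phi> t z)) = r *\<^sub>R (h z, 1, ?ws z)"
      and b: "\<bar>r\<bar> \<ge> sqrt (m / W) * exp (?c * t)"
      using s4[OF flow_in[OF z, of t], of t] False flow_cancel(2)[OF z, of t] by auto
    have r0: "r \<noteq> 0" "1 / \<bar>r\<bar> \<le> sqrt (W / m) * exp (- ?c * t)" using inv[OF b] by auto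
    show ?thesis using invariant_line_inverse[OF z r0(1) r] r0 by (intro exI[of _ "1 / r"]) simp
  qed
  have wsb: "- W \<le> ?ws z \<and> ?ws z \<le> - m" if "z \<in> N" for z using s(3)[OF that] by simp
  show thesis by (rule that[OF u(1,2) continuous_map_minus[OF s(1)] s(2) u(3) wsb u' s'])
qed

end

section \<open>Dominated splittings and hyperbolicity of framed flows\<close>

subsection \<open>Compactness and norms\<close>

lemma compact_space_bounded:
  fixes f :: "'n \<Rightarrow> real"
  assumes "compact_space X" "continuous_map X euclideanreal f"
  obtains C where "C > 0" "\<And>z. z \<in> topspace X \<Longrightarrow> \<bar>f z\<bar> \<le> C"
proof -
  have "compactin euclideanreal (f ` topspace X)"
    using image_compactin[OF _ assms(2)] assms(1) by (simp add: compact_space_def)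
  then have "bounded (f ` topspace X)" by (simp add: compact_imp_bounded)
  then obtain C where "C > 0" "\<forall>y\<in>f ` topspace X. norm y \<le> C" by (auto simp: bounded_pos)
  then show thesis using that[of C] by auto
qed

lemma compact_space_positive:
  fixes f :: "'n \<Rightarrow> real"
  assumes "compact_space X" "continuous_map X euclideanreal f" "\<And>z. z \<in> topspace X \<Longrightarrow> f z > 0"
  obtains e where "e > 0" "\<And>z. z \<in> topspace X \<Longrightarrow> e \<le> f z"
proof (cases "topspace X = {}")
  case False
  have "compactin euclideanreal (f ` topspace X)"
    using image_compactin[OF _ assms(2)] assms(1) by (simp add: compact_space_def)
  then have "compact (f ` topspace X)" by simp
  from compact_attains_inf[OF this] False obtain y where "y \<in> topspace X" "\<forall>z\<in>topspace X. f y \<le> f z" by auto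
  then show thesis using that[of "f y"] assms(3) by auto
qed (use that[of 1] in auto)

text \<open>For norms proportional to \<open>\<bar>c\<bar>\<close> the operator norm of multiplication by \<open>r\<close> would be a multiple of \<open>\<bar>r\<bar>\<close>
  with the ratio of the norms as factor; the comparability constants bound that ratio.\<close>

lemma op_norm_line:
  fixes e :: "real \<Rightarrow> 'v" and e' :: "real \<Rightarrow> 'w" and a b r :: real
  assumes "a > 0" "\<And>c. a * \<bar>c\<bar> \<le> n (e c) \<and> n (e c) \<le> b * \<bar>c\<bar>" "\<And>c. a * \<bar>c\<bar> \<le> n' (e' c) \<and> n' (e' c) \<le> b * \<bar>c\<bar>"
    and T: "\<And>c. T (e c) = e' (c * r)"
  shows "0 \<le> op_norm n n' {e c | c. True} T" "op_norm n n' {e c | c. True} T \<le> b / a * \<bar>r\<bar>"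
proof -
  let ?S = "{n' (T v) | v. v \<in> {e c | c. True} \<and> n v \<le> 1}"
  have n0: "n (e 0) = 0" "n' (e' 0) = 0" using assms(2,3)[of 0] by auto
  have "0 \<le> b" using assms(1) assms(2)[of 1] by simp
  have "T (e 0) = e' 0" using T[of 0] by simp
  then have mem: "0 \<in> ?S" using n0 by (auto intro!: exI[of _ "e 0"])
  have up: "y \<le> b / a * \<bar>r\<bar>" if "y \<in> ?S" for y
  proof -
    from that obtain c where c: "y = n' (T (e c))" "n (e c) \<le> 1" by auto
    have "a * \<bar>c\<bar> \<le> 1" using assms(2)[of c] c(2) by linarith
    then have "\<bar>c\<bar> \<le> 1 / a" using assms(1) by (simp add: field_simps)
    then have "b * (\<bar>c\<bar> * \<bar>r\<bar>) \<le> b * (1 / a * \<bar>r\<bar>)" using \<open>0 \<le> b\<close> by (intro mult_left_mono mult_right_mono) auto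
    moreover have "y \<le> b * (\<bar>c\<bar> * \<bar>r\<bar>)" using assms(3)[of "c * r"] c(1) T[of c] by (simp add: abs_mult)
    ultimately show ?thesis by simp
  qed
  show "0 \<le> op_norm n n' {e c | c. True} T"
    unfolding op_norm_def by (rule cSup_upper[OF mem]) (use up in \<open>auto simp: bdd_above_def\<close>)
  show "op_norm n n' {e c | c. True} T \<le> b / a * \<bar>r\<bar>"
    unfolding op_norm_def by (rule cSup_least) (use mem up in blast)+
qed

lemma line_image:
  fixes e :: "real \<Rightarrow> 'v" and e' :: "real \<Rightarrow> 'w"
  assumes "r \<noteq> 0" "\<And>c. T (e c) = e' (c * r)" shows "T ` {e c | c. True} = {e' c | c. True}"
proof -
  have "e' c \<in> T ` {e c | c. True}" for c using assms(2)[of "c / r"] assms(1) by (metis (mono_tags, lifting) image_eqI mem_Collect_eq nonzero_eq_divide_eq)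
  then show ?thesis using assms(2) by auto
qed

lemma topcontinuous_at_real:
  "topcontinuous_at X euclideanreal f p \<longleftrightarrow> p \<in> topspace X \<and> (f \<longlongrightarrow> f p) (atin X p)"
  by (simp add: topcontinuous_at_atin)

lemma symmetric_form_expand:
  fixes g :: "'z::euclidean_space \<Rightarrow> 'z \<Rightarrow> real"
  assumes L: "\<And>r a s c b. g (r *\<^sub>R a + s *\<^sub>R c) b = r * g a b + s * g c b" and sym: "\<And>a b. g a b = g b a"
  shows "g a b = (\<Sum>i\<in>Basis. \<Sum>j\<in>Basis. g i j * ((a \<bullet> i) * (b \<bullet> j)))"
proof -
  have lin: "linear (\<lambda>a. g a b)" for b by (rule linear_combinationI) (simp add: L)
  have E: "g a b = (\<Sum>i\<in>Basis. g b i * (a \<bullet> i))" for a b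
    using linear_sum_Basis[OF lin[of b], of a] sym by simp
  show ?thesis
    by (subst E, subst E) (simp add: sum_distrib_right sum_distrib_left mult_ac sym)
qed

context atlas begin

lemma metric_coords:
  assumes G: "riemannian_metric A G" and x: "(\<Omega>, x) \<in> A" "u \<in> \<Omega>"
  shows "G (x u) (coord_vec A x u a) (coord_vec A x u b)
    = (\<Sum>i\<in>Basis. \<Sum>j\<in>Basis. G (x u) (coord_vec A x u i) (coord_vec A x u j) * ((a \<bullet> i) * (b \<bullet> j)))"
proof -
  let ?g = "\<lambda>a b. G (x u) (coord_vec A x u a) (coord_vec A x u b)"
  have p: "x u \<in> carrier_of A" by (rule chart_carrier[OF x])
  note T = coord_vec_in_tangent_space[OF x]
  show ?thesis
  proof (rule symmetric_form_expand[of ?g])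
    show "?g (r *\<^sub>R a + s *\<^sub>R c) b = r * ?g a b + s * ?g c b" for r a s c b
      unfolding coord_vec_add[OF x] coord_vec_scaleR[OF x]
      using G p T unfolding riemannian_metric_def by blast
    show "?g a b = ?g b a" for a b using G p T unfolding riemannian_metric_def by blast
  qed
qed

lemma metric_continuous:
  assumes G: "riemannian_metric A G"
    and Y: "\<And>z. z \<in> carrier_of A \<Longrightarrow> Y z \<in> tangent_space A z" "\<And>z f. z \<in> carrier_of A \<Longrightarrow> smooth_at A z f \<Longrightarrow> smooth_at A z (\<lambda>q. Y q f)"
    and Z: "\<And>z. z \<in> carrier_of A \<Longrightarrow> Z z \<in> tangent_space A z" "\<And>z f. z \<in> carrier_of A \<Longrightarrow> smooth_at A z f \<Longrightarrow> smooth_at A z (\<lambda>q. Z q f)"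
  shows "continuous_map (atlas_topology A) euclideanreal (\<lambda>z. G z (Y z) (Z z))"
proof (rule continuous_map_chartsI)
  fix \<Omega> x assume x: "(\<Omega>, x) \<in> A"
  let ?f = "\<lambda>b z. inv_into \<Omega> x z \<bullet> b"
  have comp: "coord_vec A x u (\<Sum>b\<in>Basis. F (x u) (?f b) *\<^sub>R b) = F (x u) \<and> isCont (\<lambda>u. F (x u) (?f b)) u"
    if F: "\<And>z. z \<in> carrier_of A \<Longrightarrow> F z \<in> tangent_space A z" "\<And>z f. z \<in> carrier_of A \<Longrightarrow> smooth_at A z f \<Longrightarrow> smooth_at A z (\<lambda>q. F q f)"
      and u: "u \<in> \<Omega>" for F :: "'m vfield" and u b
  proof
    obtain a where a: "F (x u) = coord_vec A x u a" using F(1)[OF chart_carrier[OF x u]] tangent_space_eq[OF x u] by blast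
    have "(\<Sum>b\<in>Basis. F (x u) (?f b) *\<^sub>R b) = a"
      unfolding a smooth_at_chart_component(2)[OF x u] by (rule euclidean_representation)
    then show "coord_vec A x u (\<Sum>b\<in>Basis. F (x u) (?f b) *\<^sub>R b) = F (x u)" using a by simp
    have "smooth_at A (x u) (\<lambda>q. F q (?f b))" by (rule F(2)[OF chart_carrier[OF x u] smooth_at_chart_component(1)[OF x u]])
    then show "isCont (\<lambda>u. F (x u) (?f b)) u" using smooth_at_iff[OF x u] smooth_near_isCont by blast
  qed
  have coef: "(\<Sum>b\<in>Basis. F b *\<^sub>R b) \<bullet> i = F i" if "i \<in> Basis" for F :: "'e \<Rightarrow> real" and i using that by simp
  have "G (x u) (Y (x u)) (Z (x u)) = (\<Sum>i\<in>Basis. \<Sum>j\<in>Basis. G (x u) (coord_vec A x u i) (coord_vec A x u j)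
      * (Y (x u) (?f i) * Z (x u) (?f j)))" if u: "u \<in> \<Omega>" for u
    using metric_coords[OF G x u, of "\<Sum>b\<in>Basis. Y (x u) (?f b) *\<^sub>R b" "\<Sum>b\<in>Basis. Z (x u) (?f b) *\<^sub>R b"]
      comp[OF Y u] comp[OF Z u] by (simp add: coef cong: sum.cong)
  moreover have "continuous_on \<Omega> (\<lambda>u. \<Sum>i\<in>Basis. \<Sum>j\<in>Basis. G (x u) (coord_vec A x u i) (coord_vec A x u j)
      * (Y (x u) (?f i) * Z (x u) (?f j)))"
  proof (intro continuous_on_sum continuous_on_mult)
    show "continuous_on \<Omega> (\<lambda>u. G (x u) (coord_vec A x u i) (coord_vec A x u j))" for i j
    proof -
      have "smooth_on \<Omega> (\<lambda>u. G (x u) (coord_vec A x u i) (coord_vec A x u j))" using G x unfolding riemannian_metric_def by fast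
      then have "Ck_on 0 \<Omega> (\<lambda>u. G (x u) (coord_vec A x u i) (coord_vec A x u j))" unfolding smooth_on_def by blast
      then show ?thesis by simp
    qed
    show "continuous_on \<Omega> (\<lambda>u. Y (x u) (?f i))" for i
      using comp[OF Y] by (intro continuous_at_imp_continuous_on ballI) blast
    show "continuous_on \<Omega> (\<lambda>u. Z (x u) (?f i))" for i
      using comp[OF Z] by (intro continuous_at_imp_continuous_on ballI) blast
  qed
  ultimately show "continuous_on \<Omega> (\<lambda>u. G (x u) (Y (x u)) (Z (x u)))" by (simp cong: continuous_on_cong)
qed

end

context framed_flow begin

lemma flow_continuous: "continuous_map (atlas_topology A) (atlas_topology A) (\<phi> t)"
  unfolding continuous_map_def topspace_carrier openin_atlas_topology
proof (intro conjI allI impI)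
  fix U assume U: "atlas_open A U"
  show "atlas_open A {z \<in> M. \<phi> t z \<in> U}"
  proof (rule atlas_openI)
    fix \<Omega> x u assume x: "(\<Omega>, x) \<in> A" "u \<in> \<Omega>" "x u \<in> {z \<in> M. \<phi> t z \<in> U}"
    show "\<forall>\<^sub>F w in nhds u. w \<in> \<Omega> \<longrightarrow> x w \<in> {z \<in> M. \<phi> t z \<in> U}"
      using flow_eventually_space[OF x(1,2) U, of t] x(3) chart_carrier[OF x(1)] by (auto elim: eventually_mono)
  qed auto
qed (auto intro: flow_carrier)

text \<open>The coframe computes the coefficients from finitely many smooth functions.\<close>

lemma frame_coefficients_continuous:
  assumes F: "\<And>z f. z \<in> M \<Longrightarrow> smooth_at A z f \<Longrightarrow> smooth_at A z (\<lambda>q. frame q (c q) f)"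
  shows "continuous_map (atlas_topology A) euclideanreal (\<lambda>z. fst (c z))"
    "continuous_map (atlas_topology A) euclideanreal (\<lambda>z. fst (snd (c z)))"
    "continuous_map (atlas_topology A) euclideanreal (\<lambda>z. snd (snd (c z)))"
proof -
  have "smooth_at A z0 (\<lambda>z. fst (c z)) \<and> smooth_at A z0 (\<lambda>z. fst (snd (c z))) \<and> smooth_at A z0 (\<lambda>z. snd (snd (c z)))" if z0: "z0 \<in> M" for z0
  proof -
    from coframe[OF z0] obtain U and I :: "'i set" and e \<alpha> \<beta> \<gamma> where U: "atlas_open A U" "z0 \<in> U" and
      sm: "\<forall>i\<in>I. smooth_at A z0 (e i) \<and> smooth_at A z0 (\<alpha> i) \<and> smooth_at A z0 (\<beta> i) \<and> smooth_at A z0 (\<gamma> i)" and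
      rep: "\<forall>z\<in>U. \<forall>v\<in>tangent_space A z. v = tadd (tscale (\<Sum>i\<in>I. \<alpha> i z * v (e i)) (Y z))
        (tadd (tscale (\<Sum>i\<in>I. \<beta> i z * v (e i)) (e2 z)) (tscale (\<Sum>i\<in>I. \<gamma> i z * v (e i)) (e3 z)))" by blast
    obtain \<Omega> x u where x: "(\<Omega>, x) \<in> A" "u \<in> \<Omega>" "z0 = x u" using carrierE[OF z0] .
    have UM: "U \<subseteq> M" using U(1) by (simp add: atlas_open_def)
    let ?s = "\<lambda>\<alpha> z. \<Sum>i\<in>I. \<alpha> i z * frame z (c z) (e i)"
    have eq: "c z = (?s \<alpha> z, ?s \<beta> z, ?s \<gamma> z)" if "z \<in> U" for z
    proof (rule frame_inj)
      show "z \<in> M" using UM that by blast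
      then have "frame z (c z) \<in> tangent_space A z" by (rule frame_in_tangent_space)
      from rep[THEN bspec, OF that, THEN bspec, OF this]
      show "frame z (c z) = frame z (?s \<alpha> z, ?s \<beta> z, ?s \<gamma> z)" unfolding frame_Pair .
    qed
    have E: "fst (c z) = ?s \<alpha> z" "fst (snd (c z)) = ?s \<beta> z" "snd (snd (c z)) = ?s \<gamma> z" if "z \<in> U" for z
      using arg_cong[OF eq[OF that], of fst] arg_cong[OF eq[OF that], of "\<lambda>c. fst (snd c)"] arg_cong[OF eq[OF that], of "\<lambda>c. snd (snd c)"]
      by (simp_all only: fst_conv snd_conv)
    have ev: "\<forall>\<^sub>F w in nhds u. x w \<in> U" using atlas_open_eventually[OF U(1) x(1,2)] U(2) x(3) by (auto elim: eventually_mono)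
    have S: "smooth_at A z0 (?s \<alpha>')" if "\<forall>i\<in>I. smooth_at A z0 (\<alpha>' i)" for \<alpha>'
      using that sm by (intro smooth_at_intros z0 F) auto
    have "smooth_at A (x u) (\<lambda>z. fst (c z))"
    proof (rule smooth_at_cong[OF x(1,2)])
      show "\<forall>\<^sub>F w in nhds u. ?s \<alpha> (x w) = fst (c (x w))" using ev by eventually_elim (simp only: E)
      show "smooth_at A (x u) (?s \<alpha>)" using S sm x(3) by blast
    qed
    moreover have "smooth_at A (x u) (\<lambda>z. fst (snd (c z)))"
    proof (rule smooth_at_cong[OF x(1,2)])
      show "\<forall>\<^sub>F w in nhds u. ?s \<beta> (x w) = fst (snd (c (x w)))" using ev by eventually_elim (simp only: E)
      show "smooth_at A (x u) (?s \<beta>)" using S sm x(3) by blast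
    qed
    moreover have "smooth_at A (x u) (\<lambda>z. snd (snd (c z)))"
    proof (rule smooth_at_cong[OF x(1,2)])
      show "\<forall>\<^sub>F w in nhds u. ?s \<gamma> (x w) = snd (snd (c (x w)))" using ev by eventually_elim (simp only: E)
      show "smooth_at A (x u) (?s \<gamma>)" using S sm x(3) by blast
    qed
    ultimately show ?thesis using x(3) by simp
  qed
  then show "continuous_map (atlas_topology A) euclideanreal (\<lambda>z. fst (c z))"
    "continuous_map (atlas_topology A) euclideanreal (\<lambda>z. fst (snd (c z)))"
    "continuous_map (atlas_topology A) euclideanreal (\<lambda>z. snd (snd (c z)))"
    by (intro continuous_map_smooth; blast)+
qed

lemma commutator_smooth:
  assumes z: "z \<in> M" and f: "smooth_at A z f"
    and E: "\<And>f. smooth_at A z f \<Longrightarrow> smooth_at A z (\<lambda>w. E w f)"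
    and c: "\<And>w f. w \<in> M \<Longrightarrow> smooth_at A w f \<Longrightarrow> E w (\<lambda>w. Y w f) - Y w (\<lambda>w. E w f) = frame w (c w) f"
  shows "smooth_at A z (\<lambda>w. frame w (c w) f)"
proof -
  obtain \<Omega> x u where x: "(\<Omega>, x) \<in> A" "u \<in> \<Omega>" "z = x u" using carrierE[OF z] .
  have Y: "smooth_at A z (\<lambda>w. Y w f)" if "smooth_at A z f" for f
    by (rule flow_mixed_derivative(2)[OF z frame_tangent(1)[OF z] that])
  have "smooth_at A z (\<lambda>w. E w (\<lambda>w. Y w f) - Y w (\<lambda>w. E w f))" by (intro smooth_at_diff z E Y f)
  note sm = this
  have "\<forall>\<^sub>F w in nhds u. E (x w) (\<lambda>w. Y w f) - Y (x w) (\<lambda>w. E w f) = frame (x w) (c (x w)) f"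
    using atlas_open_eventually[OF atlas_open_smooth_at x(1,2), of f] z f x(3) by (auto elim!: eventually_mono intro: c)
  from smooth_at_cong[OF x(1,2) this] sm show ?thesis unfolding x(3) .
qed

text \<open>The functions \<open>l\<close>, \<open>p\<close>, \<open>k\<close>, \<open>q\<close> are the frame coefficients of the smooth fields \<open>[e2, Y]\<close> and
  \<open>[e3, Y]\<close>. For a thermostat this contains the smoothness of the Gauss curvature.\<close>

lemma coefficients_continuous:
  "continuous_map (atlas_topology A) euclideanreal l" "continuous_map (atlas_topology A) euclideanreal p"
  "continuous_map (atlas_topology A) euclideanreal k" "continuous_map (atlas_topology A) euclideanreal q"
proof -
  have "smooth_at A z (\<lambda>w. frame w (l w, p w, k w) f)" if "z \<in> M" "smooth_at A z f" for z f
    by (rule commutator_smooth[OF that frame_smooth(1)[OF that(1)]]) (auto simp only: frame_apply fst_conv snd_conv bracket2)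
  from frame_coefficients_continuous[OF this]
  show "continuous_map (atlas_topology A) euclideanreal l" "continuous_map (atlas_topology A) euclideanreal p"
    "continuous_map (atlas_topology A) euclideanreal k" by simp_all
  have "smooth_at A z (\<lambda>w. frame w (0, 1, q w) f)" if "z \<in> M" "smooth_at A z f" for z f
    by (rule commutator_smooth[OF that frame_smooth(2)[OF that(1)]]) (auto simp only: frame_apply fst_conv snd_conv bracket3 mult_zero_left add_0_left mult_1)
  from frame_coefficients_continuous(3)[OF this]
  show "continuous_map (atlas_topology A) euclideanreal q" by simp
qed

end

locale compact_framed_flow = framed_flow A Y \<phi> e2 e3 l p k q index
  for A :: "('m, 'e::euclidean_space) atlas" and Y :: "'m vfield" and \<phi> :: "real \<Rightarrow> 'm \<Rightarrow> 'm"
    and e2 e3 :: "'m vfield" and l p k q :: "'m \<Rightarrow> real" and index :: "'i itself" +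
  fixes G :: "'m metric"
  assumes compact: "compact_space (atlas_topology A)" and metric: "riemannian_metric A G"
    and k_pos: "z \<in> M \<Longrightarrow> k z > 0"
begin

lemma cone_cocycle:
  obtains B k0 where "cone_cocycle (atlas_topology A) \<phi> cocycle l p k q B k0"
proof -
  obtain k0 where k0: "k0 > 0" "\<And>z. z \<in> M \<Longrightarrow> k0 \<le> k z"
    using compact_space_positive[OF compact coefficients_continuous(3)] k_pos unfolding topspace_carrier by blast
  note bd = compact_space_bounded[OF compact, unfolded topspace_carrier]
  obtain B1 where B1: "B1 > 0" "\<And>z. z \<in> M \<Longrightarrow> \<bar>l z\<bar> \<le> B1" using bd[OF coefficients_continuous(1)] by blast
  obtain B2 where B2: "B2 > 0" "\<And>z. z \<in> M \<Longrightarrow> \<bar>p z\<bar> \<le> B2" using bd[OF coefficients_continuous(2)] by blast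
  obtain B3 where B3: "B3 > 0" "\<And>z. z \<in> M \<Longrightarrow> \<bar>k z\<bar> \<le> B3" using bd[OF coefficients_continuous(3)] by blast
  obtain B4 where B4: "B4 > 0" "\<And>z. z \<in> M \<Longrightarrow> \<bar>q z\<bar> \<le> B4" using bd[OF coefficients_continuous(4)] by blast
  have "cone_cocycle (atlas_topology A) \<phi> cocycle l p k q (B1 + B2 + B3 + B4) k0"
  proof (rule cone_cocycle.intro, unfold topspace_carrier)
    fix z assume z: "z \<in> M"
    show "\<bar>l z\<bar> \<le> B1 + B2 + B3 + B4" "\<bar>p z\<bar> \<le> B1 + B2 + B3 + B4" "\<bar>q z\<bar> \<le> B1 + B2 + B3 + B4" "k z \<le> B1 + B2 + B3 + B4"
      using B1(2)[OF z] B2(2)[OF z] B3(2)[OF z] B4(2)[OF z] B1(1) B2(1) B3(1) B4(1) by linarith+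
    show "((\<lambda>t. cocycle t z (x, y, v)) has_vector_derivative (l z * y, p z * y + v, k z * y + q z * v)) (at 0)" for x y v
      by (rule cocycle_derivative[OF z])
  qed (use flow_0 flow_add flow_continuous k0 B1(1) B2(1) B3(1) B4(1) cocycle_linear cocycle_0 cocycle_add cocycle_generator
      continuous_map_smooth[OF cocycle_smooth(1)] continuous_map_smooth[OF cocycle_smooth(2)] continuous_map_smooth[OF cocycle_smooth(3)] in auto)
  then show thesis by (rule that)
qed

lemma metric_frame: assumes z: "z \<in> M"
  shows "G z (frame z c) (frame z c) = (\<Sum>i\<in>Basis. \<Sum>j\<in>Basis. G z (frame z i) (frame z j) * ((c \<bullet> i) * (c \<bullet> j)))"
proof -
  let ?g = "\<lambda>a b. G z (frame z a) (frame z b)"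
  note T = frame_in_tangent_space[OF z]
  show ?thesis
  proof (rule symmetric_form_expand[of ?g])
    show "?g (r *\<^sub>R a + s *\<^sub>R c) b = r * ?g a b + s * ?g c b" for r a s c b
      unfolding frame_linear using metric z T unfolding riemannian_metric_def by blast
    show "?g a b = ?g b a" for a b using metric z T unfolding riemannian_metric_def by blast
  qed
qed

text \<open>The quadratic form of \<open>G\<close> in the frame is continuous and positive on the product of the manifold with
  the unit sphere of components, which is compact.\<close>

lemma frame_norm_bounds:
  obtains a b where "a > 0" "b > 0" "\<And>z c. z \<in> M \<Longrightarrow> a * norm c \<le> tnorm G z (frame z c) \<and> tnorm G z (frame z c) \<le> b * norm c"
proof -
  let ?X = "prod_topology (atlas_topology A) (top_of_set (sphere (0 :: real \<times> real \<times> real) 1))"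
  let ?Q = "\<lambda>w. G (fst w) (frame (fst w) (snd w)) (frame (fst w) (snd w))"
  have "compact_space ?X" using compact by (simp add: compact_space_prod_topology compact_space_subtopology)
  have tX: "topspace ?X = M \<times> sphere 0 1" by (simp add: topspace_carrier)
  have g: "continuous_map ?X euclideanreal (\<lambda>w. G (fst w) (frame (fst w) i) (frame (fst w) j))" for i j
    using continuous_map_compose[OF continuous_map_fst metric_continuous[OF metric frame_in_tangent_space frame_smooth_at frame_in_tangent_space frame_smooth_at]]
    by (simp add: o_def)
  have c: "continuous_map ?X euclideanreal (\<lambda>w. snd w \<bullet> i)" for i
    using continuous_map_compose[OF continuous_map_snd, of "top_of_set (sphere 0 1)" euclideanreal "\<lambda>c. c \<bullet> i"]
    by (simp add: o_def continuous_on_inner continuous_on_const continuous_on_id)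
  have "continuous_map ?X euclideanreal (\<lambda>w. \<Sum>i\<in>Basis. \<Sum>j\<in>Basis. G (fst w) (frame (fst w) i) (frame (fst w) j) * ((snd w \<bullet> i) * (snd w \<bullet> j)))"
    by (intro continuous_map_sum continuous_map_real_mult g c) simp_all
  then have Qc: "continuous_map ?X euclideanreal ?Q"
    by (rule continuous_map_eq) (unfold tX, auto simp: metric_frame)
  have Qp: "?Q w > 0" if "w \<in> topspace ?X" for w
  proof -
    have w: "fst w \<in> M" "snd w \<noteq> 0" using that unfolding tX by auto
    have "frame (fst w) (snd w) \<noteq> tzero"
    proof
      assume "frame (fst w) (snd w) = tzero"
      moreover have "tzero = frame (fst w) 0" by (simp add: frame_apply fun_eq_iff tzero_def)
      ultimately show False using frame_inj[OF w(1)] w(2) by metis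
    qed
    then show ?thesis using metric w(1) frame_in_tangent_space[OF w(1)] unfolding riemannian_metric_def by blast
  qed
  obtain a where a: "a > 0" "\<And>w. w \<in> topspace ?X \<Longrightarrow> a \<le> ?Q w"
    using compact_space_positive[OF \<open>compact_space ?X\<close> Qc Qp] by blast
  obtain b where b: "b > 0" "\<And>w. w \<in> topspace ?X \<Longrightarrow> \<bar>?Q w\<bar> \<le> b"
    using compact_space_bounded[OF \<open>compact_space ?X\<close> Qc] by blast
  have "sqrt a * norm c \<le> tnorm G z (frame z c) \<and> tnorm G z (frame z c) \<le> sqrt b * norm c" if z: "z \<in> M" for z c
  proof (cases "c = 0")
    case False
    let ?c = "(1 / norm c) *\<^sub>R c"
    have w: "(z, ?c) \<in> topspace ?X" using z False unfolding tX by simp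
    have "?Q (z, c) = (norm c)\<^sup>2 * ?Q (z, ?c)"
      unfolding fst_conv snd_conv metric_frame[OF z] sum_distrib_left
      using False by (intro sum.cong refl) (simp add: power2_eq_square)
    then have "tnorm G z (frame z c) = norm c * sqrt (?Q (z, ?c))" by (simp add: tnorm_def real_sqrt_mult)
    moreover have "norm c * sqrt a \<le> norm c * sqrt (?Q (z, ?c))" "norm c * sqrt (?Q (z, ?c)) \<le> norm c * sqrt b"
      using a(2)[OF w] b(2)[OF w] by (auto intro!: mult_left_mono)
    ultimately show ?thesis by (simp only: mult.commute[of _ "norm c"])
  qed (simp add: tnorm_def metric_frame[OF z])
  then show thesis using a(1) b(1) by (intro that[of "sqrt a" "sqrt b"]) auto
qed

end

subsection \<open>Line fields\<close>

lemma decay_rateI: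
  assumes "\<And>t z. t > 0 \<Longrightarrow> z \<in> S \<Longrightarrow> N t z \<le> C * \<tau> powr t" "C > 0" "\<tau> > 0" "\<tau> < 1"
  shows "\<exists>C>0. \<exists>\<tau>>0. \<tau> < 1 \<and> (\<forall>t>0. \<forall>z\<in>S. N t z \<le> C * \<tau> powr (t :: real))"
  using assms by blast

lemma two_line_coordinates:
  fixes a b c d y v :: real
  assumes "a \<noteq> b"
  shows "y = c + d \<and> v = c * a + d * b \<longleftrightarrow> c = (v - b * y) / (a - b) \<and> d = (a * y - v) / (a - b)"
proof
  assume "y = c + d \<and> v = c * a + d * b"
  then show "c = (v - b * y) / (a - b) \<and> d = (a * y - v) / (a - b)" using assms by (simp add: eq_divide_eq algebra_simps)
next
  assume *: "c = (v - b * y) / (a - b) \<and> d = (a * y - v) / (a - b)"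
  then have "c * (a - b) = v - b * y" "d * (a - b) = a * y - v" using assms by auto
  then have "(c + d) * (a - b) = y * (a - b)" "(c * a + d * b) * (a - b) = v * (a - b)" by algebra+
  then show "y = c + d \<and> v = c * a + d * b" using assms by simp
qed

context compact_framed_flow begin

lemma frame_scale: "tscale r (frame z d) = frame z (r *\<^sub>R d)"
  by (auto simp: frame_apply tscale_def algebra_simps)

lemma frame_add: "tadd (frame z d) (frame z d') = frame z (d + d')"
  by (auto simp: frame_apply tadd_def algebra_simps)

lemma frame_zero: "frame z 0 = tzero"
  by (auto simp: frame_apply tzero_def)

lemma frame_eq_iff: "z \<in> M \<Longrightarrow> frame z c = frame z d \<longleftrightarrow> c = d"
  using frame_inj by blast

lemma line_field_continuous:
  assumes h: "continuous_map (atlas_topology A) euclideanreal h" and w: "continuous_map (atlas_topology A) euclideanreal w"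
  shows "continuous_vfield_on A M (\<lambda>z. frame z (h z, 1, w z))"
  unfolding continuous_vfield_on_def
proof (intro conjI ballI allI impI)
  fix z f assume z: "z \<in> M" and f: "smooth_at A z f"
  have z': "z \<in> topspace (atlas_topology A)" using z by (simp add: topspace_carrier)
  note lim = topcontinuous_at_smooth[OF z, unfolded topcontinuous_at_real, THEN conjunct2]
  have c: "(h \<longlongrightarrow> h z) (atin (atlas_topology A) z)" "(w \<longlongrightarrow> w z) (atin (atlas_topology A) z)"
    using h w z' by (auto simp: continuous_map_atin)
  have Y: "smooth_at A z (\<lambda>w. Y w f)" by (rule flow_mixed_derivative(2)[OF z frame_tangent(1)[OF z] f])
  show "topcontinuous_at (atlas_topology A) euclidean (\<lambda>q. frame q (h q, 1, w q) f) z"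
    unfolding topcontinuous_at_real frame_apply fst_conv snd_conv
    by (intro conjI z' tendsto_add tendsto_mult c tendsto_const lim[OF Y] lim[OF frame_smooth(1)[OF z f]] lim[OF frame_smooth(2)[OF z f]])
qed (rule frame_in_tangent_space)

lemma M_openin: "openin (atlas_topology A) M"
  using openin_topspace[of "atlas_topology A"] unfolding topspace_carrier .

abbreviation "coset \<equiv> flow_coset Y"

lemma coset_frame: "coset z (frame z d) = range (\<lambda>s. frame z (d + (s, 0, 0)))"
proof -
  have "tadd (frame z d) (tscale s (Y z)) = frame z (d + (s, 0, 0))" for s
    by (auto simp: frame_apply tadd_def tscale_def algebra_simps)
  then show ?thesis unfolding flow_coset_def by auto
qed

lemma frame_in_coset: "frame z d \<in> coset z (frame z d)"
proof -
  have "d + (0, 0, 0) = d" by (simp add: prod_eq_iff)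
  then show ?thesis unfolding coset_frame by (metis rangeI)
qed

lemma coset_eq_iff:
  assumes z: "z \<in> M" shows "coset z (frame z d) = coset z (frame z d') \<longleftrightarrow> snd d = snd d'"
proof
  assume "coset z (frame z d) = coset z (frame z d')"
  then have "frame z d \<in> coset z (frame z d')" using frame_in_coset[of z d] by simp
  then obtain s where "frame z d = frame z (d' + (s, 0, 0))" unfolding coset_frame by blast
  then have "d = d' + (s, 0, 0)" by (rule frame_inj[OF z])
  then show "snd d = snd d'" by (cases d, cases d') simp
next
  assume eq: "snd d = snd d'"
  have "coset z (frame z a) \<subseteq> coset z (frame z b)" if "snd a = snd b" for a b
  proof -
    have "frame z (a + (s, 0, 0)) = frame z (b + (fst a - fst b + s, 0, 0))" for s
      using that by (intro arg_cong[of _ _ "frame z"]) (simp add: prod_eq_iff)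
    then show ?thesis unfolding coset_frame by auto
  qed
  then show "coset z (frame z d) = coset z (frame z d')" using eq by (metis subset_antisym)
qed

lemma coset_add_frame: "coset_add (coset z (frame z d)) (coset z (frame z d')) = coset z (frame z (d + d'))"
proof
  show "coset_add (coset z (frame z d)) (coset z (frame z d')) \<subseteq> coset z (frame z (d + d'))"
  proof
    fix e assume "e \<in> coset_add (coset z (frame z d)) (coset z (frame z d'))"
    then obtain s s' where "e = tadd (frame z (d + (s, 0, 0))) (frame z (d' + (s', 0, 0)))"
      unfolding coset_add_def coset_frame by blast
    moreover have "d + (s, 0, 0) + (d' + (s', 0, 0)) = d + d' + (s + s', 0, 0)" by (simp add: prod_eq_iff)
    ultimately have "e = frame z (d + d' + (s + s', 0, 0))" by (simp only: frame_add)
    then show "e \<in> coset z (frame z (d + d'))" unfolding coset_frame by blast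
  qed
  show "coset z (frame z (d + d')) \<subseteq> coset_add (coset z (frame z d)) (coset z (frame z d'))"
  proof
    fix e assume "e \<in> coset z (frame z (d + d'))"
    then obtain s where "e = frame z (d + d' + (s, 0, 0))" unfolding coset_frame by blast
    moreover have "d + d' + (s, 0, 0) = d + (s, 0, 0) + d'" by (simp add: algebra_simps)
    ultimately have "e = tadd (frame z (d + (s, 0, 0))) (frame z d')" by (simp only: frame_add)
    moreover have "frame z (d + (s, 0, 0)) \<in> coset z (frame z d)" unfolding coset_frame by blast
    ultimately show "e \<in> coset_add (coset z (frame z d)) (coset z (frame z d'))"
      using frame_in_coset[of z d'] unfolding coset_add_def by blast
  qed
qed

lemma quotient_flow_frame:
  assumes z: "z \<in> M" shows "quotient_flow A \<phi> t z (coset z (frame z d)) = coset (\<phi> t z) (frame (\<phi> t z) (cocycle t z d))"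
proof -
  have "cocycle t z (d + (s, 0, 0)) = cocycle t z d + (s, 0, 0)" for s
    using linear_add[OF cocycle_linear[OF z], of t d "(s, 0, 0)"] linear_scale[OF cocycle_linear[OF z], of t s "(1, 0, 0)"]
      cocycle_generator[OF z, of t] by simp
  then show ?thesis unfolding quotient_flow_def coset_frame image_image pushforward_frame[OF z] by simp
qed

text \<open>The lower bound only sees the component \<open>y\<close>, which all members of a coset share.\<close>

lemma coset_norm_bounds:
  assumes z: "z \<in> M" and a: "0 < a" "\<And>c. a * norm c \<le> tnorm G z (frame z c) \<and> tnorm G z (frame z c) \<le> b * norm c"
  shows "a * \<bar>fst (snd d)\<bar> \<le> coset_norm G z (coset z (frame z d))" "coset_norm G z (coset z (frame z d)) \<le> b * norm d"
proof -
  have le: "a * \<bar>fst (snd d)\<bar> \<le> y" if y: "y \<in> tnorm G z ` coset z (frame z d)" for y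
  proof -
    from y obtain s where y': "y = tnorm G z (frame z (d + (s, 0, 0)))" unfolding coset_frame by auto
    have "\<bar>fst (snd d)\<bar> \<le> norm (snd d)" using norm_fst_le[of "fst (snd d)" "snd (snd d)"] by simp
    also have "\<dots> \<le> norm (d + (s, 0, 0))" using norm_snd_le[of "snd d" "fst d + s"] by (cases d) simp
    finally have "a * \<bar>fst (snd d)\<bar> \<le> a * norm (d + (s, 0, 0))" using a(1) by simp
    then show ?thesis using a(2)[of "d + (s, 0, 0)"] y' by linarith
  qed
  have mem: "tnorm G z (frame z d) \<in> tnorm G z ` coset z (frame z d)" using frame_in_coset by blast
  show "a * \<bar>fst (snd d)\<bar> \<le> coset_norm G z (coset z (frame z d))"
    unfolding coset_norm_def by (rule cInf_greatest) (use le mem in blast)+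
  have "coset_norm G z (coset z (frame z d)) \<le> tnorm G z (frame z d)"
    unfolding coset_norm_def by (rule cInf_lower[OF mem]) (use le in \<open>auto simp: bdd_below_def\<close>)
  then show "coset_norm G z (coset z (frame z d)) \<le> b * norm d" using a(2)[of d] by simp
qed

lemma norm_triple_le: "norm (h, 1 :: real, w) \<le> \<bar>h\<bar> + 1 + \<bar>w\<bar>" for h w :: real
  using norm_Pair_le[of h "(1 :: real, w)"] norm_Pair_le[of "1 :: real" w] by simp

lemma norm_triple_ge: "1 \<le> norm (h, 1 :: real, w)" for h w :: real
  using norm_snd_le[of "(1 :: real, w)" h] norm_fst_le[of "1 :: real" w] by simp

subsection \<open>The dominated splitting\<close>

abbreviation coset_line :: "('m \<Rightarrow> real) \<Rightarrow> 'm \<Rightarrow> 'm tvec set set"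
  where "coset_line w z \<equiv> {coset z (tscale c (frame z (0, 1, w z))) | c. True}"

lemma coset_line_subbundle:
  assumes w: "continuous_map (atlas_topology A) euclideanreal w"
  shows "continuous_quotient_line_subbundle A Y (coset_line w)"
  unfolding continuous_quotient_line_subbundle_def
proof (intro ballI exI conjI)
  show "openin (atlas_topology A) M" by (rule M_openin)
  show "continuous_vfield_on A M (\<lambda>z. frame z (0, 1, w z))"
    by (rule line_field_continuous[OF _ w]) simp
  show "coset z (frame z (0, 1, w z)) \<noteq> coset z tzero" if "z \<in> M" for z
    unfolding frame_zero[of z, symmetric] coset_eq_iff[OF that] by (simp add: prod_eq_iff)
qed auto

lemma quotient_flow_line:
  assumes z: "z \<in> M" and r: "cocycle t z (0, 1, w) = (x, 0, 0) + r *\<^sub>R (0, 1, w')"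
  shows "quotient_flow A \<phi> t z (coset z (tscale c (frame z (0, 1, w))))
    = coset (\<phi> t z) (tscale (c * r) (frame (\<phi> t z) (0, 1, w')))"
proof -
  have "cocycle t z (c *\<^sub>R (0, 1, w)) = c *\<^sub>R ((x, 0, 0) + r *\<^sub>R (0, 1, w'))"
    by (simp only: linear_scale[OF cocycle_linear[OF z]] r)
  then show ?thesis
    unfolding frame_scale quotient_flow_frame[OF z] coset_eq_iff[OF flow_carrier[OF z]] by (simp add: prod_eq_iff)
qed

text \<open>The splitting consists of the two invariant lines of slopes \<open>wu > 0\<close> and \<open>ws < 0\<close>. On the quotient,
  norms along them are comparable to \<open>\<bar>y\<bar>\<close>, and \<open>growth_gap\<close> compares the growth of the two \<open>y\<close>.\<close>

theorem dominated_splitting: "has_dominated_splitting A G Y \<phi>"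
proof -
  obtain B k0 where "cone_cocycle (atlas_topology A) \<phi> cocycle l p k q B k0" using cone_cocycle .
  then interpret C: cone_cocycle "atlas_topology A" \<phi> cocycle l p k q B k0 .
  obtain wu ws where cont: "continuous_map (atlas_topology A) euclideanreal wu" "continuous_map (atlas_topology A) euclideanreal ws"
    and bu: "\<And>z. z \<in> M \<Longrightarrow> C.m \<le> wu z \<and> wu z \<le> C.W" and bs: "\<And>z. z \<in> M \<Longrightarrow> - C.W \<le> ws z \<and> ws z \<le> - C.m"
    and iu: "\<And>z t. z \<in> M \<Longrightarrow> \<exists>x r. r \<noteq> 0 \<and> cocycle t z (0, 1, wu z) = (x, 0, 0) + r *\<^sub>R (0, 1, wu (\<phi> t z))"
    and iv: "\<And>z t. z \<in> M \<Longrightarrow> \<exists>x r. r \<noteq> 0 \<and> cocycle t z (0, 1, ws z) = (x, 0, 0) + r *\<^sub>R (0, 1, ws (\<phi> t z))"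
    and gap: "\<And>z t. z \<in> M \<Longrightarrow> 0 \<le> t \<Longrightarrow> \<bar>fst (snd (cocycle t z (0, 1, ws z)))\<bar> \<le> \<bar>fst (snd (cocycle t z (0, 1, wu z)))\<bar> * exp (- (2 * C.m) * t)"
    using C.dominated_lines[unfolded topspace_carrier] by blast
  obtain a b where a: "a > 0" "b > 0" "\<And>z c. z \<in> M \<Longrightarrow> a * norm c \<le> tnorm G z (frame z c) \<and> tnorm G z (frame z c) \<le> b * norm c"
    using frame_norm_bounds by blast
  let ?b = "b * (1 + C.W)"
  have line_norm: "a * \<bar>c\<bar> \<le> coset_norm G z (coset z (tscale c (frame z (0, 1, w)))) \<and>
      coset_norm G z (coset z (tscale c (frame z (0, 1, w)))) \<le> ?b * \<bar>c\<bar>" if z: "z \<in> M" and w: "\<bar>w\<bar> \<le> C.W" for z w c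
  proof -
    define d :: "real \<times> real \<times> real" where "d = (0, 1, w)"
    have "norm d \<le> 1 + C.W" using norm_triple_le[of 0 w] w unfolding d_def by linarith
    then have "b * norm (c *\<^sub>R d) \<le> b * (\<bar>c\<bar> * (1 + C.W))"
      unfolding norm_scaleR using a(2) by (intro mult_left_mono) auto
    moreover have "b * (\<bar>c\<bar> * (1 + C.W)) = ?b * \<bar>c\<bar>" by simp
    moreover have f: "fst (snd (c *\<^sub>R d)) = c" by (simp add: d_def)
    note coset_norm_bounds[OF z a(1) a(3)[OF z], of "c *\<^sub>R d", unfolded f]
    ultimately show ?thesis unfolding frame_scale d_def[symmetric] by linarith
  qed
  have wu: "\<bar>wu z\<bar> \<le> C.W" and ws: "\<bar>ws z\<bar> \<le> C.W" if "z \<in> M" for z using bu[OF that] bs[OF that] C.mW by auto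
  show ?thesis
    unfolding has_dominated_splitting_def
  proof (rule exI[of _ "coset_line wu"], rule exI[of _ "coset_line ws"], intro conjI coset_line_subbundle cont)
    show "\<forall>z\<in>M. \<forall>e\<in>quotient_fibre A Y z. \<exists>!(e1, e2). e1 \<in> coset_line wu z \<and> e2 \<in> coset_line ws z \<and> e = coset_add e1 e2"
    proof (intro ballI)
      fix z e assume z: "z \<in> M" and "e \<in> quotient_fibre A Y z"
      then obtain x y v where e: "e = coset z (frame z (x, y, v))"
        unfolding quotient_fibre_def using frame_surj[OF z] by (metis (no_types, lifting) imageE prod_cases3)
      have ne: "wu z - ws z \<noteq> 0" using bu[OF z] bs[OF z] C.mW by auto
      let ?e1 = "\<lambda>c. coset z (tscale c (frame z (0, 1, wu z)))" and ?e2 = "\<lambda>c. coset z (tscale c (frame z (0, 1, ws z)))"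
      have iff: "e = coset_add (?e1 c) (?e2 d) \<longleftrightarrow> c = (v - ws z * y) / (wu z - ws z) \<and> d = (wu z * y - v) / (wu z - ws z)" for c d
      proof -
        have "e = coset_add (?e1 c) (?e2 d) \<longleftrightarrow> y = c + d \<and> v = c * wu z + d * ws z"
          unfolding e frame_scale coset_add_frame coset_eq_iff[OF z] by simp
        also have "\<dots> \<longleftrightarrow> c = (v - ws z * y) / (wu z - ws z) \<and> d = (wu z * y - v) / (wu z - ws z)"
          by (rule two_line_coordinates) (use ne in simp)
        finally show ?thesis .
      qed
      show "\<exists>!(e1, e2). e1 \<in> coset_line wu z \<and> e2 \<in> coset_line ws z \<and> e = coset_add e1 e2"
      proof (rule ex1I[of _ "(?e1 ((v - ws z * y) / (wu z - ws z)), ?e2 ((wu z * y - v) / (wu z - ws z)))"])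
        show "case (?e1 ((v - ws z * y) / (wu z - ws z)), ?e2 ((wu z * y - v) / (wu z - ws z))) of
            (e1, e2) \<Rightarrow> e1 \<in> coset_line wu z \<and> e2 \<in> coset_line ws z \<and> e = coset_add e1 e2"
          unfolding split_conv using iff by blast
        fix s assume "case s of (e1, e2) \<Rightarrow> e1 \<in> coset_line wu z \<and> e2 \<in> coset_line ws z \<and> e = coset_add e1 e2"
        then obtain c d where s: "s = (?e1 c, ?e2 d)" "e = coset_add (?e1 c) (?e2 d)" by (cases s) blast
        show "s = (?e1 ((v - ws z * y) / (wu z - ws z)), ?e2 ((wu z * y - v) / (wu z - ws z)))"
          using iff[of c d, THEN iffD1, OF s(2)] unfolding s(1) by blast
      qed
    qed
    show "\<forall>t. \<forall>z\<in>M. quotient_flow A \<phi> t z ` coset_line wu z = coset_line wu (\<phi> t z) \<and>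
         quotient_flow A \<phi> t z ` coset_line ws z = coset_line ws (\<phi> t z)"
    proof (intro allI ballI conjI)
      fix t z assume z: "z \<in> M"
      obtain x r where r: "r \<noteq> 0" "cocycle t z (0, 1, wu z) = (x, 0, 0) + r *\<^sub>R (0, 1, wu (\<phi> t z))" using iu[OF z] by blast
      show "quotient_flow A \<phi> t z ` coset_line wu z = coset_line wu (\<phi> t z)"
        by (rule line_image[OF r(1)]) (rule quotient_flow_line[OF z r(2)])
      obtain x r where r: "r \<noteq> 0" "cocycle t z (0, 1, ws z) = (x, 0, 0) + r *\<^sub>R (0, 1, ws (\<phi> t z))" using iv[OF z] by blast
      show "quotient_flow A \<phi> t z ` coset_line ws z = coset_line ws (\<phi> t z)"
        by (rule line_image[OF r(1)]) (rule quotient_flow_line[OF z r(2)])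
    qed
    let ?C = "(?b / a)\<^sup>2" and ?\<tau> = "exp (- (2 * C.m))"
    have b0: "?b > 0" using a(2) C.mW by simp
    have bound: "op_norm (coset_norm G z) (coset_norm G (\<phi> t z)) (coset_line ws z) (quotient_flow A \<phi> t z) *
         op_norm (coset_norm G (\<phi> t z)) (coset_norm G z) (coset_line wu (\<phi> t z)) (quotient_flow A \<phi> (- t) (\<phi> t z))
         \<le> ?C * ?\<tau> powr t" if t: "t > 0" and z: "z \<in> M" for t z
    proof -
      have z': "\<phi> t z \<in> M" by (rule flow_carrier[OF z])
      obtain x r where r: "r \<noteq> 0" "cocycle t z (0, 1, wu z) = (x, 0, 0) + r *\<^sub>R (0, 1, wu (\<phi> t z))" using iu[OF z] by blast
      obtain x' r' where r': "r' \<noteq> 0" "cocycle t z (0, 1, ws z) = (x', 0, 0) + r' *\<^sub>R (0, 1, ws (\<phi> t z))" using iv[OF z] by blast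
      have gap': "\<bar>r'\<bar> \<le> \<bar>r\<bar> * exp (- (2 * C.m) * t)" using gap[OF z, of t] t unfolding r(2) r'(2) by simp
      have ret: "\<phi> (- t) (\<phi> t z) = z" using flow_add[OF z, of "- t" t] flow_0[OF z] by simp
      \<comment> \<open>the backward flow divides by the factor of the forward flow\<close>
      have inv: "quotient_flow A \<phi> (- t) (\<phi> t z) (coset (\<phi> t z) (tscale c (frame (\<phi> t z) (0, 1, wu (\<phi> t z)))))
          = coset z (tscale (c * (1 / r)) (frame z (0, 1, wu z)))" for c
      proof -
        obtain y s where s: "cocycle (- t) (\<phi> t z) (0, 1, wu (\<phi> t z)) = (y, 0, 0) + s *\<^sub>R (0, 1, wu z)"
          using iu[OF z', of "- t"] ret by auto
        have "(0, 1, wu z) = cocycle (- t) (\<phi> t z) (cocycle t z (0, 1, wu z))"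
          using cocycle_add[OF z, of "- t" t] cocycle_0[OF z] by simp
        also have "\<dots> = x *\<^sub>R cocycle (- t) (\<phi> t z) (1, 0, 0) + r *\<^sub>R cocycle (- t) (\<phi> t z) (0, 1, wu (\<phi> t z))"
          unfolding r(2) using linear_add[OF cocycle_linear[OF z']] linear_scale[OF cocycle_linear[OF z']]
          by (metis mult.right_neutral mult_zero_right real_scaleR_def scaleR_Pair)
        also have "\<dots> = (x + r * y, r * s, r * s * wu z)" unfolding cocycle_generator[OF z'] s by simp
        finally have "s = 1 / r" using r(1) by (simp add: field_simps)
        then show ?thesis using quotient_flow_line[OF z', of "- t" "wu (\<phi> t z)" y s "wu z" c] s ret by simp
      qed
      note S = op_norm_line[where n = "coset_norm G z" and n' = "coset_norm G (\<phi> t z)" and T = "quotient_flow A \<phi> t z"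
          and e = "\<lambda>c. coset z (tscale c (frame z (0, 1, ws z)))" and r = r' and a = a and b = ?b
          and e' = "\<lambda>c. coset (\<phi> t z) (tscale c (frame (\<phi> t z) (0, 1, ws (\<phi> t z))))",
          OF a(1) line_norm[OF z ws[OF z]] line_norm[OF z' ws[OF z']] quotient_flow_line[OF z r'(2)]]
      note U = op_norm_line[where n = "coset_norm G (\<phi> t z)" and n' = "coset_norm G z" and T = "quotient_flow A \<phi> (- t) (\<phi> t z)"
          and e = "\<lambda>c. coset (\<phi> t z) (tscale c (frame (\<phi> t z) (0, 1, wu (\<phi> t z))))" and r = "1 / r" and a = a and b = ?b
          and e' = "\<lambda>c. coset z (tscale c (frame z (0, 1, wu z)))",
          OF a(1) line_norm[OF z' wu[OF z']] line_norm[OF z wu[OF z]] inv]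
      have sq: "\<beta> * x * (\<beta> * \<bar>1 / r\<bar>) = \<beta>\<^sup>2 * (x / \<bar>r\<bar>)" for \<beta> x by (simp add: power2_eq_square)
      have "op_norm (coset_norm G z) (coset_norm G (\<phi> t z)) (coset_line ws z) (quotient_flow A \<phi> t z) *
         op_norm (coset_norm G (\<phi> t z)) (coset_norm G z) (coset_line wu (\<phi> t z)) (quotient_flow A \<phi> (- t) (\<phi> t z))
         \<le> (?b / a * \<bar>r'\<bar>) * (?b / a * \<bar>1 / r\<bar>)"
        using mult_mono[OF S(2) U(2) _ U(1)] b0 a(1) by simp
      also have "\<dots> = ?C * (\<bar>r'\<bar> / \<bar>r\<bar>)" by (rule sq)
      also have "\<dots> \<le> ?C * exp (- (2 * C.m) * t)"
        using gap' r(1) by (intro mult_left_mono) (simp_all add: field_simps)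
      also have "exp (- (2 * C.m) * t) = ?\<tau> powr t" by (simp add: powr_def)
      finally show "op_norm (coset_norm G z) (coset_norm G (\<phi> t z)) (coset_line ws z) (quotient_flow A \<phi> t z) *
         op_norm (coset_norm G (\<phi> t z)) (coset_norm G z) (coset_line wu (\<phi> t z)) (quotient_flow A \<phi> (- t) (\<phi> t z))
         \<le> ?C * ?\<tau> powr t" .
    qed
    have "?C > 0" using a(1) b0 by (intro zero_less_power divide_pos_pos)
    moreover have "?\<tau> < 1" using C.mW by simp
    ultimately show "\<exists>C>0. \<exists>\<tau>>0. \<tau> < 1 \<and> (\<forall>t>0. \<forall>z\<in>M.
         op_norm (coset_norm G z) (coset_norm G (\<phi> t z)) (coset_line ws z) (quotient_flow A \<phi> t z) *
         op_norm (coset_norm G (\<phi> t z)) (coset_norm G z) (coset_line wu (\<phi> t z)) (quotient_flow A \<phi> (- t) (\<phi> t z))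
         \<le> C * \<tau> powr t)"
      by (intro decay_rateI[OF bound] exp_gt_zero)
  qed
qed

end

subsection \<open>The Anosov property\<close>

lemma two_decay_ratesI:
  assumes "\<And>t z. t > 0 \<Longrightarrow> z \<in> S \<Longrightarrow> N t z \<le> C * \<eta> powr (- t) \<and> N' t z \<le> C * \<zeta> powr t" "C > 0" "\<zeta> > 0" "\<zeta> < 1" "1 < \<eta>"
  shows "\<exists>C>0. \<exists>\<zeta>>0. \<exists>\<eta>. \<zeta> < 1 \<and> 1 < \<eta> \<and> (\<forall>t>0. \<forall>z\<in>S. N t z \<le> C * \<eta> powr (- t) \<and> N' t z \<le> C * \<zeta> powr (t :: real))"
  using assms by blast

context compact_framed_flow begin

abbreviation frame_line :: "('m \<Rightarrow> real) \<Rightarrow> ('m \<Rightarrow> real) \<Rightarrow> 'm \<Rightarrow> 'm tvec set"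
  where "frame_line h w z \<equiv> {tscale c (frame z (h z, 1, w z)) | c. True}"

lemma frame_line_subbundle:
  assumes "continuous_map (atlas_topology A) euclideanreal h" "continuous_map (atlas_topology A) euclideanreal w"
  shows "continuous_line_subbundle A (frame_line h w)"
  unfolding continuous_line_subbundle_def
proof (intro ballI exI conjI)
  show "openin (atlas_topology A) M" by (rule M_openin)
  show "continuous_vfield_on A M (\<lambda>z. frame z (h z, 1, w z))" by (rule line_field_continuous[OF assms])
  show "frame z (h z, 1, w z) \<noteq> tzero" if "z \<in> M" for z
    unfolding frame_zero[of z, symmetric] frame_eq_iff[OF that] by (simp add: prod_eq_iff)
qed auto

lemma pushforward_line:
  assumes "z \<in> M" "cocycle t z d = r *\<^sub>R d'"
  shows "pushforward A (\<phi> t) z (tscale c (frame z d)) = tscale (c * r) (frame (\<phi> t z) d')"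
  unfolding frame_scale pushforward_frame[OF assms(1)] linear_scale[OF cocycle_linear[OF assms(1)]] assms(2) scaleR_scaleR ..

text \<open>Completing the square shows that \<open>(p + q)\<^sup>2 / 4 < k\<close> makes the form \<open>v\<^sup>2 + (p + q) y v + k y\<^sup>2\<close> at least
  \<open>e y\<^sup>2\<close>, with \<open>e > 0\<close> uniform by compactness. The lines in the quotient then expand and contract, and
  lift to invariant lines of the tangent bundle.\<close>

theorem anosov_if_definite:
  assumes def: "\<And>z. z \<in> M \<Longrightarrow> (p z + q z)\<^sup>2 / 4 < k z"
  shows "anosov A G Y \<phi>"
proof -
  obtain B k0 where "cone_cocycle (atlas_topology A) \<phi> cocycle l p k q B k0" using cone_cocycle .
  then interpret C: cone_cocycle "atlas_topology A" \<phi> cocycle l p k q B k0 .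
  have "continuous_map (atlas_topology A) euclideanreal (\<lambda>z. k z - (p z + q z) * (p z + q z) / 4)"
    using coefficients_continuous by (intro continuous_intros) auto
  from compact_space_positive[OF compact this]
  obtain e where e: "e > 0" "\<And>z. z \<in> M \<Longrightarrow> e \<le> k z - (p z + q z) * (p z + q z) / 4"
    unfolding topspace_carrier using def by (auto simp: power2_eq_square)
  have form: "v\<^sup>2 + (p z + q z) * y * v + k z * y\<^sup>2 \<ge> e * y\<^sup>2" if "z \<in> M" for z y v
  proof -
    have "v\<^sup>2 + (p z + q z) * y * v + k z * y\<^sup>2 = (v + (p z + q z) * y / 2)\<^sup>2 + (k z - (p z + q z) * (p z + q z) / 4) * y\<^sup>2"
      by (simp add: power2_eq_square algebra_simps)
    moreover have "e * y\<^sup>2 \<le> (k z - (p z + q z) * (p z + q z) / 4) * y\<^sup>2" using e(2)[OF that] by (intro mult_right_mono) auto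
    ultimately show ?thesis using zero_le_power2[of "v + (p z + q z) * y / 2"] by linarith
  qed
  let ?c = "e / (2 * C.W)" and ?K = "sqrt (C.W / C.m)"
  obtain wu hu ws hs where cu: "continuous_map (atlas_topology A) euclideanreal wu" "continuous_map (atlas_topology A) euclideanreal hu"
    and cs: "continuous_map (atlas_topology A) euclideanreal ws" "continuous_map (atlas_topology A) euclideanreal hs"
    and bu: "\<And>z. z \<in> M \<Longrightarrow> C.m \<le> wu z \<and> wu z \<le> C.W" and bs: "\<And>z. z \<in> M \<Longrightarrow> - C.W \<le> ws z \<and> ws z \<le> - C.m"
    and iu: "\<And>z t. z \<in> M \<Longrightarrow> \<exists>r. r \<noteq> 0 \<and> cocycle t z (hu z, 1, wu z) = r *\<^sub>R (hu (\<phi> t z), 1, wu (\<phi> t z))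
        \<and> (t \<le> 0 \<longrightarrow> \<bar>r\<bar> \<le> ?K * exp (?c * t))"
    and iv: "\<And>z t. z \<in> M \<Longrightarrow> \<exists>r. r \<noteq> 0 \<and> cocycle t z (hs z, 1, ws z) = r *\<^sub>R (hs (\<phi> t z), 1, ws (\<phi> t z))
        \<and> (t \<ge> 0 \<longrightarrow> \<bar>r\<bar> \<le> ?K * exp (- ?c * t))"
    using C.hyperbolic_lines[unfolded topspace_carrier, OF e(1) form] by blast
  obtain a b where a: "a > 0" "b > 0" "\<And>z c. z \<in> M \<Longrightarrow> a * norm c \<le> tnorm G z (frame z c) \<and> tnorm G z (frame z c) \<le> b * norm c"
    using frame_norm_bounds by blast
  obtain Hu where Hu: "Hu > 0" "\<And>z. z \<in> M \<Longrightarrow> \<bar>hu z\<bar> \<le> Hu"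
    using compact_space_bounded[OF compact cu(2)] unfolding topspace_carrier by blast
  obtain Hs where Hs: "Hs > 0" "\<And>z. z \<in> M \<Longrightarrow> \<bar>hs z\<bar> \<le> Hs"
    using compact_space_bounded[OF compact cs(2)] unfolding topspace_carrier by blast
  let ?L = "Hu + Hs + 1 + C.W"
  let ?b = "b * ?L"
  have L0: "?L > 0" using Hu(1) Hs(1) C.mW by linarith
  have line_norm: "a * \<bar>c\<bar> \<le> tnorm G z (tscale c (frame z (h, 1, w))) \<and> tnorm G z (tscale c (frame z (h, 1, w))) \<le> ?b * \<bar>c\<bar>"
    if z: "z \<in> M" and h: "\<bar>h\<bar> \<le> Hu + Hs" and w: "\<bar>w\<bar> \<le> C.W" for z h w c
  proof -
    define d :: "real \<times> real \<times> real" where "d = (h, 1, w)"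
    have d: "1 \<le> norm d" "norm d \<le> ?L" using norm_triple_ge[of h w] norm_triple_le[of h w] h w unfolding d_def by linarith+
    have "a * \<bar>c\<bar> * 1 \<le> a * \<bar>c\<bar> * norm d" using a(1) d(1) by (intro mult_left_mono) auto
    moreover have "b * \<bar>c\<bar> * norm d \<le> b * \<bar>c\<bar> * ?L" using a(2) d(2) by (intro mult_left_mono) auto
    moreover have "a * norm (c *\<^sub>R d) = a * \<bar>c\<bar> * norm d" "b * norm (c *\<^sub>R d) = b * \<bar>c\<bar> * norm d" "b * \<bar>c\<bar> * ?L = ?b * \<bar>c\<bar>" by simp_all
    ultimately show ?thesis using a(3)[OF z, of "c *\<^sub>R d"] unfolding frame_scale d_def[symmetric] by linarith
  qed
  have u: "\<bar>wu z\<bar> \<le> C.W" "\<bar>hu z\<bar> \<le> Hu + Hs" and s: "\<bar>ws z\<bar> \<le> C.W" "\<bar>hs z\<bar> \<le> Hu + Hs" if "z \<in> M" for z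
    using bu[OF that] bs[OF that] C.mW Hu(2)[OF that] Hs(2)[OF that] Hu(1) Hs(1) by auto
  have c0: "?c > 0" using e(1) C.mW by simp
  show ?thesis
    unfolding anosov_def
  proof (intro conjI)
    show "\<forall>z\<in>M. Y z \<noteq> tzero"
    proof
      fix z assume z: "z \<in> M"
      show "Y z \<noteq> tzero" unfolding frame_generator[of z, symmetric] frame_zero[of z, symmetric] frame_eq_iff[OF z] by (simp add: prod_eq_iff)
    qed
    show "\<exists>Es Eu. continuous_line_subbundle A Es \<and> continuous_line_subbundle A Eu \<and>
      (\<forall>z\<in>M. \<forall>v\<in>tangent_space A z.
         \<exists>!(c, vs, vu). vs \<in> Es z \<and> vu \<in> Eu z \<and> v = tadd (tscale c (Y z)) (tadd vs vu)) \<and>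
      (\<forall>t. \<forall>z\<in>M. pushforward A (\<phi> t) z ` Es z = Es (\<phi> t z) \<and> pushforward A (\<phi> t) z ` Eu z = Eu (\<phi> t z)) \<and>
      (\<exists>C>0. \<exists>\<zeta>>0. \<exists>\<eta>. \<zeta> < 1 \<and> 1 < \<eta> \<and> (\<forall>t>0. \<forall>z\<in>M.
         op_norm (tnorm G z) (tnorm G (\<phi> (- t) z)) (Eu z) (pushforward A (\<phi> (- t)) z) \<le> C * \<eta> powr (- t) \<and>
         op_norm (tnorm G z) (tnorm G (\<phi> t z)) (Es z) (pushforward A (\<phi> t) z) \<le> C * \<zeta> powr t))"
    proof (rule exI[of _ "frame_line hs ws"], rule exI[of _ "frame_line hu wu"], intro conjI frame_line_subbundle cu cs)
      show "\<forall>z\<in>M. \<forall>v\<in>tangent_space A z.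
         \<exists>!(c, vs, vu). vs \<in> frame_line hs ws z \<and> vu \<in> frame_line hu wu z \<and> v = tadd (tscale c (Y z)) (tadd vs vu)"
      proof (intro ballI)
        fix z d' assume z: "z \<in> M" and "d' \<in> tangent_space A z"
        then obtain x y v where d': "d' = frame z (x, y, v)" using frame_surj by (metis prod_cases3)
        have ne: "ws z \<noteq> wu z" using bu[OF z] bs[OF z] C.mW by auto
        let ?vs = "\<lambda>c. tscale c (frame z (hs z, 1, ws z))" and ?vu = "\<lambda>c. tscale c (frame z (hu z, 1, wu z))"
        let ?r = "(v - wu z * y) / (ws z - wu z)" and ?s = "(ws z * y - v) / (ws z - wu z)"
        let ?x = "x - ?r * hs z - ?s * hu z"
        have iff: "d' = tadd (tscale c (Y z)) (tadd (?vs r) (?vu s)) \<longleftrightarrow> c = ?x \<and> r = ?r \<and> s = ?s" for c r s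
        proof -
          have "d' = tadd (tscale c (Y z)) (tadd (?vs r) (?vu s)) \<longleftrightarrow> x = c + (r * hs z + s * hu z) \<and> y = r + s \<and> v = r * ws z + s * wu z"
            unfolding d' frame_generator[of z, symmetric] frame_scale frame_add frame_eq_iff[OF z] by simp
          also have "\<dots> \<longleftrightarrow> x = c + (r * hs z + s * hu z) \<and> r = ?r \<and> s = ?s"
            using two_line_coordinates[OF ne] by blast
          also have "\<dots> \<longleftrightarrow> c = ?x \<and> r = ?r \<and> s = ?s" by auto
          finally show ?thesis .
        qed
        show "\<exists>!(c, vs, vu). vs \<in> frame_line hs ws z \<and> vu \<in> frame_line hu wu z \<and> d' = tadd (tscale c (Y z)) (tadd vs vu)"
        proof (rule ex1I[of _ "(?x, ?vs ?r, ?vu ?s)"])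
          show "case (?x, ?vs ?r, ?vu ?s) of (c, vs, vu) \<Rightarrow> vs \<in> frame_line hs ws z \<and> vu \<in> frame_line hu wu z \<and> d' = tadd (tscale c (Y z)) (tadd vs vu)"
            unfolding split_conv using iff by blast
          fix \<sigma> assume "case \<sigma> of (c, vs, vu) \<Rightarrow> vs \<in> frame_line hs ws z \<and> vu \<in> frame_line hu wu z \<and> d' = tadd (tscale c (Y z)) (tadd vs vu)"
          then obtain c r s where \<sigma>: "\<sigma> = (c, ?vs r, ?vu s)" "d' = tadd (tscale c (Y z)) (tadd (?vs r) (?vu s))" by (cases \<sigma>) blast
          show "\<sigma> = (?x, ?vs ?r, ?vu ?s)"
            using iff[of c r s, THEN iffD1, OF \<sigma>(2)] unfolding \<sigma>(1) by blast
        qed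
      qed
      show "\<forall>t. \<forall>z\<in>M. pushforward A (\<phi> t) z ` frame_line hs ws z = frame_line hs ws (\<phi> t z) \<and>
         pushforward A (\<phi> t) z ` frame_line hu wu z = frame_line hu wu (\<phi> t z)"
      proof (intro allI ballI conjI)
        fix t z assume z: "z \<in> M"
        obtain r where r: "r \<noteq> 0" "cocycle t z (hu z, 1, wu z) = r *\<^sub>R (hu (\<phi> t z), 1, wu (\<phi> t z))" using iu[OF z] by blast
        show "pushforward A (\<phi> t) z ` frame_line hu wu z = frame_line hu wu (\<phi> t z)"
          by (rule line_image[OF r(1)]) (rule pushforward_line[OF z r(2)])
        obtain r where r: "r \<noteq> 0" "cocycle t z (hs z, 1, ws z) = r *\<^sub>R (hs (\<phi> t z), 1, ws (\<phi> t z))" using iv[OF z] by blast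
        show "pushforward A (\<phi> t) z ` frame_line hs ws z = frame_line hs ws (\<phi> t z)"
          by (rule line_image[OF r(1)]) (rule pushforward_line[OF z r(2)])
      qed
      let ?C = "?b / a * ?K"
      have ba: "?b / a \<ge> 0" using L0 a(1,2) by (intro divide_nonneg_nonneg mult_nonneg_nonneg) auto
      have bound: "op_norm (tnorm G z) (tnorm G (\<phi> (- t) z)) (frame_line hu wu z) (pushforward A (\<phi> (- t)) z) \<le> ?C * exp ?c powr (- t) \<and>
         op_norm (tnorm G z) (tnorm G (\<phi> t z)) (frame_line hs ws z) (pushforward A (\<phi> t) z) \<le> ?C * exp (- ?c) powr t"
        if t: "t > 0" and z: "z \<in> M" for t z
      proof
        have z': "\<phi> (- t) z \<in> M" "\<phi> t z \<in> M" using flow_carrier[OF z] by auto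
        obtain r where r: "cocycle (- t) z (hu z, 1, wu z) = r *\<^sub>R (hu (\<phi> (- t) z), 1, wu (\<phi> (- t) z))" "\<bar>r\<bar> \<le> ?K * exp (?c * - t)"
          using iu[OF z, of "- t"] t by auto
        have "op_norm (tnorm G z) (tnorm G (\<phi> (- t) z)) (frame_line hu wu z) (pushforward A (\<phi> (- t)) z) \<le> ?b / a * \<bar>r\<bar>"
          using op_norm_line(2)[where n = "tnorm G z" and n' = "tnorm G (\<phi> (- t) z)" and T = "pushforward A (\<phi> (- t)) z" and r = r and a = a and b = ?b
             and e = "\<lambda>c. tscale c (frame z (hu z, 1, wu z))" and e' = "\<lambda>c. tscale c (frame (\<phi> (- t) z) (hu (\<phi> (- t) z), 1, wu (\<phi> (- t) z)))",
             OF a(1) line_norm[OF z u(2,1)[OF z]] line_norm[OF z'(1) u(2,1)[OF z'(1)]] pushforward_line[OF z r(1)]] .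
        also have "\<dots> \<le> ?b / a * (?K * exp (?c * - t))" by (rule mult_left_mono[OF r(2) ba])
        also have "\<dots> = ?C * exp ?c powr (- t)" by (simp add: powr_def mult.commute)
        finally show "op_norm (tnorm G z) (tnorm G (\<phi> (- t) z)) (frame_line hu wu z) (pushforward A (\<phi> (- t)) z) \<le> ?C * exp ?c powr (- t)" .
        obtain r where r: "cocycle t z (hs z, 1, ws z) = r *\<^sub>R (hs (\<phi> t z), 1, ws (\<phi> t z))" "\<bar>r\<bar> \<le> ?K * exp (- ?c * t)"
          using iv[OF z, of t] t by auto
        have "op_norm (tnorm G z) (tnorm G (\<phi> t z)) (frame_line hs ws z) (pushforward A (\<phi> t) z) \<le> ?b / a * \<bar>r\<bar>"
          using op_norm_line(2)[where n = "tnorm G z" and n' = "tnorm G (\<phi> t z)" and T = "pushforward A (\<phi> t) z" and r = r and a = a and b = ?b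
             and e = "\<lambda>c. tscale c (frame z (hs z, 1, ws z))" and e' = "\<lambda>c. tscale c (frame (\<phi> t z) (hs (\<phi> t z), 1, ws (\<phi> t z)))",
             OF a(1) line_norm[OF z s(2,1)[OF z]] line_norm[OF z'(2) s(2,1)[OF z'(2)]] pushforward_line[OF z r(1)]] .
        also have "\<dots> \<le> ?b / a * (?K * exp (- ?c * t))" by (rule mult_left_mono[OF r(2) ba])
        also have "\<dots> = ?C * exp (- ?c) powr t" by (simp add: powr_def mult.commute)
        finally show "op_norm (tnorm G z) (tnorm G (\<phi> t z)) (frame_line hs ws z) (pushforward A (\<phi> t) z) \<le> ?C * exp (- ?c) powr t" .
      qed
      have "?C > 0" using a(1,2) L0 C.mW by (intro mult_pos_pos divide_pos_pos) auto
      moreover have "exp (- ?c) < 1" "1 < exp ?c" using c0 by (simp_all only: exp_less_one_iff one_less_exp_iff neg_less_0_iff_less)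
      ultimately show "\<exists>C>0. \<exists>\<zeta>>0. \<exists>\<eta>. \<zeta> < 1 \<and> 1 < \<eta> \<and> (\<forall>t>0. \<forall>z\<in>M.
         op_norm (tnorm G z) (tnorm G (\<phi> (- t) z)) (frame_line hu wu z) (pushforward A (\<phi> (- t)) z) \<le> C * \<eta> powr (- t) \<and>
         op_norm (tnorm G z) (tnorm G (\<phi> t z)) (frame_line hs ws z) (pushforward A (\<phi> t) z) \<le> C * \<zeta> powr t)"
        by (intro two_decay_ratesI[OF bound] exp_gt_zero)
    qed
  qed
qed

end

section \<open>Thermostats\<close>

subsection \<open>Compactness of the unit tangent bundle\<close>

context surface begin

lemma SM_param_continuous:
  assumes x: "(\<Omega>, x) \<in> A"
  shows "continuous_map (top_of_set (\<Omega> \<times> UNIV)) (atlas_topology SM) (SM_param x)"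
  unfolding continuous_map_def SM.topspace_carrier openin_atlas_topology
proof (intro conjI allI impI)
  have chart: "SM_param x w \<in> carrier_of SM" if "w \<in> \<Omega> \<times> UNIV" for w
    using SM.chart_carrier[OF SM_chartI[OF x, of "snd w - 1"], of w] that pi_gt3 by auto
  then show "SM_param x \<in> topspace (top_of_set (\<Omega> \<times> UNIV)) \<rightarrow> carrier_of SM" by simp
  fix U assume U: "atlas_open SM U"
  have eq: "{w \<in> topspace (top_of_set (\<Omega> \<times> UNIV)). SM_param x w \<in> U} = (\<Union>\<alpha>. {w \<in> \<Omega> \<times> {\<alpha><..<\<alpha> + 2 * pi}. SM_param x w \<in> U})"
  proof -
    have "w \<in> \<Omega> \<times> {snd w - 1<..<snd w - 1 + 2 * pi}" if "w \<in> \<Omega> \<times> UNIV" for w using that pi_gt3 by auto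
    then show ?thesis by auto
  qed
  have "open (\<Union>\<alpha>. {w \<in> \<Omega> \<times> {\<alpha><..<\<alpha> + 2 * pi}. SM_param x w \<in> U})"
    using U SM_chartI[OF x] unfolding atlas_open_def by (intro open_UN ballI) fast
  moreover have "open (\<Omega> \<times> (UNIV :: real set))" by (intro open_Times chart_open[OF x] open_UNIV)
  ultimately show "openin (top_of_set (\<Omega> \<times> UNIV)) {w \<in> topspace (top_of_set (\<Omega> \<times> UNIV)). SM_param x w \<in> U}"
    unfolding eq by (subst openin_open_eq) auto
qed

text \<open>Finitely many closed coordinate balls cover \<open>M\<close>. Over each of them \<open>SM\<close> is a continuous image of the
  ball times the interval of angles from \<open>0\<close> to \<open>2\<pi>\<close>.\<close>

lemma SM_compact: "compact_space (atlas_topology SM)"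
proof -
  define \<U> where "\<U> = {x ` ball u r | \<Omega> x u r. (\<Omega>, x) \<in> A \<and> cball u r \<subseteq> \<Omega>}"
  have comp: "compact_space (atlas_topology A)"
    using surface by (simp add: closed_oriented_riemannian_surface_def closed_manifold_def)
  have op: "openin (atlas_topology A) V" if "V \<in> \<U>" for V
    using that unfolding openin_atlas_topology \<U>_def by (auto intro!: atlas_open_chart_image dest: subset_trans[OF ball_subset_cball])
  have cov: "topspace (atlas_topology A) \<subseteq> \<Union>\<U>"
  proof
    fix z assume "z \<in> topspace (atlas_topology A)"
    then obtain \<Omega> x u where x: "(\<Omega>, x) \<in> A" "u \<in> \<Omega>" "z = x u" unfolding topspace_carrier by (rule carrierE)
    obtain r where "r > 0" "cball u r \<subseteq> \<Omega>" using chart_open[OF x(1)] x(2) open_contains_cball by blast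
    then show "z \<in> \<Union>\<U>" using x unfolding \<U>_def by (intro UnionI[of "x ` ball u r"]) auto
  qed
  obtain F where F: "finite F" "F \<subseteq> \<U>" "topspace (atlas_topology A) \<subseteq> \<Union>F"
    using comp[unfolded compact_space_alt, THEN spec, THEN mp, OF conjI[OF ballI[OF op] cov]] by blast
  have ex: "\<exists>K. compactin (atlas_topology SM) K \<and> {z \<in> carrier_of SM. fst z \<in> V} \<subseteq> K" if V: "V \<in> F" for V
  proof -
    obtain \<Omega> x u r where x: "(\<Omega>, x) \<in> A" "cball u r \<subseteq> \<Omega>" "V = x ` ball u r"
      using subsetD[OF F(2) V] unfolding \<U>_def by (elim CollectE exE conjE)
    let ?K = "cball u r \<times> {0..2 * pi}"
    have "compactin (top_of_set (\<Omega> \<times> UNIV)) ?K"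
      unfolding compactin_subtopology using x(2) compact_Times[OF compact_cball compact_Icc, of u r 0 "2 * pi"] by auto
    then have "compactin (atlas_topology SM) (SM_param x ` ?K)"
      by (rule image_compactin[OF _ SM_param_continuous[OF x(1)]])
    moreover have "z \<in> SM_param x ` ?K" if z: "z \<in> carrier_of SM" "fst z \<in> V" for z
    proof -
      obtain v where v: "v \<in> ball u r" "x v = fst z" using z(2) x(3) by auto
      then have v': "v \<in> \<Omega>" using x(2) by auto
      obtain a where a: "gcoord A g x v a a = 1" "z = unit_point x (v, a)" using SM_point[OF z(1) x(1) v' v(2)] by blast
      have "a \<noteq> 0" by (rule unit_nonzero[OF x(1) v' a(1)])
      then obtain s \<theta> where s: "s > 0" "a = s *\<^sub>R ecirc \<theta>" using polar_angle_exists by blast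
      obtain \<theta>' where \<theta>': "0 \<le> \<theta>'" "\<theta>' < 2 * pi" "cos \<theta> = cos \<theta>'" "sin \<theta> = sin \<theta>'"
        using sincos_total_2pi[OF sin_cos_squared_add2] by metis
      have "z = SM_param x (v, \<theta>')"
        using unit_point_scale[OF x(1) v' s(1), of "ecirc \<theta>"] a(2) s(2) \<theta>'(3,4) by (simp add: SM_param_def)
      then show ?thesis using v(1) \<theta>' by auto
    qed
    ultimately show ?thesis by blast
  qed
  from bchoice[OF ballI[OF ex]]
  obtain K where K: "\<forall>V\<in>F. compactin (atlas_topology SM) (K V) \<and> {z \<in> carrier_of SM. fst z \<in> V} \<subseteq> K V" ..
  have "compactin (atlas_topology SM) (\<Union>(K ` F))"
    by (rule compactin_Union) (use F(1) K in auto)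
  moreover have "\<Union>(K ` F) = topspace (atlas_topology SM)"
  proof
    show "\<Union>(K ` F) \<subseteq> topspace (atlas_topology SM)" using K compactin_subset_topspace by blast
    have "fst z \<in> \<Union>F" if "z \<in> carrier_of SM" for z
    proof (rule subsetD[OF F(3)[unfolded topspace_carrier]])
      show "fst z \<in> carrier_of A" using that by (auto simp: SM_carrier unit_tangent_bundle_def)
    qed
    then show "topspace (atlas_topology SM) \<subseteq> \<Union>(K ` F)" unfolding SM.topspace_carrier using K by blast
  qed
  ultimately show ?thesis by (simp add: compact_space_def)
qed

subsection \<open>The moving frame of a thermostat\<close>

text \<open>By the Leibniz rule the structure equations give \<open>[F, V] = - H - (V\<lambda>) V\<close> and
  \<open>[F, H] = \<kappa> V - \<lambda> F\<close>. Passing from \<open>H\<close> to \<open>H + p V\<close> replaces \<open>\<kappa>\<close> by \<open>\<kappa>\<^sub>p\<close>.\<close>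

lemma thermostat_framed_flow:
  fixes lam p :: "'m tpoint \<Rightarrow> real"
  defines "Y \<equiv> thermostat_vfield A g lam" and "E \<equiv> \<lambda>z. tadd (HH z) (tscale (p z) (VV z))"
  assumes lam: "smooth_function SM lam" and p: "smooth_function SM p" and flow: "flow_generated_by SM Y \<phi>"
  shows "framed_flow TYPE((real^2) \<times> (real^2)) SM Y \<phi> E VV lam p (\<lambda>z. - kappa_p A g lam p z) (\<lambda>z. VV z lam - p z)"
proof (intro framed_flow.intro smooth_flow.intro SM.atlas_axioms smooth_flow_axioms.intro flow framed_flow_axioms.intro)
  have Yf: "Y z f = XX z f + lam z * VV z f" and Ef: "E z f = HH z f + p z * VV z f" for z f
    by (simp_all add: Y_def E_def thermostat_vfield_def tadd_def tscale_def)
  note sm = XX_smooth(2) HH_smooth(2) VV_smooth(2)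
  fix z assume z: "z \<in> carrier_of SM"
  have l: "smooth_at SM z lam" and pp: "smooth_at SM z p" using lam p z by (auto simp: smooth_function_def)
  show "Y z \<in> tangent_space SM z" "E z \<in> tangent_space SM z" "VV z \<in> tangent_space SM z"
    unfolding Y_def E_def thermostat_vfield_def
    by (intro SM.tangent_space_add SM.tangent_space_scale z XX_smooth(1) HH_smooth(1) VV_smooth(1))+
  show "r = 0 \<and> s = 0 \<and> t = 0" if eq: "\<And>f. smooth_at SM z f \<Longrightarrow> r * Y z f + s * E z f + t * VV z f = 0" for r s t
  proof -
    have "r = 0 \<and> s = 0 \<and> r * lam z + s * p z + t = 0"
      using eq by (intro SM_frame_independent[OF z]) (simp add: Yf Ef algebra_simps)
    then show ?thesis by auto
  qed
  fix f assume f: "smooth_at SM z f"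
  show "smooth_at SM z (\<lambda>w. E w f)" "smooth_at SM z (\<lambda>w. VV w f)"
    unfolding Ef by (intro SM.smooth_at_intros z pp sm f)+
  have D: "v (\<lambda>w. Y w f) = v (\<lambda>w. XX w f) + (lam z * v (\<lambda>w. VV w f) + VV z f * v lam)"
    "v (\<lambda>w. E w f) = v (\<lambda>w. HH w f) + (p z * v (\<lambda>w. VV w f) + VV z f * v p)" if v: "v \<in> tangent_space SM z" for v
    unfolding Yf Ef by (simp_all add: SM.tangent_add[OF z v] SM.tangent_mult[OF z v] SM.smooth_at_mult z l pp sm f)
  note D = D[OF XX_smooth(1)[OF z]] D[OF HH_smooth(1)[OF z]] D[OF VV_smooth(1)[OF z]]
  note S = structure_equations[OF z f]
  show "VV z (\<lambda>w. Y w f) - Y z (\<lambda>w. VV w f) = E z f + (VV z lam - p z) * VV z f"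
    unfolding D unfolding Yf Ef using S(1) by (simp add: algebra_simps)
  have k: "kappa_p A g lam p z = gauss_curvature A g (fst z) - HH z lam + lam z * lam z + (XX z p + lam z * VV z p) + p z * (p z - VV z lam)"
    by (simp add: kappa_p_def kappa_def Y_def[symmetric] Yf power2_eq_square)
  show "E z (\<lambda>w. Y w f) - Y z (\<lambda>w. E w f) = lam z * Y z f + p z * E z f + - kappa_p A g lam p z * VV z f"
  proof -
    have "E z (\<lambda>w. Y w f) - Y z (\<lambda>w. E w f) = - (XX z (\<lambda>w. HH w f) - HH z (\<lambda>w. XX w f)) - lam z * (VV z (\<lambda>w. HH w f) - HH z (\<lambda>w. VV w f))
        + p z * (VV z (\<lambda>w. XX w f) - XX z (\<lambda>w. VV w f)) + (HH z lam + p z * VV z lam - XX z p - lam z * VV z p) * VV z f"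
      unfolding Yf[of z "\<lambda>w. E w f"] Ef[of z "\<lambda>w. Y w f"] D by (simp add: algebra_simps)
    also have "\<dots> = lam z * Y z f + p z * E z f + - kappa_p A g lam p z * VV z f"
      unfolding S k Yf Ef by (simp add: algebra_simps)
    finally show ?thesis .
  qed
next
  have Yz: "Y z = tadd (XX z) (tscale (lam z) (VV z))" for z by (simp add: Y_def thermostat_vfield_def)
  fix z0 assume z0: "z0 \<in> carrier_of SM"
  obtain U and I :: "((real^2) \<times> (real^2)) set" and e a b c where U: "atlas_open SM U" "z0 \<in> U" "finite I"
    and sm: "\<And>i. i \<in> I \<Longrightarrow> smooth_at SM z0 (e i) \<and> smooth_at SM z0 (a i) \<and> smooth_at SM z0 (b i) \<and> smooth_at SM z0 (c i)"
    and rep: "\<And>z v. z \<in> U \<Longrightarrow> v \<in> tangent_space SM z \<Longrightarrow> v = tadd (tscale (\<Sum>i\<in>I. a i z * v (e i)) (XX z))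
      (tadd (tscale (\<Sum>i\<in>I. b i z * v (e i)) (HH z)) (tscale (\<Sum>i\<in>I. c i z * v (e i)) (VV z)))"
    using SM_coframe[OF z0] by blast
  let ?c = "\<lambda>i z. c i z - lam z * a i z - p z * b i z"
  have lp: "smooth_at SM z0 lam" "smooth_at SM z0 p" using lam p z0 by (auto simp: smooth_function_def)
  have "smooth_at SM z0 (?c i)" if "i \<in> I" for i using sm[OF that] lp by (intro SM.smooth_at_intros z0) auto
  then have 1: "\<forall>i\<in>I. smooth_at SM z0 (e i) \<and> smooth_at SM z0 (a i) \<and> smooth_at SM z0 (b i) \<and> smooth_at SM z0 (?c i)" using sm by blast
  have 2: "\<forall>z\<in>U. \<forall>v\<in>tangent_space SM z. v = tadd (tscale (\<Sum>i\<in>I. a i z * v (e i)) (Y z)) (tadd (tscale (\<Sum>i\<in>I. b i z * v (e i)) (E z)) (tscale (\<Sum>i\<in>I. ?c i z * v (e i)) (VV z)))"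
  proof (intro ballI ext)
    fix z v f assume z: "z \<in> U" and v: "v \<in> tangent_space SM z"
    define \<alpha> \<beta> \<gamma> where "\<alpha> = (\<Sum>i\<in>I. a i z * v (e i))" and "\<beta> = (\<Sum>i\<in>I. b i z * v (e i))" and "\<gamma> = (\<Sum>i\<in>I. c i z * v (e i))"
    have S: "(\<Sum>i\<in>I. ?c i z * v (e i)) = \<gamma> - lam z * \<alpha> - p z * \<beta>"
      unfolding \<alpha>_def \<beta>_def \<gamma>_def by (simp add: sum_subtractf sum_distrib_left left_diff_distrib mult.assoc)
    have "v f = tadd (tscale \<alpha> (XX z)) (tadd (tscale \<beta> (HH z)) (tscale \<gamma> (VV z))) f"
      using fun_cong[OF rep[OF z v], of f] unfolding \<alpha>_def \<beta>_def \<gamma>_def .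
    then show "v f = tadd (tscale (\<Sum>i\<in>I. a i z * v (e i)) (Y z)) (tadd (tscale (\<Sum>i\<in>I. b i z * v (e i)) (E z)) (tscale (\<Sum>i\<in>I. ?c i z * v (e i)) (VV z))) f"
      unfolding S \<alpha>_def[symmetric] \<beta>_def[symmetric] by (simp add: Yz E_def tadd_def tscale_def algebra_simps)
  qed
  show "\<exists>U (I :: ((real^2) \<times> (real^2)) set) e a b c. atlas_open SM U \<and> z0 \<in> U \<and> finite I \<and>
      (\<forall>i\<in>I. smooth_at SM z0 (e i) \<and> smooth_at SM z0 (a i) \<and> smooth_at SM z0 (b i) \<and> smooth_at SM z0 (c i)) \<and>
      (\<forall>z\<in>U. \<forall>v\<in>tangent_space SM z. v = tadd (tscale (\<Sum>i\<in>I. a i z * v (e i)) (Y z))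
        (tadd (tscale (\<Sum>i\<in>I. b i z * v (e i)) (E z)) (tscale (\<Sum>i\<in>I. c i z * v (e i)) (VV z))))"
    by (rule exI[of _ U], rule exI[of _ I], rule exI[of _ e], rule exI[of _ a], rule exI[of _ b], rule exI[of _ ?c], intro conjI U 1 2)
qed

end

theorem theorem3p7:
  fixes A :: "('m, real^2) atlas" and g :: "'m metric"
    and lam p :: "'m tpoint \<Rightarrow> real"
    and \<phi> :: "real \<Rightarrow> 'm tpoint \<Rightarrow> 'm tpoint"
    and G :: "'m tpoint metric"
  assumes "closed_oriented_riemannian_surface A g"
    and "smooth_function (SM_atlas A g) lam"
    and "flow_generated_by (SM_atlas A g) (thermostat_vfield A g lam) \<phi>"
    and "riemannian_metric (SM_atlas A g) G"
    and "smooth_function (SM_atlas A g) p"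
    and "\<forall>z\<in>unit_tangent_bundle A g. kappa_p A g lam p z < 0"
  shows "has_dominated_splitting (SM_atlas A g) G (thermostat_vfield A g lam) \<phi> \<and>
    ((\<forall>z\<in>unit_tangent_bundle A g.
        kappa_p A g lam p z + (vertical_vfield A g z lam)\<^sup>2 / 4 < 0)
      \<longrightarrow> anosov (SM_atlas A g) G (thermostat_vfield A g lam) \<phi>)"
proof -
  interpret surface A g by unfold_locales (rule assms(1))
  interpret framed_flow SM "thermostat_vfield A g lam" \<phi> "\<lambda>z. tadd (HH z) (tscale (p z) (VV z))" VV
      lam p "\<lambda>z. - kappa_p A g lam p z" "\<lambda>z. VV z lam - p z" "TYPE((real^2) \<times> (real^2))"
    by (rule thermostat_framed_flow[OF assms(2,5,3)])
  interpret compact_framed_flow SM "thermostat_vfield A g lam" \<phi> "\<lambda>z. tadd (HH z) (tscale (p z) (VV z))" VV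
      lam p "\<lambda>z. - kappa_p A g lam p z" "\<lambda>z. VV z lam - p z" "TYPE((real^2) \<times> (real^2))" G
    by unfold_locales (use SM_compact assms(4,6) in \<open>simp_all add: SM_carrier\<close>)
  have "anosov SM G (thermostat_vfield A g lam) \<phi>"
    if "\<forall>z\<in>unit_tangent_bundle A g. kappa_p A g lam p z + (VV z lam)\<^sup>2 / 4 < 0"
  proof (rule anosov_if_definite)
    show "(p z + (VV z lam - p z))\<^sup>2 / 4 < - kappa_p A g lam p z" if "z \<in> carrier_of SM" for z
      using \<open>\<forall>z\<in>unit_tangent_bundle A g. kappa_p A g lam p z + (VV z lam)\<^sup>2 / 4 < 0\<close> that
      unfolding SM_carrier by (simp add: less_diff_eq[symmetric] add.commute) force
  qed
  then show ?thesis using dominated_splitting by blast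
qed

end
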